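(* Let $n\ge 2$ and let $\mathscr{U}\subset\mathbb{C}^n$ be a bounded monomial polyhedron. Then the Bergman projection of $\mathscr{U}$ is bounded on $L^p(\mathscr{U})$ if and only if $$\frac{2\kappa(\mathscr{U})}{\kappa(\mathscr{U})+1}<p<\frac{2\kappa(\mathscr{U})}{\kappa(\mathscr{U})-1},$$ where $\kappa(\mathscr{U})$ is the complexity of $\mathscr{U}$ (when $\kappa(\mathscr{U})=1$ the upper bound is interpreted as $+\infty$). In particular, the matrix $B$ representing $\mathscr{U}$ is invertible, so $\kappa(\mathscr{U})$ is well defined.
   Context: For $b^1,\dots,b^n\in\mathbb{Q}^n$ (rows $b^j=(b^j_1,\dots,b^j_n)$), the monomial polyhedron they define is $\mathscr{U}=\{z\in\mathbb{C}^n:\ \prod_{k=1}^n|z_k|^{b^j_k}<1 \text{ for } 1\le j\le n\}$, where a point $z$ is not in $\mathscr{U}$ if for some $j$ the product is undefined because of division by zero (i.e. $z_k=0$ with $b^j_k<0$). It is assumed to be a domain (nonempty, open, connected). Let $B\in M_n(\mathbb{Q})$ be the matrix whose $j$-th row is $b^j$. For $x\in\mathbb{Q}^n\setminus\{0\}$, the projective height $\mathsf{h}(x)$ is defined as follows: choose $y\in\mathbb{Z}^n$ with $y=\lambda x$ for some $\lambda\in\mathbb{Q}\setminus\{0\}$ and $\gcd(y_1,\dots,y_n)=1$, and set $\mathsf{h}(x)=\sum_{j=1}^n|y_j|$. The complexity is $\kappa(\mathscr{U})=\max_{1\le k\le n}\mathsf{h}(B^{-1}e_k)$, i.e. the maximal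 projective height of the columns of $B^{-1}$ ($e_k$ the $k$-th standard basis column vector). The Bergman projection is the orthogonal projection $L^2(\mathscr{U})\to A^2(\mathscr{U})$ onto square-integrable holomorphic functions (Lebesgue measure); "bounded on $L^p$" means there is $C>0$ with $\|\bm{B}f\|_{L^p}\le C\|f\|_{L^p}$ for all $f\in L^2\cap L^p$. *)

theory Defs
  imports "HOL-Analysis.Analysis"
begin

text \<open>Monomial power |z|^b with the conventions r^0 = 1 (also for r = 0).\<close>
definition mpow :: "real \<Rightarrow> real \<Rightarrow> real" where
  "mpow r b = (if b = 0 then 1 else r powr b)"

text \<open>Monomial polyhedron defined by the rows of B: z is excluded when some
  product is undefined (z_k = 0 with negative exponent).\<close>
definition monomial_polyhedron :: "real^'n^'n \<Rightarrow> (complex^'n) set" where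
  "monomial_polyhedron B =
     {z. \<forall>j. (\<forall>k. z$k = 0 \<longrightarrow> 0 \<le> B$j$k) \<and>
              (\<Prod>k\<in>UNIV. mpow (cmod (z$k)) (B$j$k)) < 1}"

definition proj_height :: "real^'n \<Rightarrow> int" where
  "proj_height x = (THE s. \<exists>(y::int^'n) (lam::real). lam \<noteq> 0 \<and>
      (\<forall>k. real_of_int (y$k) = lam * x$k) \<and> Gcd (range (\<lambda>k. y$k)) = 1 \<and>
      s = (\<Sum>k\<in>UNIV. \<bar>y$k\<bar>))"

definition complexity :: "real^'n^'n \<Rightarrow> int" where
  "complexity B = Max (range (\<lambda>k. proj_height (matrix_inv B *v axis k 1)))"

definition in_Lp :: "(complex^'n) set \<Rightarrow> real \<Rightarrow> (complex^'n \<Rightarrow> complex) \<Rightarrow> bool" where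
  "in_Lp U p f \<longleftrightarrow> f \<in> borel_measurable (lebesgue_on U) \<and>
     (\<integral>\<^sup>+ z\<in>U. ennreal (cmod (f z) powr p) \<partial>lebesgue) < \<infinity>"

definition Lp_norm :: "(complex^'n) set \<Rightarrow> real \<Rightarrow> (complex^'n \<Rightarrow> complex) \<Rightarrow> real" where
  "Lp_norm U p f = enn2real (\<integral>\<^sup>+ z\<in>U. ennreal (cmod (f z) powr p) \<partial>lebesgue) powr (1/p)"

definition cscale :: "complex \<Rightarrow> complex^'n \<Rightarrow> complex^'n" where
  "cscale c v = (\<chi> k. c * v$k)"

definition holomorphic_n :: "(complex^'n \<Rightarrow> complex) \<Rightarrow> (complex^'n) set \<Rightarrow> bool" where
  "holomorphic_n f U \<longleftrightarrow> (\<forall>z\<in>U. \<exists>L. (f has_derivative L) (at z) \<and>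
       (\<forall>c v. L (cscale c v) = c * L v))"

definition in_A2 :: "(complex^'n) set \<Rightarrow> (complex^'n \<Rightarrow> complex) \<Rightarrow> bool" where
  "in_A2 U h \<longleftrightarrow> holomorphic_n h U \<and> in_Lp U 2 h"

definition is_bergman_proj :: "(complex^'n) set \<Rightarrow> (complex^'n \<Rightarrow> complex) \<Rightarrow> (complex^'n \<Rightarrow> complex) \<Rightarrow> bool" where
  "is_bergman_proj U f g \<longleftrightarrow> in_A2 U g \<and>
     (\<forall>h. in_A2 U h \<longrightarrow> set_lebesgue_integral lebesgue U (\<lambda>z. (f z - g z) * cnj (h z)) = 0)"

definition bergman_Lp_bounded :: "(complex^'n) set \<Rightarrow> real \<Rightarrow> bool" where
  "bergman_Lp_bounded U p \<longleftrightarrow> (\<exists>C>0. \<forall>f g. in_Lp U 2 f \<longrightarrow> in_Lp U p f \<longrightarrow>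
      is_bergman_proj U f g \<longrightarrow> in_Lp U p g \<and> Lp_norm U p g \<le> C * Lp_norm U p f)"

end

theory Submission
  imports Defs "HOL-Complex_Analysis.Complex_Analysis"
begin

text \<open>In logarithmic coordinates a bounded monomial polyhedron is a simplicial cone times a torus, and its
  holomorphic square integrable functions are spanned by the monomials \<open>w\<^sup>a\<close> with \<open>\<langle>a + 1, y\<^sub>k\<rangle> \<ge> 1\<close> for
  all \<open>k\<close>, where the \<open>y\<^sub>k\<close> are the primitive vectors on the edges of the cone. Summing these monomials over
  residue classes shows that the Bergman kernel is dominated by a constant times
  \<open>\<Prod>k. (r\<^sub>k(z) r\<^sub>k(w)) powr (1 - h\<^sub>k) / |1 - s\<^sub>k|\<^sup>2\<close>, where \<open>s\<^sub>k\<close> runs over the monomials defining the polyhedron,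
  evaluated at \<open>z cnj w\<close>, \<open>r\<^sub>k(z) r\<^sub>k(w)\<close> is the \<open>N\<close>-th root of \<open>|s\<^sub>k|\<close>, and \<open>h\<^sub>k\<close> is the sum of the entries of
  \<open>y\<^sub>k\<close>. This bound has product structure, so a Schur test with test functions
  \<open>\<Prod>k. r\<^sub>k powr (-d\<^sub>k) * (1 - R\<^sub>k\<^sup>2) powr (-e)\<close>, \<open>R\<^sub>k = r\<^sub>k powr N\<close>, proves boundedness in the asserted range.
  Conversely let \<open>h\<^sub>k\<close> be maximal and choose an admissible \<open>a\<close> with \<open>\<langle>a + 1, y\<^sub>k\<rangle> = 1\<close>. A radial multiple of
  \<open>w\<^sup>a\<close> projects to a constant multiple of \<open>w\<^sup>a\<close>, which is not in \<open>L\<^sup>p\<close> when \<open>p\<close> is at or above the upper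
  bound; truncations of \<open>w\<^sup>a |w\<^sup>a| powr (q - 2)\<close> treat the dual range, and the remaining exponent \<open>p = 1\<close>
  is a logarithmic divergence as in the unit disc.\<close>

unbundle no Formal_Power_Series.fps_syntax

subsection \<open>Translation invariant measures and Lebesgue measure on complex vectors\<close>

text \<open>The monomials with exponents \<open>G k\<close> map the polyhedron into a product of
  discs, but not injectively: the vectors \<open>G k\<close> span only a sublattice of finite index,
  whose cosets reappear as the finitely many residues in the kernel. No branch of an inverse is
  used. Phases are handled by averaging over the torus and moduli by logarithmic coordinates, and
  both changes of variables rest on the uniqueness of translation invariant measures. In logarithmic
  coordinates Lebesgue measure has density \<open>exp (2 * h k * y / N)\<close> in direction
  \<open>k\<close>, so the power \<open>|mon a|^p\<close> is integrable exactly if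
  \<open>p * dot a k + 2 * h k > 0\<close> for all \<open>k\<close>. For
  \<open>dot a k + h k = 1\<close> this reads \<open>p * (h k - 1) < 2 * h k\<close>; the lower
  bound on \<open>p\<close> is the same condition for the conjugate exponent. The projection enters
  as a relation between \<open>f\<close> and \<open>g\<close>: for sufficiency every related
  \<open>g\<close> is shown to be the kernel integral of \<open>f\<close>, for necessity explicit
  pairs with computable norms are exhibited.\<close>

lemma nn_integral_lborel_translate:
  fixes a :: "'a::euclidean_space"
  assumes [measurable]: "f \<in> borel_measurable borel"
  shows "(\<integral>\<^sup>+x. f (a + x) \<partial>lborel) = (\<integral>\<^sup>+x. f x \<partial>lborel)"
proof -
  have "(\<integral>\<^sup>+x. f x \<partial>lborel) = (\<integral>\<^sup>+x. f x \<partial>(distr lborel borel ((+) a)))"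
    by (simp add: lborel_distr_plus)
  then show ?thesis by (simp add: nn_integral_distr)
qed

text \<open>Weil's double-counting argument: against a test function \<open>g\<close> of integral 1,
  \<open>\<integral>\<integral> f x * g y\<close> is rewritten by the substitutions \<open>x \<mapsto> y + x\<close>, \<open>y \<mapsto> y - x\<close>, \<open>x \<mapsto> y + x\<close>.\<close>

lemma translation_invariant_imp_lborel:
  fixes M :: "'a::euclidean_space measure"
  assumes M[measurable_cong]: "sets M = sets borel"
    and inv: "\<And>a f. f \<in> borel_measurable borel \<Longrightarrow> (\<integral>\<^sup>+x. f (a + x) \<partial>M) = (\<integral>\<^sup>+x. f x \<partial>M)"
    and fin: "\<And>r. emeasure M (cball 0 r) < \<infinity>"
  obtains c where "c < \<infinity>" "\<And>f. f \<in> borel_measurable borel \<Longrightarrow> (\<integral>\<^sup>+x. f x \<partial>M) = c * (\<integral>\<^sup>+x. f x \<partial>lborel)"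
proof -
  have "sigma_finite_measure M"
  proof (rule sigma_finite_measure.intro, intro exI conjI)
    show "countable (range (\<lambda>n::nat. cball (0::'a) (real n)))" by simp
    show "range (\<lambda>n::nat. cball (0::'a) (real n)) \<subseteq> sets M" by (auto simp: M)
    have "x \<in> (\<Union>n::nat. cball 0 (real n))" for x :: 'a
      using real_arch_simple[of "norm x"] by auto
    then show "\<Union> (range (\<lambda>n::nat. cball (0::'a) (real n))) = space M" 
      using sets_eq_imp_space_eq[OF M] by auto
    show "\<forall>a\<in>range (\<lambda>n. cball 0 (real n)). emeasure M a \<noteq> \<infinity>" using fin by (auto simp: less_top)
  qed
  then interpret pair_sigma_finite M lborel
    by (simp add: pair_sigma_finite_def sigma_finite_lborel)
  define g :: "'a \<Rightarrow> ennreal" where "g = indicator (cbox 0 One)"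
  have [measurable]: "g \<in> borel_measurable borel" unfolding g_def by measurable
  have g1: "(\<integral>\<^sup>+y. g y \<partial>lborel) = 1" unfolding g_def by simp
  define c where "c = (\<integral>\<^sup>+x. g (- x) \<partial>M)"
  obtain r where r: "cbox (0::'a) One \<subseteq> cball 0 r"
    using bounded_cbox[of "0::'a" One] unfolding bounded_iff by (meson mem_cball_0 subsetI)
  have "c \<le> (\<integral>\<^sup>+x. indicator (cball 0 r) x \<partial>M)"
    unfolding c_def g_def
  proof (rule nn_integral_mono)
    fix x :: 'a
    have "- x \<in> cbox 0 One \<Longrightarrow> x \<in> cball 0 r" using r by (metis mem_cball_0 norm_minus_cancel subsetD)
    then show "(indicator (cbox 0 One) (- x) :: ennreal) \<le> indicator (cball 0 r) x"
      by (simp add: indicator_def del: mem_cball)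
  qed
  also have "\<dots> < \<infinity>" using fin[of r] by simp
  finally have "c < \<infinity>" .
  moreover have "(\<integral>\<^sup>+x. f x \<partial>M) = c * (\<integral>\<^sup>+x. f x \<partial>lborel)" if [measurable]: "f \<in> borel_measurable borel" for f
  proof -
    have "(\<integral>\<^sup>+x. f x \<partial>M) = (\<integral>\<^sup>+x. \<integral>\<^sup>+y. f x * g y \<partial>lborel \<partial>M)"
      by (simp add: nn_integral_cmult g1)
    also have "\<dots> = (\<integral>\<^sup>+y. \<integral>\<^sup>+x. f x * g y \<partial>M \<partial>lborel)"
      by (rule Fubini'[symmetric]) measurable
    also have "\<dots> = (\<integral>\<^sup>+y. \<integral>\<^sup>+x. f (y + x) * g y \<partial>M \<partial>lborel)"
    proof (rule nn_integral_cong)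
      fix y
      show "(\<integral>\<^sup>+x. f x * g y \<partial>M) = (\<integral>\<^sup>+x. f (y + x) * g y \<partial>M)"
        using inv[of "\<lambda>x. f x * g y" y] by simp
    qed
    also have "\<dots> = (\<integral>\<^sup>+x. \<integral>\<^sup>+y. f (y + x) * g y \<partial>lborel \<partial>M)"
      by (rule Fubini') measurable
    also have "\<dots> = (\<integral>\<^sup>+x. \<integral>\<^sup>+y. f y * g (y - x) \<partial>lborel \<partial>M)"
    proof (rule nn_integral_cong)
      fix x
      show "(\<integral>\<^sup>+y. f (y + x) * g y \<partial>lborel) = (\<integral>\<^sup>+y. f y * g (y - x) \<partial>lborel)"
        using nn_integral_lborel_translate[of "\<lambda>y. f y * g (y - x)" x] by (simp add: add.commute)
    qed
    also have "\<dots> = (\<integral>\<^sup>+y. \<integral>\<^sup>+x. f y * g (y - x) \<partial>M \<partial>lborel)"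
      by (rule Fubini'[symmetric]) measurable
    also have "\<dots> = (\<integral>\<^sup>+y. f y * c \<partial>lborel)"
    proof (rule nn_integral_cong)
      fix y
      have "(\<integral>\<^sup>+x. f y * g (y - x) \<partial>M) = f y * (\<integral>\<^sup>+x. g (y - x) \<partial>M)"
        by (rule nn_integral_cmult) measurable
      also have "(\<integral>\<^sup>+x. g (y - x) \<partial>M) = (\<integral>\<^sup>+x. g (y - (y + x)) \<partial>M)"
        by (rule inv[symmetric]) measurable
      finally show "(\<integral>\<^sup>+x. f y * g (y - x) \<partial>M) = f y * c" by (simp add: c_def)
    qed
    also have "\<dots> = (\<integral>\<^sup>+y. f y \<partial>lborel) * c" by (rule nn_integral_multc) measurable
    finally show ?thesis by (simp only: mult.commute)
  qed
  ultimately show thesis by (rule that)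
qed

section \<open>Product integrals, measurability and scaling for vectors\<close>

lemma prod_Basis_vec:
  fixes f :: "('b::euclidean_space)^'n \<Rightarrow> 'c::comm_monoid_mult"
  shows "(\<Prod>j\<in>Basis. f j) = (\<Prod>k\<in>UNIV. \<Prod>u\<in>Basis. f (axis k u))"
proof -
  have eq: "(Basis :: ('b^'n) set) = (\<lambda>(k,u). axis k u) ` (UNIV \<times> Basis)"
    by (auto simp: Basis_vec_def)
  have "inj_on (\<lambda>(k,u). axis k u :: 'b^'n) (UNIV \<times> Basis)"
    by (auto simp: inj_on_def axis_eq_axis)
  then show ?thesis
    unfolding eq by (subst prod.reindex) (simp_all add: prod.cartesian_product case_prod_beta)
qed

lemma nn_integral_lborel_vec_prod:
  fixes f :: "'n::finite \<Rightarrow> real \<Rightarrow> ennreal"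
  assumes [measurable]: "\<And>k. f k \<in> borel_measurable borel"
  shows "(\<integral>\<^sup>+y. (\<Prod>k\<in>UNIV. f k (y$k)) \<partial>(lborel :: (real^'n) measure)) = (\<Prod>k\<in>UNIV. (\<integral>\<^sup>+x. f k x \<partial>lborel))"
proof -
  define F where "F b = f (THE k. axis k 1 = b)" for b :: "real^'n"
  have F: "F (axis k 1) = f k" for k
    unfolding F_def by (rule arg_cong[of _ _ f]) (auto simp: axis_eq_axis)
  have "(\<integral>\<^sup>+y. (\<Prod>b\<in>Basis. F b (y \<bullet> b)) \<partial>(lborel :: (real^'n) measure)) = (\<Prod>b\<in>Basis. (\<integral>\<^sup>+x. F b x \<partial>lborel))"
    by (rule nn_integral_lborel_prod) (auto simp: F_def)
  then show ?thesis by (simp add: prod_Basis_vec F inner_axis)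
qed

lemma borel_measurable_vec_nth [measurable]:
  "(\<lambda>w. w $ k) \<in> borel_measurable (borel :: ('b::euclidean_space^'n) measure)"
  by (intro borel_measurable_continuous_onI continuous_intros)

lemma borel_measurable_vec_lambda [measurable (raw)]:
  fixes f :: "'c \<Rightarrow> 'n::finite \<Rightarrow> 'b::euclidean_space"
  assumes "\<And>k. (\<lambda>x. f x k) \<in> borel_measurable M"
  shows "(\<lambda>x. \<chi> k. f x k) \<in> borel_measurable M"
proof (rule borel_measurable_euclidean_space[THEN iffD2], rule ballI)
  fix b :: "'b^'n" assume "b \<in> Basis"
  then obtain k u where b: "b = axis k u" by (auto simp: Basis_vec_def)
  show "(\<lambda>x. (\<chi> k. f x k) \<bullet> b) \<in> borel_measurable M"
    using assms[of k] by (simp add: b inner_axis)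
qed

lemma borel_measurable_vec_times [measurable (raw)]:
  fixes f g :: "'c \<Rightarrow> complex^'n"
  assumes [measurable]: "f \<in> borel_measurable M" "g \<in> borel_measurable M"
  shows "(\<lambda>x. f x * g x) \<in> borel_measurable M"
proof -
  have "(\<lambda>x. \<chi> k. f x $ k * g x $ k) \<in> borel_measurable M" by measurable
  then show ?thesis by (simp add: times_vec_def)
qed

lemma AE_vec_nonzero: "AE w in lborel. \<forall>k. (w::complex^'n) $ k \<noteq> 0"
proof -
  have "AE w in lborel. (w::complex^'n) $ k \<noteq> 0" for k
  proof -
    have "{w. axis k 1 \<bullet> (w::complex^'n) = 0} \<in> null_sets lebesgue"
      using negligible_hyperplane[of "axis k 1 :: complex^'n" 0] by (simp add: axis_eq_0_iff negligible_iff_null_sets)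
    moreover have "{w. w $ k = 0} \<subseteq> {w. axis k 1 \<bullet> (w::complex^'n) = 0}" by (auto simp: inner_axis')
    ultimately have "{w. (w::complex^'n) $ k = 0} \<in> null_sets lebesgue"
      by (metis negligible_iff_null_sets negligible_subset)
    then have "AE w in lebesgue. \<not> ((w::complex^'n) $ k = 0)"
      by (rule AE_I'[of _ _ ]) auto
    then show ?thesis by (simp add: AE_completion_iff)
  qed
  then show ?thesis by (simp add: AE_all_countable countable_finite)
qed

text \<open>The multiplier is split into moduli and phases. Moduli act as a diagonal real map with
  explicit determinant. The image of Lebesgue measure under phases is again translation invariant
  and gives balls about 0 the same measure, so it is Lebesgue measure by uniqueness.\<close>

lemma nn_integral_lborel_vec_scale:
  fixes l :: "complex^'n"
  assumes l: "\<And>k. l$k \<noteq> 0" and [measurable]: "f \<in> borel_measurable borel"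
  shows "(\<integral>\<^sup>+w. f (l * w) \<partial>lborel) * ennreal (\<Prod>k\<in>UNIV. (cmod (l$k))\<^sup>2) = (\<integral>\<^sup>+w. f w \<partial>lborel)"
proof -
  define P :: "(complex^'n) set" where "P = {w. \<forall>k. cmod (w$k) \<le> 1}"
  \<comment> \<open>Each complex coordinate contributes two real directions stretched by
    \<open>r k\<close>, whence the squares.\<close>
  have real: "(\<integral>\<^sup>+w. f ((\<chi> k. of_real (r k)) * w) \<partial>lborel) * ennreal (\<Prod>k\<in>UNIV. (r k)\<^sup>2) = (\<integral>\<^sup>+w. f w \<partial>lborel)"
    if r: "\<And>k. r k > 0" and [measurable]: "f \<in> borel_measurable borel" for r :: "'n \<Rightarrow> real" and f :: "complex^'n \<Rightarrow> ennreal"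
  proof -
    define c where "c j = (\<Sum>k\<in>UNIV. r k * norm (j$k))" for j :: "complex^'n"
    have c: "c (axis k u) = r k" if "u \<in> Basis" for k u
    proof -
      have "c (axis k u) = (\<Sum>i\<in>UNIV. if i = k then r k else 0)"
        unfolding c_def using that by (intro sum.cong) (auto simp: axis_def)
      then show ?thesis by simp
    qed
    have T: "(\<Sum>j\<in>Basis. (c j * (w \<bullet> j)) *\<^sub>R j) = (\<chi> k. of_real (r k)) * w" for w
    proof (rule euclidean_eqI)
      fix b :: "complex^'n" assume b: "b \<in> Basis"
      then obtain k u where bk: "b = axis k u" "u \<in> Basis" by (auto simp: Basis_vec_def)
      have "((\<chi> k. of_real (r k)) * w) \<bullet> b = c b * (w \<bullet> b)"
        by (simp add: bk c inner_axis scaleR_conv_of_real[symmetric])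
      then show "(\<Sum>j\<in>Basis. (c j * (w \<bullet> j)) *\<^sub>R j) \<bullet> b = ((\<chi> k. of_real (r k)) * w) \<bullet> b"
        using b by simp
    qed
    have "lborel = density (distr lborel borel (\<lambda>x. 0 + (\<Sum>j\<in>Basis. (c j * (x \<bullet> j)) *\<^sub>R j))) (\<lambda>_. (\<Prod>j\<in>Basis. \<bar>c j\<bar>))"
      using r by (intro lborel_affine_euclidean) (auto simp: Basis_vec_def c, metis less_irrefl)
    moreover have "(\<Prod>j\<in>Basis. \<bar>c j\<bar>) = (\<Prod>k\<in>UNIV. (r k)\<^sup>2)"
      using r by (simp add: prod_Basis_vec c Basis_complex_def power2_eq_square)
    ultimately have eq: "(lborel :: (complex^'n) measure) = density (distr lborel borel (\<lambda>w. (\<chi> k. of_real (r k)) * w)) (\<lambda>_. ennreal (\<Prod>k\<in>UNIV. (r k)\<^sup>2))"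
      by (simp add: T)
    show ?thesis
      by (subst (2) eq) (simp add: nn_integral_density nn_integral_multc nn_integral_distr mult.commute)
  qed
  have unim: "(\<integral>\<^sup>+w. f (u * w) \<partial>lborel) = (\<integral>\<^sup>+w. f w \<partial>lborel)"
    if u: "\<And>k. cmod (u$k) = 1" and [measurable]: "f \<in> borel_measurable borel" for u :: "complex^'n" and f :: "complex^'n \<Rightarrow> ennreal"
  proof -
    define M where "M = distr lborel borel (\<lambda>w. u * w)"
    have nn: "(\<integral>\<^sup>+x. h x \<partial>M) = (\<integral>\<^sup>+x. h (u * x) \<partial>lborel)" if [measurable]: "h \<in> borel_measurable borel" for h
      unfolding M_def by (simp add: nn_integral_distr)
    have un: "u $ k * cnj (u $ k) = 1" for k
      using u[of k] by (simp add: complex_norm_square[symmetric])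
    have inv: "(\<integral>\<^sup>+x. h (a + x) \<partial>M) = (\<integral>\<^sup>+x. h x \<partial>M)" if [measurable]: "h \<in> borel_measurable borel" for a h
    proof -
      define b :: "complex^'n" where "b = (\<chi> k. cnj (u$k)) * a"
      have "u * (b + x) = a + u * x" for x
        by (simp add: vec_eq_iff b_def distrib_left mult.assoc[symmetric] un)
      then show ?thesis
        using nn_integral_lborel_translate[of "\<lambda>x. h (u * x)" b] by (simp add: nn)
    qed
    have nu: "norm (u * x) = norm x" for x
      using u by (simp add: norm_vec_def L2_set_def norm_mult)
    have ball: "(\<integral>\<^sup>+x. indicator (cball 0 r) x \<partial>M) = (\<integral>\<^sup>+x. indicator (cball 0 r) x \<partial>(lborel :: (complex^'n) measure))" for r
    proof -
      have "(indicator (cball 0 r) :: complex^'n \<Rightarrow> ennreal) \<in> borel_measurable borel" by (rule borel_measurable_indicator) simp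
      moreover have "(\<lambda>x. indicator (cball 0 r) (u * x) :: ennreal) = indicator (cball 0 r)"
        by (simp only: fun_eq_iff indicator_def mem_cball_0 nu simp_thms)
      ultimately show ?thesis using nn[of "indicator (cball 0 r)"] by simp
    qed
    have fin: "emeasure M (cball 0 r) < \<infinity>" for r
    proof -
      have "(\<integral>\<^sup>+x. indicator (cball 0 r) x \<partial>M) = (\<integral>\<^sup>+x. indicator (cball 0 r) x \<partial>(lborel :: (complex^'n) measure))"
        by (rule ball)
      moreover have "emeasure lborel (cball (0::complex^'n) r) < \<infinity>"
        by (intro emeasure_lborel_cball_finite)
      ultimately show ?thesis by (simp add: M_def)
    qed
    obtain c where c: "\<And>f. f \<in> borel_measurable borel \<Longrightarrow> (\<integral>\<^sup>+x. f x \<partial>M) = c * (\<integral>\<^sup>+x. f x \<partial>lborel)"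
      using translation_invariant_imp_lborel[of M] inv fin unfolding M_def by (metis sets_distr)
    have "(\<integral>\<^sup>+x. indicator (cball 0 1) x \<partial>M) = (\<integral>\<^sup>+x. indicator (cball 0 1) x \<partial>(lborel :: (complex^'n) measure))"
      by (rule ball)
    then have "c * emeasure lborel (cball (0::complex^'n) 1) = emeasure lborel (cball (0::complex^'n) 1)"
      using c[OF borel_measurable_indicator, of "cball 0 1"] by simp
    moreover have "emeasure lborel (cball (0::complex^'n) 1) \<noteq> 0"
      using content_cball_pos[of 1 "0::complex^'n"] by (auto simp: measure_def)
    moreover have "emeasure lborel (cball (0::complex^'n) 1) \<noteq> \<infinity>"
      using emeasure_lborel_cball_finite[of "0::complex^'n" 1] by simp
    ultimately have "c = 1" 
      by (metis mult_divide_eq_ennreal mult_1 infinity_ennreal_def)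
    then show ?thesis using c[of f] nn[of f] by simp
  qed
  define u where "u = (\<chi> k. sgn (l$k))"
  have "(\<integral>\<^sup>+w. f (l * w) \<partial>lborel) = (\<integral>\<^sup>+w. f (u * ((\<chi> k. of_real (cmod (l$k))) * w)) \<partial>lborel)"
    by (intro nn_integral_cong arg_cong[of _ _ f])
       (simp add: vec_eq_iff u_def sgn_div_norm scaleR_conv_of_real l)
  moreover have "(\<integral>\<^sup>+w. f w \<partial>lborel) = (\<integral>\<^sup>+w. f (u * w) \<partial>lborel)"
    using l by (intro unim[symmetric]) (auto simp: u_def norm_sgn)
  ultimately show ?thesis
    using real[of "\<lambda>k. cmod (l$k)" "\<lambda>w. f (u * w)"] l by simp
qed

subsection \<open>Monomials and the Haar measure of the torus\<close>

definition mon :: "('n \<Rightarrow> int) \<Rightarrow> complex^'n \<Rightarrow> complex" where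
  "mon a w = (\<Prod>k\<in>UNIV. w$k powi a k)"

definition torus :: "(complex^'n) set" where
  "torus = {u. \<forall>k. cmod (u$k) = 1}"

text \<open>Normalised Haar measure, obtained as the law of the coordinatewise phases of a uniformly
  distributed point of the closed polydisc. It is a measure on the ambient space concentrated on
  \<open>torus\<close>, so facts about torus elements enter as almost-everywhere statements.\<close>

definition torus_measure :: "(complex^'n) measure" where
  "torus_measure = distr (uniform_measure lborel {w. \<forall>k. cmod (w$k) \<le> 1}) borel (\<lambda>w. \<chi> k. sgn (w$k))"

lemma mon_mult: "mon a (u * w) = mon a u * mon a w"
  by (simp add: mon_def power_int_mult_distrib prod.distrib)

lemma mon_0 [simp]: "mon (\<lambda>_. 0) w = 1"
  by (simp add: mon_def)

lemma mon_eq_0_iff: "(\<forall>k. w$k \<noteq> 0) \<Longrightarrow> mon a w \<noteq> 0"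
  by (simp add: mon_def)

lemma mon_add: "(\<forall>k. w$k \<noteq> 0) \<Longrightarrow> mon (\<lambda>k. a k + b k) w = mon a w * mon b w"
  by (simp add: mon_def power_int_add prod.distrib)

lemma mon_diff: "(\<forall>k. w$k \<noteq> 0) \<Longrightarrow> mon (\<lambda>k. a k - b k) w = mon a w / mon b w"
  by (simp add: mon_def power_int_diff prod_dividef)

lemma mon_minus: "mon (\<lambda>k. - a k) w = inverse (mon a w)"
  by (simp add: mon_def power_int_minus prod_inversef[symmetric] o_def)

lemma mon_power: "mon (\<lambda>k. int q * a k) w = mon a w ^ q"
proof -
  have "w$k powi (int q * a k) = (w$k powi a k) ^ q" for k
    by (subst mult.commute) (metis power_int_mult power_int_of_nat)
  then show ?thesis by (simp add: mon_def prod_power_distrib)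
qed

lemma norm_mon: "cmod (mon a w) = (\<Prod>k\<in>UNIV. cmod (w$k) powi a k)"
  by (simp add: mon_def prod_norm[symmetric] norm_power_int)

lemma norm_mon_torus: "u \<in> torus \<Longrightarrow> cmod (mon a u) = 1"
  by (simp add: norm_mon torus_def)

lemma torus_nonzero: "u \<in> torus \<Longrightarrow> u$k \<noteq> 0"
  by (auto simp: torus_def) (metis norm_zero zero_neq_one)

lemma norm_torus_mult [simp]: "u \<in> torus \<Longrightarrow> cmod ((u * w)$k) = cmod (w$k)"
  by (simp add: torus_def norm_mult)

lemma cnj_mon_torus: "u \<in> torus \<Longrightarrow> cnj (mon a u) = inverse (mon a u)"
  using norm_mon_torus[of u a] complex_norm_square[of "mon a u"] by (intro inverse_unique[symmetric]) simp

lemma mon_cis: "mon a (\<chi> k. cis (t k)) = cis (\<Sum>k\<in>UNIV. real_of_int (a k) * t k)"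
proof -
  have "cis x powi n = cis (real_of_int n * x)" for x n
    by (simp add: cis_power_int)
  moreover have "(\<Prod>k\<in>A. cis (f k)) = cis (\<Sum>k\<in>A. f k)" if "finite A" for A and f :: "'a \<Rightarrow> real"
    using that by induction (auto simp: cis_mult)
  ultimately show ?thesis by (simp add: mon_def)
qed

lemma borel_measurable_powi [measurable (raw)]:
  fixes f :: "'a \<Rightarrow> complex"
  assumes [measurable]: "f \<in> borel_measurable M"
  shows "(\<lambda>x. f x powi n) \<in> borel_measurable M"
  by (cases "n \<ge> 0") (simp_all add: power_int_def)

lemma borel_measurable_mon [measurable]: "mon a \<in> borel_measurable borel"
  unfolding mon_def by measurable

section \<open>Haar measure of the torus: invariance and averaging\<close>

lemma sets_torus_measure [measurable_cong, simp]: "sets torus_measure = sets borel"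
  by (simp add: torus_measure_def)

lemma space_torus_measure [simp]: "space torus_measure = UNIV"
  by (simp add: torus_measure_def)

lemma borel_torus [measurable]: "torus \<in> sets borel"
proof -
  have "torus = {u. \<forall>k. cmod (u$k) = 1}" by (auto simp: torus_def)
  also have "\<dots> \<in> sets borel" by measurable
  finally show ?thesis .
qed

lemma bounded_polydisc: "bounded {w::complex^'n. \<forall>k. cmod (w$k) \<le> 1}"
proof (rule boundedI)
  fix w :: "complex^'n" assume w: "w \<in> {w. \<forall>k. cmod (w$k) \<le> 1}"
  have "norm w \<le> (\<Sum>k\<in>UNIV. cmod (w$k))" unfolding norm_vec_def by (rule L2_set_le_sum) simp
  also have "\<dots> \<le> (\<Sum>k\<in>(UNIV::'n set). 1)" using w by (intro sum_mono) auto
  finally show "norm w \<le> real CARD('n)" by simp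
qed

lemma compact_torus: "compact (torus :: (complex^'n) set)"
proof (rule compact_eq_bounded_closed[THEN iffD2], rule conjI)
  show "bounded (torus :: (complex^'n) set)"
    by (rule bounded_subset[OF bounded_polydisc]) (auto simp: torus_def)
  have "(torus :: (complex^'n) set) = (\<Inter>k. {u. cmod (u$k) = 1})" by (auto simp: torus_def)
  also have "closed \<dots>"
    by (intro closed_INT ballI closed_Collect_eq continuous_intros)
  finally show "closed (torus :: (complex^'n) set)" .
qed

lemma closed_polydisc: "closed {w::complex^'n. \<forall>k. cmod (w$k) \<le> 1}"
  by (intro closed_Collect_all closed_Collect_le continuous_intros)

lemma borel_polydisc [measurable]: "{w::complex^'n. \<forall>k. cmod (w$k) \<le> 1} \<in> sets borel"
  by (rule borel_closed[OF closed_polydisc])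

lemma emeasure_polydisc:
  "emeasure lborel {w::complex^'n. \<forall>k. cmod (w$k) \<le> 1} \<noteq> 0"
  "emeasure lborel {w::complex^'n. \<forall>k. cmod (w$k) \<le> 1} \<noteq> \<infinity>"
proof -
  let ?P = "{w::complex^'n. \<forall>k. cmod (w$k) \<le> 1}"
  have P: "?P \<in> sets borel" by (rule borel_polydisc)
  have "cmod (x$k) \<le> 1" if "norm x \<le> 1" for x :: "complex^'n" and k
    using Finite_Cartesian_Product.norm_nth_le[of x k] that by linarith
  then have "cball 0 1 \<subseteq> ?P" by auto
  then have "emeasure lborel (cball (0::complex^'n) 1) \<le> emeasure lborel ?P"
    using P by (intro emeasure_mono) auto
  moreover have "emeasure lborel (cball (0::complex^'n) 1) \<noteq> 0"
    using content_cball_pos[of 1 "0::complex^'n"] by (auto simp: measure_def)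
  ultimately show "emeasure lborel ?P \<noteq> 0" by auto
  show "emeasure lborel ?P \<noteq> \<infinity>"
    using emeasure_bounded_finite[OF bounded_polydisc[where 'n='n]] by simp
qed

lemma nn_integral_torus:
  assumes [measurable]: "f \<in> borel_measurable borel"
  shows "(\<integral>\<^sup>+u. f u \<partial>torus_measure) = (\<integral>\<^sup>+w. f (\<chi> k. sgn (w$k)) * indicator {w::complex^'n. \<forall>k. cmod (w$k) \<le> 1} w \<partial>lborel)
     / emeasure lborel {w::complex^'n. \<forall>k. cmod (w$k) \<le> 1}"
proof -
  have [measurable]: "(sgn :: complex \<Rightarrow> complex) \<in> borel_measurable borel"
    unfolding sgn_div_norm by measurable
  show ?thesis
    unfolding torus_measure_def by (simp add: nn_integral_distr nn_integral_uniform_measure emeasure_polydisc)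
qed

lemma emeasure_torus_measure: "emeasure (torus_measure :: (complex^'n) measure) UNIV = 1"
proof -
  have "(\<integral>\<^sup>+u. 1 \<partial>(torus_measure :: (complex^'n) measure)) = 1"
    using emeasure_polydisc[where 'n='n] closed_polydisc[where 'n='n]
    by (subst nn_integral_torus) (auto simp: less_top)
  then show ?thesis by simp
qed

lemma finite_measure_torus: "finite_measure torus_measure"
  by (rule finite_measureI) (simp add: emeasure_torus_measure)

lemma measure_torus_measure [simp]: "measure torus_measure UNIV = 1"
  by (simp add: measure_def emeasure_torus_measure)

interpretation torus_measure: finite_measure torus_measure
  by (rule finite_measure_torus)

interpretation lborel_torus: pair_sigma_finite lborel torus_measure
  by (simp add: pair_sigma_finite_def sigma_finite_lborel torus_measure.sigma_finite_measure_axioms)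

lemma AE_torus: "AE u in torus_measure. u \<in> (torus :: (complex^'n) set)"
proof -
  have "(\<integral>\<^sup>+u. indicator (- torus) u \<partial>(torus_measure :: (complex^'n) measure)) = 0"
  proof (subst nn_integral_torus)
    have "AE w in lborel. indicator (- torus) (\<chi> k. sgn ((w::complex^'n)$k)) = (0::ennreal)"
      using AE_vec_nonzero[where 'n='n]
      by eventually_elim (auto simp: indicator_def torus_def norm_sgn)
    then have "(\<integral>\<^sup>+w. indicator (- torus) (\<chi> k. sgn (w $ k)) * indicator {w::complex^'n. \<forall>k. cmod (w $ k) \<le> 1} w \<partial>lborel) = (\<integral>\<^sup>+w. 0 \<partial>(lborel :: (complex^'n) measure))"
      by (intro nn_integral_cong_AE) auto
    then show "(\<integral>\<^sup>+w. indicator (- torus) (\<chi> k. sgn (w $ k)) * indicator {w::complex^'n. \<forall>k. cmod (w $ k) \<le> 1} w \<partial>lborel) /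
     emeasure lborel {w::complex^'n. \<forall>k. cmod (w $ k) \<le> 1} = 0"
      by simp
  qed simp
  then have "emeasure torus_measure (- torus :: (complex^'n) set) = 0" by simp
  then show ?thesis by (intro AE_I[of _ _ "- torus"]) auto
qed

lemma nn_integral_lborel_torus_mult:
  fixes u :: "complex^'n"
  assumes u: "u \<in> torus" and [measurable]: "f \<in> borel_measurable borel"
  shows "(\<integral>\<^sup>+w. f (u * w) \<partial>lborel) = (\<integral>\<^sup>+w. f w \<partial>lborel)"
  using nn_integral_lborel_vec_scale[of u f] u torus_nonzero[OF u] by (simp add: torus_def)

text \<open>Taking phases commutes with multiplication by a torus element and the polydisc is
  invariant, so the claim reduces to Lebesgue measure.\<close>

lemma nn_integral_torus_invariant:
  fixes u :: "complex^'n"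
  assumes u: "u \<in> torus" and [measurable]: "f \<in> borel_measurable borel"
  shows "(\<integral>\<^sup>+z. f (u * z) \<partial>torus_measure) = (\<integral>\<^sup>+z. f z \<partial>torus_measure)"
proof -
  have [measurable]: "(sgn :: complex \<Rightarrow> complex) \<in> borel_measurable borel"
    unfolding sgn_div_norm by measurable
  let ?P = "indicator {w::complex^'n. \<forall>k. cmod (w$k) \<le> 1} :: _ \<Rightarrow> ennreal"
  have "(\<integral>\<^sup>+w. f (u * (\<chi> k. sgn (w$k))) * ?P w \<partial>lborel) = (\<integral>\<^sup>+w. f (\<chi> k. sgn ((u*w)$k)) * ?P (u * w) \<partial>lborel)"
  proof (rule nn_integral_cong)
    fix w :: "complex^'n"
    have "u * (\<chi> k. sgn (w$k)) = (\<chi> k. sgn ((u*w)$k))"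
      using u by (simp add: vec_eq_iff torus_def sgn_div_norm norm_mult)
    moreover have "?P (u * w) = ?P w" using u by (simp add: indicator_def del: vector_mult_component)
    ultimately show "f (u * (\<chi> k. sgn (w$k))) * ?P w = f (\<chi> k. sgn ((u*w)$k)) * ?P (u * w)" by simp
  qed
  also have "\<dots> = (\<integral>\<^sup>+w. f (\<chi> k. sgn (w$k)) * ?P w \<partial>lborel)"
    by (rule nn_integral_lborel_torus_mult[OF u]) measurable
  finally show ?thesis by (simp add: nn_integral_torus)
qed

lemma distr_torus_invariant:
  fixes u :: "complex^'n"
  assumes u: "u \<in> torus"
  shows "distr torus_measure borel (\<lambda>z. u * z) = torus_measure" "distr lborel borel (\<lambda>z. u * z) = lborel"
proof -
  show "distr torus_measure borel (\<lambda>z. u * z) = torus_measure"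
  proof (rule measure_eqI)
    fix A assume "A \<in> sets (distr torus_measure borel (\<lambda>z. u * z))"
    then have [measurable]: "A \<in> sets borel" by simp
    have "emeasure (distr torus_measure borel (\<lambda>z. u * z)) A = (\<integral>\<^sup>+z. indicator A z \<partial>(distr torus_measure borel (\<lambda>z. u * z)))"
      by simp
    also have "\<dots> = (\<integral>\<^sup>+z. indicator A (u * z) \<partial>torus_measure)" by (rule nn_integral_distr) measurable
    also have "\<dots> = (\<integral>\<^sup>+z. indicator A z \<partial>torus_measure)" by (rule nn_integral_torus_invariant[OF u]) measurable
    finally show "emeasure (distr torus_measure borel (\<lambda>z. u * z)) A = emeasure torus_measure A" by simp
  qed simp
  show "distr lborel borel (\<lambda>z. u * z) = lborel"
  proof (rule measure_eqI)
    fix A assume "A \<in> sets (distr lborel borel (\<lambda>z. u * z))"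
    then have [measurable]: "A \<in> sets borel" by simp
    have "emeasure (distr lborel borel (\<lambda>z. u * z)) A = (\<integral>\<^sup>+z. indicator A z \<partial>(distr lborel borel (\<lambda>z. u * z)))"
      by simp
    also have "\<dots> = (\<integral>\<^sup>+z. indicator A (u * z) \<partial>lborel)" by (rule nn_integral_distr) measurable
    also have "\<dots> = (\<integral>\<^sup>+z. indicator A z \<partial>lborel)" by (rule nn_integral_lborel_torus_mult[OF u]) measurable
    finally show "emeasure (distr lborel borel (\<lambda>z. u * z)) A = emeasure lborel A" by simp
  qed simp
qed

lemma integral_torus_invariant:
  fixes f :: "complex^'n \<Rightarrow> complex"
  assumes u: "u \<in> torus" and [measurable]: "f \<in> borel_measurable borel"
  shows "(\<integral>z. f (u * z) \<partial>torus_measure) = (\<integral>z. f z \<partial>torus_measure)"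
  by (subst (2) distr_torus_invariant(1)[OF u, symmetric], subst integral_distr) measurable

text \<open>Orthogonality of characters: translation by a point where a nontrivial
  \<open>mon a\<close> has the value -1 shows that its integral equals its own negative.\<close>

lemma integral_mon_torus: 
  fixes a :: "'n::finite \<Rightarrow> int"
  shows "(\<integral>z. mon a z \<partial>torus_measure) = (if a = (\<lambda>_. 0) then 1 else 0)"
proof (cases "a = (\<lambda>_. 0)")
  case True
  then show ?thesis by simp
next
  case False
  then obtain k where k: "a k \<noteq> 0" by auto
  \<comment> \<open>Only coordinate \<open>k\<close> is rotated, by an angle that the exponent
    \<open>a k\<close> turns into \<open>pi\<close>.\<close>
  define u :: "complex^'n" where "u = (\<chi> j. cis (if j = k then pi / a k else 0))"
  have u: "u \<in> torus" by (simp add: u_def torus_def)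
  have "(\<Sum>j\<in>UNIV. real_of_int (a j) * (if j = k then pi / a k else 0)) = (\<Sum>j\<in>UNIV. if j = k then pi else 0)"
    using k by (intro sum.cong) auto
  then have "mon a u = -1" unfolding u_def mon_cis by simp
  then have "(\<integral>z. mon a z \<partial>torus_measure) = - (\<integral>z. mon a z \<partial>torus_measure)"
    using integral_torus_invariant[OF u, of "mon a"] by (simp add: mon_mult)
  then have "2 * (\<integral>z. mon a z \<partial>(torus_measure :: (complex^'n) measure)) = 0"
    by (simp add: eq_neg_iff_add_eq_0)
  then show ?thesis using False by simp
qed

lemma integrable_torus_bounded:
  fixes f :: "complex^'n \<Rightarrow> complex"
  assumes [measurable]: "f \<in> borel_measurable borel" and b: "\<And>u. u \<in> torus \<Longrightarrow> cmod (f u) \<le> C"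
  shows "integrable torus_measure f"
  using AE_torus b by (intro torus_measure.integrable_const_bound[of _ C]) (auto elim: eventually_mono)

lemma norm_integral_torus_le:
  fixes f :: "complex^'n \<Rightarrow> complex"
  assumes [measurable]: "f \<in> borel_measurable borel" and b: "\<And>u. u \<in> torus \<Longrightarrow> cmod (f u) \<le> C"
  shows "cmod (\<integral>u. f u \<partial>torus_measure) \<le> C"
proof -
  have "cmod (\<integral>u. f u \<partial>torus_measure) \<le> (\<integral>u. cmod (f u) \<partial>torus_measure)" by (rule integral_norm_bound)
  also have "\<dots> \<le> (\<integral>u. C \<partial>(torus_measure :: (complex^'n) measure))"
    using integrable_torus_bounded[OF assms] AE_torus b
    by (intro integral_mono_AE) (auto elim: eventually_mono)
  finally show ?thesis by simp
qed

text \<open>Invariance of Lebesgue measure under each fixed \<open>u\<close>, integrated over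
  \<open>u\<close> with the order interchanged. This replaces polar coordinates: phases are
  integrated first, with the moduli frozen.\<close>

lemma nn_integral_torus_average:
  fixes f :: "complex^'n \<Rightarrow> ennreal"
  assumes [measurable]: "f \<in> borel_measurable borel"
  shows "(\<integral>\<^sup>+w. f w \<partial>lborel) = (\<integral>\<^sup>+w. \<integral>\<^sup>+u. f (u * w) \<partial>torus_measure \<partial>lborel)"
proof -
  have "(\<integral>\<^sup>+w. \<integral>\<^sup>+u. f (u * w) \<partial>torus_measure \<partial>lborel) = (\<integral>\<^sup>+u. \<integral>\<^sup>+w. f (u * w) \<partial>lborel \<partial>torus_measure)"
    by (rule lborel_torus.Fubini'[symmetric]) measurable
  also have "\<dots> = (\<integral>\<^sup>+u. \<integral>\<^sup>+w. f w \<partial>lborel \<partial>(torus_measure :: (complex^'n) measure))"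
    using AE_torus by (intro nn_integral_cong_AE) (auto elim!: eventually_mono simp: nn_integral_lborel_torus_mult)
  finally show ?thesis by (simp add: emeasure_torus_measure)
qed

lemma integral_torus_average:
  fixes f :: "complex^'n \<Rightarrow> complex"
  assumes f: "integrable lborel f"
  shows "(\<integral>w. f w \<partial>lborel) = (\<integral>w. (\<integral>u. f (u * w) \<partial>torus_measure) \<partial>lborel)"
proof -
  have [measurable]: "f \<in> borel_measurable borel" using f by auto
  have "integrable (lborel \<Otimes>\<^sub>M torus_measure) (\<lambda>(w,u). f (u * w))"
  proof (rule integrableI_bounded)
    have "(\<integral>\<^sup>+x. norm (case x of (w,u) \<Rightarrow> f (u * w)) \<partial>(lborel \<Otimes>\<^sub>M torus_measure)) = (\<integral>\<^sup>+w. \<integral>\<^sup>+u. norm (f (u * w)) \<partial>torus_measure \<partial>lborel)"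
      by (subst torus_measure.nn_integral_fst[symmetric]) (auto intro!: nn_integral_cong)
    also have "\<dots> = (\<integral>\<^sup>+w. norm (f w) \<partial>lborel)"
      by (rule nn_integral_torus_average[symmetric]) measurable
    also have "\<dots> < \<infinity>" using f by (simp add: integrable_iff_bounded)
    finally show "(\<integral>\<^sup>+x. norm (case x of (w,u) \<Rightarrow> f (u * w)) \<partial>(lborel \<Otimes>\<^sub>M torus_measure)) < \<infinity>" .
  qed measurable
  then have "(\<integral>w. (\<integral>u. f (u * w) \<partial>torus_measure) \<partial>lborel) = (\<integral>u. (\<integral>w. f (u * w) \<partial>lborel) \<partial>torus_measure)"
    by (rule lborel_torus.Fubini_integral[symmetric])
  also have "\<dots> = (\<integral>u. (\<integral>w. f w \<partial>lborel) \<partial>(torus_measure :: (complex^'n) measure))"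
  proof (rule integral_cong_AE)
    show "AE u in torus_measure. (\<integral>w. f (u * w) \<partial>lborel) = (\<integral>w. f w \<partial>lborel)"
      using AE_torus
    proof eventually_elim
      case (elim u)
      show ?case
        by (subst (2) distr_torus_invariant(2)[OF elim, symmetric], subst integral_distr) measurable
    qed
  qed (auto intro!: lborel.borel_measurable_lebesgue_integral)
  finally show ?thesis by simp
qed

subsection \<open>Monomial polyhedra in logarithmic coordinates\<close>

text \<open>Applied to each logarithmic coordinate, this decides whether a power of a monomial is
  integrable over the polyhedron.\<close>

lemma nn_integral_exp_neg:
  "(\<integral>\<^sup>+y. ennreal (exp (c * y)) * indicator {..<0} y \<partial>lborel) = (if c > 0 then ennreal (1 / c) else \<infinity>)"
proof (cases "c > 0")
  case True
  have "(\<integral>\<^sup>+y. ennreal (exp (c * y)) * indicator {..<0} y \<partial>lborel)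
      = ennreal \<bar>-1\<bar> * (\<integral>\<^sup>+y. ennreal (exp (c * (0 + (-1) * y))) * indicator {..<0} (0 + (-1) * y) \<partial>lborel)"
    by (rule nn_integral_real_affine) auto
  also have "\<dots> = (\<integral>\<^sup>+y. ennreal (exp (- c * y)) * indicator {0<..} y \<partial>lborel)"
    by (auto intro!: nn_integral_cong simp: indicator_def)
  also have "\<dots> = (\<integral>\<^sup>+y. ennreal (exp (- c * y)) * indicator {0..} y \<partial>lborel)"
    using AE_lborel_singleton[of 0] by (intro nn_integral_cong_AE) (auto elim!: eventually_mono simp: indicator_def)
  also have "\<dots> = ennreal (0 - (- exp (- c * 0) / c))"
  proof (rule nn_integral_FTC_atLeast)
    show "((\<lambda>y. - exp (- c * y) / c) \<longlongrightarrow> 0) at_top"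
      using True by real_asymp
    show "DERIV (\<lambda>y. - exp (- c * y) / c) x :> exp (- c * x)" for x
      using True by (auto intro!: derivative_eq_intros)
  qed auto
  finally show ?thesis using True by simp
next
  case False
  have "of_nat n \<le> emeasure lborel {..<(0::real)}" for n
  proof -
    have "of_nat n = emeasure lborel {- real n..<0}" by (simp add: ennreal_of_nat_eq_real_of_nat)
    also have "\<dots> \<le> emeasure lborel {..<(0::real)}" by (rule emeasure_mono) auto
    finally show ?thesis .
  qed
  then have "(SUP n. of_nat n) \<le> emeasure lborel {..<(0::real)}" by (intro SUP_least)
  then have "(\<infinity>::ennreal) = emeasure lborel {..<(0::real)}"
    by (simp add: ennreal_SUP_of_nat_eq_top top_unique)
  also have "\<dots> = (\<integral>\<^sup>+y. indicator {..<(0::real)} y \<partial>lborel)" by simp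
  also have "\<dots> \<le> (\<integral>\<^sup>+y. ennreal (exp (c * y)) * indicator {..<0} y \<partial>lborel)"
    using False by (intro nn_integral_mono) (auto simp: indicator_def mult_nonpos_nonpos)
  finally show ?thesis using False by (simp add: top_unique)
qed

lemma nn_integral_exp_neg_nonzero:
  "(\<integral>\<^sup>+y. ennreal (exp (c * y)) * indicator {..<0} y \<partial>lborel) \<noteq> 0"
  by (simp add: nn_integral_exp_neg)

text \<open>For the polyhedron of a matrix \<open>B\<close>, the rows \<open>G k\<close> are positive integral multiples of the rows of
  \<open>B\<close>, and \<open>Y k\<close> is the primitive integral vector on the ray of the \<open>k\<close>-th column of the inverse of \<open>B\<close>, so
  that \<open>\<Sum>j. Y k j\<close> is its projective height. With \<open>t = (mon (G k) w)\<^sub>k\<close> one has formally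
  \<open>w j = (\<Prod>k. t k powr Y k j) powr (1/N)\<close>. That \<open>N\<close> exceeds the heights makes \<open>1 / mon (G k)\<close> fail to be
  square integrable.\<close>

locale monomial_cone =
  fixes Y G :: "'n::finite \<Rightarrow> 'n \<Rightarrow> int" and N :: int
  assumes N_pos: "N > 0"
    and GY: "\<And>k l. (\<Sum>j\<in>UNIV. G k j * Y l j) = (if k = l then N else 0)"
    and YG: "\<And>i j. (\<Sum>k\<in>UNIV. Y k i * G k j) = (if i = j then N else 0)"
    and Y_nonneg: "\<And>k j. Y k j \<ge> 0"
    and N_gt: "\<And>k. (\<Sum>j\<in>UNIV. Y k j) < N"
begin

definition h :: "'n \<Rightarrow> int" where "h k = (\<Sum>j\<in>UNIV. Y k j)"

definition dot :: "('n \<Rightarrow> int) \<Rightarrow> 'n \<Rightarrow> int" where "dot a k = (\<Sum>j\<in>UNIV. a j * Y k j)"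

definition U :: "(complex^'n) set" where
  "U = {z. \<forall>k. (\<forall>j. z$j = 0 \<longrightarrow> 0 \<le> G k j) \<and> cmod (mon (G k) z) < 1}"

text \<open>Off the coordinate hyperplanes the polyhedron is the negative orthant in these
  coordinates; see \<open>U_iff\<close>.\<close>

definition L :: "'n \<Rightarrow> complex^'n \<Rightarrow> real" where "L k w = ln (cmod (mon (G k) w))"

lemma borel_measurable_L [measurable]: "L k \<in> borel_measurable borel"
  unfolding L_def by measurable

lemma dot_G: "dot (G k) l = (if k = l then N else 0)"
  by (simp add: dot_def GY)

lemma dot_add: "dot (\<lambda>j. a j + b j) k = dot a k + dot b k"
  by (simp add: dot_def distrib_right sum.distrib)

lemma dot_diff: "dot (\<lambda>j. a j - b j) k = dot a k - dot b k"
  by (simp add: dot_def left_diff_distrib sum_subtractf)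

lemma dot_cmult: "dot (\<lambda>j. m * a j) k = m * dot a k"
  by (simp add: dot_def sum_distrib_left mult.assoc)

lemma dot_sum: "dot (\<lambda>j. \<Sum>i\<in>I. a i j) k = (\<Sum>i\<in>I. dot (a i) k)"
  unfolding dot_def sum_distrib_right by (rule sum.swap)

lemma dot_1: "dot (\<lambda>_. 1) k = h k"
  by (simp add: dot_def h_def)

lemma h_pos: "h k \<ge> 1"
proof (rule ccontr)
  assume "\<not> h k \<ge> 1"
  then have "h k = 0" using Y_nonneg sum_nonneg[of UNIV "Y k"] unfolding h_def by fastforce
  then have "Y k j = 0" for j using Y_nonneg by (simp add: h_def sum_nonneg_eq_0_iff)
  then show False using GY[of k k] N_pos by simp
qed

text \<open>\<open>Y\<close> and \<open>G\<close> are dual bases up to the factor \<open>N\<close>,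
  so an exponent can be recovered from its pairings with the edge vectors.\<close>

lemma dot_inverse: "(\<Sum>k\<in>UNIV. G k j * dot a k) = N * a j"
proof -
  have "(\<Sum>k\<in>UNIV. G k j * dot a k) = (\<Sum>k\<in>UNIV. \<Sum>i\<in>UNIV. G k j * (a i * Y k i))"
    by (simp add: dot_def sum_distrib_left)
  also have "\<dots> = (\<Sum>i\<in>UNIV. \<Sum>k\<in>UNIV. G k j * (a i * Y k i))" by (rule sum.swap)
  also have "\<dots> = (\<Sum>i\<in>UNIV. a i * (\<Sum>k\<in>UNIV. Y k i * G k j))"
    by (simp add: sum_distrib_left mult_ac)
  also have "\<dots> = (\<Sum>i\<in>UNIV. if i = j then a i * N else 0)" unfolding YG by (intro sum.cong) auto
  finally show ?thesis by simp
qed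

lemma dot_inj: "(\<And>k. dot a k = dot b k) \<Longrightarrow> a = b"
proof
  fix j assume "\<And>k. dot a k = dot b k"
  then have "N * a j = N * b j" by (simp flip: dot_inverse)
  then show "a j = b j" using N_pos by simp
qed

lemma ln_norm_mon: "(\<forall>j. w$j \<noteq> 0) \<Longrightarrow> ln (cmod (mon a w)) = (\<Sum>j\<in>UNIV. a j * ln (cmod (w$j)))"
  by (simp add: norm_mon ln_prod powr_real_of_int'[symmetric] ln_powr)

lemma L_eq: "(\<forall>j. w$j \<noteq> 0) \<Longrightarrow> L k w = (\<Sum>j\<in>UNIV. G k j * ln (cmod (w$j)))"
  by (simp add: L_def ln_norm_mon)

lemma ln_norm_mon_L:
  assumes w: "\<forall>j. w$j \<noteq> 0"
  shows "ln (cmod (mon a w)) = (\<Sum>k\<in>UNIV. dot a k * L k w) / N"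
proof -
  have "(\<Sum>k\<in>UNIV. dot a k * L k w) = (\<Sum>k\<in>UNIV. \<Sum>j\<in>UNIV. (dot a k * G k j) * ln (cmod (w$j)))"
    by (simp add: L_eq[OF w] sum_distrib_left mult.assoc)
  also have "\<dots> = (\<Sum>j\<in>UNIV. \<Sum>k\<in>UNIV. (dot a k * G k j) * ln (cmod (w$j)))" by (rule sum.swap)
  also have "\<dots> = (\<Sum>j\<in>UNIV. of_int (\<Sum>k\<in>UNIV. G k j * dot a k) * ln (cmod (w$j)))"
    by (simp add: sum_distrib_left sum_distrib_right mult_ac)
  also have "\<dots> = N * ln (cmod (mon a w))"
    unfolding dot_inverse ln_norm_mon[OF w] by (simp add: sum_distrib_left mult.assoc)
  finally show ?thesis using N_pos by simp
qed

lemma norm_mon_L: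
  assumes w: "\<forall>j. w$j \<noteq> 0"
  shows "cmod (mon a w) = exp (\<Sum>k\<in>UNIV. dot a k * L k w / N)"
  using ln_norm_mon_L[OF w, of a] mon_eq_0_iff[OF w, of a]
  by (metis exp_ln sum_divide_distrib zero_less_norm_iff)

lemma U_iff: "(\<forall>j. w$j \<noteq> 0) \<Longrightarrow> w \<in> U \<longleftrightarrow> (\<forall>k. L k w < 0)"
  using mon_eq_0_iff[of w] by (auto simp: U_def L_def)

lemma L_torus [simp]: "u \<in> torus \<Longrightarrow> L k (u * w) = L k w"
  by (simp add: L_def mon_mult norm_mult norm_mon_torus)

lemma U_torus [simp]: "u \<in> torus \<Longrightarrow> u * w \<in> U \<longleftrightarrow> w \<in> U"
  using torus_nonzero[of u] by (simp add: U_def mon_mult norm_mult norm_mon_torus)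

lemma borel_U [measurable]: "U \<in> sets borel"
  unfolding U_def by measurable

text \<open>Lebesgue measure divided by the squared moduli of all coordinates is invariant under
  multiplication by vectors without zero entry, and such a multiplication translates the vector of
  all \<open>L k\<close>. Its image under \<open>L\<close> is therefore translation invariant, hence
  a multiple of Lebesgue measure. Undoing the division restores the squared modulus of the product
  of the coordinates, which is the exponential weight on the right.\<close>

lemma radial_const_exists:
  "\<exists>c::real. c > 0 \<and> (\<forall>f\<in>borel_measurable borel. (\<integral>\<^sup>+w. f (\<chi> k. L k w) \<partial>lborel)
     = c * (\<integral>\<^sup>+y. f y * ennreal (exp (\<Sum>k\<in>UNIV. 2 * h k * y$k / N)) \<partial>lborel))"
proof -
  define q :: "complex^'n \<Rightarrow> real" where "q w = (\<Prod>k\<in>UNIV. inverse ((cmod (w$k))\<^sup>2))" for w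
  have [measurable]: "q \<in> borel_measurable borel" unfolding q_def by measurable
  have q_nonneg: "q w \<ge> 0" for w by (auto simp: q_def intro!: prod_nonneg)
  define M where "M = distr (density lborel (\<lambda>w. ennreal (q w))) borel (\<lambda>w. \<chi> k. L k w)"
  have M: "(\<integral>\<^sup>+y. f y \<partial>M) = (\<integral>\<^sup>+w. f (\<chi> k. L k w) * ennreal (q w) \<partial>lborel)"
    if [measurable]: "f \<in> borel_measurable borel" for f
    unfolding M_def by (simp add: nn_integral_distr nn_integral_density mult.commute)
  have inv: "(\<integral>\<^sup>+y. f (a + y) \<partial>M) = (\<integral>\<^sup>+y. f y \<partial>M)" if [measurable]: "f \<in> borel_measurable borel" for a f
  proof -
    \<comment> \<open>A multiplier with prescribed logarithmic coordinates \<open>a\<close>, found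
      with the inverse matrix \<open>Y / N\<close>.\<close>
    define r where "r j = exp (\<Sum>k\<in>UNIV. Y k j * a$k / N)" for j
    define l :: "complex^'n" where "l = (\<chi> j. of_real (r j))"
    have l: "l$j \<noteq> 0" "cmod (l$j) = r j" for j by (simp_all add: l_def r_def)
    have Ll: "L k l = a$k" for k
    proof -
      have "L k l = (\<Sum>j\<in>UNIV. \<Sum>m\<in>UNIV. G k j * Y m j * a$m / N)"
        using l by (subst L_eq) (auto simp: r_def sum_distrib_left mult.assoc)
      also have "\<dots> = (\<Sum>m\<in>UNIV. \<Sum>j\<in>UNIV. G k j * Y m j * a$m / N)" by (rule sum.swap)
      also have "\<dots> = (\<Sum>m\<in>UNIV. of_int (\<Sum>j\<in>UNIV. G k j * Y m j) * a$m / N)"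
        by (simp add: sum_distrib_right sum_divide_distrib)
      also have "\<dots> = (\<Sum>m\<in>UNIV. if k = m then a$m else 0)"
        unfolding GY using N_pos by (intro sum.cong) auto
      finally show ?thesis by simp
    qed
    have "(\<integral>\<^sup>+y. f (a + y) \<partial>M) = (\<integral>\<^sup>+w. f (a + (\<chi> k. L k w)) * ennreal (q w) \<partial>lborel)"
      by (rule M) measurable
    also have "\<dots> = (\<integral>\<^sup>+w. f (\<chi> k. L k (l * w)) * ennreal (q (l * w)) * ennreal (\<Prod>k\<in>UNIV. (cmod (l$k))\<^sup>2) \<partial>lborel)"
    proof (rule nn_integral_cong_AE)
      show "AE w in lborel. f (a + (\<chi> k. L k w)) * ennreal (q w)
        = f (\<chi> k. L k (l * w)) * ennreal (q (l * w)) * ennreal (\<Prod>k\<in>UNIV. (cmod (l$k))\<^sup>2)"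
        using AE_vec_nonzero
      proof eventually_elim
        case (elim w)
        have "L k (l * w) = a$k + L k w" for k
          using elim l(1) mon_eq_0_iff[of l] mon_eq_0_iff[of w]
          by (simp add: Ll[symmetric]) (simp add: L_def mon_mult norm_mult ln_mult)
        then have "(\<chi> k. L k (l * w)) = a + (\<chi> k. L k w)" by (simp add: vec_eq_iff)
        moreover have "q w = q (l * w) * (\<Prod>k\<in>UNIV. (cmod (l$k))\<^sup>2)"
          unfolding q_def prod.distrib[symmetric] using l(1)
          by (intro prod.cong) (auto simp: norm_mult power_mult_distrib field_simps)
        ultimately show ?case
          by (simp add: ennreal_mult q_nonneg prod_nonneg mult.assoc)
      qed
    qed
    also have "\<dots> = (\<integral>\<^sup>+w. f (\<chi> k. L k (l * w)) * ennreal (q (l * w)) \<partial>lborel) * ennreal (\<Prod>k\<in>UNIV. (cmod (l$k))\<^sup>2)"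
      by (rule nn_integral_multc) measurable
    also have "\<dots> = (\<integral>\<^sup>+w. f (\<chi> k. L k w) * ennreal (q w) \<partial>lborel)"
      using l by (intro nn_integral_lborel_vec_scale) measurable
    finally show ?thesis by (simp add: M)
  qed
  have fin: "emeasure M (cball 0 r) < \<infinity>" for r
  proof -
    \<comment> \<open>Bounded \<open>L\<close> forces bounded logarithms of all coordinates: the
      preimage of a ball lies in a region where the moduli stay between \<open>exp (- R)\<close> and
      \<open>exp R\<close> and the density \<open>q\<close> is bounded.\<close>
    define R where "R = (\<Sum>j\<in>UNIV. \<Sum>k\<in>UNIV. real_of_int (Y k j) * \<bar>r\<bar> / N)"
    have b: "\<bar>ln (cmod (w$j))\<bar> \<le> R" if w: "\<forall>j. w$j \<noteq> 0" and "(\<chi> k. L k w) \<in> cball 0 r" for w j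
    proof -
      have Lk: "\<bar>L k w\<bar> \<le> \<bar>r\<bar>" for k
        using that(2) Finite_Cartesian_Product.norm_nth_le[of "\<chi> k. L k w" k] by auto
      have "dot (\<lambda>i. if i = j then 1 else 0) k = Y k j" for k
      proof -
        have "dot (\<lambda>i. if i = j then 1 else 0) k = (\<Sum>i\<in>UNIV. if i = j then Y k i else 0)"
          unfolding dot_def by (intro sum.cong) auto
        then show ?thesis by simp
      qed
      moreover have "mon (\<lambda>i. if i = j then 1 else 0) w = w$j"
      proof -
        have "mon (\<lambda>i. if i = j then 1 else 0) w = (\<Prod>i\<in>UNIV. if i = j then w$i else 1)"
          unfolding mon_def by (intro prod.cong) auto
        then show ?thesis by simp
      qed
      ultimately have "ln (cmod (w$j)) = (\<Sum>k\<in>UNIV. Y k j * L k w) / N"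
        using ln_norm_mon_L[OF w, of "\<lambda>i. if i = j then 1 else 0"] by simp
      also have "\<bar>\<dots>\<bar> \<le> (\<Sum>k\<in>UNIV. \<bar>Y k j * L k w / N\<bar>)" unfolding sum_divide_distrib by (rule sum_abs)
      also have "\<dots> \<le> (\<Sum>k\<in>UNIV. real_of_int (Y k j) * \<bar>r\<bar> / N)"
        using N_pos Y_nonneg Lk by (intro sum_mono) (auto simp: abs_mult intro!: divide_right_mono mult_left_mono)
      also have "\<dots> \<le> R" unfolding R_def
        using N_pos Y_nonneg by (intro member_le_sum[of j UNIV "\<lambda>j. \<Sum>k\<in>UNIV. real_of_int (Y k j) * \<bar>r\<bar> / N"])
            (auto intro!: sum_nonneg)
      finally show ?thesis .
    qed
    define D :: "(complex^'n) set" where "D = {w. \<forall>j. cmod (w$j) \<le> exp R}"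
    have "closed D" unfolding D_def by (intro closed_Collect_all closed_Collect_le continuous_intros)
    then have [measurable]: "D \<in> sets borel" by (rule borel_closed)
    have "bounded D"
    proof (rule boundedI)
      fix w :: "complex^'n" assume w: "w \<in> D"
      have "norm w \<le> (\<Sum>k\<in>UNIV. cmod (w$k))" unfolding norm_vec_def by (rule L2_set_le_sum) simp
      also have "\<dots> \<le> (\<Sum>k\<in>(UNIV::'n set). exp R)" using w by (intro sum_mono) (auto simp: D_def)
      finally show "norm w \<le> real CARD('n) * exp R" by simp
    qed
    have "emeasure M (cball 0 r) = (\<integral>\<^sup>+y. indicator (cball 0 r) y \<partial>M)" by (simp add: M_def)
    also have "\<dots> = (\<integral>\<^sup>+w. indicator (cball 0 r) (\<chi> k. L k w) * ennreal (q w) \<partial>lborel)"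
      by (rule M[OF borel_measurable_indicator]) simp
    also have "\<dots> \<le> (\<integral>\<^sup>+w. ennreal (exp (2 * R) ^ CARD('n)) * indicator D w \<partial>lborel)"
    proof (rule nn_integral_mono_AE)
      show "AE w in lborel. indicator (cball 0 r) (\<chi> k. L k w) * ennreal (q w) \<le> ennreal (exp (2 * R) ^ CARD('n)) * indicator D w"
        using AE_vec_nonzero
      proof eventually_elim
        case (elim w)
        show ?case
        proof (cases "(\<chi> k. L k w) \<in> cball 0 r")
          case True
          have x: "cmod (w$j) \<le> exp R" "exp (- R) \<le> cmod (w$j)" for j
          proof -
            have "exp (ln (cmod (w$j))) \<le> exp R" "exp (- R) \<le> exp (ln (cmod (w$j)))"
              using b[OF elim True, of j] by (auto simp: abs_le_iff simp del: exp_ln)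
            then show "cmod (w$j) \<le> exp R" "exp (- R) \<le> cmod (w$j)" using elim by auto
          qed
          have "inverse ((cmod (w$j))\<^sup>2) \<le> exp (2 * R)" for j
          proof -
            have "inverse (cmod (w$j)) \<le> inverse (exp (- R))" by (rule le_imp_inverse_le[OF x(2)]) simp
            then have "inverse (cmod (w$j)) \<le> exp R" by (simp add: exp_minus)
            then have "(inverse (cmod (w$j)))\<^sup>2 \<le> (exp R)\<^sup>2" by (rule power_mono) simp
            then show ?thesis by (simp add: power_inverse exp_double)
          qed
          then have "q w \<le> (\<Prod>j\<in>(UNIV::'n set). exp (2 * R))" unfolding q_def by (intro prod_mono) auto
          then have "q w \<le> exp (2 * R) ^ CARD('n)" by simp
          moreover have "w \<in> D" using x by (simp add: D_def)
          ultimately show ?thesis using True by (simp add: ennreal_leI del: mem_cball_0)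
        qed (simp del: mem_cball_0)
      qed
    qed
    also have "\<dots> = ennreal (exp (2 * R) ^ CARD('n)) * emeasure lborel D"
      by (simp add: nn_integral_cmult)
    also have "\<dots> < \<infinity>" using emeasure_bounded_finite[OF \<open>bounded D\<close>] by (simp add: ennreal_mult_less_top)
    finally show ?thesis .
  qed
  obtain c where c: "c < \<infinity>" "\<And>f. f \<in> borel_measurable borel \<Longrightarrow> (\<integral>\<^sup>+x. f x \<partial>M) = c * (\<integral>\<^sup>+x. f x \<partial>lborel)"
    using translation_invariant_imp_lborel[of M] inv fin unfolding M_def by (metis sets_distr)
  have main: "(\<integral>\<^sup>+w. f (\<chi> k. L k w) \<partial>lborel) = c * (\<integral>\<^sup>+y. f y * ennreal (exp (\<Sum>k\<in>UNIV. 2 * h k * y$k / N)) \<partial>lborel)"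
    if [measurable]: "f \<in> borel_measurable borel" for f
  proof -
    have "(\<integral>\<^sup>+w. f (\<chi> k. L k w) \<partial>lborel) = (\<integral>\<^sup>+w. (f (\<chi> k. L k w) * ennreal (exp (\<Sum>k\<in>UNIV. 2 * h k * (\<chi> k. L k w)$k / N))) * ennreal (q w) \<partial>lborel)"
    proof (rule nn_integral_cong_AE)
      show "AE w in lborel. f (\<chi> k. L k w) = (f (\<chi> k. L k w) * ennreal (exp (\<Sum>k\<in>UNIV. 2 * h k * (\<chi> k. L k w)$k / N))) * ennreal (q w)"
        using AE_vec_nonzero
      proof eventually_elim
        case (elim w)
        have "q w = inverse ((cmod (mon (\<lambda>_. 1) w))\<^sup>2)"
          by (simp add: q_def norm_mon prod_inversef[symmetric] o_def prod_power_distrib)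
        also have "cmod (mon (\<lambda>_. 1) w) = exp (\<Sum>k\<in>UNIV. h k * L k w / N)"
          by (simp add: norm_mon_L[OF elim] dot_1)
        also have "(exp (\<Sum>k\<in>UNIV. h k * L k w / N))\<^sup>2 = exp (\<Sum>k\<in>UNIV. 2 * h k * L k w / N)"
          by (simp add: exp_double[symmetric] sum_distrib_left mult.assoc)
        finally have "exp (\<Sum>k\<in>UNIV. 2 * h k * L k w / N) * q w = 1" by simp
        then show ?case by (simp add: mult.assoc ennreal_mult[symmetric] q_nonneg)
      qed
    qed
    also have "\<dots> = (\<integral>\<^sup>+y. f y * ennreal (exp (\<Sum>k\<in>UNIV. 2 * h k * y$k / N)) \<partial>M)"
      by (rule M[symmetric]) measurable
    also have "\<dots> = c * (\<integral>\<^sup>+y. f y * ennreal (exp (\<Sum>k\<in>UNIV. 2 * h k * y$k / N)) \<partial>lborel)"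
      by (rule c(2)) measurable
    finally show ?thesis .
  qed
  \<comment> \<open>A vanishing constant would give the whole space Lebesgue measure 0.\<close>
  have "c \<noteq> 0" using main[of "\<lambda>_. 1"] by auto
  then have "enn2real c > 0" "ennreal (enn2real c) = c" using c(1) by (auto simp: enn2real_positive_iff less_top zero_less_iff_neq_zero)
  then show ?thesis using main by (intro exI[of _ "enn2real c"]) auto
qed

definition rc :: real where
  "rc = (SOME c. c > 0 \<and> (\<forall>f\<in>borel_measurable borel. (\<integral>\<^sup>+w. f (\<chi> k. L k w) \<partial>lborel)
     = ennreal c * (\<integral>\<^sup>+y. f y * ennreal (exp (\<Sum>k\<in>UNIV. 2 * h k * y$k / N)) \<partial>lborel)))"

lemma rc: "rc > 0"
  "f \<in> borel_measurable borel \<Longrightarrow> (\<integral>\<^sup>+w. f (\<chi> k. L k w) \<partial>lborel)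
     = ennreal rc * (\<integral>\<^sup>+y. f y * ennreal (exp (\<Sum>k\<in>UNIV. 2 * h k * y$k / N)) \<partial>lborel)"
  using someI_ex[OF radial_const_exists] unfolding rc_def[symmetric] by auto

text \<open>The polyhedron has become an orthant and the density a product of exponentials, so
  integrands of product form integrate factor by factor.\<close>

lemma nn_integral_U_prod:
  fixes f :: "'n \<Rightarrow> real \<Rightarrow> ennreal"
  assumes [measurable]: "\<And>k. f k \<in> borel_measurable borel"
  shows "(\<integral>\<^sup>+w. (\<Prod>k\<in>UNIV. f k (L k w)) * indicator U w \<partial>lborel)
    = rc * (\<Prod>k\<in>UNIV. \<integral>\<^sup>+y. f k y * ennreal (exp (2 * h k / N * y)) * indicator {..<0} y \<partial>lborel)"
proof -
  have "(\<integral>\<^sup>+w. (\<Prod>k\<in>UNIV. f k (L k w)) * indicator U w \<partial>lborel)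
     = (\<integral>\<^sup>+w. (\<Prod>k\<in>UNIV. f k ((\<chi> k. L k w)$k) * indicator {..<0} ((\<chi> k. L k w)$k)) \<partial>lborel)"
  proof (rule nn_integral_cong_AE)
    show "AE w in lborel. (\<Prod>k\<in>UNIV. f k (L k w)) * indicator U w = (\<Prod>k\<in>UNIV. f k ((\<chi> k. L k w)$k) * indicator {..<0} ((\<chi> k. L k w)$k))"
      using AE_vec_nonzero
    proof eventually_elim
      case (elim w)
      then show ?case by (auto simp: U_iff prod.distrib indicator_def prod_zero_iff)
    qed
  qed
  also have "\<dots> = rc * (\<integral>\<^sup>+y. (\<Prod>k\<in>UNIV. f k (y$k) * indicator {..<0} (y$k)) * ennreal (exp (\<Sum>k\<in>UNIV. 2 * h k * y$k / N)) \<partial>lborel)"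
    by (rule rc(2)) measurable
  also have "(\<integral>\<^sup>+y. (\<Prod>k\<in>UNIV. f k (y$k) * indicator {..<0} (y$k)) * ennreal (exp (\<Sum>k\<in>UNIV. 2 * h k * y$k / N)) \<partial>(lborel :: (real^'n) measure))
      = (\<integral>\<^sup>+y. (\<Prod>k\<in>UNIV. f k (y$k) * ennreal (exp (2 * h k / N * y$k)) * indicator {..<0} (y$k)) \<partial>lborel)"
    by (simp add: exp_sum prod.distrib prod_ennreal[symmetric] mult_ac)
  also have "\<dots> = (\<Prod>k\<in>UNIV. \<integral>\<^sup>+y. f k y * ennreal (exp (2 * h k / N * y)) * indicator {..<0} y \<partial>lborel)"
    by (rule nn_integral_lborel_vec_prod) measurable
  finally show ?thesis .
qed

lemma nn_integral_U_exp:
  fixes c :: "'n \<Rightarrow> real"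
  shows "(\<integral>\<^sup>+w. ennreal (exp (\<Sum>k\<in>UNIV. c k * L k w / N)) * indicator U w \<partial>lborel)
    = (if \<forall>k. c k + 2 * h k > 0 then ennreal (rc * (\<Prod>k\<in>UNIV. N / (c k + 2 * h k))) else \<infinity>)"
proof -
  have "(\<integral>\<^sup>+w. ennreal (exp (\<Sum>k\<in>UNIV. c k * L k w / N)) * indicator U w \<partial>lborel)
    = (\<integral>\<^sup>+w. (\<Prod>k\<in>UNIV. ennreal (exp (c k * L k w / N))) * indicator U w \<partial>lborel)"
    by (simp add: exp_sum prod_ennreal)
  also have "\<dots> = rc * (\<Prod>k\<in>UNIV. \<integral>\<^sup>+y. ennreal (exp (c k * y / N)) * ennreal (exp (2 * h k / N * y)) * indicator {..<0} y \<partial>lborel)"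
    by (rule nn_integral_U_prod) measurable
  also have "\<dots> = rc * (\<Prod>k\<in>UNIV. \<integral>\<^sup>+y. ennreal (exp ((c k + 2 * h k) / N * y)) * indicator {..<0} y \<partial>lborel)"
    by (simp add: ennreal_mult[symmetric] exp_add[symmetric] add_divide_distrib distrib_right)
  also have "\<dots> = (if \<forall>k. c k + 2 * h k > 0 then ennreal (rc * (\<Prod>k\<in>UNIV. N / (c k + 2 * h k))) else \<infinity>)"
  proof (cases "\<forall>k. c k + 2 * h k > 0")
    case True
    have "(\<Prod>k\<in>UNIV. \<integral>\<^sup>+y. ennreal (exp ((c k + 2 * h k) / N * y)) * indicator {..<0} y \<partial>lborel)
      = (\<Prod>k\<in>UNIV. ennreal (N / (c k + 2 * h k)))"
      using True N_pos by (intro prod.cong refl) (subst nn_integral_exp_neg, simp)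
    then show ?thesis using N_pos rc(1) True
      by (simp add: prod_ennreal less_imp_le ennreal_mult prod_nonneg)
  next
    case False
    then obtain k where "\<not> c k + 2 * h k > 0" by auto
    then have "(\<integral>\<^sup>+y. ennreal (exp ((c k + 2 * h k) / N * y)) * indicator {..<0} y \<partial>lborel) = \<infinity>"
      using N_pos by (subst nn_integral_exp_neg) (simp add: zero_less_divide_iff)
    \<comment> \<open>One infinite factor makes the product infinite because no other factor is
      0.\<close>
    then have "(\<Prod>k\<in>UNIV. \<integral>\<^sup>+y. ennreal (exp ((c k + 2 * h k) / N * y)) * indicator {..<0} y \<partial>lborel) = \<infinity>"
      by (subst prod.remove[of _ k]) (simp_all add: ennreal_mult_eq_top_iff prod_zero_iff del: times_divide_eq_left, use nn_integral_exp_neg_nonzero in blast)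
    then show ?thesis using False rc(1) by (simp add: ennreal_mult_top)
  qed
  finally show ?thesis .
qed

text \<open>\<open>adm a\<close> says that \<open>mon a\<close> is square integrable on \<open>U\<close>.\<close>

definition adm :: "('n \<Rightarrow> int) \<Rightarrow> bool" where
  "adm a \<longleftrightarrow> (\<forall>k. dot a k + h k \<ge> 1)"

lemma nn_integral_U_mon:
  fixes s :: real
  shows "(\<integral>\<^sup>+w. ennreal (cmod (mon a w) powr s) * indicator U w \<partial>lborel)
    = (if \<forall>k. s * dot a k + 2 * h k > 0 then ennreal (rc * (\<Prod>k\<in>UNIV. N / (s * dot a k + 2 * h k))) else \<infinity>)"
proof -
  have "(\<integral>\<^sup>+w. ennreal (cmod (mon a w) powr s) * indicator U w \<partial>lborel)
     = (\<integral>\<^sup>+w. ennreal (exp (\<Sum>k\<in>UNIV. (s * dot a k) * L k w / N)) * indicator U w \<partial>lborel)"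
  proof (rule nn_integral_cong_AE)
    show "AE w in lborel. ennreal (cmod (mon a w) powr s) * indicator U w = ennreal (exp (\<Sum>k\<in>UNIV. (s * dot a k) * L k w / N)) * indicator U w"
      using AE_vec_nonzero
      by eventually_elim (simp add: norm_mon_L exp_powr_real sum_distrib_left sum_distrib_right mult_ac)
  qed
  then show ?thesis by (simp add: nn_integral_U_exp)
qed

text \<open>The squared norm of \<open>mon a\<close> in the space of square integrable functions on
  the polyhedron, for admissible \<open>a\<close>.\<close>

definition msq :: "('n \<Rightarrow> int) \<Rightarrow> real" where
  "msq a = rc * (\<Prod>k\<in>UNIV. N / (2 * (dot a k + h k)))"

lemma nn_integral_U_mon_sq:
  "(\<integral>\<^sup>+w. ennreal ((cmod (mon a w))\<^sup>2) * indicator U w \<partial>lborel) = (if adm a then ennreal (msq a) else \<infinity>)"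
proof -
  \<comment> \<open>By integrality, strict positivity is the lower bound 1 that defines
    \<open>adm\<close>.\<close>
  have iff: "2 * real_of_int (dot a k) + 2 * real_of_int (h k) > 0 \<longleftrightarrow> dot a k + h k \<ge> 1" for k
    by linarith
  have "(cmod (mon a w))\<^sup>2 = cmod (mon a w) powr 2" for w by simp
  then show ?thesis
    using nn_integral_U_mon[of a 2] unfolding adm_def msq_def iff[symmetric] by (simp add: distrib_left)
qed

lemma msq_pos: "adm a \<Longrightarrow> msq a > 0"
proof -
  assume "adm a"
  then have "0 < 2 * (dot a k + h k)" for k unfolding adm_def by (smt (verit))
  then show ?thesis
    using rc(1) N_pos unfolding msq_def
    by (intro mult_pos_pos prod_pos divide_pos_pos) (simp_all only: of_int_0_less_iff)
qed

end

subsection \<open>Fourier and Laurent coefficients\<close>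

lemma borel_measurable_cnj [measurable (raw)]:
  "f \<in> borel_measurable M \<Longrightarrow> (\<lambda>x. cnj (f x)) \<in> borel_measurable M"
  by (rule borel_measurable_continuous_on[of cnj]) (auto intro: continuous_intros)

text \<open>Functions multiplying the space of functions with vanishing Fourier coefficients into itself
  form an algebra containing the coordinates; so Stone-Weierstrass gives uniqueness.\<close>

lemma torus_fourier_unique:
  fixes D :: "complex^'n \<Rightarrow> complex"
  assumes [measurable]: "D \<in> borel_measurable borel" and cont: "continuous_on torus D"
    and zero: "\<And>a. (\<integral>u. D u * mon a u \<partial>torus_measure) = 0"
  shows "AE u in torus_measure. D u = 0"
proof -
  obtain B where B: "\<And>u. u \<in> torus \<Longrightarrow> cmod (D u) \<le> B"
    using compact_imp_bounded[OF compact_continuous_image[OF cont compact_torus]]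
    unfolding bounded_iff by auto
  have B0: "B \<ge> 0"
  proof -
    have "(\<chi> k. 1) \<in> (torus :: (complex^'n) set)" by (simp add: torus_def)
    from B[OF this] show ?thesis using norm_ge_zero order_trans by blast
  qed
  \<comment> \<open>Boundedness on the torus is included so that all products below are
    integrable.\<close>
  define N where "N = {F. F \<in> borel_measurable borel \<and> (\<exists>C. \<forall>u\<in>torus. cmod (F u) \<le> C)
    \<and> (\<forall>a. (\<integral>u. D u * (F u * mon a u) \<partial>torus_measure) = 0)}"
  define M where "M = {F. \<forall>H\<in>N. (\<lambda>u. F u * H u) \<in> N}"
  have int: "integrable torus_measure (\<lambda>u. D u * (F u * mon a u))" if F: "F \<in> N" for F a
  proof -
    obtain C where [measurable]: "F \<in> borel_measurable borel" and C: "\<And>u. u \<in> torus \<Longrightarrow> cmod (F u) \<le> C"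
      using F unfolding N_def by blast
    show ?thesis
      using B C by (intro integrable_torus_bounded[of _ "B * C"])
        (auto simp: norm_mult norm_mon_torus intro!: mult_mono order_trans[OF norm_ge_zero])
  qed
  have Nadd: "(\<lambda>u. F u + H u) \<in> N" if F: "F \<in> N" and H: "H \<in> N" for F H
  proof -
    obtain C C' where C: "\<forall>u\<in>torus. cmod (F u) \<le> C" "\<forall>u\<in>torus. cmod (H u) \<le> C'"
      using F H by (auto simp: N_def)
    then have "\<forall>u\<in>torus. cmod (F u + H u) \<le> C + C'" by (auto intro!: norm_triangle_le add_mono)
    then show ?thesis
      using F H int[OF F] int[OF H] by (auto simp: N_def distrib_left distrib_right)
  qed
  have Ncmult: "(\<lambda>u. c * F u) \<in> N" if F: "F \<in> N" for F c
  proof -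
    obtain C where "\<forall>u\<in>torus. cmod (F u) \<le> C"
      using F by (auto simp: N_def)
    then have "\<forall>u\<in>torus. cmod (c * F u) \<le> cmod c * C" by (auto simp: norm_mult intro!: mult_left_mono)
    moreover have "(\<integral>u. D u * (c * F u * mon a u) \<partial>torus_measure) = c * (\<integral>u. D u * (F u * mon a u) \<partial>torus_measure)" for a
      by (simp flip: integral_mult_right_zero) (simp add: mult_ac)
    ultimately show ?thesis
      using F by (auto simp: N_def)
  qed
  have Nmon: "(\<lambda>u. mon b u * F u) \<in> N" if F: "F \<in> N" for F b
  proof -
    have [measurable]: "F \<in> borel_measurable borel" using F by (simp add: N_def)
    obtain C where "\<forall>u\<in>torus. cmod (F u) \<le> C"
      using F by (auto simp: N_def)
    then have "\<forall>u\<in>torus. cmod (mon b u * F u) \<le> C" by (auto simp: norm_mult norm_mon_torus)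
    moreover have "(\<integral>u. D u * (mon b u * F u * mon a u) \<partial>torus_measure) = (\<integral>u. D u * (F u * mon (\<lambda>k. a k + b k) u) \<partial>torus_measure)" for a
      using AE_torus by (intro integral_cong_AE) (auto elim!: eventually_mono simp: mon_add torus_nonzero)
    ultimately show ?thesis
      using F by (auto simp: N_def)
  qed
  have N1: "(\<lambda>_. 1) \<in> N" using zero by (auto simp: N_def)
  have Mconst: "(\<lambda>_. c) \<in> M" for c using Ncmult by (auto simp: M_def)
  have Madd: "(\<lambda>u. F u + H u) \<in> M" if "F \<in> M" "H \<in> M" for F H
    using that Nadd by (auto simp: M_def distrib_right)
  have Mmult: "(\<lambda>u. F u * H u) \<in> M" if "F \<in> M" "H \<in> M" for F H
    using that by (auto simp: M_def mult.assoc)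
  have Mmon: "mon b \<in> M" for b using Nmon by (auto simp: M_def)
  have Msum: "(\<lambda>u. \<Sum>i\<in>I. F i u) \<in> M" if "\<And>i. i \<in> I \<Longrightarrow> F i \<in> M" for F and I :: "'n set"
    using finite[of I] that by induction (auto intro: Mconst[of 0] Madd)
  have Mcong: "F \<in> M" if H: "H \<in> M" and eq: "\<And>u. u \<in> torus \<Longrightarrow> F u = H u" and [measurable]: "F \<in> borel_measurable borel" for F H
  proof -
    have "(\<lambda>u. F u * K u) \<in> N" if K: "K \<in> N" for K
    proof -
      have HK: "(\<lambda>u. H u * K u) \<in> N" using H K by (auto simp: M_def)
      have [measurable]: "K \<in> borel_measurable borel" using K by (simp add: N_def)
      have m: "(\<lambda>u. H u * K u) \<in> borel_measurable borel" using HK by (simp add: N_def)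
      have [measurable]: "(\<lambda>u. D u * (H u * K u * mon a u)) \<in> borel_measurable borel" for a
        using m by measurable
      have "(\<integral>u. D u * (F u * K u * mon a u) \<partial>torus_measure) = (\<integral>u. D u * (H u * K u * mon a u) \<partial>torus_measure)" for a
        using AE_torus eq by (intro integral_cong_AE) (auto elim!: eventually_mono)
      then show ?thesis using HK eq by (auto simp: N_def)
    qed
    then show ?thesis by (auto simp: M_def)
  qed
  have Mlin: "(\<lambda>u. complex_of_real (f u)) \<in> M" if f: "bounded_linear f" for f :: "complex^'n \<Rightarrow> real"
  proof -
    define e where "e k i = (if i = k then 1 else 0 :: int)" for k i :: 'n
    define p where "p k = complex_of_real (f (axis k 1))" for k
    define q where "q k = complex_of_real (f (axis k \<i>))" for k
    have mon_e: "mon (e k) u = u$k" for k u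
    proof -
      have "mon (e k) u = (\<Prod>i\<in>UNIV. if i = k then u$i else 1)"
        unfolding mon_def e_def by (intro prod.cong) auto
      then show ?thesis by simp
    qed
    \<comment> \<open>On the torus the conjugate of a coordinate is its inverse, so real and
      imaginary parts are combinations of two monomials.\<close>
    have "(\<lambda>u. \<Sum>k\<in>UNIV. (p k - \<i> * q k) / 2 * mon (e k) u + (p k + \<i> * q k) / 2 * mon (\<lambda>i. - e k i) u) \<in> M"
      by (intro Msum Madd Mmult Mconst Mmon)
    then show ?thesis
    proof (rule Mcong)
      fix u :: "complex^'n" assume u: "u \<in> torus"
      interpret f: bounded_linear f by (rule f)
      have "u = (\<Sum>k\<in>UNIV. Re (u$k) *\<^sub>R axis k 1 + Im (u$k) *\<^sub>R axis k \<i>)"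
      proof -
        have "(\<Sum>k\<in>UNIV. Re (u$k) *\<^sub>R axis k 1 + Im (u$k) *\<^sub>R axis k \<i>) $ j = u $ j" for j
        proof -
          have "(\<Sum>k\<in>UNIV. Re (u$k) *\<^sub>R axis k 1 + Im (u$k) *\<^sub>R axis k \<i>) $ j = (\<Sum>k\<in>UNIV. if k = j then u $ j else 0)"
            unfolding sum_component by (intro sum.cong) (auto simp: axis_def complex_eq_iff)
          then show ?thesis by simp
        qed
        then show ?thesis by (simp add: vec_eq_iff)
      qed
      then have "f u = f (\<Sum>k\<in>UNIV. Re (u$k) *\<^sub>R axis k 1 + Im (u$k) *\<^sub>R axis k \<i>)" by simp
      also have "\<dots> = (\<Sum>k\<in>UNIV. Re (u$k) * f (axis k 1) + Im (u$k) * f (axis k \<i>))"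
        by (simp add: f.sum f.add f.scaleR)
      finally have 1: "complex_of_real (f u) = (\<Sum>k\<in>UNIV. complex_of_real (Re (u$k)) * p k + complex_of_real (Im (u$k)) * q k)"
        by (simp add: p_def q_def)
      have "mon (\<lambda>i. - e k i) u = cnj (u$k)" for k
        using cnj_mon_torus[OF u, of "e k"] by (simp add: mon_minus mon_e)
      then show "complex_of_real (f u) = (\<Sum>k\<in>UNIV. (p k - \<i> * q k) / 2 * mon (e k) u + (p k + \<i> * q k) / 2 * mon (\<lambda>i. - e k i) u)"
        unfolding 1 by (intro sum.cong) (auto simp: mon_e complex_eq_iff p_def q_def field_simps)
    next
      have "f \<in> borel_measurable borel" using f
        by (intro borel_measurable_continuous_onI linear_continuous_on)
      then show "(\<lambda>u. complex_of_real (f u)) \<in> borel_measurable borel" by measurable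
    qed
  qed
  have Mpoly: "(\<lambda>u. complex_of_real (g u)) \<in> M" if "real_polynomial_function g" for g :: "complex^'n \<Rightarrow> real"
    using that
  proof induction
    case (linear f) then show ?case by (rule Mlin)
  next
    case (const c) then show ?case by (rule Mconst)
  next
    case (add f g) then show ?case using Madd by simp
  next
    case (mult f g) then show ?case using Mmult by simp
  qed
  have le: "(\<integral>u. (cmod (D u))\<^sup>2 \<partial>torus_measure) \<le> B * (2 * e)" if e: "e > 0" for e
  proof -
    obtain g1 g2 :: "complex^'n \<Rightarrow> real" where g: "real_polynomial_function g1" "\<And>x. x \<in> torus \<Longrightarrow> \<bar>Re (D x) - g1 x\<bar> < e"
        "real_polynomial_function g2" "\<And>x. x \<in> torus \<Longrightarrow> \<bar>Im (D x) - g2 x\<bar> < e"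
      using Stone_Weierstrass_real_polynomial_function[OF compact_torus _ e, of "\<lambda>u. Re (D u)"]
        Stone_Weierstrass_real_polynomial_function[OF compact_torus _ e, of "\<lambda>u. Im (D u)"] cont
      by (metis continuous_on_Re continuous_on_Im)
    \<comment> \<open>\<open>P\<close> approximates the conjugate of \<open>D\<close>. As
      \<open>D * P\<close> integrates to 0, the integral of \<open>|D|^2\<close> equals that of
      \<open>D\<close> times the approximation error.\<close>
    define P where "P u = complex_of_real (g1 u) + (- \<i>) * complex_of_real (g2 u)" for u
    have "P \<in> M" unfolding P_def[abs_def] by (intro Madd Mmult Mconst Mpoly g)
    then have PN: "P \<in> N" using N1 by (auto simp: M_def)
    then have [measurable]: "P \<in> borel_measurable borel" by (simp add: N_def)
    have P0: "(\<integral>u. D u * P u \<partial>torus_measure) = 0" and Pi: "integrable torus_measure (\<lambda>u. D u * P u)"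
      using PN int[OF PN, of "\<lambda>_. 0"] by (auto simp: N_def dest: spec[of _ "\<lambda>_. 0"])
    have DP: "cmod (cnj (D u) - P u) \<le> 2 * e" if u: "u \<in> torus" for u
    proof -
      have "cmod (cnj (D u) - P u) \<le> \<bar>Re (cnj (D u) - P u)\<bar> + \<bar>Im (cnj (D u) - P u)\<bar>" by (rule cmod_le)
      also have "\<dots> = \<bar>Re (D u) - g1 u\<bar> + \<bar>Im (D u) - g2 u\<bar>" by (simp add: P_def)
      finally show ?thesis using g(2)[OF u] g(4)[OF u] by linarith
    qed
    have i1: "integrable torus_measure (\<lambda>u. D u * cnj (D u))"
      using B by (intro integrable_torus_bounded[of _ "B * B"]) (auto simp: norm_mult intro!: mult_mono B0)
    have "complex_of_real (\<integral>u. (cmod (D u))\<^sup>2 \<partial>torus_measure) = (\<integral>u. D u * cnj (D u) \<partial>torus_measure)"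
      by (simp only: complex_norm_square[symmetric] integral_complex_of_real)
    also have "\<dots> = (\<integral>u. D u * (cnj (D u) - P u) \<partial>torus_measure)"
      using i1 Pi P0 by (simp add: right_diff_distrib)
    finally have "\<bar>\<integral>u. (cmod (D u))\<^sup>2 \<partial>torus_measure\<bar> = cmod (\<integral>u. D u * (cnj (D u) - P u) \<partial>torus_measure)"
      by (metis norm_of_real)
    also have "\<dots> \<le> B * (2 * e)"
      using B DP by (intro norm_integral_torus_le) (auto simp: norm_mult intro!: mult_mono B0)
    finally show ?thesis by linarith
  qed
  have "(\<integral>u. (cmod (D u))\<^sup>2 \<partial>torus_measure) \<le> 0 + e" if e: "e > 0" for e
  proof -
    have "B * (2 * (e / (2 * B + 1))) \<le> e" using B0 e by (simp add: field_simps)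
    then show ?thesis using le[of "e / (2 * B + 1)"] B0 e by simp
  qed
  then have "(\<integral>u. (cmod (D u))\<^sup>2 \<partial>torus_measure) \<le> 0" by (rule field_le_epsilon)
  moreover have "(\<integral>u. (cmod (D u))\<^sup>2 \<partial>torus_measure) \<ge> 0" by simp
  ultimately have z: "(\<integral>u. (cmod (D u))\<^sup>2 \<partial>torus_measure) = 0" by linarith
  have "integrable torus_measure (\<lambda>u. (cmod (D u))\<^sup>2)"
    using B AE_torus by (intro torus_measure.integrable_const_bound[of _ "B^2"]) (auto elim!: eventually_mono intro!: power_mono)
  then have "AE u in torus_measure. (cmod (D u))\<^sup>2 = 0"
    using z by (subst (asm) integral_nonneg_eq_0_iff_AE) auto
  then show ?thesis by simp
qed

section \<open>Holomorphic functions of several variables and their torus means\<close>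

lemma holomorphic_n_subset: "holomorphic_n f V \<Longrightarrow> W \<subseteq> V \<Longrightarrow> holomorphic_n f W"
  by (auto simp: holomorphic_n_def)

lemma holomorphic_n_continuous_on: "holomorphic_n f V \<Longrightarrow> continuous_on V f"
  unfolding holomorphic_n_def
  by (meson continuous_at_imp_continuous_on has_derivative_continuous)

lemma holomorphic_n_mult:
  assumes "holomorphic_n f V" "holomorphic_n g V"
  shows "holomorphic_n (\<lambda>z. f z * g z) V"
  unfolding holomorphic_n_def
proof
  fix z assume "z \<in> V"
  then obtain L L' where *: "(f has_derivative L) (at z)" "\<And>c v. L (cscale c v) = c * L v"
      "(g has_derivative L') (at z)" "\<And>c v. L' (cscale c v) = c * L' v"
    using assms unfolding holomorphic_n_def by metis
  show "\<exists>L. ((\<lambda>z. f z * g z) has_derivative L) (at z) \<and> (\<forall>c v. L (cscale c v) = c * L v)"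
    by (intro exI conjI, rule has_derivative_mult[OF *(1,3)]) (simp add: *(2,4) algebra_simps)
qed

lemma holomorphic_n_sum:
  assumes "\<And>i. i \<in> I \<Longrightarrow> holomorphic_n (f i) V"
  shows "holomorphic_n (\<lambda>z. \<Sum>i\<in>I. c i * f i z) V"
  unfolding holomorphic_n_def
proof
  fix z assume "z \<in> V"
  then have "\<forall>i\<in>I. \<exists>L. (f i has_derivative L) (at z) \<and> (\<forall>c v. L (cscale c v) = c * L v)"
    using assms unfolding holomorphic_n_def by blast
  then obtain L where L: "\<And>i. i \<in> I \<Longrightarrow> (f i has_derivative L i) (at z)" "\<And>i c v. i \<in> I \<Longrightarrow> L i (cscale c v) = c * L i v"
    by metis
  have "((\<lambda>z. \<Sum>i\<in>I. c i * f i z) has_derivative (\<lambda>v. \<Sum>i\<in>I. c i * L i v)) (at z)"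
    by (intro has_derivative_sum has_derivative_mult_right L)
  moreover have "(\<Sum>i\<in>I. c i * L i (cscale d v)) = d * (\<Sum>i\<in>I. c i * L i v)" for d v
    unfolding sum_distrib_left by (intro sum.cong refl) (simp add: L)
  ultimately show "\<exists>L. ((\<lambda>z. \<Sum>i\<in>I. c i * f i z) has_derivative L) (at z) \<and> (\<forall>c v. L (cscale c v) = c * L v)"
    by blast
qed

lemma holomorphic_n_mon:
  assumes "\<And>z j. z \<in> V \<Longrightarrow> z$j = 0 \<Longrightarrow> 0 \<le> a j"
  shows "holomorphic_n (mon a) V"
  unfolding holomorphic_n_def
proof
  fix z assume z: "z \<in> V"
  have "\<exists>d. ((\<lambda>x. x powi a j) has_field_derivative d) (at (z$j))" for j
  proof (cases "z$j = 0")
    case True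
    then obtain m where "a j = int m" using assms[OF z True] nonneg_int_cases by metis
    then show ?thesis by (auto intro!: exI derivative_eq_intros)
  next
    case False
    then show ?thesis by (auto intro!: exI derivative_eq_intros)
  qed
  then obtain d where d: "\<And>j. ((\<lambda>x. x powi a j) has_field_derivative d j) (at (z$j))" by metis
  have dj: "((\<lambda>w. w$j powi a j) has_derivative (\<lambda>v. d j * v$j)) (at z)" for j
    using has_derivative_compose[OF bounded_linear_imp_has_derivative[OF bounded_linear_vec_nth[of j]] d[of j, unfolded has_field_derivative_def]]
    by simp
  have "(mon a has_derivative (\<lambda>v. \<Sum>i\<in>UNIV. d i * v$i * (\<Prod>j\<in>UNIV - {i}. z$j powi a j))) (at z)"
    unfolding mon_def[abs_def] by (intro has_derivative_prod dj)
  moreover have "(\<Sum>i\<in>UNIV. d i * (cscale c v)$i * (\<Prod>j\<in>UNIV - {i}. z$j powi a j)) = c * (\<Sum>i\<in>UNIV. d i * v$i * (\<Prod>j\<in>UNIV - {i}. z$j powi a j))" for c v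
    by (simp add: cscale_def sum_distrib_left mult_ac)
  ultimately show "\<exists>L. (mon a has_derivative L) (at z) \<and> (\<forall>c v. L (cscale c v) = c * L v)" by blast
qed

text \<open>Reduces several variables to one; complex linearity of the derivative makes the
  composite complex differentiable.\<close>

lemma holomorphic_n_compose_curve:
  assumes f: "holomorphic_n f V" and c: "\<And>k. ((\<lambda>s. c s $ k) has_field_derivative c' k) (at s)" and V: "c s \<in> V"
  shows "(\<lambda>s. f (c s)) field_differentiable (at s)"
proof -
  obtain L where L: "(f has_derivative L) (at (c s))" "\<And>d v. L (cscale d v) = d * L v"
    using f V unfolding holomorphic_n_def by metis
  have "(c has_derivative (\<lambda>d. cscale d (\<chi> k. c' k))) (at s)"
    unfolding has_derivative_componentwise_within[of c]
  proof
    fix b :: "complex^'a" assume "b \<in> Basis"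
    then obtain k u where b: "b = axis k u" by (auto simp: Basis_vec_def)
    show "((\<lambda>x. c x \<bullet> b) has_derivative (\<lambda>d. cscale d (\<chi> k. c' k) \<bullet> b)) (at s)"
      using has_derivative_inner_left[OF c[of k, unfolded has_field_derivative_def], of u]
      by (simp add: b inner_axis cscale_def mult.commute)
  qed
  from has_derivative_compose[OF this L(1)]
  have "((\<lambda>s. f (c s)) has_derivative (\<lambda>d. d * L (\<chi> k. c' k))) (at s)" by (simp add: L)
  then show ?thesis unfolding field_differentiable_def has_field_derivative_def
    by (auto simp: mult.commute[of _ "L _"] intro!: exI)
qed

lemma continuous_on_vec_times [continuous_intros]:
  fixes f g :: "'c::topological_space \<Rightarrow> complex^'n"
  assumes "continuous_on S f" "continuous_on S g"
  shows "continuous_on S (\<lambda>x. f x * g x)"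
proof -
  have "continuous_on S (\<lambda>x. \<chi> k. f x $ k * g x $ k)" by (intro continuous_intros assms)
  then show ?thesis by (simp add: times_vec_def)
qed

context monomial_cone
begin

text \<open>After division by \<open>mon a\<close> the claim is that the torus mean of a holomorphic
  function is the same at all points. Two points are joined, up to phases, by a complex
  one-parameter curve along which real time moves the moduli and imaginary time only the phases. The
  mean is then constant in imaginary time, and Cauchy's theorem on a rectangle transfers this to
  real time. Cauchy's theorem is applied for each fixed phase and averaged afterwards, so nothing is
  differentiated under the integral.\<close>

lemma fourier_coeff_monomial:
  assumes g: "holomorphic_n g U" and gm[measurable]: "g \<in> borel_measurable borel"
  shows "\<exists>c. \<forall>w\<in>U. (\<forall>j. w$j \<noteq> 0) \<longrightarrow> (\<integral>u. g (u * w) * mon (\<lambda>j. - a j) u \<partial>torus_measure) = c * mon a w"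
proof -
  define W where "W = {w\<in>U. \<forall>j. w$j \<noteq> 0}"
  define F where "F z = g z * mon (\<lambda>j. - a j) z" for z
  have [measurable]: "F \<in> borel_measurable borel" unfolding F_def[abs_def] by measurable
  have F: "holomorphic_n F W"
    unfolding F_def[abs_def]
    by (rule holomorphic_n_mult[OF holomorphic_n_subset[OF g] holomorphic_n_mon]) (auto simp: W_def)
  have contF: "continuous_on W F" by (rule holomorphic_n_continuous_on[OF F])
  have uW: "u * w \<in> W \<longleftrightarrow> w \<in> W" if "u \<in> torus" for u w
    using that torus_nonzero[OF that] by (simp add: W_def)
  have const: "(\<integral>u. F (u * w0) \<partial>torus_measure) = (\<integral>u. F (u * w1) \<partial>torus_measure)"
    if w0: "w0 \<in> W" and w1: "w1 \<in> W" for w0 w1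
  proof -
    \<comment> \<open>The curve \<open>w\<close> starts at \<open>w0\<close> and has the moduli of
      \<open>w1\<close> at time 1. Its logarithmic coordinates are affine in \<open>Re s\<close>, so
      the parameter set \<open>S\<close> is convex.\<close>
    define v where "v k = ln (cmod (w1$k)) - ln (cmod (w0$k))" for k
    define w where "w s = (\<chi> k. exp (s * of_real (v k))) * w0" for s
    have wnz: "w s $ k \<noteq> 0" for s k using w0 by (simp add: w_def W_def)
    have w00: "w 0 = w0" by (simp add: w_def vec_eq_iff)
    define S where "S = {s. \<forall>k. L k w0 + Re s * (L k w1 - L k w0) < 0}"
    have Lw: "L k (w s) = L k w0 + Re s * (L k w1 - L k w0)" for k s
    proof -
      have "ln (cmod (w s $ j)) = ln (cmod (w0$j)) + Re s * v j" for j
        using w0 by (simp add: w_def norm_mult ln_mult W_def)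
      then have "L k (w s) = (\<Sum>j\<in>UNIV. G k j * (ln (cmod (w0$j)) + Re s * v j))"
        using wnz by (simp add: L_eq)
      then show ?thesis
        using w0 w1 by (simp add: L_eq W_def v_def algebra_simps sum.distrib sum_subtractf sum_distrib_left)
    qed
    have S: "w s \<in> W \<longleftrightarrow> s \<in> S" for s
      using wnz U_iff[of "w s"] by (simp add: W_def S_def Lw)
    have "S = (\<Inter>k. {s. L k w0 + Re s * (L k w1 - L k w0) < 0})" by (auto simp: S_def)
    moreover have "open \<dots>" by (intro open_INT ballI open_Collect_less continuous_intros) auto
    moreover have "convex {s. L k w0 + Re s * (L k w1 - L k w0) < 0}" for k
    proof -
      have "{s. L k w0 + Re s * (L k w1 - L k w0) < 0} = {s. (of_real (L k w1 - L k w0)) \<bullet> s < - L k w0}"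
        by (auto simp: inner_complex_def algebra_simps)
      then show ?thesis by (simp add: convex_halfspace_lt)
    qed
    ultimately have oS: "open S" and cS: "convex S" by (auto intro: convex_INT)
    have S0: "0 \<in> S" using w0 S[of 0] by (simp add: w00)
    have S1: "1 \<in> S" using w1 U_iff[of w1] by (auto simp: S_def W_def)
    define E where "E u s = F (u * w s)" for u s
    have contw: "continuous_on UNIV w" unfolding w_def by (intro continuous_intros)
    then have [measurable]: "w \<in> borel_measurable borel" by (rule borel_measurable_continuous_onI)
    have holE: "E u holomorphic_on S" if u: "u \<in> torus" for u
      unfolding holomorphic_on_def
    proof
      fix s assume s: "s \<in> S"
      have "(\<lambda>s. F (u * w s)) field_differentiable (at s)"
      proof (rule holomorphic_n_compose_curve[OF F])
        show "((\<lambda>s. (u * w s) $ k) has_field_derivative (u $ k * (exp (s * of_real (v k)) * of_real (v k) * w0 $ k))) (at s)" for k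
          by (auto simp: w_def intro!: derivative_eq_intros)
        show "u * w s \<in> W" using uW[OF u] S s by simp
      qed
      then show "E u field_differentiable (at s within S)"
        unfolding E_def[abs_def] by (rule field_differentiable_at_within)
    qed
    define H where "H s = (\<integral>u. E u s \<partial>torus_measure)" for s
    \<comment> \<open>Imaginary time is multiplication by a torus element, which the torus mean
      absorbs.\<close>
    have Hper: "H (s + \<i> * of_real t) = H s" for s t
    proof -
      define r :: "complex^'n" where "r = (\<chi> k. cis (t * v k))"
      have r: "r \<in> torus" by (simp add: r_def torus_def)
      have "w (s + \<i> * of_real t) = r * w s"
        by (simp add: vec_eq_iff w_def r_def distrib_left distrib_right exp_add cis_conv_exp mult_ac)
      then have "H (s + \<i> * of_real t) = (\<integral>u. F ((r * u) * w s) \<partial>torus_measure)"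
        by (simp add: H_def E_def mult_ac)
      also have "\<dots> = H s" unfolding H_def E_def
        by (rule integral_torus_invariant[OF r, of "\<lambda>u. F (u * w s)"]) measurable
      finally show ?thesis .
    qed
    \<comment> \<open>The integral of \<open>E u\<close> along the segment from \<open>p\<close> to
      \<open>q\<close>, without the factor \<open>q - p\<close>.\<close>
    define I where "I u p q = (\<integral>x. indicator {0..1} x *\<^sub>R E u (p + of_real x * (q - p)) \<partial>lborel)" for u p q
    have seg: "p + of_real x * (q - p) \<in> S" if "p \<in> S" "q \<in> S" "x \<in> {0..1}" for p q and x :: real
    proof -
      have "(1 - x) *\<^sub>R p + x *\<^sub>R q \<in> S" using cS that by (auto simp: convex_def)
      then show ?thesis by (simp add: scaleR_conv_of_real algebra_simps)
    qed
    have swap: "(\<integral>u. I u p q \<partial>torus_measure) = (\<integral>x. indicator {0..1} x *\<^sub>R H (p + of_real x * (q - p)) \<partial>lborel)"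
      and int: "integrable torus_measure (\<lambda>u. I u p q)" if p: "p \<in> S" and q: "q \<in> S" for p q
    proof -
      \<comment> \<open>All points of evaluation form a compact subset of \<open>W\<close>, which
        supplies the bound for Fubini.\<close>
      define K where "K = (\<lambda>(x::real,u). u * w (p + of_real x * (q - p))) ` ({0..1} \<times> torus)"
      have contw': "continuous_on A (\<lambda>x. w (f x))" if "continuous_on A f" for A and f :: "'b::topological_space \<Rightarrow> complex"
        using continuous_on_compose2[OF contw that] by simp
      have "continuous_on ({0..1} \<times> torus) (\<lambda>(x::real,u). u * w (p + of_real x * (q - p)))"
        unfolding case_prod_beta by (intro continuous_intros contw')
      then have "compact K" unfolding K_def
        by (intro compact_continuous_image compact_Times compact_torus) auto
      moreover have KW: "K \<subseteq> W" using seg[OF p q] S uW by (auto simp: K_def)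
      ultimately have cF: "compact (F ` K)"
        using contF by (intro compact_continuous_image) (auto intro: continuous_on_subset)
      then obtain C where C: "\<And>z. z \<in> K \<Longrightarrow> cmod (F z) \<le> C"
        using compact_imp_bounded[OF cF] unfolding bounded_iff by auto
      have C': "cmod (E u (p + of_real x * (q - p))) \<le> C" if "u \<in> torus" "x \<in> {0..1}" for u x
        unfolding E_def using that by (intro C) (auto simp: K_def)
      have intg: "integrable (lborel \<Otimes>\<^sub>M torus_measure) (\<lambda>(x,u). indicator {0..1} x *\<^sub>R E u (p + of_real x * (q - p)))"
      proof (rule integrableI_bounded)
        have [measurable]: "(\<lambda>(x,u). F (u * w (p + complex_of_real x * (q - p)))) \<in> borel_measurable (lborel \<Otimes>\<^sub>M torus_measure)"
          by measurable
        show "(\<lambda>(x,u). indicator {0..1} x *\<^sub>R E u (p + of_real x * (q - p))) \<in> borel_measurable (lborel \<Otimes>\<^sub>M torus_measure)"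
          unfolding E_def by measurable
        have "(\<integral>\<^sup>+z. norm (case z of (x,u) \<Rightarrow> indicator {0..1} x *\<^sub>R E u (p + of_real x * (q - p))) \<partial>(lborel \<Otimes>\<^sub>M torus_measure))
          = (\<integral>\<^sup>+x. \<integral>\<^sup>+u. ennreal (norm (indicator {0..1} x *\<^sub>R E u (p + of_real x * (q - p)))) \<partial>torus_measure \<partial>lborel)"
          unfolding E_def by (subst torus_measure.nn_integral_fst[symmetric]) auto
        also have "\<dots> \<le> (\<integral>\<^sup>+x. \<integral>\<^sup>+u. ennreal C * indicator {0..1} (x::real) \<partial>(torus_measure :: (complex^'n) measure) \<partial>lborel)"
        proof (rule nn_integral_mono, rule nn_integral_mono_AE)
          fix x :: real
          show "AE u in torus_measure. ennreal (norm (indicator {0..1} x *\<^sub>R E u (p + of_real x * (q - p)))) \<le> ennreal C * indicator {0..1} x"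
            using AE_torus by eventually_elim (use C' in \<open>auto simp: indicator_def ennreal_leI\<close>)
        qed
        also have "\<dots> = (\<integral>\<^sup>+x. ennreal C * indicator {0..1} (x::real) \<partial>lborel)"
          by (simp add: emeasure_torus_measure)
        also have "\<dots> < \<infinity>" by (simp add: nn_integral_cmult)
        finally show "(\<integral>\<^sup>+z. norm (case z of (x,u) \<Rightarrow> indicator {0..1} x *\<^sub>R E u (p + of_real x * (q - p))) \<partial>(lborel \<Otimes>\<^sub>M torus_measure)) < \<infinity>" .
      qed
      have "(\<integral>u. I u p q \<partial>torus_measure) = (\<integral>x. \<integral>u. indicator {0..1} x *\<^sub>R E u (p + of_real x * (q - p)) \<partial>torus_measure \<partial>lborel)"
        unfolding I_def using lborel_torus.Fubini_integral[OF intg] by simp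
      also have "\<dots> = (\<integral>x. indicator {0..1} x *\<^sub>R H (p + of_real x * (q - p)) \<partial>lborel)"
        by (simp add: H_def)
      finally show "(\<integral>u. I u p q \<partial>torus_measure) = (\<integral>x. indicator {0..1} x *\<^sub>R H (p + of_real x * (q - p)) \<partial>lborel)" .
      show "integrable torus_measure (\<lambda>u. I u p q)"
        unfolding I_def by (rule lborel_torus.integrable_snd[OF intg])
    qed
    have prim: "\<exists>\<Phi>. \<forall>p\<in>S. \<forall>q\<in>S. (q - p) * I u p q = \<Phi> q - \<Phi> p" if u: "u \<in> torus" for u
    proof -
      obtain \<Phi> where \<Phi>: "\<And>x. x \<in> S \<Longrightarrow> (\<Phi> has_field_derivative E u x) (at x within S)"
        using holomorphic_convex_primitive'[OF cS oS holE[OF u]] by metis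
      then have \<Phi>': "(\<Phi> has_field_derivative E u x) (at x)" if "x \<in> S" for x
        using oS that by (metis at_within_open)
      have "(q - p) * I u p q = \<Phi> q - \<Phi> p" if p: "p \<in> S" and q: "q \<in> S" for p q
      proof -
        have "(\<integral>x. indicator {0..1} x *\<^sub>R (E u (p + of_real x * (q - p)) * (q - p)) \<partial>lborel)
            = \<Phi> (p + of_real 1 * (q - p)) - \<Phi> (p + of_real 0 * (q - p))"
        proof (rule integral_FTC_atLeastAtMost)
          show "((\<lambda>x. \<Phi> (p + of_real x * (q - p))) has_vector_derivative E u (p + of_real x * (q - p)) * (q - p)) (at x within {0..1})"
            if x: "0 \<le> x" "x \<le> 1" for x
          proof -
            have "((\<lambda>x. p + complex_of_real x * (q - p)) has_vector_derivative (q - p)) (at x)"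
              by (auto intro!: derivative_eq_intros simp: has_vector_derivative_def scaleR_conv_of_real)
            moreover have "(\<Phi> has_field_derivative E u (p + of_real x * (q - p))) (at (p + of_real x * (q - p)))"
              using x by (intro \<Phi>' seg p q) auto
            ultimately have "((\<lambda>x. \<Phi> (p + of_real x * (q - p))) has_vector_derivative (q - p) * E u (p + of_real x * (q - p))) (at x)"
              using field_vector_diff_chain_at[of "\<lambda>x. p + complex_of_real x * (q - p)" "q - p" x \<Phi>] by (simp add: o_def)
            then show ?thesis by (auto simp: mult.commute intro: has_vector_derivative_at_within)
          qed
          have "continuous_on S (E u)" using holE[OF u] by (rule holomorphic_on_imp_continuous_on)
          then show "continuous_on {0..1} (\<lambda>x. E u (p + complex_of_real x * (q - p)) * (q - p))"
            by (intro continuous_on_mult_right continuous_on_compose2[of S "E u" "{0..1}"])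
              (auto intro!: continuous_intros seg[OF p q])
        qed simp
        moreover have "(q - p) * I u p q = (\<integral>x. indicator {0..1} x *\<^sub>R (E u (p + of_real x * (q - p)) * (q - p)) \<partial>lborel)"
          by (simp only: I_def mult.commute[of "q - p"] integral_mult_left_zero[symmetric] mult_scaleR_left)
        ultimately show ?thesis by simp
      qed
      then show ?thesis by blast
    qed
    have S0i: "\<i> \<in> S" and S1i: "1 + \<i> \<in> S" using S0 S1 by (auto simp: S_def)
    \<comment> \<open>The contour integral around the rectangle with corners 0, 1,
      \<open>1 + \<i>\<close> and \<open>\<i>\<close>, for one fixed phase.\<close>
    have rect: "I u 0 1 + \<i> * I u 1 (1 + \<i>) - I u \<i> (1 + \<i>) - \<i> * I u 0 \<i> = 0" if u: "u \<in> torus" for u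
    proof -
      obtain \<Phi> where \<Phi>: "\<And>p q. p \<in> S \<Longrightarrow> q \<in> S \<Longrightarrow> (q - p) * I u p q = \<Phi> q - \<Phi> p" using prim[OF u] by metis
      have "I u 0 1 = \<Phi> 1 - \<Phi> 0" "\<i> * I u 1 (1 + \<i>) = \<Phi> (1 + \<i>) - \<Phi> 1"
        "I u \<i> (1 + \<i>) = \<Phi> (1 + \<i>) - \<Phi> \<i>" "\<i> * I u 0 \<i> = \<Phi> \<i> - \<Phi> 0"
        using \<Phi>[OF S0 S1] \<Phi>[OF S1 S1i] \<Phi>[OF S0i S1i] \<Phi>[OF S0 S0i] by simp_all
      then show ?thesis by (simp only:) simp
    qed
    \<comment> \<open>After averaging, the integrand is constant on each vertical side and the
      horizontal sides agree, so the contour integral leaves only the difference of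
      \<open>H 1\<close> and \<open>H 0\<close>.\<close>
    have Hs: "(\<integral>x. indicator {0..1} x *\<^sub>R H (1 + of_real x * (1 + \<i> - 1)) \<partial>lborel) = H 1"
         "(\<integral>x. indicator {0..1} x *\<^sub>R H (0 + of_real x * (\<i> - 0)) \<partial>lborel) = H 0"
         "(\<integral>x. indicator {0..1} x *\<^sub>R H (\<i> + of_real x * (1 + \<i> - \<i>)) \<partial>lborel) = (\<integral>x. indicator {0..1} x *\<^sub>R H (0 + of_real x * (1 - 0)) \<partial>lborel)"
    proof -
      have "H (1 + of_real x * (1 + \<i> - 1)) = H 1" "H (0 + of_real x * (\<i> - 0)) = H 0" 
        "H (\<i> + of_real x * (1 + \<i> - \<i>)) = H (0 + of_real x * (1 - 0))" for x
        using Hper[of 1 x] Hper[of 0 x] Hper[of "of_real x" 1] by (simp_all add: mult.commute add.commute)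
      then show "(\<integral>x. indicator {0..1} x *\<^sub>R H (1 + of_real x * (1 + \<i> - 1)) \<partial>lborel) = H 1"
         "(\<integral>x. indicator {0..1} x *\<^sub>R H (0 + of_real x * (\<i> - 0)) \<partial>lborel) = H 0"
         "(\<integral>x. indicator {0..1} x *\<^sub>R H (\<i> + of_real x * (1 + \<i> - \<i>)) \<partial>lborel) = (\<integral>x. indicator {0..1} x *\<^sub>R H (0 + of_real x * (1 - 0)) \<partial>lborel)"
        by (simp_all del: add_0 diff_zero)
    qed
    have "0 = (\<integral>u. I u 0 1 + \<i> * I u 1 (1 + \<i>) - I u \<i> (1 + \<i>) - \<i> * I u 0 \<i> \<partial>torus_measure)"
      using AE_torus rect by (intro integral_eq_zero_AE[symmetric]) (auto elim!: eventually_mono)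
    also have "\<dots> = (\<integral>u. I u 0 1 \<partial>torus_measure) + \<i> * (\<integral>u. I u 1 (1 + \<i>) \<partial>torus_measure)
         - (\<integral>u. I u \<i> (1 + \<i>) \<partial>torus_measure) - \<i> * (\<integral>u. I u 0 \<i> \<partial>torus_measure)"
      using int S0 S1 S0i S1i by simp
    also have "\<dots> = \<i> * (H 1 - H 0)"
      unfolding swap[OF S0 S1] swap[OF S1 S1i] swap[OF S0i S1i] swap[OF S0 S0i] Hs by (simp add: algebra_simps)
    finally have H01: "H 1 = H 0" by simp
    \<comment> \<open>\<open>w1\<close> and the end point \<open>w 1\<close> of the curve differ
      only by phases.\<close>
    define r where "r = (\<chi> k. w1$k / w 1 $ k)"
    have "cmod (w 1 $ k) = cmod (w1 $ k)" for k
    proof -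
      have "cmod (w 1 $ k) = exp (v k) * cmod (w0 $ k)" by (simp add: w_def norm_mult)
      then show ?thesis using w0 w1 by (simp add: W_def v_def exp_diff)
    qed
    then have r: "r \<in> torus" using w1 wnz by (simp add: r_def torus_def norm_divide W_def)
    have "w1 = r * w 1" using wnz by (simp add: r_def vec_eq_iff)
    then have "(\<integral>u. F (u * w1) \<partial>torus_measure) = (\<integral>u. F ((r * u) * w 1) \<partial>torus_measure)" by (simp add: mult_ac)
    also have "\<dots> = H 1" unfolding H_def E_def
      by (rule integral_torus_invariant[OF r, of "\<lambda>u. F (u * w 1)"]) measurable
    finally show ?thesis using H01 by (simp add: H_def E_def w00)
  qed
  have eq: "(\<integral>u. g (u * w) * mon (\<lambda>j. - a j) u \<partial>torus_measure) = (\<integral>u. F (u * w) \<partial>torus_measure) * mon a w"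
    if w: "w \<in> W" for w
  proof -
    have "mon (\<lambda>j. - a j) w * mon a w = 1" using w mon_eq_0_iff[of w a] by (simp add: mon_minus W_def)
    then have "F (u * w) * mon a w = g (u * w) * mon (\<lambda>j. - a j) u" for u
      by (simp add: F_def mon_mult mult_ac)
    then show ?thesis by (simp only: integral_mult_left_zero[symmetric])
  qed
  show ?thesis
  proof (cases "W = {}")
    case True
    then show ?thesis by (intro exI[of _ 0]) (auto simp: W_def)
  next
    case False
    then obtain w0 where w0: "w0 \<in> W" by auto
    show ?thesis
      using eq const[OF w0] by (intro exI[of _ "\<integral>u. F (u * w0) \<partial>torus_measure"]) (auto simp: W_def)
  qed
qed

end

subsection \<open>Square integrable holomorphic functions\<close>

lemma completion_ex_borel_measurable_complex:
  fixes f :: "'a \<Rightarrow> complex"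
  assumes [measurable]: "f \<in> borel_measurable (completion M)"
  shows "\<exists>g\<in>borel_measurable M. (AE x in M. f x = g x)"
proof -
  have "(\<lambda>x. Re (f x)) \<in> borel_measurable (completion M)" "(\<lambda>x. Im (f x)) \<in> borel_measurable (completion M)"
    by measurable
  from this[THEN completion_ex_borel_measurable_real]
  obtain g h where [measurable]: "g \<in> borel_measurable M" "h \<in> borel_measurable M"
    and ae: "AE x in M. Re (f x) = g x" "AE x in M. Im (f x) = h x"
    by blast
  have "(\<lambda>x. Complex (g x) (h x)) \<in> borel_measurable M"
    unfolding Complex_eq by measurable
  moreover have "AE x in M. f x = Complex (g x) (h x)"
    using ae by eventually_elim (simp add: complex_eq_iff)
  ultimately show ?thesis by (intro bexI[of _ "\<lambda>x. Complex (g x) (h x)"])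
qed

text \<open>Square integrability over the whole space; functions on the polyhedron are extended by 0
  first.\<close>

definition square_integrable :: "('a::euclidean_space \<Rightarrow> complex) \<Rightarrow> bool" where
  "square_integrable f \<longleftrightarrow> f \<in> borel_measurable borel \<and> (\<integral>\<^sup>+w. ennreal ((cmod (f w))\<^sup>2) \<partial>lborel) < \<infinity>"


lemma square_integrable_cnj: "square_integrable f \<Longrightarrow> square_integrable (\<lambda>w. cnj (f w))"
  by (auto simp: square_integrable_def)

lemma square_integrable_mult:
  assumes f: "square_integrable f" and g: "square_integrable g"
  shows "integrable lborel (\<lambda>w. f w * g w)"
proof (rule integrableI_bounded)
  have [measurable]: "f \<in> borel_measurable borel" "g \<in> borel_measurable borel"
    using assms by (auto simp: square_integrable_def)
  show "(\<lambda>w. f w * g w) \<in> borel_measurable lborel" by measurable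
  have "(\<integral>\<^sup>+w. norm (f w * g w) \<partial>lborel) \<le> (\<integral>\<^sup>+w. ennreal ((cmod (f w))\<^sup>2) + ennreal ((cmod (g w))\<^sup>2) \<partial>lborel)"
  proof (rule nn_integral_mono)
    fix w
    have "0 \<le> (cmod (f w) - cmod (g w))\<^sup>2" by simp
    then have "2 * (cmod (f w) * cmod (g w)) \<le> (cmod (f w))\<^sup>2 + (cmod (g w))\<^sup>2"
      by (simp add: power2_diff mult.assoc)
    moreover have "0 \<le> cmod (f w) * cmod (g w)" by simp
    ultimately have "norm (f w * g w) \<le> (cmod (f w))\<^sup>2 + (cmod (g w))\<^sup>2"
      unfolding norm_mult by linarith
    then show "ennreal (norm (f w * g w)) \<le> ennreal ((cmod (f w))\<^sup>2) + ennreal ((cmod (g w))\<^sup>2)"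
      by (simp add: ennreal_leI flip: ennreal_plus)
  qed
  also have "\<dots> = (\<integral>\<^sup>+w. ennreal ((cmod (f w))\<^sup>2) \<partial>lborel) + (\<integral>\<^sup>+w. ennreal ((cmod (g w))\<^sup>2) \<partial>lborel)"
    by (rule nn_integral_add) measurable
  also have "\<dots> < \<infinity>" using assms by (auto simp: square_integrable_def)
  finally show "(\<integral>\<^sup>+w. norm (f w * g w) \<partial>lborel) < \<infinity>" .
qed

lemma square_integrable_bound:
  assumes f: "square_integrable f" and [measurable]: "g \<in> borel_measurable borel"
    and b: "AE w in lborel. cmod (g w) \<le> C * cmod (f w)"
  shows "square_integrable g"
proof -
  have [measurable]: "f \<in> borel_measurable borel" using f by (simp add: square_integrable_def)
  have "(\<integral>\<^sup>+w. ennreal ((cmod (g w))\<^sup>2) \<partial>lborel) \<le> (\<integral>\<^sup>+w. ennreal (C\<^sup>2) * ennreal ((cmod (f w))\<^sup>2) \<partial>lborel)"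
  proof (rule nn_integral_mono_AE)
    show "AE w in lborel. ennreal ((cmod (g w))\<^sup>2) \<le> ennreal (C\<^sup>2) * ennreal ((cmod (f w))\<^sup>2)"
      using b
    proof eventually_elim
      case (elim w)
      then have "(cmod (g w))\<^sup>2 \<le> (C * cmod (f w))\<^sup>2" by (intro power_mono) auto
      then show ?case by (simp add: power_mult_distrib ennreal_leI flip: ennreal_mult)
    qed
  qed
  also have "\<dots> = ennreal (C\<^sup>2) * (\<integral>\<^sup>+w. ennreal ((cmod (f w))\<^sup>2) \<partial>lborel)"
    by (rule nn_integral_cmult) measurable
  also have "\<dots> < \<infinity>" using f by (simp add: square_integrable_def ennreal_mult_less_top)
  finally show ?thesis by (simp add: square_integrable_def)
qed

text \<open>\<open>f'\<close> is a Borel version of \<open>f\<close>, extended by 0. Norms and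
  orthogonality are defined with Lebesgue measurable functions on a set, whereas scaling, averaging
  and Fubini are used for Borel functions on the whole space; \<open>rep\<close> carries statements
  across.\<close>

definition rep :: "'a set \<Rightarrow> ('a::euclidean_space \<Rightarrow> complex) \<Rightarrow> ('a \<Rightarrow> complex) \<Rightarrow> bool" where
  "rep V f f' \<longleftrightarrow> f' \<in> borel_measurable borel \<and> (\<forall>w. w \<notin> V \<longrightarrow> f' w = 0) \<and> (AE w in lborel. w \<in> V \<longrightarrow> f w = f' w)"

lemma rep_exists:
  assumes [measurable]: "V \<in> sets borel" and f: "f \<in> borel_measurable (lebesgue_on V)"
  shows "\<exists>f'. rep V f f'"
proof -
  have "(\<lambda>w. indicator V w *\<^sub>R f w) \<in> borel_measurable lebesgue"
    using f by (subst (asm) borel_measurable_restrict_space_iff) auto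
  then obtain g where g[measurable]: "g \<in> borel_measurable lborel" and ae: "AE w in lborel. indicator V w *\<^sub>R f w = g w"
    using completion_ex_borel_measurable_complex by metis
  have "rep V f (\<lambda>w. indicator V w *\<^sub>R g w)"
    unfolding rep_def using g ae by (auto elim!: eventually_mono simp: indicator_def split: if_splits)
  then show ?thesis by blast
qed

lemma rep_measurable_lebesgue_on:
  assumes [measurable]: "V \<in> sets borel" and f: "rep V f f'"
  shows "f \<in> borel_measurable (lebesgue_on V)"
proof (subst borel_measurable_restrict_space_iff)
  show "V \<inter> space lebesgue \<in> sets lebesgue" by simp
  have f'[measurable]: "f' \<in> borel_measurable lebesgue" using f by (auto simp: rep_def intro: measurable_completion)
  have ae: "AE w in lebesgue. f' w = indicator V w *\<^sub>R f w"
    using f unfolding rep_def AE_completion_iff by (auto elim!: eventually_mono simp: indicator_def)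
  show "(\<lambda>w. indicator V w *\<^sub>R f w) \<in> borel_measurable lebesgue"
    using ae f' by (rule borel_measurable_AE[rotated])
qed

lemma rep_continuous:
  assumes "open V" and "continuous_on V f"
  shows "rep V f (\<lambda>w. indicator V w *\<^sub>R f w)"
  using assms by (auto simp: rep_def intro!: borel_measurable_continuous_on_indicator)

lemma rep_nn_integral:
  assumes f: "rep V f f'" and [measurable]: "V \<in> sets borel" "F \<in> borel_measurable borel"
  shows "(\<integral>\<^sup>+w. F (f w) * indicator V w \<partial>lebesgue) = (\<integral>\<^sup>+w. F (f' w) * indicator V w \<partial>lborel)"
proof -
  have "(\<integral>\<^sup>+w. F (f w) * indicator V w \<partial>lebesgue) = (\<integral>\<^sup>+w. F (f' w) * indicator V w \<partial>lebesgue)"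
    using f unfolding rep_def by (intro nn_integral_cong_AE) (auto simp: AE_completion_iff indicator_def elim!: eventually_mono)
  then show ?thesis by (simp add: nn_integral_completion)
qed

lemma rep_nn_integral_powr:
  assumes f: "rep V f f'" and [measurable]: "V \<in> sets borel" and p: "p > 0"
  shows "(\<integral>\<^sup>+w. ennreal (cmod (f w) powr p) * indicator V w \<partial>lebesgue) = (\<integral>\<^sup>+w. ennreal (cmod (f' w) powr p) \<partial>lborel)"
proof -
  have "(\<integral>\<^sup>+w. ennreal (cmod (f w) powr p) * indicator V w \<partial>lebesgue) = (\<integral>\<^sup>+w. ennreal (cmod (f' w) powr p) * indicator V w \<partial>lborel)"
    using rep_nn_integral[OF f, of "\<lambda>z. ennreal (cmod z powr p)"] by simp
  also have "\<dots> = (\<integral>\<^sup>+w. ennreal (cmod (f' w) powr p) \<partial>lborel)"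
    using f p by (intro nn_integral_cong) (auto simp: rep_def indicator_def)
  finally show ?thesis .
qed

lemma rep_in_L2:
  assumes f: "rep V f f'" and V[measurable]: "V \<in> sets borel"
  shows "in_Lp V 2 f \<longleftrightarrow> square_integrable f'"
  using rep_nn_integral_powr[OF f V, of 2] rep_measurable_lebesgue_on[OF V f] f
  by (simp add: in_Lp_def square_integrable_def rep_def)

lemma rep_integral:
  assumes f: "rep V f f'" and g: "rep V g g'" and h: "rep V h h'" and [measurable]: "V \<in> sets borel"
  shows "set_lebesgue_integral lebesgue V (\<lambda>z. (f z - g z) * cnj (h z)) = (\<integral>w. (f' w - g' w) * cnj (h' w) \<partial>lborel)"
proof -
  have [measurable]: "f' \<in> borel_measurable borel" "g' \<in> borel_measurable borel" "h' \<in> borel_measurable borel"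
    using assms by (auto simp: rep_def)
  have 0: "\<And>z. z \<notin> V \<Longrightarrow> f' z = 0 \<and> g' z = 0"
    using f g by (auto simp: rep_def)
  have "AE z in lborel. z \<in> V \<longrightarrow> f z = f' z" "AE z in lborel. z \<in> V \<longrightarrow> g z = g' z" "AE z in lborel. z \<in> V \<longrightarrow> h z = h' z"
    using f g h by (auto simp: rep_def)
  then have "AE z in lborel. (f' z - g' z) * cnj (h' z) = indicator V z *\<^sub>R ((f z - g z) * cnj (h z))"
  proof eventually_elim
    case (elim z)
    then show ?case using 0[of z] by (cases "z \<in> V") auto
  qed
  then have ae: "AE z in lebesgue. (f' z - g' z) * cnj (h' z) = indicator V z *\<^sub>R ((f z - g z) * cnj (h z))"
    by (simp add: AE_completion_iff)
  have m: "(\<lambda>z. (f' z - g' z) * cnj (h' z)) \<in> borel_measurable lebesgue" by (intro measurable_completion) measurable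
  have "(\<integral>z. indicator V z *\<^sub>R ((f z - g z) * cnj (h z)) \<partial>lebesgue) = (\<integral>w. (f' w - g' w) * cnj (h' w) \<partial>lebesgue)"
    using ae m by (intro integral_cong_AE[symmetric]) (auto intro: borel_measurable_AE[OF m ae])
  then show ?thesis unfolding set_lebesgue_integral_def by (simp add: integral_completion)
qed

text \<open>Jensen's inequality, by integrating \<open>2 * m * |F| \<le> m^2 + |F|^2\<close> with
  \<open>m\<close> the modulus of the mean. A non-integrable \<open>F\<close> has integral 0 by
  convention.\<close>

lemma norm_integral_torus_sq_le:
  fixes F :: "complex^'n \<Rightarrow> complex"
  assumes [measurable]: "F \<in> borel_measurable borel"
  shows "ennreal ((cmod (\<integral>u. F u \<partial>torus_measure))\<^sup>2) \<le> (\<integral>\<^sup>+u. ennreal ((cmod (F u))\<^sup>2) \<partial>torus_measure)"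
proof (cases "integrable torus_measure F")
  case False
  then show ?thesis by (simp add: not_integrable_integral_eq)
next
  case True
  define m where "m = cmod (\<integral>u. F u \<partial>torus_measure)"
  have m: "m \<ge> 0" by (simp add: m_def)
  have "ennreal m \<le> (\<integral>\<^sup>+u. ennreal (cmod (F u)) \<partial>torus_measure)"
    unfolding m_def by (rule integral_norm_bound_ennreal[OF True])
  then have "ennreal (2 * m) * ennreal m \<le> ennreal (2 * m) * (\<integral>\<^sup>+u. ennreal (cmod (F u)) \<partial>torus_measure)"
    by (rule mult_left_mono) simp
  also have "\<dots> = (\<integral>\<^sup>+u. ennreal (2 * m) * ennreal (cmod (F u)) \<partial>torus_measure)"
    by (rule nn_integral_cmult[symmetric]) measurable
  also have "\<dots> \<le> (\<integral>\<^sup>+u. ennreal (m\<^sup>2) + ennreal ((cmod (F u))\<^sup>2) \<partial>torus_measure)"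
  proof (rule nn_integral_mono)
    fix u
    have "0 \<le> (m - cmod (F u))\<^sup>2" by simp
    then have "2 * m * cmod (F u) \<le> m\<^sup>2 + (cmod (F u))\<^sup>2" by (simp add: power2_diff)
    then show "ennreal (2 * m) * ennreal (cmod (F u)) \<le> ennreal (m\<^sup>2) + ennreal ((cmod (F u))\<^sup>2)"
      using m by (simp add: ennreal_leI flip: ennreal_mult ennreal_plus)
  qed
  also have "\<dots> = ennreal (m\<^sup>2) + (\<integral>\<^sup>+u. ennreal ((cmod (F u))\<^sup>2) \<partial>torus_measure)"
    by (simp add: nn_integral_add emeasure_torus_measure)
  finally have "ennreal (m\<^sup>2) + ennreal (m\<^sup>2) \<le> ennreal (m\<^sup>2) + (\<integral>\<^sup>+u. ennreal ((cmod (F u))\<^sup>2) \<partial>torus_measure)"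
    using m by (simp add: power2_eq_square mult.assoc flip: ennreal_mult ennreal_plus)
  then show ?thesis by (simp add: m_def ennreal_add_left_cancel_le)
qed

locale monomial_domain = monomial_cone Y G N
  for Y G :: "'n::finite \<Rightarrow> 'n \<Rightarrow> int" and N :: int +
  assumes open_U: "open U"
begin

text \<open>Admissible monomials have no poles on the polyhedron. At a point with
  \<open>z $ j = 0\<close> all \<open>G k j\<close> are nonnegative and one is positive, so
  \<open>dot_inverse\<close> exhibits \<open>N * (a j + 1)\<close> as a sum of nonnegative terms
  with a positive one among them.\<close>

lemma adm_nonneg:
  assumes a: "adm a" and z: "z \<in> U" "z $ j = 0"
  shows "a j \<ge> 0"
proof -
  have G: "G k j \<ge> 0" for k using z by (auto simp: U_def)
  have d: "dot a k + h k \<ge> 1" for k using a by (simp add: adm_def)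
  have "N * (a j + 1) = (\<Sum>k\<in>UNIV. G k j * dot (\<lambda>j. a j + 1) k)" by (rule dot_inverse[symmetric])
  also have "\<dots> = (\<Sum>k\<in>UNIV. G k j * (dot a k + h k))" by (simp add: dot_add dot_1)
  finally have eq: "N * (a j + 1) = (\<Sum>k\<in>UNIV. G k j * (dot a k + h k))" .
  have "\<exists>k. Y k j * G k j \<noteq> 0"
  proof (rule ccontr)
    assume "\<nexists>k. Y k j * G k j \<noteq> 0"
    then have "(\<Sum>k\<in>UNIV. Y k j * G k j) = 0" by (intro sum.neutral) auto
    then show False using YG[of j j] N_pos by simp
  qed
  then obtain k where "Y k j * G k j \<noteq> 0" by blast
  then have "G k j > 0" using G[of k] by (cases "G k j = 0") auto
  then have "0 < G k j * (dot a k + h k)" using d[of k] by simp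
  also have "\<dots> \<le> (\<Sum>k\<in>UNIV. G k j * (dot a k + h k))"
  proof (rule member_le_sum)
    show "0 \<le> G i j * (dot a i + h i)" for i
      using G[of i] d[of i] by simp
  qed auto
  finally have "0 < N * (a j + 1)" using eq by simp
  then show ?thesis using N_pos by (simp add: zero_less_mult_iff)
qed

lemma rep_holomorphic: "holomorphic_n f U \<Longrightarrow> rep U f (\<lambda>w. indicator U w *\<^sub>R f w)"
  by (intro rep_continuous open_U holomorphic_n_continuous_on)

lemma square_integrable_mon: "adm a \<Longrightarrow> square_integrable (\<lambda>w. indicator U w *\<^sub>R mon a w)"
proof -
  assume "adm a"
  have "(\<integral>\<^sup>+w. ennreal ((cmod (indicator U w *\<^sub>R mon a w))\<^sup>2) \<partial>lborel) = (\<integral>\<^sup>+w. ennreal ((cmod (mon a w))\<^sup>2) * indicator U w \<partial>lborel)"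
    by (intro nn_integral_cong) (auto simp: indicator_def)
  then show ?thesis using \<open>adm a\<close> by (simp add: square_integrable_def nn_integral_U_mon_sq)
qed

lemma in_A2_mon: "adm a \<Longrightarrow> in_A2 U (mon a)"
proof -
  assume a: "adm a"
  have hol: "holomorphic_n (mon a) U" using adm_nonneg[OF a] by (intro holomorphic_n_mon) auto
  then show ?thesis
    using rep_in_L2[OF rep_holomorphic[OF hol] borel_U] square_integrable_mon[OF a] by (simp add: in_A2_def)
qed

lemma in_A2_square_integrable: "in_A2 U g \<Longrightarrow> square_integrable (\<lambda>w. indicator U w *\<^sub>R g w)"
  using rep_in_L2[OF rep_holomorphic borel_U] by (auto simp: in_A2_def)

text \<open>Averaging over phases first replaces \<open>g\<close> by its Fourier coefficient of
  frequency \<open>a\<close>, since the rest of the integrand is \<open>mon a\<close> times a radial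
  function.\<close>

lemma radial_pairing:
  assumes [measurable]: "g \<in> borel_measurable borel" "\<psi> \<in> borel_measurable borel"
    and c: "\<And>w. w \<in> U \<Longrightarrow> (\<forall>j. w$j \<noteq> 0) \<Longrightarrow> (\<integral>u. g (u * w) * mon (\<lambda>j. - a j) u \<partial>torus_measure) = c * mon a w"
    and \<psi>: "\<And>u w. u \<in> torus \<Longrightarrow> \<psi> (u * w) = \<psi> w"
    and int: "integrable lborel (\<lambda>w. indicator U w *\<^sub>R (complex_of_real (\<psi> w) * mon a w * cnj (g w)))"
  shows "(\<integral>w. indicator U w *\<^sub>R (complex_of_real (\<psi> w) * mon a w * cnj (g w)) \<partial>lborel)
    = cnj c * complex_of_real (\<integral>w. indicator U w * (\<psi> w * (cmod (mon a w))\<^sup>2) \<partial>lborel)"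
proof -
  have "(\<integral>w. indicator U w *\<^sub>R (complex_of_real (\<psi> w) * mon a w * cnj (g w)) \<partial>lborel)
    = (\<integral>w. (\<integral>u. indicator U (u * w) *\<^sub>R (complex_of_real (\<psi> (u * w)) * mon a (u * w) * cnj (g (u * w))) \<partial>torus_measure) \<partial>lborel)"
    by (rule integral_torus_average[OF int])
  also have "\<dots> = (\<integral>w. cnj c * complex_of_real (indicator U w * (\<psi> w * (cmod (mon a w))\<^sup>2)) \<partial>lborel)"
  proof (rule integral_cong_AE)
    show "(\<lambda>w. (\<integral>u. indicator U (u * w) *\<^sub>R (complex_of_real (\<psi> (u * w)) * mon a (u * w) * cnj (g (u * w))) \<partial>torus_measure)) \<in> borel_measurable lborel"
      by (intro torus_measure.borel_measurable_lebesgue_integral) measurable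
    show "AE w in lborel. (\<integral>u. indicator U (u * w) *\<^sub>R (complex_of_real (\<psi> (u * w)) * mon a (u * w) * cnj (g (u * w))) \<partial>torus_measure)
        = cnj c * complex_of_real (indicator U w * (\<psi> w * (cmod (mon a w))\<^sup>2))"
      using AE_vec_nonzero
    proof eventually_elim
      case (elim w)
      have "(\<integral>u. indicator U (u * w) *\<^sub>R (complex_of_real (\<psi> (u * w)) * mon a (u * w) * cnj (g (u * w))) \<partial>torus_measure)
        = (\<integral>u. (indicator U w *\<^sub>R (complex_of_real (\<psi> w) * mon a w)) * cnj (g (u * w) * mon (\<lambda>j. - a j) u) \<partial>torus_measure)"
      proof (rule integral_cong_AE)
        show "AE u in torus_measure. indicator U (u * w) *\<^sub>R (complex_of_real (\<psi> (u * w)) * mon a (u * w) * cnj (g (u * w)))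
          = (indicator U w *\<^sub>R (complex_of_real (\<psi> w) * mon a w)) * cnj (g (u * w) * mon (\<lambda>j. - a j) u)"
          using AE_torus
        proof eventually_elim
          case (elim u)
          have "cnj (mon (\<lambda>j. - a j) u) = mon a u"
            using cnj_mon_torus[OF elim, of a] by (simp add: mon_minus)
          then show ?case using elim \<psi>[OF elim] by (simp add: mon_mult indicator_def)
        qed
      qed measurable
      also have "\<dots> = (indicator U w *\<^sub>R (complex_of_real (\<psi> w) * mon a w)) * cnj (\<integral>u. g (u * w) * mon (\<lambda>j. - a j) u \<partial>torus_measure)"
        by (simp only: integral_mult_right_zero Bochner_Integration.integral_cnj)
      also have "\<dots> = cnj c * complex_of_real (indicator U w * (\<psi> w * (cmod (mon a w))\<^sup>2))"
        using c[OF _ elim] complex_norm_square[of "mon a w"]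
        by (cases "w \<in> U") (simp_all add: mult_ac)
      finally show ?case .
    qed
  qed measurable
  also have "\<dots> = cnj c * complex_of_real (\<integral>w. indicator U w * (\<psi> w * (cmod (mon a w))\<^sup>2) \<partial>lborel)"
    by (simp only: integral_mult_right_zero integral_complex_of_real)
  finally show ?thesis .
qed

lemma integral_U_mon_sq: "adm a \<Longrightarrow> (\<integral>w. indicator U w * (cmod (mon a w))\<^sup>2 \<partial>lborel) = msq a"
proof -
  assume a: "adm a"
  have "(\<integral>\<^sup>+w. ennreal (indicator U w * (cmod (mon a w))\<^sup>2) \<partial>lborel) = (\<integral>\<^sup>+w. ennreal ((cmod (mon a w))\<^sup>2) * indicator U w \<partial>lborel)"
    by (intro nn_integral_cong) (auto simp: indicator_def)
  then have "(\<integral>\<^sup>+w. ennreal (indicator U w * (cmod (mon a w))\<^sup>2) \<partial>lborel) = ennreal (msq a)"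
    using a by (simp add: nn_integral_U_mon_sq)
  then show ?thesis using msq_pos[OF a] by (intro integral_eq_nn_integral[THEN trans]) auto
qed

text \<open>A coefficient at a non-admissible \<open>a\<close> vanishes because Jensen's inequality
  on torus orbits bounds \<open>|c a|^2\<close> times the infinite squared norm of
  \<open>mon a\<close> by the finite squared norm of \<open>g\<close>. At admissible
  \<open>a\<close> the coefficient is determined by the inner product with
  \<open>mon a\<close>.\<close>

lemma laurent_coefficients:
  assumes g: "in_A2 U g"
  defines "g' \<equiv> (\<lambda>w. indicator U w *\<^sub>R g w)"
  obtains c where "\<And>a w. w \<in> U \<Longrightarrow> (\<forall>j. w$j \<noteq> 0) \<Longrightarrow> (\<integral>u. g' (u * w) * mon (\<lambda>j. - a j) u \<partial>torus_measure) = c a * mon a w"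
    "\<And>a. \<not> adm a \<Longrightarrow> c a = 0"
    "\<And>a. adm a \<Longrightarrow> (\<integral>w. (indicator U w *\<^sub>R mon a w) * cnj (g' w) \<partial>lborel) = cnj (c a) * msq a"
proof -
  have hol: "holomorphic_n g U" using g by (simp add: in_A2_def)
  have hol': "holomorphic_n g' U"
    unfolding holomorphic_n_def
  proof
    fix z assume z: "z \<in> U"
    then obtain L where L: "(g has_derivative L) (at z)" "\<forall>c v. L (cscale c v) = c * L v"
      using hol unfolding holomorphic_n_def by blast
    have "(g' has_derivative L) (at z)"
      using L(1) open_U z by (rule has_derivative_transform_within_open) (simp add: g'_def)
    with L(2) show "\<exists>L. (g' has_derivative L) (at z) \<and> (\<forall>c v. L (cscale c v) = c * L v)" by blast
  qed
  have sq: "square_integrable g'" unfolding g'_def by (rule in_A2_square_integrable[OF g])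
  then have [measurable]: "g' \<in> borel_measurable borel" by (simp add: square_integrable_def)
  have "\<forall>a. \<exists>c. \<forall>w\<in>U. (\<forall>j. w$j \<noteq> 0) \<longrightarrow> (\<integral>u. g' (u * w) * mon (\<lambda>j. - a j) u \<partial>torus_measure) = c * mon a w"
    using fourier_coeff_monomial[OF hol'] by simp
  then obtain c where c: "\<And>a w. w \<in> U \<Longrightarrow> (\<forall>j. w$j \<noteq> 0) \<Longrightarrow> (\<integral>u. g' (u * w) * mon (\<lambda>j. - a j) u \<partial>torus_measure) = c a * mon a w"
    by metis
  moreover have "c a = 0" if a: "\<not> adm a" for a
  proof (rule ccontr)
    assume ca: "c a \<noteq> 0"
    have "\<infinity> = ennreal ((cmod (c a))\<^sup>2) * (\<integral>\<^sup>+w. ennreal ((cmod (mon a w))\<^sup>2) * indicator U w \<partial>lborel)"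
      using a ca by (simp add: nn_integral_U_mon_sq ennreal_mult_top)
    also have "\<dots> = (\<integral>\<^sup>+w. ennreal ((cmod (c a))\<^sup>2) * (ennreal ((cmod (mon a w))\<^sup>2) * indicator U w) \<partial>lborel)"
      by (rule nn_integral_cmult[symmetric]) measurable
    also have "\<dots> \<le> (\<integral>\<^sup>+w. \<integral>\<^sup>+u. ennreal ((cmod (g' (u * w)))\<^sup>2) \<partial>torus_measure \<partial>lborel)"
    proof (rule nn_integral_mono_AE)
      show "AE w in lborel. ennreal ((cmod (c a))\<^sup>2) * (ennreal ((cmod (mon a w))\<^sup>2) * indicator U w)
          \<le> (\<integral>\<^sup>+u. ennreal ((cmod (g' (u * w)))\<^sup>2) \<partial>torus_measure)"
        using AE_vec_nonzero
      proof eventually_elim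
        case (elim w)
        show ?case
        proof (cases "w \<in> U")
          case True
          have "ennreal ((cmod (c a))\<^sup>2) * (ennreal ((cmod (mon a w))\<^sup>2) * indicator U w) = ennreal ((cmod (\<integral>u. g' (u * w) * mon (\<lambda>j. - a j) u \<partial>torus_measure))\<^sup>2)"
            using True by (simp add: c[OF True elim] norm_mult power_mult_distrib flip: ennreal_mult)
          also have "\<dots> \<le> (\<integral>\<^sup>+u. ennreal ((cmod (g' (u * w) * mon (\<lambda>j. - a j) u))\<^sup>2) \<partial>torus_measure)"
            by (rule norm_integral_torus_sq_le) measurable
          also have "\<dots> = (\<integral>\<^sup>+u. ennreal ((cmod (g' (u * w)))\<^sup>2) \<partial>torus_measure)"
            using AE_torus by (intro nn_integral_cong_AE) (auto elim!: eventually_mono simp: norm_mult norm_mon_torus)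
          finally show ?thesis .
        qed simp
      qed
    qed
    also have "\<dots> = (\<integral>\<^sup>+w. ennreal ((cmod (g' w))\<^sup>2) \<partial>lborel)"
      by (rule nn_integral_torus_average[symmetric]) measurable
    also have "\<dots> < \<infinity>" using sq by (simp add: square_integrable_def)
    finally show False by simp
  qed
  moreover have "(\<integral>w. (indicator U w *\<^sub>R mon a w) * cnj (g' w) \<partial>lborel) = cnj (c a) * msq a" if a: "adm a" for a
  proof -
    have "integrable lborel (\<lambda>w. (indicator U w *\<^sub>R mon a w) * cnj (g' w))"
      by (intro square_integrable_mult square_integrable_mon a square_integrable_cnj sq)
    then show ?thesis
      using radial_pairing[of g' "\<lambda>_. 1" a "c a"] c integral_U_mon_sq[OF a] by simp
  qed
  ultimately show thesis by (rule that)
qed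

end

subsection \<open>The Bergman kernel\<close>

text \<open>Closed form of the series with terms \<open>(N * q + r) * s ^ q\<close>, from splitting
  the coefficient as \<open>N * (q + 1) + (r - N)\<close>.\<close>

definition gser :: "int \<Rightarrow> int \<Rightarrow> complex \<Rightarrow> complex" where
  "gser N r s = of_int N / (1 - s)\<^sup>2 + of_int (r - N) / (1 - s)"

lemma gser_sums:
  assumes "cmod s < 1"
  shows "(\<lambda>q. of_int (N * int q + r) * s ^ q) sums gser N r s"
proof -
  have "(\<lambda>q. of_int N * (of_nat (Suc q) * s ^ q) + of_int (r - N) * s ^ q) sums
      (of_int N * (1 / (1 - s)\<^sup>2) + of_int (r - N) * (1 / (1 - s)))"
    by (intro sums_add sums_mult geometric_deriv_sums geometric_sums assms)
  then show ?thesis by (simp add: gser_def algebra_simps)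
qed

text \<open>The simple pole is absorbed into the double one, as \<open>|1 - s|\<close> is at most
  2.\<close>

lemma norm_gser_le:
  assumes r: "1 \<le> r" "r \<le> N" and s: "cmod s < 1"
  shows "cmod (gser N r s) \<le> 3 * real_of_int N / (cmod (1 - s))\<^sup>2"
proof -
  have s1: "cmod (1 - s) > 0" using s by auto
  have s2: "cmod (1 - s) \<le> 2" using s norm_triangle_ineq4[of 1 s] by simp
  have "cmod (gser N r s) \<le> cmod (of_int N / (1 - s)\<^sup>2) + cmod (of_int (r - N) / (1 - s))"
    unfolding gser_def by (rule norm_triangle_ineq)
  also have "\<dots> = N / (cmod (1 - s))\<^sup>2 + (N - r) * cmod (1 - s) / (cmod (1 - s))\<^sup>2"
  proof -
    have "cmod (of_int (r - N)) = real_of_int (N - r)" using r by (subst norm_of_int) simp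
    moreover have "cmod (of_int N) = real_of_int N" using r by (subst norm_of_int) simp
    ultimately show ?thesis
      using s1 by (simp add: norm_divide norm_power norm_mult power2_eq_square)
  qed
  also have "\<dots> \<le> N / (cmod (1 - s))\<^sup>2 + (N * 2) / (cmod (1 - s))\<^sup>2"
  proof -
    have "real_of_int (N - r) * cmod (1 - s) \<le> real_of_int N * 2"
      using r s2 by (intro mult_mono) auto
    then show ?thesis by (intro add_mono divide_right_mono) auto
  qed
  also have "\<dots> = 3 * real_of_int N / (cmod (1 - s))\<^sup>2" by (simp add: add_divide_distrib[symmetric])
  finally show ?thesis .
qed

lemma cnj_power_int: "cnj (x powi n) = cnj x powi n"
  by (simp add: power_int_def)

definition cp :: "complex^'n \<Rightarrow> complex^'n \<Rightarrow> complex^'n" where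
  "cp z w = z * (\<chi> k. cnj (w$k))"

lemma cp_nth [simp]: "cp z w $ k = z$k * cnj (w$k)"
  by (simp add: cp_def)

lemma cp_mult: "cp (u * z) w = u * cp z w"
  by (simp add: cp_def mult.assoc)

lemma mon_cp: "mon a (cp z w) = mon a z * cnj (mon a w)"
  by (simp add: mon_def power_int_mult_distrib prod.distrib cnj_power_int)

lemma borel_measurable_cp [measurable (raw)]:
  fixes f g :: "'c \<Rightarrow> complex^'n"
  assumes [measurable]: "f \<in> borel_measurable M" "g \<in> borel_measurable M"
  shows "(\<lambda>x. cp (f x) (g x)) \<in> borel_measurable M"
  unfolding cp_def by measurable

context monomial_cone
begin

definition residues :: "('n \<Rightarrow> int) set" where
  "residues = {b. \<forall>k. 1 \<le> dot b k \<and> dot b k \<le> N}"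

lemma finite_residues: "finite residues"
proof (rule inj_on_finite[of dot])
  show "inj_on dot residues" by (rule inj_onI) (metis dot_inj)
  show "dot ` residues \<subseteq> Pi\<^sub>E UNIV (\<lambda>_. {1..N})" by (auto simp: residues_def)
  show "finite (Pi\<^sub>E (UNIV::'n set) (\<lambda>_. {1..N}))" by (intro finite_PiE) auto
qed

text \<open>The factor common to all reciprocal norms: for admissible \<open>a\<close> one has
  \<open>1 / msq a = kc * (\<Prod>k\<in>UNIV. dot a k + h k)\<close>.\<close>

definition kc :: real where "kc = (2 / N) ^ CARD('n) / rc"

text \<open>The Bergman kernel is \<open>kern (cp z w)\<close>. It is the sum of \<open>x\<^sup>a / msq a\<close> over the admissible \<open>a\<close>, and a
  positive vector \<open>dot a + h\<close> is split into quotient and remainder modulo \<open>N\<close>: the remainders, in \<open>1..N\<close>,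
  are those of the finite set \<open>residues\<close>, and the quotients are summed by \<open>gser\<close>.\<close>

definition kern :: "complex^'n \<Rightarrow> complex" where
  "kern x = kc * (\<Sum>b\<in>residues. mon (\<lambda>j. b j - 1) x * (\<Prod>k\<in>UNIV. gser N (dot b k) (mon (G k) x)))"

lemma borel_measurable_kern [measurable]: "kern \<in> borel_measurable borel"
  unfolding kern_def gser_def by measurable

lemma kc_pos: "kc > 0" using N_pos rc(1) by (simp add: kc_def)

text \<open>Inverse of division with remainder: \<open>b\<close> carries remainders and
  \<open>q\<close> quotients. The -1 passes from \<open>a + 1\<close>, where residues are taken,
  back to the exponent \<open>a\<close>.\<close>

definition shift :: "('n \<Rightarrow> int) \<Rightarrow> ('n \<Rightarrow> nat) \<Rightarrow> 'n \<Rightarrow> int" where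
  "shift b q j = b j - 1 + (\<Sum>k\<in>UNIV. int (q k) * G k j)"

lemma dot_shift: "dot (shift b q) l + h l = dot b l + N * int (q l)"
proof -
  have "dot (shift b q) l = dot b l - h l + (\<Sum>k\<in>UNIV. int (q k) * dot (G k) l)"
    unfolding shift_def dot_add dot_diff dot_sum dot_cmult by (simp add: dot_1)
  also have "(\<Sum>k\<in>UNIV. int (q k) * dot (G k) l) = (\<Sum>k\<in>UNIV. if k = l then N * int (q k) else 0)"
    unfolding dot_G by (intro sum.cong) auto
  finally show ?thesis by simp
qed

lemma shift_unique:
  assumes "b \<in> residues" "b' \<in> residues" "shift b q = shift b' q'"
  shows "b = b' \<and> q = q'"
proof -
  have *: "dot b l = dot b' l \<and> q l = q' l" for l
  proof -
    have "dot b l - 1 + N * int (q l) = dot b' l - 1 + N * int (q' l)"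
      using dot_shift[of b q l] dot_shift[of b' q' l] assms(3) by simp
    \<comment> \<open>Lowered by 1, the remainders lie in the usual range from 0 to
      \<open>N - 1\<close>, where division determines the quotient.\<close>
    moreover have "0 \<le> dot b l - 1" "dot b l - 1 < N" "0 \<le> dot b' l - 1" "dot b' l - 1 < N"
      using assms by (auto simp: residues_def dest!: spec[of _ l])
    ultimately have "int (q l) = int (q' l)"
      by (metis add.commute N_pos div_mult_self2 div_pos_pos_trivial add_cancel_left_left order_less_imp_not_eq2)
    moreover from this \<open>dot b l - 1 + N * int (q l) = dot b' l - 1 + N * int (q' l)\<close> have "dot b l = dot b' l" by simp
    ultimately show ?thesis by simp
  qed
  then have "q = q'" by auto
  moreover have "b = b'" using * by (intro dot_inj) simp
  ultimately show ?thesis by simp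
qed

lemma shift_exists:
  assumes "adm a"
  shows "\<exists>b\<in>residues. \<exists>q. shift b q = a"
proof -
  \<comment> \<open>Subtracting 1 before the division puts the remainders into
    \<open>1..N\<close>.\<close>
  define q where "q l = nat ((dot a l + h l - 1) div N)" for l
  define b where "b j = a j + 1 - (\<Sum>k\<in>UNIV. int (q k) * G k j)" for j
  have s: "shift b q = a" by (auto simp: shift_def b_def)
  have "1 \<le> dot b l \<and> dot b l \<le> N" for l
  proof -
    have m: "dot a l + h l \<ge> 1" using assms by (simp add: adm_def)
    then have "int (q l) = (dot a l + h l - 1) div N" using N_pos by (simp add: q_def pos_imp_zdiv_nonneg_iff)
    then have "dot b l = (dot a l + h l - 1) mod N + 1"
      using dot_shift[of b q l] unfolding s by (simp add: minus_mult_div_eq_mod[symmetric])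
    then show ?thesis
      using pos_mod_bound[OF N_pos, of "dot a l + h l - 1"] pos_mod_sign[OF N_pos, of "dot a l + h l - 1"] by linarith
  qed
  then show ?thesis using s by (auto simp: residues_def)
qed

text \<open>For partial sums over boxes of quotients this is orthogonality of characters, each
  frequency occurring at most once by \<open>shift_unique\<close>. The moduli of all monomials are
  fixed on the orbit of \<open>x\<close>, so dominated convergence gives the limit.\<close>

lemma kern_fourier:
  assumes x: "\<forall>j. x$j \<noteq> 0" and xG: "\<And>k. cmod (mon (G k) x) < 1"
  shows "(\<integral>u. kern (u * x) * mon (\<lambda>j. - a j) u \<partial>torus_measure) = (if adm a then mon a x / msq a else 0)"
proof -
  define Q where "Q M = (Pi\<^sub>E UNIV (\<lambda>_. {..M}) :: ('n \<Rightarrow> nat) set)" for M :: nat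
  define co where "co b q = (\<Prod>k\<in>UNIV. complex_of_int (N * int (q k) + dot b k))" for b and q :: "'n \<Rightarrow> nat"
  define ps where "ps M y = kc * (\<Sum>b\<in>residues. mon (\<lambda>j. b j - 1) y * (\<Prod>k\<in>UNIV. \<Sum>q\<le>M. of_int (N * int q + dot b k) * mon (G k) y ^ q))" for M y
  have ps_eq: "ps M y = kc * (\<Sum>b\<in>residues. \<Sum>q\<in>Q M. co b q * mon (shift b q) y)" if y: "\<forall>j. y$j \<noteq> 0" for M y
  proof -
    have "mon (\<lambda>j. b j - 1) y * (\<Prod>k\<in>UNIV. \<Sum>q\<le>M. of_int (N * int q + dot b k) * mon (G k) y ^ q)
       = (\<Sum>q\<in>Q M. co b q * mon (shift b q) y)" for b
    proof -
      have "(\<Prod>k\<in>UNIV. \<Sum>q\<le>M. of_int (N * int q + dot b k) * mon (G k) y ^ q)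
        = (\<Sum>q\<in>Q M. \<Prod>k\<in>UNIV. of_int (N * int (q k) + dot b k) * mon (G k) y ^ q k)"
        unfolding Q_def by (rule prod_sum_PiE) auto
      also have "\<dots> = (\<Sum>q\<in>Q M. co b q * (\<Prod>k\<in>UNIV. mon (G k) y ^ q k))"
        by (simp add: co_def prod.distrib)
      finally have "mon (\<lambda>j. b j - 1) y * (\<Prod>k\<in>UNIV. \<Sum>q\<le>M. of_int (N * int q + dot b k) * mon (G k) y ^ q)
         = (\<Sum>q\<in>Q M. co b q * (mon (\<lambda>j. b j - 1) y * (\<Prod>k\<in>UNIV. mon (G k) y ^ q k)))"
        by (simp add: sum_distrib_left mult_ac)
      moreover have "mon (\<lambda>j. b j - 1) y * (\<Prod>k\<in>UNIV. mon (G k) y ^ q k) = mon (shift b q) y" for q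
      proof -
        have "(\<Prod>k\<in>S. mon (G k) y ^ q k) = mon (\<lambda>j. \<Sum>k\<in>S. int (q k) * G k j) y" if "finite S" for S
          using that
        proof induction
          case (insert k S)
          then show ?case
            using mon_add[OF y, of "\<lambda>j. int (q k) * G k j" "\<lambda>j. \<Sum>k\<in>S. int (q k) * G k j"] by (simp add: mon_power)
        qed simp
        then show ?thesis
          using mon_add[OF y, of "\<lambda>j. b j - 1" "\<lambda>j. \<Sum>k\<in>UNIV. int (q k) * G k j"] by (simp add: shift_def[abs_def])
      qed
      ultimately show ?thesis by simp
    qed
    then show ?thesis by (simp add: ps_def)
  qed
  have finQ: "finite (Q M)" for M unfolding Q_def by (intro finite_PiE) auto
  have ps_m [measurable]: "ps M \<in> borel_measurable borel" for M unfolding ps_def by measurable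
  have ux: "\<forall>j. (u * x)$j \<noteq> 0" if "u \<in> torus" for u
    using x torus_nonzero[OF that] unfolding vector_mult_component mult_eq_0_iff by blast
  have G_ux: "cmod (mon a (u * x)) = cmod (mon a x)" if "u \<in> torus" for a u
    unfolding mon_mult norm_mult norm_mon_torus[OF that] by (rule mult_1)
  \<comment> \<open>A majorant on the whole orbit: the same series with every monomial replaced by
    its modulus.\<close>
  define Bd where "Bd = kc * (\<Sum>b\<in>residues. cmod (mon (\<lambda>j. b j - 1) x) * (\<Prod>k\<in>UNIV. \<Sum>q. (N * int q + dot b k) * cmod (mon (G k) x) ^ q))"
  have ps_bound: "cmod (ps M (u * x)) \<le> Bd" if u: "u \<in> torus" for M u
  proof -
    have "cmod (\<Sum>q\<le>M. of_int (N * int q + dot b k) * mon (G k) (u * x) ^ q) \<le> (\<Sum>q. (N * int q + dot b k) * cmod (mon (G k) x) ^ q)"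
      if b: "b \<in> residues" for b k
    proof -
      have nn: "N * int q + dot b k \<ge> 0" for q
      proof -
        have "1 \<le> dot b k" using b by (simp add: residues_def)
        then show ?thesis using N_pos by simp
      qed
      have "(\<lambda>q. complex_of_int (N * int q + dot b k) * of_real (cmod (mon (G k) x)) ^ q) sums gser N (dot b k) (of_real (cmod (mon (G k) x)))"
        using xG by (intro gser_sums) simp
      then have sm: "summable (\<lambda>q. (N * int q + dot b k) * cmod (mon (G k) x) ^ q)"
        using summable_Re[OF sums_summable] by (fastforce simp flip: of_real_power)
      have "cmod (\<Sum>q\<le>M. of_int (N * int q + dot b k) * mon (G k) (u * x) ^ q) \<le> (\<Sum>q\<le>M. cmod (of_int (N * int q + dot b k) * mon (G k) (u * x) ^ q))"
        by (rule norm_sum)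
      also have "\<dots> = (\<Sum>q\<le>M. (N * int q + dot b k) * cmod (mon (G k) x) ^ q)"
        using nn by (intro sum.cong refl) (simp add: norm_mult norm_power G_ux[OF u] norm_of_int del: of_int_add of_int_mult)
      also have "\<dots> \<le> (\<Sum>q. (N * int q + dot b k) * cmod (mon (G k) x) ^ q)"
        using nn by (intro sum_le_suminf sm) (auto simp del: of_int_add of_int_mult)
      finally show ?thesis .
    qed
    then have "cmod (\<Sum>b\<in>residues. mon (\<lambda>j. b j - 1) (u * x) * (\<Prod>k\<in>UNIV. \<Sum>q\<le>M. of_int (N * int q + dot b k) * mon (G k) (u * x) ^ q))
      \<le> (\<Sum>b\<in>residues. cmod (mon (\<lambda>j. b j - 1) x) * (\<Prod>k\<in>UNIV. \<Sum>q. (N * int q + dot b k) * cmod (mon (G k) x) ^ q))"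
      by (intro sum_norm_le) (auto simp: norm_mult G_ux[OF u] prod_norm[symmetric] intro!: mult_left_mono prod_mono)
    then show ?thesis using kc_pos by (simp add: ps_def Bd_def norm_mult)
  qed
  have ps_lim: "(\<lambda>M. ps M (u * x)) \<longlonglongrightarrow> kern (u * x)" if u: "u \<in> torus" for u
  proof -
    have "(\<lambda>M. \<Sum>q\<le>M. of_int (N * int q + dot b k) * mon (G k) (u * x) ^ q) \<longlonglongrightarrow> gser N (dot b k) (mon (G k) (u * x))" for b k
      using gser_sums[of "mon (G k) (u * x)" N "dot b k"] xG[of k] by (simp add: G_ux[OF u] sums_def_le)
    then show ?thesis unfolding ps_def kern_def by (intro tendsto_intros)
  qed
  have "(\<lambda>M. \<integral>u. ps M (u * x) * mon (\<lambda>j. - a j) u \<partial>torus_measure) \<longlonglongrightarrow> (\<integral>u. kern (u * x) * mon (\<lambda>j. - a j) u \<partial>torus_measure)"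
  proof (rule integral_dominated_convergence[where w = "\<lambda>_. Bd"])
    show "AE u in torus_measure. (\<lambda>M. ps M (u * x) * mon (\<lambda>j. - a j) u) \<longlonglongrightarrow> kern (u * x) * mon (\<lambda>j. - a j) u"
      using AE_torus by eventually_elim (intro tendsto_intros ps_lim)
    show "AE u in torus_measure. norm (ps M (u * x) * mon (\<lambda>j. - a j) u) \<le> Bd" for M
      using AE_torus by eventually_elim (use ps_bound in \<open>simp add: norm_mult norm_mon_torus\<close>)
  qed (auto, measurable)
  moreover have "(\<integral>u. ps M (u * x) * mon (\<lambda>j. - a j) u \<partial>torus_measure)
      = kc * (\<Sum>b\<in>residues. \<Sum>q\<in>Q M. co b q * (if shift b q = a then mon a x else 0))" for M
  proof -
    have "(\<integral>u. ps M (u * x) * mon (\<lambda>j. - a j) u \<partial>torus_measure)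
      = (\<integral>u. kc * (\<Sum>b\<in>residues. \<Sum>q\<in>Q M. co b q * (mon (shift b q) x * mon (\<lambda>j. shift b q j - a j) u)) \<partial>torus_measure)"
    proof (rule integral_cong_AE)
      show "AE u in torus_measure. ps M (u * x) * mon (\<lambda>j. - a j) u
          = kc * (\<Sum>b\<in>residues. \<Sum>q\<in>Q M. co b q * (mon (shift b q) x * mon (\<lambda>j. shift b q j - a j) u))"
        using AE_torus
      proof eventually_elim
        case (elim u)
        have "mon (shift b q) (u * x) * mon (\<lambda>j. - a j) u = mon (shift b q) x * mon (\<lambda>j. shift b q j - a j) u" for b q
          using mon_diff[of u "shift b q" a] torus_nonzero[OF elim] by (simp add: mon_mult mon_minus divide_inverse)
        then show ?case
          by (simp add: ps_eq[OF ux[OF elim]] sum_distrib_right mult.assoc)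
      qed
    qed measurable
    also have "\<dots> = kc * (\<Sum>b\<in>residues. \<Sum>q\<in>Q M. co b q * (mon (shift b q) x * (\<integral>u. mon (\<lambda>j. shift b q j - a j) u \<partial>torus_measure)))"
    proof -
      have i: "integrable torus_measure (mon b :: complex^'n \<Rightarrow> complex)" for b
        by (rule integrable_torus_bounded[of _ 1]) (auto simp: norm_mon_torus)
      show ?thesis using i by simp
    qed
    also have "\<dots> = kc * (\<Sum>b\<in>residues. \<Sum>q\<in>Q M. co b q * (if shift b q = a then mon a x else 0))"
    proof -
      have "(\<lambda>j. shift b q j - a j) = (\<lambda>_. 0) \<longleftrightarrow> shift b q = a" for b q by (auto simp: fun_eq_iff)
      then have "mon (shift b q) x * (\<integral>u. mon (\<lambda>j. shift b q j - a j) u \<partial>torus_measure) = (if shift b q = a then mon a x else 0)" for b q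
        by (simp add: integral_mon_torus)
      then show ?thesis by simp
    qed
    finally show ?thesis .
  qed
  ultimately have lim: "(\<lambda>M. kc * (\<Sum>b\<in>residues. \<Sum>q\<in>Q M. co b q * (if shift b q = a then mon a x else 0)))
     \<longlonglongrightarrow> (\<integral>u. kern (u * x) * mon (\<lambda>j. - a j) u \<partial>torus_measure)" by simp
  show ?thesis
  proof (cases "adm a")
    case False
    have "shift b q \<noteq> a" if "b \<in> residues" for b q
    proof
      assume "shift b q = a"
      then have "dot a l + h l \<ge> 1" for l
        using dot_shift[of b q l] that N_pos by (auto simp: residues_def intro!: add_increasing2)
      then show False using False by (simp add: adm_def)
    qed
    then have "(\<Sum>b\<in>residues. \<Sum>q\<in>Q M. co b q * (if shift b q = a then mon a x else 0)) = 0" for M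
      by (intro sum.neutral ballI) auto
    then have "(\<lambda>_. 0) \<longlonglongrightarrow> (\<integral>u. kern (u * x) * mon (\<lambda>j. - a j) u \<partial>torus_measure)" using lim by simp
    then have "(\<integral>u. kern (u * x) * mon (\<lambda>j. - a j) u \<partial>torus_measure) = 0"
      using LIMSEQ_unique tendsto_const by blast
    then show ?thesis using False by simp
  next
    case True
    then obtain b0 q0 where b0: "b0 \<in> residues" "shift b0 q0 = a" using shift_exists by metis
    \<comment> \<open>The normalisation \<open>kc\<close> is chosen to make this coefficient the
      reciprocal of the squared norm.\<close>
    have co: "kc * co b0 q0 = 1 / complex_of_real (msq a)"
    proof -
      have "co b0 q0 = of_real (\<Prod>k\<in>UNIV. real_of_int (dot a k + h k))"
        using dot_shift[of b0 q0] b0 by (simp add: co_def add.commute)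
      moreover have "(\<Prod>k\<in>UNIV. real_of_int (dot a k + h k)) * kc = 1 / msq a"
      proof -
        have nz: "dot a k + h k \<noteq> 0" for k using True unfolding adm_def by (metis not_one_le_zero)
        have "(\<Prod>k\<in>UNIV. real_of_int (dot a k + h k)) * (2 / N) ^ CARD('n) = (\<Prod>k\<in>UNIV. real_of_int (dot a k + h k) * (2 / N))"
          by (simp only: prod.distrib prod_constant)
        also have "\<dots> = (\<Prod>k\<in>UNIV. inverse (N / (2 * real_of_int (dot a k + h k))))"
          by (intro prod.cong) (simp_all add: field_simps)
        also have "\<dots> = inverse (\<Prod>k\<in>UNIV. N / (2 * real_of_int (dot a k + h k)))"
          by (simp add: prod_inversef[symmetric] o_def)
        finally show ?thesis by (simp add: kc_def msq_def divide_inverse mult_ac)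
      qed
      ultimately show ?thesis by (metis mult.commute of_real_1 of_real_divide of_real_mult)
    qed
    have ev: "\<forall>\<^sub>F M in sequentially. kc * (\<Sum>b\<in>residues. \<Sum>q\<in>Q M. co b q * (if shift b q = a then mon a x else 0)) = mon a x / msq a"
    proof (rule eventually_sequentiallyI)
      \<comment> \<open>From here on the box contains the quotient vector of \<open>a\<close>, and
        the sum no longer changes.\<close>
      fix M assume M: "Max (range q0) \<le> M"
      have "q0 k \<le> M" for k using M Max_ge[of "range q0" "q0 k"] by (meson finite finite_imageI order_trans rangeI)
      then have q0: "q0 \<in> Q M" by (auto simp: Q_def)
      have "(\<Sum>q\<in>Q M. co b q * (if shift b q = a then mon a x else 0)) = (if b = b0 then co b0 q0 * mon a x else 0)" if b: "b \<in> residues" for b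
      proof (cases "b = b0")
        case True
        have "co b q * (if shift b q = a then mon a x else 0) = (if q = q0 then co b0 q0 * mon a x else 0)" for q
        proof (cases "q = q0")
          case True
          then show ?thesis using b0(2) \<open>b = b0\<close> by simp
        next
          case False
          then have "shift b0 q \<noteq> shift b0 q0" using shift_unique[OF b0(1) b0(1)] by blast
          then show ?thesis using False b0(2) \<open>b = b0\<close> by simp
        qed
        then show ?thesis using q0 finQ True by simp
      next
        case False
        then have "shift b q \<noteq> a" for q using shift_unique[OF b b0(1), of q q0] b0(2) by auto
        then show ?thesis using False by simp
      qed
      then have "(\<Sum>b\<in>residues. \<Sum>q\<in>Q M. co b q * (if shift b q = a then mon a x else 0)) = (\<Sum>b\<in>residues. if b = b0 then co b0 q0 * mon a x else 0)"
        by (intro sum.cong) auto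
      also have "\<dots> = co b0 q0 * mon a x" using b0 finite_residues by simp
      finally show "kc * (\<Sum>b\<in>residues. \<Sum>q\<in>Q M. co b q * (if shift b q = a then mon a x else 0)) = mon a x / msq a"
        using co by (simp flip: mult.assoc)
    qed
    show ?thesis using LIMSEQ_unique[OF lim tendsto_eventually[OF ev]] True by simp
  qed
qed

definition kb :: real where "kb = kc * (card residues * (3 * N) ^ CARD('n))"

lemma kb_nonneg: "kb \<ge> 0" using kc_pos N_pos by (simp add: kb_def)

text \<open>All \<open>L k x\<close> are at most 0, so the smallest remainder, 1, gives the largest
  monomial; this is the origin of the exponent \<open>1 - h k\<close>.\<close>

lemma norm_kern_le:
  assumes x: "\<forall>j. x$j \<noteq> 0" and xG: "\<And>k. cmod (mon (G k) x) < 1"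
  shows "cmod (kern x) \<le> kb * exp (\<Sum>k\<in>UNIV. (1 - h k) * L k x / N) * (\<Prod>k\<in>UNIV. 1 / (cmod (1 - mon (G k) x))\<^sup>2)"
proof -
  have Lneg: "L k x \<le> 0" for k
    using xG[of k] mon_eq_0_iff[OF x, of "G k"] by (simp add: L_def)
  have "cmod (mon (\<lambda>j. b j - 1) x * (\<Prod>k\<in>UNIV. gser N (dot b k) (mon (G k) x)))
     \<le> exp (\<Sum>k\<in>UNIV. (1 - h k) * L k x / N) * (\<Prod>k\<in>UNIV. 3 * N / (cmod (1 - mon (G k) x))\<^sup>2)"
    if b: "b \<in> residues" for b
  proof -
    have "cmod (mon (\<lambda>j. b j - 1) x) = exp (\<Sum>k\<in>UNIV. (dot b k - h k) * L k x / N)"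
      using norm_mon_L[OF x, of "\<lambda>j. b j - 1"] by (simp add: dot_diff dot_1)
    also have "\<dots> \<le> exp (\<Sum>k\<in>UNIV. (1 - h k) * L k x / N)"
      using b Lneg N_pos by (auto simp: residues_def intro!: sum_mono divide_right_mono mult_right_mono_neg)
    finally show ?thesis
      unfolding norm_mult prod_norm[symmetric]
      using b xG by (intro mult_mono prod_mono) (auto simp: residues_def intro!: norm_gser_le prod_nonneg)
  qed
  then have "cmod (\<Sum>b\<in>residues. mon (\<lambda>j. b j - 1) x * (\<Prod>k\<in>UNIV. gser N (dot b k) (mon (G k) x)))
     \<le> (\<Sum>b\<in>residues. exp (\<Sum>k\<in>UNIV. (1 - h k) * L k x / N) * (\<Prod>k\<in>UNIV. 3 * N / (cmod (1 - mon (G k) x))\<^sup>2))"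
    by (rule sum_norm_le)
  also have "\<dots> = card residues * (exp (\<Sum>k\<in>UNIV. (1 - h k) * L k x / N) * ((3 * N) ^ CARD('n) * (\<Prod>k\<in>UNIV. 1 / (cmod (1 - mon (G k) x))\<^sup>2)))"
    by (simp add: prod_dividef)
  finally have "kc * cmod (\<Sum>b\<in>residues. mon (\<lambda>j. b j - 1) x * (\<Prod>k\<in>UNIV. gser N (dot b k) (mon (G k) x)))
    \<le> kc * (card residues * (exp (\<Sum>k\<in>UNIV. (1 - h k) * L k x / N) * ((3 * N) ^ CARD('n) * (\<Prod>k\<in>UNIV. 1 / (cmod (1 - mon (G k) x))\<^sup>2))))"
    using kc_pos by (intro mult_left_mono) auto
  then show ?thesis using kc_pos by (simp add: kern_def kb_def norm_mult mult_ac)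
qed

lemma L_cp: "(\<forall>j. z$j \<noteq> 0) \<Longrightarrow> (\<forall>j. w$j \<noteq> 0) \<Longrightarrow> L k (cp z w) = L k z + L k w"
  using mon_eq_0_iff[of z "G k"] mon_eq_0_iff[of w "G k"] by (simp add: L_def mon_cp norm_mult ln_mult)

lemma cp_dom:
  assumes "z \<in> U" "w \<in> U"
  shows "cmod (mon (G k) (cp z w)) < 1" "cmod (mon (G k) (cp z w)) \<le> cmod (mon (G k) z)"
proof -
  have "cmod (mon (G k) z) < 1" "cmod (mon (G k) w) < 1" using assms by (auto simp: U_def)
  then show "cmod (mon (G k) (cp z w)) \<le> cmod (mon (G k) z)"
    by (simp add: mon_cp norm_mult mult_left_le)
  then show "cmod (mon (G k) (cp z w)) < 1" using \<open>cmod (mon (G k) z) < 1\<close> by linarith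
qed

lemma continuous_on_kern:
  "continuous_on {x. (\<forall>j. x$j \<noteq> 0) \<and> (\<forall>k. cmod (mon (G k) x) < 1)} kern"
proof -
  let ?S = "{x::complex^'n. (\<forall>j. x$j \<noteq> 0) \<and> (\<forall>k. cmod (mon (G k) x) < 1)}"
  have m: "continuous_on ?S (mon a)" for a
    by (rule holomorphic_n_continuous_on[OF holomorphic_n_mon]) auto
  have "1 - mon (G k) x \<noteq> 0" if "x \<in> ?S" for k x
  proof
    assume "1 - mon (G k) x = 0"
    then have "cmod (mon (G k) x) = 1" by simp
    moreover have "cmod (mon (G k) x) < 1" using that by blast
    ultimately show False by simp
  qed
  then show ?thesis unfolding kern_def gser_def
    by (intro continuous_intros m) auto
qed

end

context monomial_domain
begin

text \<open>\<open>wt\<close> dominates \<open>w \<mapsto> kern (cp z w)\<close> up to a constant depending on \<open>z\<close>, and it is square integrable.\<close>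

definition wt :: "complex^'n \<Rightarrow> complex" where
  "wt w = complex_of_real (indicator U w * exp (\<Sum>k\<in>UNIV. (1 - h k) * L k w / N))"

lemma square_integrable_wt: "square_integrable wt"
proof -
  have [measurable]: "wt \<in> borel_measurable borel" unfolding wt_def by measurable
  have "(\<integral>\<^sup>+w. ennreal ((cmod (wt w))\<^sup>2) \<partial>lborel)
    = (\<integral>\<^sup>+w. ennreal (exp (\<Sum>k\<in>UNIV. (2 - 2 * real_of_int (h k)) * L k w / N)) * indicator U w \<partial>lborel)"
  proof (rule nn_integral_cong)
    fix w
    have "(exp (\<Sum>k\<in>UNIV. (1 - h k) * L k w / N))\<^sup>2 = exp (2 * (\<Sum>k\<in>UNIV. (1 - h k) * L k w / N))"
      by (simp add: exp_double)
    also have "2 * (\<Sum>k\<in>UNIV. (1 - h k) * L k w / N) = (\<Sum>k\<in>UNIV. (2 - 2 * real_of_int (h k)) * L k w / N)"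
      unfolding sum_distrib_left by (intro sum.cong refl) (simp add: algebra_simps)
    finally show "ennreal ((cmod (wt w))\<^sup>2) = ennreal (exp (\<Sum>k\<in>UNIV. (2 - 2 * real_of_int (h k)) * L k w / N)) * indicator U w"
      by (simp add: wt_def norm_mult power_mult_distrib indicator_def)
  qed
  then show ?thesis
    using nn_integral_U_exp[of "\<lambda>k. 2 - 2 * real_of_int (h k)"] by (simp add: square_integrable_def)
qed

text \<open>For fixed \<open>z\<close> the denominators stay away from 0, because
  \<open>|mon (G k)|\<close> at \<open>cp z w\<close> is at most its value at \<open>z\<close>. The
  constant serves the whole torus orbit of \<open>z\<close>.\<close>

lemma norm_kern_cp_le:
  assumes z: "z \<in> U" "\<forall>j. z$j \<noteq> 0"
  shows "\<exists>C. \<forall>w. w \<in> U \<longrightarrow> (\<forall>j. w$j \<noteq> 0) \<longrightarrow> (\<forall>u\<in>torus. cmod (kern (cp (u * z) w)) \<le> C * cmod (wt w))"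
proof -
  define C where "C = kb * exp (\<Sum>k\<in>UNIV. (1 - h k) * L k z / N) * (\<Prod>k\<in>UNIV. 1 / (1 - cmod (mon (G k) z))\<^sup>2)"
  have "cmod (kern (cp (u * z) w)) \<le> C * cmod (wt w)" if w: "w \<in> U" "\<forall>j. w$j \<noteq> 0" and u: "u \<in> torus" for u w
  proof -
    have uz: "u * z \<in> U" "\<forall>j. (u * z)$j \<noteq> 0" using z u torus_nonzero[OF u] by auto
    have nz: "\<forall>j. cp (u * z) w $ j \<noteq> 0" using uz(2) w(2) by simp
    have "cmod (kern (cp (u * z) w)) \<le> kb * exp (\<Sum>k\<in>UNIV. (1 - h k) * L k (cp (u * z) w) / N) * (\<Prod>k\<in>UNIV. 1 / (cmod (1 - mon (G k) (cp (u * z) w)))\<^sup>2)"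
      by (rule norm_kern_le[OF nz cp_dom(1)[OF uz(1) w(1)]])
    also have "\<dots> \<le> kb * exp (\<Sum>k\<in>UNIV. (1 - h k) * L k (cp (u * z) w) / N) * (\<Prod>k\<in>UNIV. 1 / (1 - cmod (mon (G k) z))\<^sup>2)"
    proof -
      have "1 / (cmod (1 - mon (G k) (cp (u * z) w)))\<^sup>2 \<le> 1 / (1 - cmod (mon (G k) z))\<^sup>2" for k
      proof -
        have a: "cmod (mon (G k) (cp (u * z) w)) \<le> cmod (mon (G k) z)"
          using cp_dom(2)[OF uz(1) w(1), of k] u by (simp add: mon_mult norm_mult norm_mon_torus)
        have b: "cmod (mon (G k) z) < 1" using z by (simp add: U_def)
        have c: "1 - cmod (mon (G k) (cp (u * z) w)) \<le> cmod (1 - mon (G k) (cp (u * z) w))"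
          using norm_triangle_ineq2[of 1 "mon (G k) (cp (u * z) w)"] by simp
        have "(1 - cmod (mon (G k) z))\<^sup>2 \<le> (cmod (1 - mon (G k) (cp (u * z) w)))\<^sup>2"
          using a b c by (intro power_mono) auto
        moreover have "0 < (1 - cmod (mon (G k) z))\<^sup>2" using b by simp
        ultimately show ?thesis by (rule frac_le[OF zero_le_one order_refl, rotated])
      qed
      then show ?thesis by (intro mult_left_mono prod_mono) (auto simp: kb_nonneg)
    qed
    also have "(\<Sum>k\<in>UNIV. (1 - h k) * L k (cp (u * z) w) / N) = (\<Sum>k\<in>UNIV. (1 - h k) * L k z / N) + (\<Sum>k\<in>UNIV. (1 - h k) * L k w / N)"
      unfolding sum.distrib[symmetric]
      by (intro sum.cong refl) (simp add: L_cp[OF uz(2) w(2)] u distrib_left add_divide_distrib)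
    finally show ?thesis using w(1) by (simp add: C_def wt_def exp_add mult_ac)
  qed
  then show ?thesis by blast
qed

text \<open>On the torus orbit of a point, \<open>g\<close> and the kernel integral are continuous
  and have the same Fourier coefficients, so they agree almost everywhere on the orbit; averaging
  over orbits yields almost every \<open>z\<close>. The expansion of \<open>g\<close> is thereby
  never summed.\<close>

lemma bergman_representation:
  assumes f: "square_integrable f'" and f0: "\<And>w. w \<notin> U \<Longrightarrow> f' w = 0"
    and g: "in_A2 U g"
    and proj: "\<And>a. adm a \<Longrightarrow> (\<integral>w. (f' w - indicator U w *\<^sub>R g w) * cnj (indicator U w *\<^sub>R mon a w) \<partial>lborel) = 0"
  shows "AE z in lborel. z \<in> U \<longrightarrow> g z = (\<integral>w. kern (cp z w) * f' w \<partial>lborel)"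
proof -
  define g' where "g' = (\<lambda>w. indicator U w *\<^sub>R g w)"
  have sqg: "square_integrable g'" unfolding g'_def by (rule in_A2_square_integrable[OF g])
  have [measurable]: "f' \<in> borel_measurable borel" "g' \<in> borel_measurable borel" "wt \<in> borel_measurable borel"
    using f sqg square_integrable_wt by (auto simp: square_integrable_def)
  obtain c where c: "\<And>a w. w \<in> U \<Longrightarrow> (\<forall>j. w$j \<noteq> 0) \<Longrightarrow> (\<integral>u. g' (u * w) * mon (\<lambda>j. - a j) u \<partial>torus_measure) = c a * mon a w"
    "\<And>a. \<not> adm a \<Longrightarrow> c a = 0"
    "\<And>a. adm a \<Longrightarrow> (\<integral>w. (indicator U w *\<^sub>R mon a w) * cnj (g' w) \<partial>lborel) = cnj (c a) * msq a"
    unfolding g'_def by (rule laurent_coefficients[OF g]) blast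
  \<comment> \<open>Orthogonality to \<open>mon a\<close> turns the Laurent coefficients of
    \<open>g\<close> into integrals of \<open>f'\<close>.\<close>
  have c_f: "(\<integral>w. f' w * cnj (mon a w) \<partial>lborel) = c a * msq a" if a: "adm a" for a
  proof -
    have sm: "square_integrable (\<lambda>w. cnj (indicator U w *\<^sub>R mon a w))"
      by (rule square_integrable_cnj[OF square_integrable_mon[OF a]])
    have i: "integrable lborel (\<lambda>w. f' w * cnj (indicator U w *\<^sub>R mon a w))" "integrable lborel (\<lambda>w. g' w * cnj (indicator U w *\<^sub>R mon a w))"
      using square_integrable_mult[OF f sm] square_integrable_mult[OF sqg sm] by auto
    have "0 = (\<integral>w. f' w * cnj (indicator U w *\<^sub>R mon a w) - g' w * cnj (indicator U w *\<^sub>R mon a w) \<partial>lborel)"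
      using proj[OF a] by (simp only: g'_def left_diff_distrib)
    also have "\<dots> = (\<integral>w. f' w * cnj (indicator U w *\<^sub>R mon a w) \<partial>lborel) - (\<integral>w. g' w * cnj (indicator U w *\<^sub>R mon a w) \<partial>lborel)"
      using i by (rule Bochner_Integration.integral_diff)
    finally have "(\<integral>w. f' w * cnj (indicator U w *\<^sub>R mon a w) \<partial>lborel) = (\<integral>w. cnj ((indicator U w *\<^sub>R mon a w) * cnj (g' w)) \<partial>lborel)"
      by (simp add: mult.commute)
    also have "\<dots> = cnj (\<integral>w. (indicator U w *\<^sub>R mon a w) * cnj (g' w) \<partial>lborel)" by (rule Bochner_Integration.integral_cnj)
    also have "\<dots> = c a * msq a" using c(3)[OF a] by simp
    also have "(\<integral>w. f' w * cnj (indicator U w *\<^sub>R mon a w) \<partial>lborel) = (\<integral>w. f' w * cnj (mon a w) \<partial>lborel)"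
      by (intro Bochner_Integration.integral_cong refl) (auto simp: indicator_def f0)
    finally show ?thesis .
  qed
  define T where "T z = (\<integral>w. kern (cp z w) * f' w \<partial>lborel)" for z
  have Tm [measurable]: "T \<in> borel_measurable borel"
    unfolding T_def[abs_def] by (rule lborel.borel_measurable_lebesgue_integral) measurable
  have AE0: "AE u in torus_measure. g' (u * z) - T (u * z) = 0" if z: "z \<in> U" "\<forall>j. z$j \<noteq> 0" for z
  proof (rule torus_fourier_unique)
    obtain C where C: "\<And>w u. w \<in> U \<Longrightarrow> (\<forall>j. w$j \<noteq> 0) \<Longrightarrow> u \<in> torus \<Longrightarrow> cmod (kern (cp (u * z) w)) \<le> C * cmod (wt w)"
      using norm_kern_cp_le[OF z] by blast
    \<comment> \<open>Integrable as a product of two square integrable functions, and a bound for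
      all phases at once; it serves both continuity in \<open>u\<close> and Fubini.\<close>
    define W where "W w = C * (cmod (wt w) * cmod (f' w))" for w
    have W: "integrable lborel W"
      using integrable_norm[OF square_integrable_mult[OF square_integrable_wt f]] unfolding W_def
      by (intro integrable_mult_right) (simp add: norm_mult)
    have [measurable]: "W \<in> borel_measurable borel" using W by auto
    have bound: "AE w in lborel. \<forall>u\<in>torus. cmod (kern (cp (u * z) w) * f' w) \<le> W w"
      using AE_vec_nonzero
    proof eventually_elim
      case (elim w)
      show ?case
      proof (cases "w \<in> U")
        case True
        then show ?thesis using C[OF True elim] by (auto simp: W_def norm_mult mult.assoc[symmetric] intro!: mult_right_mono)
      qed (simp add: f0 W_def)
    qed
    show "(\<lambda>u. g' (u * z) - T (u * z)) \<in> borel_measurable borel" by measurable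
    have uz: "u * z \<in> U" if "u \<in> torus" for u using that z by simp
    have "continuous_on torus (\<lambda>u. g' (u * z))"
    proof -
      have "continuous_on U g" using g by (auto simp: in_A2_def intro: holomorphic_n_continuous_on)
      then have "continuous_on torus (\<lambda>u. g (u * z))"
        by (rule continuous_on_compose2) (auto intro!: continuous_intros uz)
      then show ?thesis by (rule continuous_on_eq) (simp add: g'_def indicator_def z)
    qed
    moreover have "continuous_on torus (\<lambda>u. T (u * z))"
    proof (rule continuous_on_sequentiallyI)
      fix v :: "nat \<Rightarrow> complex^'n" and u assume v: "\<forall>n. v n \<in> torus" "u \<in> torus" "v \<longlonglongrightarrow> u"
      show "(\<lambda>n. T (v n * z)) \<longlonglongrightarrow> T (u * z)" unfolding T_def
      proof (rule integral_dominated_convergence[OF _ _ W])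
        show "AE w in lborel. (\<lambda>n. kern (cp (v n * z) w) * f' w) \<longlonglongrightarrow> kern (cp (u * z) w) * f' w"
          using AE_vec_nonzero
        proof eventually_elim
          case (elim w)
          show ?case
          proof (cases "w \<in> U")
            case True
            define D where "D = {x::complex^'n. (\<forall>j. x$j \<noteq> 0) \<and> (\<forall>k. cmod (mon (G k) x) < 1)}"
            have D: "cp (u * z) w \<in> D" if "u \<in> torus" for u
              using cp_dom(1)[OF uz[OF that] True] z(2) elim torus_nonzero[OF that] by (simp add: D_def)
            have "continuous_on D kern" unfolding D_def by (rule continuous_on_kern)
            moreover have "continuous_on torus (\<lambda>u. cp (u * z) w)" unfolding cp_def by (intro continuous_intros)
            ultimately have "continuous_on torus (\<lambda>u. kern (cp (u * z) w))"
              by (rule continuous_on_compose2) (use D in blast)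
            then have "(\<lambda>n. kern (cp (v n * z) w)) \<longlonglongrightarrow> kern (cp (u * z) w)"
              using v unfolding continuous_on_sequentially o_def by auto
            then show ?thesis by (intro tendsto_intros)
          qed (simp add: f0)
        qed
        show "AE w in lborel. norm (kern (cp (v n * z) w) * f' w) \<le> W w" for n
          using bound v by (auto elim!: eventually_mono)
      qed measurable
    qed
    ultimately show "continuous_on torus (\<lambda>u. g' (u * z) - T (u * z))" by (rule continuous_on_diff)
    fix b :: "'n \<Rightarrow> int"
    define a where "a j = - b j" for j
    have b: "b = (\<lambda>j. - a j)" by (auto simp: a_def)
    have intg: "integrable (lborel \<Otimes>\<^sub>M torus_measure) (\<lambda>(w,u). kern (cp (u * z) w) * f' w * mon b u)"
    proof (rule integrableI_bounded)
      have "(\<integral>\<^sup>+x. norm (case x of (w,u) \<Rightarrow> kern (cp (u * z) w) * f' w * mon b u) \<partial>(lborel \<Otimes>\<^sub>M torus_measure))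
          = (\<integral>\<^sup>+w. \<integral>\<^sup>+u. ennreal (norm (kern (cp (u * z) w) * f' w * mon b u)) \<partial>torus_measure \<partial>lborel)"
        by (subst torus_measure.nn_integral_fst[symmetric]) auto
      also have "\<dots> \<le> (\<integral>\<^sup>+w. \<integral>\<^sup>+u. ennreal (W w) \<partial>(torus_measure :: (complex^'n) measure) \<partial>lborel)"
      proof (rule nn_integral_mono_AE)
        show "AE w in lborel. (\<integral>\<^sup>+u. ennreal (norm (kern (cp (u * z) w) * f' w * mon b u)) \<partial>torus_measure) \<le> (\<integral>\<^sup>+u. ennreal (W w) \<partial>(torus_measure :: (complex^'n) measure))"
          using bound
        proof eventually_elim
          case (elim w)
          show ?case
            using AE_torus elim by (intro nn_integral_mono_AE) (auto elim!: eventually_mono simp: norm_mult norm_mon_torus intro!: ennreal_leI)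
        qed
      qed
      also have "\<dots> = (\<integral>\<^sup>+w. ennreal (W w) \<partial>lborel)" by (simp add: emeasure_torus_measure)
      also have "\<dots> \<le> (\<integral>\<^sup>+w. ennreal (norm (W w)) \<partial>lborel)" by (intro nn_integral_mono ennreal_leI) simp
      also have "\<dots> < \<infinity>" using W by (simp add: integrable_iff_bounded)
      finally show "(\<integral>\<^sup>+x. norm (case x of (w,u) \<Rightarrow> kern (cp (u * z) w) * f' w * mon b u) \<partial>(lborel \<Otimes>\<^sub>M torus_measure)) < \<infinity>" .
    qed measurable
    have iT: "integrable torus_measure (\<lambda>u. T (u * z) * mon b u)"
      using lborel_torus.integrable_snd[OF intg] by (simp add: T_def)
    obtain B where B: "\<And>u. u \<in> torus \<Longrightarrow> cmod (g' (u * z)) \<le> B"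
      using compact_imp_bounded[OF compact_continuous_image[OF \<open>continuous_on torus (\<lambda>u. g' (u * z))\<close> compact_torus]]
      unfolding bounded_iff by auto
    have ig: "integrable torus_measure (\<lambda>u. g' (u * z) * mon b u)"
      using B by (intro integrable_torus_bounded[of _ B]) (auto simp: norm_mult norm_mon_torus)
    have "(\<integral>u. T (u * z) * mon b u \<partial>torus_measure) = (\<integral>u. (\<integral>w. kern (cp (u * z) w) * f' w * mon b u \<partial>lborel) \<partial>torus_measure)"
      by (simp add: T_def)
    also have "\<dots> = (\<integral>w. (\<integral>u. kern (cp (u * z) w) * f' w * mon b u \<partial>torus_measure) \<partial>lborel)"
      using lborel_torus.Fubini_integral[OF intg] by simp
    also have "\<dots> = (\<integral>w. (if adm a then mon a z / msq a else 0) * (f' w * cnj (mon a w)) \<partial>lborel)"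
    proof (rule integral_cong_AE)
      show "AE w in lborel. (\<integral>u. kern (cp (u * z) w) * f' w * mon b u \<partial>torus_measure)
          = (if adm a then mon a z / msq a else 0) * (f' w * cnj (mon a w))"
        using AE_vec_nonzero
      proof eventually_elim
        case (elim w)
        show ?case
        proof (cases "w \<in> U")
          case True
          have "(\<integral>u. kern (cp (u * z) w) * f' w * mon b u \<partial>torus_measure) = (\<integral>u. f' w * (kern (u * cp z w) * mon (\<lambda>j. - a j) u) \<partial>torus_measure)"
            by (simp add: cp_mult b mult_ac)
          also have "\<dots> = f' w * (if adm a then mon a (cp z w) / msq a else 0)"
            using kern_fourier[of "cp z w" a] z(2) elim cp_dom(1)[OF z(1) True] by simp
          finally show ?thesis by (simp add: mon_cp)
        qed (simp add: f0)
      qed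
    qed measurable
    also have "\<dots> = (if adm a then mon a z / msq a else 0) * (\<integral>w. f' w * cnj (mon a w) \<partial>lborel)"
      by (rule Bochner_Integration.integral_mult_right_zero)
    also have "\<dots> = c a * mon a z"
      using c_f[of a] c(2)[of a] msq_pos[of a] by auto
    finally have "(\<integral>u. T (u * z) * mon b u \<partial>torus_measure) = (\<integral>u. g' (u * z) * mon b u \<partial>torus_measure)"
      using c(1)[OF z, of a] by (simp add: b)
    then show "(\<integral>u. (g' (u * z) - T (u * z)) * mon b u \<partial>torus_measure) = 0"
      using iT ig by (simp add: left_diff_distrib)
  qed
  have "(\<integral>\<^sup>+z. ennreal (cmod (g' z - T z)) * indicator U z \<partial>lborel)
     = (\<integral>\<^sup>+z. \<integral>\<^sup>+u. ennreal (cmod (g' (u * z) - T (u * z))) * indicator U (u * z) \<partial>torus_measure \<partial>lborel)"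
    by (rule nn_integral_torus_average) measurable
  also have "\<dots> = (\<integral>\<^sup>+z. 0 \<partial>(lborel :: (complex^'n) measure))"
  proof (rule nn_integral_cong_AE)
    show "AE z in lborel. (\<integral>\<^sup>+u. ennreal (cmod (g' (u * z) - T (u * z))) * indicator U (u * z) \<partial>torus_measure) = 0"
      using AE_vec_nonzero
    proof eventually_elim
      case (elim z)
      have "AE u in torus_measure. ennreal (cmod (g' (u * z) - T (u * z))) * indicator U (u * z) = 0"
      proof (cases "z \<in> U")
        case True
        show ?thesis using AE0[OF True elim] by eventually_elim simp
      next
        case False
        show ?thesis using AE_torus by eventually_elim (simp add: False)
      qed
      then show ?case by (subst nn_integral_0_iff_AE) auto
    qed
  qed
  finally have "(\<integral>\<^sup>+z. ennreal (cmod (g' z - T z)) * indicator U z \<partial>lborel) = 0" by simp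
  then have "AE z in lborel. ennreal (cmod (g' z - T z)) * indicator U z = 0"
    by (subst (asm) nn_integral_0_iff_AE) auto
  then show ?thesis
  proof eventually_elim
    case (elim z)
    then show ?case by (auto simp: g'_def T_def)
  qed
qed

end

subsection \<open>Boundedness by the Schur test\<close>

text \<open>The pointwise bound for \<open>g\<close> uses Young's inequality with a parameter
  \<open>t\<close>, tuned for each \<open>z\<close>, in the role of Hoelder's inequality.
  Integration over \<open>z\<close> and Fubini then bring in the second test inequality.\<close>

lemma schur_test:
  fixes K :: "'a::euclidean_space \<Rightarrow> 'a \<Rightarrow> real" and \<phi> F g :: "'a \<Rightarrow> real"
  assumes pq: "p > 1" "q > 1" "1 / p + 1 / q = 1"
    and [measurable]: "case_prod K \<in> borel_measurable (borel \<Otimes>\<^sub>M borel)" "\<phi> \<in> borel_measurable borel" "F \<in> borel_measurable borel" "g \<in> borel_measurable borel"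
    and K: "\<And>z w. K z w \<ge> 0" and \<phi>: "\<And>z. \<phi> z > 0" and F: "\<And>w. F w \<ge> 0" and g: "\<And>z. g z \<ge> 0" and A: "A > 0"
    and 1: "AE z in lborel. (\<integral>\<^sup>+w. ennreal (K z w * \<phi> w powr q) \<partial>lborel) \<le> ennreal (A * \<phi> z powr q)"
    and 2: "AE w in lborel. (\<integral>\<^sup>+z. ennreal (K z w * \<phi> z powr p) \<partial>lborel) \<le> ennreal (A * \<phi> w powr p)"
    and gK: "AE z in lborel. ennreal (g z) \<le> (\<integral>\<^sup>+w. ennreal (K z w * F w) \<partial>lborel)"
  shows "(\<integral>\<^sup>+z. ennreal (g z powr p) \<partial>lborel) \<le> ennreal (A powr p) * (\<integral>\<^sup>+w. ennreal (F w powr p) \<partial>lborel)"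
proof -
  have q: "q * (p - 1) = p" using pq by (simp add: field_simps)
  define Z where "Z z = (\<integral>\<^sup>+w. ennreal (K z w * (\<phi> w powr (- p) * F w powr p)) \<partial>lborel)" for z
  have pt: "ennreal (g z powr p) \<le> ennreal (A powr (p - 1) * \<phi> z powr p) * Z z"
    if z1: "(\<integral>\<^sup>+w. ennreal (K z w * \<phi> w powr q) \<partial>lborel) \<le> ennreal (A * \<phi> z powr q)"
      and z2: "ennreal (g z) \<le> (\<integral>\<^sup>+w. ennreal (K z w * F w) \<partial>lborel)" for z
  proof -
    define X where "X = A * \<phi> z powr q"
    have X: "X > 0" using A \<phi>[of z] by (simp add: X_def)
    have Xp: "X powr (p - 1) = A powr (p - 1) * \<phi> z powr p"
      using A by (simp add: X_def powr_mult powr_powr q)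
    have Xp0: "X powr (p - 1) > 0" using X by simp
    show ?thesis
    proof (cases "Z z = \<infinity>")
      case True
      then show ?thesis using A \<phi>[of z] by (simp add: ennreal_mult_top)
    next
      case False
      then obtain r where r: "Z z = ennreal r" "r \<ge> 0" by (cases "Z z") auto
      \<comment> \<open>A value \<open>r'\<close> above \<open>r\<close> keeps the parameter
        \<open>t\<close> positive when \<open>Z z\<close> is 0; at the end \<open>r'\<close>
        decreases to \<open>r\<close>.\<close>
      have "g z powr p \<le> X powr (p - 1) * r'" if r': "r' > r" for r'
      proof -
        have r'0: "r' > 0" using r r' by simp
        \<comment> \<open>Balances the two terms of Young's inequality: since
          \<open>p + q = p * q\<close>, this choice gives
          \<open>r' * t powr (- p) = X * t powr q\<close>.\<close>
        define t where "t = (r' / X) powr (1 / (p * q))"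
        have t: "t > 0" using r'0 X by (simp add: t_def)
        have tq: "t powr q = (r' / X) powr (1 / p)" using pq by (simp add: t_def powr_powr)
        have tp: "t powr (- p) = (r' / X) powr (- (1 / q))" using pq by (simp add: t_def powr_powr)
        have young: "K z w * F w \<le> K z w * (\<phi> w powr (- p) * F w powr p) * (t powr (- p) / p) + K z w * \<phi> w powr q * (t powr q / q)" for w
        proof -
          have "F w = (F w / (\<phi> w * t)) * (t * \<phi> w)" using \<phi>[of w] t by (simp add: field_simps)
          also have "\<dots> \<le> (F w / (\<phi> w * t)) powr p / p + (t * \<phi> w) powr q / q"
            using pq F[of w] \<phi>[of w] t by (intro Youngs_inequality) auto
          also have "\<dots> = (\<phi> w powr (- p) * F w powr p) * (t powr (- p) / p) + \<phi> w powr q * (t powr q / q)"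
            using F[of w] \<phi>[of w] t by (simp add: powr_divide powr_mult powr_minus field_simps)
          finally have "K z w * F w \<le> K z w * ((\<phi> w powr (- p) * F w powr p) * (t powr (- p) / p) + \<phi> w powr q * (t powr q / q))"
            using K by (intro mult_left_mono) auto
          then show ?thesis by (simp add: distrib_left mult.assoc)
        qed
        have "ennreal (g z) \<le> (\<integral>\<^sup>+w. ennreal (K z w * F w) \<partial>lborel)" by (rule z2)
        also have "\<dots> \<le> (\<integral>\<^sup>+w. ennreal (K z w * (\<phi> w powr (- p) * F w powr p)) * ennreal (t powr (- p) / p) + ennreal (K z w * \<phi> w powr q) * ennreal (t powr q / q) \<partial>lborel)"
        proof (rule nn_integral_mono)
          fix w
          show "ennreal (K z w * F w) \<le> ennreal (K z w * (\<phi> w powr (- p) * F w powr p)) * ennreal (t powr (- p) / p) + ennreal (K z w * \<phi> w powr q) * ennreal (t powr q / q)"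
            using young[of w] K[of z w] pq by (simp add: ennreal_leI flip: ennreal_mult ennreal_plus)
        qed
        also have "\<dots> = Z z * ennreal (t powr (- p) / p) + (\<integral>\<^sup>+w. ennreal (K z w * \<phi> w powr q) \<partial>lborel) * ennreal (t powr q / q)"
          unfolding Z_def by (simp add: nn_integral_add nn_integral_multc)
        also have "\<dots> \<le> ennreal r' * ennreal (t powr (- p) / p) + ennreal X * ennreal (t powr q / q)"
          using z1 r r' by (intro add_mono mult_right_mono) (auto simp: X_def ennreal_leI)
        also have "\<dots> = ennreal (r' * (t powr (- p) / p) + X * (t powr q / q))"
          using r'0 X pq by (simp flip: ennreal_mult ennreal_plus)
        finally have "g z \<le> r' * (t powr (- p) / p) + X * (t powr q / q)"
          using r'0 X pq by (subst (asm) ennreal_le_iff) auto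
        also have "r' * t powr (- p) = X * t powr q"
        proof -
          have "1 / p = - (1 / q) + 1" using pq(3) by linarith
          then have "X * t powr q = X * ((r' / X) powr (- (1/q)) * (r' / X) powr 1)"
            by (simp only: tq powr_add)
          also have "\<dots> = r' * t powr (- p)" using X r'0 unfolding tp by simp
          finally show ?thesis by simp
        qed
        then have "r' * (t powr (- p) / p) + X * (t powr q / q) = X * t powr q * (1 / p + 1 / q)"
          by (simp add: field_simps)
        also have "\<dots> = X * t powr q" using pq by simp
        finally have "g z \<le> X * (r' / X) powr (1 / p)" by (simp add: tq)
        then have "g z powr p \<le> (X * (r' / X) powr (1 / p)) powr p"
          using pq g[of z] by (intro powr_mono2) auto
        also have "\<dots> = X powr p * (r' / X)"
          using X r'0 pq by (simp add: powr_mult powr_powr)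
        also have "\<dots> = X powr (p - 1) * r'"
          using X by (simp add: powr_diff)
        finally show ?thesis .
      qed
      then have "g z powr p / X powr (p - 1) \<le> r'" if "r < r'" for r'
        using that Xp0 by (simp add: field_simps)
      then have "g z powr p / X powr (p - 1) \<le> r" by (rule dense_ge)
      then have "g z powr p \<le> X powr (p - 1) * r" using Xp0 by (simp add: field_simps)
      then show ?thesis using r(2) by (simp add: r(1) Xp ennreal_leI A flip: ennreal_mult)
    qed
  qed
  have "(\<integral>\<^sup>+z. ennreal (g z powr p) \<partial>lborel) \<le> (\<integral>\<^sup>+z. ennreal (A powr (p - 1) * \<phi> z powr p) * Z z \<partial>lborel)"
  proof (rule nn_integral_mono_AE)
    show "AE z in lborel. ennreal (g z powr p) \<le> ennreal (A powr (p - 1) * \<phi> z powr p) * Z z"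
      using 1 gK by eventually_elim (rule pt)
  qed
  also have "\<dots> = (\<integral>\<^sup>+z. \<integral>\<^sup>+w. ennreal (A powr (p - 1)) * (ennreal (K z w * \<phi> z powr p) * ennreal (\<phi> w powr (- p) * F w powr p)) \<partial>lborel \<partial>lborel)"
    unfolding Z_def
    by (subst nn_integral_cmult[symmetric]) (auto intro!: nn_integral_cong simp: K mult_ac simp flip: ennreal_mult)
  also have "\<dots> = (\<integral>\<^sup>+w. \<integral>\<^sup>+z. ennreal (A powr (p - 1)) * (ennreal (K z w * \<phi> z powr p) * ennreal (\<phi> w powr (- p) * F w powr p)) \<partial>lborel \<partial>lborel)"
    by (rule lborel_pair.Fubini'[symmetric]) measurable
  also have "\<dots> = (\<integral>\<^sup>+w. ennreal (A powr (p - 1)) * ((\<integral>\<^sup>+z. ennreal (K z w * \<phi> z powr p) \<partial>lborel) * ennreal (\<phi> w powr (- p) * F w powr p)) \<partial>lborel)"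
    by (simp add: nn_integral_cmult nn_integral_multc)
  also have "\<dots> \<le> (\<integral>\<^sup>+w. ennreal (A powr p) * ennreal (F w powr p) \<partial>lborel)"
  proof (rule nn_integral_mono_AE)
    show "AE w in lborel. ennreal (A powr (p - 1)) * ((\<integral>\<^sup>+z. ennreal (K z w * \<phi> z powr p) \<partial>lborel) * ennreal (\<phi> w powr (- p) * F w powr p))
       \<le> ennreal (A powr p) * ennreal (F w powr p)"
      using 2
    proof eventually_elim
      case (elim w)
      have "ennreal (A powr (p - 1)) * ((\<integral>\<^sup>+z. ennreal (K z w * \<phi> z powr p) \<partial>lborel) * ennreal (\<phi> w powr (- p) * F w powr p))
        \<le> ennreal (A powr (p - 1)) * (ennreal (A * \<phi> w powr p) * ennreal (\<phi> w powr (- p) * F w powr p))"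
        using elim by (intro mult_left_mono mult_right_mono) auto
      also have "\<dots> = ennreal ((A powr (p - 1) * A) * (\<phi> w powr p * \<phi> w powr (- p)) * F w powr p)"
        using A by (simp add: mult_ac flip: ennreal_mult)
      also have "(A powr (p - 1) * A) * (\<phi> w powr p * \<phi> w powr (- p)) * F w powr p = A powr p * F w powr p"
        using A \<phi>[of w] by (simp add: powr_diff powr_minus field_simps)
      finally show ?case by (simp add: ennreal_mult)
    qed
  qed
  also have "\<dots> = ennreal (A powr p) * (\<integral>\<^sup>+w. ennreal (F w powr p) \<partial>lborel)"
    by (rule nn_integral_cmult) measurable
  finally show ?thesis .
qed

lemma nn_integral_powr_rational_finite:
  assumes e: "0 < e" "e < 1"
  shows "(\<integral>\<^sup>+u. ennreal (u powr (- e) / (1 + u)) * indicator {0..} u \<partial>lborel) < \<infinity>"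
proof -
  have i1: "(\<integral>\<^sup>+u. ennreal (u powr (- e)) * indicator {0..1} u \<partial>lborel) = ennreal (1 powr (- e + 1) / (- e + 1))"
    using e by (intro nn_integral_has_integral_lebesgue' has_integral_powr_from_0) auto
  have i2: "(\<integral>\<^sup>+u. ennreal (u powr (- e - 1)) * indicator {1..} u \<partial>lborel) = ennreal (- (1 powr (- e - 1 + 1)) / (- e - 1 + 1))"
    using e by (intro nn_integral_has_integral_lebesgue' has_integral_powr_to_inf) auto
  have "(\<integral>\<^sup>+u. ennreal (u powr (- e) / (1 + u)) * indicator {0..} u \<partial>lborel)
    \<le> (\<integral>\<^sup>+u. ennreal (u powr (- e)) * indicator {0..1} u + ennreal (u powr (- e - 1)) * indicator {1..} u \<partial>lborel)"
  proof (rule nn_integral_mono)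
    fix u :: real
    have "u powr (- e) / (1 + u) \<le> u powr (- e)" if "u \<ge> 0"
      using that by (simp add: divide_le_eq mult_le_cancel_left1)
    moreover have "u powr (- e) / (1 + u) \<le> u powr (- e - 1)" if "u \<ge> 1"
      using that by (simp add: powr_diff frac_le)
    ultimately show "ennreal (u powr (- e) / (1 + u)) * indicator {0..} u \<le> ennreal (u powr (- e)) * indicator {0..1} u + ennreal (u powr (- e - 1)) * indicator {1..} u"
      by (cases "u < 0"; cases "u \<le> 1") (simp_all add: indicator_def ennreal_leI add_increasing2)
  qed
  also have "\<dots> = (\<integral>\<^sup>+u. ennreal (u powr (- e)) * indicator {0..1} u \<partial>lborel) + (\<integral>\<^sup>+u. ennreal (u powr (- e - 1)) * indicator {1..} u \<partial>lborel)"
    by (rule nn_integral_add) measurable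
  also have "\<dots> < \<infinity>" unfolding i1 i2 by simp
  finally show ?thesis .
qed

text \<open>A Forelli-Rudin estimate in one logarithmic variable. For \<open>y\<close> near 0 the
  denominator is bounded below by a multiple of \<open>d - y\<close>, where
  \<open>d = 1 - exp (2 * x)\<close>, and the substitution \<open>y = - d * u\<close> extracts the
  power of \<open>d\<close>. For other \<open>y\<close> the denominator is bounded below by a
  constant and \<open>exp (a * y)\<close> ensures integrability.\<close>

lemma nn_integral_disc_estimate:
  assumes e: "0 < e" "e < 1" and a: "a > 0"
  obtains C where "C > 0" "\<And>x. x < 0 \<Longrightarrow>
    (\<integral>\<^sup>+y. ennreal (exp (a * y) * (1 - exp (2 * y)) powr (- e) / (1 - exp (2 * (x + y)))) * indicator {..<0} y \<partial>lborel)
      \<le> ennreal (C * (1 - exp (2 * x)) powr (- e))"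
proof -
  \<comment> \<open>The value of \<open>exp (2 * y)\<close> at \<open>y = -1\<close>, where the
    range of integration is split.\<close>
  define c1 where "c1 = exp (-2::real)"
  have c1: "0 < c1" "c1 < 1" "c1 \<le> 2/3"
  proof -
    have "(1 + 2) \<le> exp (2::real)" by (rule exp_ge_add_one_self)
    then have "exp (-2::real) \<le> 1/3" by (simp add: exp_minus field_simps)
    then show "0 < c1" "c1 < 1" "c1 \<le> 2/3" by (auto simp: c1_def)
  qed
  define J where "J = enn2real (\<integral>\<^sup>+u. ennreal (u powr (- e) / (1 + u)) * indicator {0..} u \<partial>lborel)"
  have J: "(\<integral>\<^sup>+u. ennreal (u powr (- e) / (1 + u)) * indicator {0..} u \<partial>lborel) = ennreal J" "J \<ge> 0"
    using nn_integral_powr_rational_finite[OF e] by (auto simp: J_def)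
  define A where "A = (2/3) powr (- e) / c1"
  define B where "B = (1 - c1) powr (- e) / (1 - c1)"
  have AB: "A > 0" "B > 0" using c1 by (auto simp: A_def B_def)
  have bound: "(\<integral>\<^sup>+y. ennreal (exp (a * y) * (1 - exp (2 * y)) powr (- e) / (1 - exp (2 * (x + y)))) * indicator {..<0} y \<partial>lborel)
      \<le> ennreal ((A * J + B / a) * (1 - exp (2 * x)) powr (- e))" if x: "x < 0" for x
  proof -
    define d where "d = 1 - exp (2 * x)"
    have d: "0 < d" "d < 1" using x by (auto simp: d_def)
    have pt: "exp (a * y) * (1 - exp (2 * y)) powr (- e) / (1 - exp (2 * (x + y))) \<le> A * ((- y) powr (- e) / (d + - y)) + B * exp (a * y)"
      if y: "y < 0" for y
    proof -
      \<comment> \<open>Both summands are positive, so the denominator dominates each of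
        them.\<close>
      have eq: "1 - exp (2 * (x + y)) = d * exp (2 * y) + (1 - exp (2 * y))"
        by (simp add: d_def distrib_left exp_add algebra_simps)
      have ey: "0 < 1 - exp (2 * y)" using y by simp
      have ea: "exp (a * y) \<le> 1" "exp (a * y) > 0" using a y by (auto simp: mult_nonneg_nonpos)
      show ?thesis
      proof (cases "y \<ge> -1")
        case True
        have "1 - 2 * y \<le> exp (- 2 * y)" using exp_ge_add_one_self[of "- 2 * y"] by simp
        then have "exp (2 * y) \<le> 1 / (1 - 2 * y)" using y by (simp add: exp_minus field_simps)
        then have "1 - exp (2 * y) \<ge> 1 - 1 / (1 - 2 * y)" by simp
        also have "1 - 1 / (1 - 2 * y) = - 2 * y / (1 - 2 * y)" using y by (simp add: field_simps)
        also have "- 2 * y / (1 - 2 * y) \<ge> - 2 * y / 3" using True y by (intro divide_left_mono) auto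
        finally have v: "2/3 * - y \<le> 1 - exp (2 * y)" by simp
        have "(1 - exp (2 * y)) powr (- e) \<le> (2/3 * - y) powr (- e)"
          using v y e by (intro powr_mono2') auto
        also have "\<dots> = (2/3) powr (- e) * (- y) powr (- e)" using y by (subst powr_mult) auto
        finally have n: "exp (a * y) * (1 - exp (2 * y)) powr (- e) \<le> 1 * ((2/3) powr (- e) * (- y) powr (- e))"
          using ea by (intro mult_mono) auto
        have "c1 \<le> exp (2 * y)" using True by (simp add: c1_def)
        then have "d * c1 \<le> d * exp (2 * y)" using d by simp
        moreover have "c1 * - y \<le> 2/3 * - y" using c1 y by (intro mult_right_mono) auto
        ultimately have m: "c1 * (d + - y) \<le> 1 - exp (2 * (x + y))" unfolding eq using v by (simp add: algebra_simps)
        have "exp (a * y) * (1 - exp (2 * y)) powr (- e) / (1 - exp (2 * (x + y))) \<le> ((2/3) powr (- e) * (- y) powr (- e)) / (c1 * (d + - y))"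
          using n m d y c1 by (intro frac_le) (auto intro: mult_pos_pos)
        also have "\<dots> = A * ((- y) powr (- e) / (d + - y))" by (simp add: A_def)
        finally show ?thesis using AB ea by (simp add: add_increasing2)
      next
        case False
        have v: "1 - c1 \<le> 1 - exp (2 * y)" using False by (simp add: c1_def)
        have m: "1 - c1 \<le> 1 - exp (2 * (x + y))" unfolding eq using v d by (simp add: add_increasing)
        have "(1 - exp (2 * y)) powr (- e) \<le> (1 - c1) powr (- e)"
          using v c1 e by (intro powr_mono2') auto
        then have "exp (a * y) * (1 - exp (2 * y)) powr (- e) \<le> exp (a * y) * (1 - c1) powr (- e)"
          using ea by (intro mult_left_mono) auto
        then have "exp (a * y) * (1 - exp (2 * y)) powr (- e) / (1 - exp (2 * (x + y))) \<le> (exp (a * y) * (1 - c1) powr (- e)) / (1 - c1)"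
          using m c1 ea by (intro frac_le) auto
        also have "\<dots> = B * exp (a * y)" by (simp add: B_def)
        finally show ?thesis using AB d y by (simp add: add_increasing)
      qed
    qed
    have i1: "(\<integral>\<^sup>+y. ennreal ((- y) powr (- e) / (d + - y)) * indicator {..<0} y \<partial>lborel) \<le> ennreal (J * d powr (- e))"
    proof -
      have "(\<integral>\<^sup>+y. ennreal ((- y) powr (- e) / (d + - y)) * indicator {..<0} y \<partial>lborel)
        = ennreal \<bar>- d\<bar> * (\<integral>\<^sup>+u. ennreal ((- (0 + - d * u)) powr (- e) / (d + - (0 + - d * u))) * indicator {..<0} (0 + - d * u) \<partial>lborel)"
        using d by (intro nn_integral_real_affine) auto
      also have "\<dots> = (\<integral>\<^sup>+u. ennreal d * (ennreal ((- (0 + - d * u)) powr (- e) / (d + - (0 + - d * u))) * indicator {..<0} (0 + - d * u)) \<partial>lborel)"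
        using d by (subst nn_integral_cmult) auto
      also have "\<dots> \<le> (\<integral>\<^sup>+u. ennreal (d powr (- e)) * (ennreal (u powr (- e) / (1 + u)) * indicator {0..} u) \<partial>lborel)"
      proof (rule nn_integral_mono)
        fix u :: real
        show "ennreal d * (ennreal ((- (0 + - d * u)) powr (- e) / (d + - (0 + - d * u))) * indicator {..<0} (0 + - d * u))
           \<le> ennreal (d powr (- e)) * (ennreal (u powr (- e) / (1 + u)) * indicator {0..} u)"
        proof (cases "u > 0")
          case True
          have "d * ((d * u) powr (- e) / (d + d * u)) = d powr (- e) * (u powr (- e) / (1 + u))"
          proof -
            have "d + d * u = d * (1 + u)" by (simp add: distrib_left)
            then show ?thesis using True d by (simp add: powr_mult)
          qed
          then show ?thesis using True d by (simp add: indicator_def flip: ennreal_mult)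
        next
          case False
          then show ?thesis using d by (simp add: indicator_def mult_nonneg_nonpos not_less)
        qed
      qed
      also have "\<dots> = ennreal (d powr (- e)) * ennreal J" unfolding J(1)[symmetric] by (rule nn_integral_cmult) measurable
      finally show ?thesis using J(2) by (simp add: mult.commute flip: ennreal_mult)
    qed
    have "(\<integral>\<^sup>+y. ennreal (exp (a * y) * (1 - exp (2 * y)) powr (- e) / (1 - exp (2 * (x + y)))) * indicator {..<0} y \<partial>lborel)
      \<le> (\<integral>\<^sup>+y. ennreal A * (ennreal ((- y) powr (- e) / (d + - y)) * indicator {..<0} y) + ennreal B * (ennreal (exp (a * y)) * indicator {..<0} y) \<partial>lborel)"
    proof (rule nn_integral_mono)
      fix y :: real
      show "ennreal (exp (a * y) * (1 - exp (2 * y)) powr (- e) / (1 - exp (2 * (x + y)))) * indicator {..<0} y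
        \<le> ennreal A * (ennreal ((- y) powr (- e) / (d + - y)) * indicator {..<0} y) + ennreal B * (ennreal (exp (a * y)) * indicator {..<0} y)"
        using pt[of y] AB d by (auto simp: indicator_def ennreal_leI simp flip: ennreal_mult ennreal_plus)
    qed
    also have "\<dots> = ennreal A * (\<integral>\<^sup>+y. ennreal ((- y) powr (- e) / (d + - y)) * indicator {..<0} y \<partial>lborel)
        + ennreal B * (\<integral>\<^sup>+y. ennreal (exp (a * y)) * indicator {..<0} y \<partial>lborel)"
      by (simp add: nn_integral_add nn_integral_cmult)
    also have "\<dots> \<le> ennreal A * ennreal (J * d powr (- e)) + ennreal B * ennreal (1 / a)"
      using i1 a by (intro add_mono mult_left_mono) (auto simp: nn_integral_exp_neg)
    also have "\<dots> = ennreal (A * J * d powr (- e) + B / a)"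
      using AB J a by (simp add: mult.assoc flip: ennreal_mult ennreal_plus)
    also have "\<dots> \<le> ennreal ((A * J + B / a) * d powr (- e))"
    proof (rule ennreal_leI)
      \<comment> \<open>As \<open>d\<close> is below 1, the constant from the far range is absorbed
        by the power of \<open>d\<close>.\<close>
      have "1 \<le> d powr (- e)" using d e by (simp add: powr_minus one_le_inverse powr_le_one_le powr_le1)
      then have "B / a * 1 \<le> B / a * d powr (- e)" using AB a by (intro mult_left_mono) auto
      then show "A * J * d powr (- e) + B / a \<le> (A * J + B / a) * d powr (- e)" by (simp add: distrib_right)
    qed
    finally show ?thesis by (simp add: d_def)
  qed
  have "A * J + B / a > 0" using AB J a by (simp add: add_nonneg_pos)
  then show thesis using bound by (rule that)
qed

context monomial_cone
begin

text \<open>Parseval for the partial sums of the product of geometric series, whose frequencies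
  \<open>\<Sum>k. q k * G k\<close> are pairwise distinct.\<close>

lemma torus_poisson_le:
  assumes s: "\<And>k. cmod (s k) < 1"
  shows "(\<integral>\<^sup>+u. ennreal (\<Prod>k\<in>UNIV. 1 / (cmod (1 - s k * mon (G k) u))\<^sup>2) \<partial>torus_measure) \<le> ennreal (\<Prod>k\<in>UNIV. 1 / (1 - (cmod (s k))\<^sup>2))"
proof -
  define Q where "Q M = (PiE UNIV (\<lambda>_. {..M}) :: ('n \<Rightarrow> nat) set)" for M :: nat
  have finQ: "finite (Q M)" for M unfolding Q_def by (intro finite_PiE) auto
  define fr where "fr q j = (\<Sum>k\<in>UNIV. int (q k) * G k j)" for q :: "'n \<Rightarrow> nat" and j
  define ps where "ps M u = (\<Prod>k\<in>UNIV. \<Sum>q\<le>M. (s k * mon (G k) u) ^ q)" for M u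
  have [measurable]: "ps M \<in> borel_measurable borel" for M unfolding ps_def by measurable
  have fr_inj: "q = q'" if "fr q = fr q'" for q q'
  proof
    fix l
    have "dot (fr q) l = N * int (q l)" for q
    proof -
      have "dot (fr q) l = (\<Sum>k\<in>UNIV. int (q k) * dot (G k) l)"
        unfolding fr_def dot_sum dot_cmult ..
      also have "\<dots> = (\<Sum>k\<in>UNIV. if k = l then N * int (q l) else 0)"
        unfolding dot_G by (intro sum.cong) auto
      finally show ?thesis by simp
    qed
    then show "q l = q' l" using that N_pos by (metis mult_cancel_left of_nat_eq_iff less_irrefl)
  qed
  have ps_eq: "ps M u = (\<Sum>q\<in>Q M. (\<Prod>k\<in>UNIV. s k ^ q k) * mon (fr q) u)" if u: "u \<in> torus" for M u
  proof -
    have nz: "\<forall>j. u$j \<noteq> 0" using torus_nonzero[OF u] by blast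
    have "mon (fr q) u = (\<Prod>k\<in>UNIV. mon (G k) u ^ q k)" for q
    proof -
      have "(\<Prod>k\<in>S. mon (G k) u ^ q k) = mon (\<lambda>j. \<Sum>k\<in>S. int (q k) * G k j) u" if "finite S" for S
        using that
      proof induction
        case (insert k S)
        then show ?case
          using mon_add[OF nz, of "\<lambda>j. int (q k) * G k j" "\<lambda>j. \<Sum>k\<in>S. int (q k) * G k j"] by (simp add: mon_power)
      qed simp
      then show ?thesis by (simp add: fr_def[abs_def])
    qed
    moreover have "ps M u = (\<Sum>q\<in>Q M. \<Prod>k\<in>UNIV. (s k * mon (G k) u) ^ q k)"
      unfolding ps_def Q_def by (rule prod_sum_PiE) auto
    ultimately show ?thesis by (simp add: power_mult_distrib prod.distrib)
  qed
  have i: "integrable torus_measure (mon b :: complex^'n \<Rightarrow> complex)" for b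
    by (rule integrable_torus_bounded[of _ 1]) (auto simp: norm_mon_torus)
  have sq: "(\<integral>\<^sup>+u. ennreal ((cmod (ps M u))\<^sup>2) \<partial>torus_measure) \<le> ennreal (\<Prod>k\<in>UNIV. 1 / (1 - (cmod (s k))\<^sup>2))" for M
  proof -
    have "(\<integral>u. ps M u * cnj (ps M u) \<partial>torus_measure)
      = (\<integral>u. (\<Sum>q\<in>Q M. \<Sum>q'\<in>Q M. ((\<Prod>k\<in>UNIV. s k ^ q k) * cnj (\<Prod>k\<in>UNIV. s k ^ q' k)) * mon (\<lambda>j. fr q j - fr q' j) u) \<partial>torus_measure)"
    proof (rule integral_cong_AE)
      show "AE u in torus_measure. ps M u * cnj (ps M u)
        = (\<Sum>q\<in>Q M. \<Sum>q'\<in>Q M. ((\<Prod>k\<in>UNIV. s k ^ q k) * cnj (\<Prod>k\<in>UNIV. s k ^ q' k)) * mon (\<lambda>j. fr q j - fr q' j) u)"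
        using AE_torus
      proof eventually_elim
        case (elim u)
        have "mon (\<lambda>j. fr q j - fr q' j) u = mon (fr q) u * cnj (mon (fr q') u)" for q q'
          using mon_diff[of u "fr q" "fr q'"] torus_nonzero[OF elim] cnj_mon_torus[OF elim] by (simp add: divide_inverse)
        then show ?case
          unfolding ps_eq[OF elim] cnj_sum sum_product by (simp add: mult_ac)
      qed
    qed measurable
    also have "\<dots> = (\<Sum>q\<in>Q M. \<Sum>q'\<in>Q M. ((\<Prod>k\<in>UNIV. s k ^ q k) * cnj (\<Prod>k\<in>UNIV. s k ^ q' k)) * (\<integral>u. mon (\<lambda>j. fr q j - fr q' j) u \<partial>torus_measure))"
      using i by simp
    also have "\<dots> = (\<Sum>q\<in>Q M. \<Sum>q'\<in>Q M. if q' = q then (\<Prod>k\<in>UNIV. s k ^ q k) * cnj (\<Prod>k\<in>UNIV. s k ^ q k) else 0)"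
    proof (intro sum.cong refl)
      fix q q'
      have "(\<lambda>j. fr q j - fr q' j) = (\<lambda>_. 0) \<longleftrightarrow> fr q = fr q'" by (auto simp: fun_eq_iff)
      then have "(\<lambda>j. fr q j - fr q' j) = (\<lambda>_. 0) \<longleftrightarrow> q' = q" using fr_inj by metis
      then show "((\<Prod>k\<in>UNIV. s k ^ q k) * cnj (\<Prod>k\<in>UNIV. s k ^ q' k)) * (\<integral>u. mon (\<lambda>j. fr q j - fr q' j) u \<partial>torus_measure)
        = (if q' = q then (\<Prod>k\<in>UNIV. s k ^ q k) * cnj (\<Prod>k\<in>UNIV. s k ^ q k) else 0)"
        by (simp add: integral_mon_torus)
    qed
    also have "\<dots> = (\<Sum>q\<in>Q M. (\<Prod>k\<in>UNIV. s k ^ q k) * cnj (\<Prod>k\<in>UNIV. s k ^ q k))"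
      using finQ by simp
    also have "\<dots> = complex_of_real (\<Sum>q\<in>Q M. \<Prod>k\<in>UNIV. ((cmod (s k))\<^sup>2) ^ q k)"
    proof -
      have "(\<Prod>k\<in>UNIV. s k ^ q k) * cnj (\<Prod>k\<in>UNIV. s k ^ q k) = (\<Prod>k\<in>UNIV. (s k * cnj (s k)) ^ q k)" for q
        by (simp add: power_mult_distrib prod.distrib)
      then show ?thesis unfolding complex_norm_square[symmetric] by simp
    qed
    also have "(\<Sum>q\<in>Q M. \<Prod>k\<in>UNIV. ((cmod (s k))\<^sup>2) ^ q k) = (\<Prod>k\<in>UNIV. \<Sum>q\<le>M. ((cmod (s k))\<^sup>2) ^ q)"
      unfolding Q_def by (rule prod_sum_PiE[symmetric]) auto
    finally have "complex_of_real (\<integral>u. (cmod (ps M u))\<^sup>2 \<partial>torus_measure) = complex_of_real (\<Prod>k\<in>UNIV. \<Sum>q\<le>M. ((cmod (s k))\<^sup>2) ^ q)"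
      by (simp only: complex_norm_square[symmetric] integral_complex_of_real)
    then have eq: "(\<integral>u. (cmod (ps M u))\<^sup>2 \<partial>torus_measure) = (\<Prod>k\<in>UNIV. \<Sum>q\<le>M. ((cmod (s k))\<^sup>2) ^ q)"
      using of_real_eq_iff by blast
    have s2: "(cmod (s k))\<^sup>2 < 1" for k using s[of k] by (simp add: power_less_one_iff abs_square_less_1)
    have le: "(\<Prod>k\<in>UNIV. \<Sum>q\<le>M. ((cmod (s k))\<^sup>2) ^ q) \<le> (\<Prod>k\<in>UNIV. 1 / (1 - (cmod (s k))\<^sup>2))"
    proof (intro prod_mono conjI)
      fix k
      have "(\<Sum>q\<le>M. ((cmod (s k))\<^sup>2) ^ q) \<le> (\<Sum>q. ((cmod (s k))\<^sup>2) ^ q)"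
        using s2[of k] by (intro sum_le_suminf summable_geometric) auto
      then show "(\<Sum>q\<le>M. ((cmod (s k))\<^sup>2) ^ q) \<le> 1 / (1 - (cmod (s k))\<^sup>2)"
        using s2[of k] by (subst (asm) suminf_geometric) auto
    qed (auto intro: sum_nonneg)
    have "integrable torus_measure (\<lambda>u. (cmod (ps M u))\<^sup>2)"
    proof -
      have "cmod (ps M u) \<le> (\<Prod>k\<in>UNIV. \<Sum>q\<le>M. cmod (s k) ^ q)" if u: "u \<in> torus" for u
        unfolding ps_def prod_norm[symmetric]
        by (intro prod_mono conjI norm_ge_zero order_trans[OF norm_sum] sum_mono)
           (simp add: norm_power norm_mult norm_mon_torus[OF u])
      then show ?thesis using AE_torus
        by (intro torus_measure.integrable_const_bound[of _ "(\<Prod>k\<in>UNIV. \<Sum>q\<le>M. cmod (s k) ^ q)\<^sup>2"]) (auto elim!: eventually_mono intro!: power_mono)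
    qed
    then have "(\<integral>\<^sup>+u. ennreal ((cmod (ps M u))\<^sup>2) \<partial>torus_measure) = ennreal (\<integral>u. (cmod (ps M u))\<^sup>2 \<partial>torus_measure)"
      by (rule nn_integral_eq_integral) simp
    then show ?thesis using le by (simp add: eq ennreal_leI)
  qed
  have "(\<integral>\<^sup>+u. ennreal (\<Prod>k\<in>UNIV. 1 / (cmod (1 - s k * mon (G k) u))\<^sup>2) \<partial>torus_measure) = (\<integral>\<^sup>+u. liminf (\<lambda>M. ennreal ((cmod (ps M u))\<^sup>2)) \<partial>torus_measure)"
  proof (rule nn_integral_cong_AE)
    show "AE u in torus_measure. ennreal (\<Prod>k\<in>UNIV. 1 / (cmod (1 - s k * mon (G k) u))\<^sup>2) = liminf (\<lambda>M. ennreal ((cmod (ps M u))\<^sup>2))"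
      using AE_torus
    proof eventually_elim
      case (elim u)
      have "(\<lambda>M. ps M u) \<longlonglongrightarrow> (\<Prod>k\<in>UNIV. 1 / (1 - s k * mon (G k) u))"
        unfolding ps_def
      proof (intro tendsto_intros)
        fix k
        have "cmod (s k * mon (G k) u) < 1" using s[of k] by (simp add: norm_mult norm_mon_torus[OF elim])
        from geometric_sums[OF this] show "(\<lambda>M. \<Sum>q\<le>M. (s k * mon (G k) u) ^ q) \<longlonglongrightarrow> 1 / (1 - s k * mon (G k) u)"
          by (simp add: sums_def_le)
      qed
      then have "(\<lambda>M. ennreal ((cmod (ps M u))\<^sup>2)) \<longlonglongrightarrow> ennreal ((cmod (\<Prod>k\<in>UNIV. 1 / (1 - s k * mon (G k) u)))\<^sup>2)"
        by (intro tendsto_intros)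
      then have "liminf (\<lambda>M. ennreal ((cmod (ps M u))\<^sup>2)) = ennreal ((cmod (\<Prod>k\<in>UNIV. 1 / (1 - s k * mon (G k) u)))\<^sup>2)"
        by (intro lim_imp_Liminf) auto
      moreover have "(cmod (\<Prod>k\<in>UNIV. 1 / (1 - s k * mon (G k) u)))\<^sup>2 = (\<Prod>k\<in>UNIV. 1 / (cmod (1 - s k * mon (G k) u))\<^sup>2)"
        by (simp add: prod_norm[symmetric] norm_divide prod_power_distrib power_divide)
      ultimately show ?case by simp
    qed
  qed
  \<comment> \<open>Fatou's lemma suffices, as only an upper bound is wanted.\<close>
  also have "\<dots> \<le> liminf (\<lambda>M. \<integral>\<^sup>+u. ennreal ((cmod (ps M u))\<^sup>2) \<partial>torus_measure)"
    by (rule nn_integral_liminf) measurable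
  also have "\<dots> \<le> liminf (\<lambda>M. ennreal (\<Prod>k\<in>UNIV. 1 / (1 - (cmod (s k))\<^sup>2)))"
    by (intro Liminf_mono always_eventually allI sq)
  also have "\<dots> = ennreal (\<Prod>k\<in>UNIV. 1 / (1 - (cmod (s k))\<^sup>2))" by (simp add: Liminf_const)
  finally show ?thesis .
qed

end


section \<open>The Schur test on the polyhedron\<close>

context monomial_domain
begin

definition V :: "(complex^'n) set" where "V = {z\<in>U. \<forall>j. z$j \<noteq> 0}"

lemma borel_V [measurable]: "V \<in> sets borel"
proof -
  have "V = U \<inter> {z. \<forall>j. z$j \<noteq> 0}" by (auto simp: V_def)
  moreover have "{z::complex^'n. \<forall>j. z$j \<noteq> 0} \<in> sets borel" by measurable
  ultimately show ?thesis by auto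
qed

lemma V_torus [simp]: "u \<in> torus \<Longrightarrow> u * w \<in> V \<longleftrightarrow> w \<in> V"
  using torus_nonzero[of u] by (auto simp: V_def)

lemma L_neg: "w \<in> V \<Longrightarrow> L k w < 0"
  using U_iff by (auto simp: V_def)

text \<open>The bound of \<open>norm_kern_le\<close> at \<open>cp z w\<close>, cut off to
  \<open>V\<close>, where all logarithms are genuine. Its symmetry lets one estimate serve both
  Schur inequalities.\<close>

definition absk :: "complex^'n \<Rightarrow> complex^'n \<Rightarrow> real" where
  "absk z w = kb * (indicator V z * indicator V w) * exp (\<Sum>k\<in>UNIV. (1 - h k) * (L k z + L k w) / N)
     * (\<Prod>k\<in>UNIV. 1 / (cmod (1 - mon (G k) (cp z w)))\<^sup>2)"

lemma absk_nonneg: "absk z w \<ge> 0"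
  using kb_nonneg by (auto simp: absk_def intro!: mult_nonneg_nonneg prod_nonneg)

lemma absk_sym: "absk z w = absk w z"
proof -
  have "cmod (1 - mon (G k) (cp z w)) = cmod (1 - mon (G k) (cp w z))" for k
  proof -
    have "1 - mon (G k) (cp z w) = cnj (1 - mon (G k) (cp w z))" by (simp add: mon_cp mult.commute)
    then show ?thesis by (simp only: complex_mod_cnj)
  qed
  then show ?thesis by (simp add: absk_def add.commute mult.commute)
qed

lemma borel_measurable_absk [measurable]: "case_prod absk \<in> borel_measurable (borel \<Otimes>\<^sub>M borel)"
  unfolding absk_def case_prod_beta by measurable

lemma norm_kern_le_absk: "z \<in> V \<Longrightarrow> w \<in> V \<Longrightarrow> cmod (kern (cp z w)) \<le> absk z w"
proof -
  assume z: "z \<in> V" and w: "w \<in> V"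
  have "cmod (kern (cp z w)) \<le> kb * exp (\<Sum>k\<in>UNIV. (1 - h k) * L k (cp z w) / N) * (\<Prod>k\<in>UNIV. 1 / (cmod (1 - mon (G k) (cp z w)))\<^sup>2)"
    using z w by (intro norm_kern_le cp_dom(1)) (auto simp: V_def)
  moreover have "L k (cp z w) = L k z + L k w" for k using z w by (intro L_cp) (auto simp: V_def)
  ultimately show ?thesis using z w by (simp add: absk_def)
qed

text \<open>The exponential factor follows the growth of the kernel where a defining monomial tends
  to 0, the other factor treats the boundary where its modulus tends to 1. The value 1 off
  \<open>V\<close> keeps the function positive everywhere, as \<open>schur_test\<close>
  demands.\<close>

definition schur_fun :: "('n \<Rightarrow> real) \<Rightarrow> real \<Rightarrow> complex^'n \<Rightarrow> real" where
  "schur_fun d e z = (if z \<in> V then \<Prod>k\<in>UNIV. exp (- d k * L k z / N) * (1 - exp (2 * L k z)) powr (- e) else 1)"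

lemma schur_fun_pos: "schur_fun d e z > 0"
  using L_neg by (auto simp: schur_fun_def intro!: prod_pos mult_pos_pos less_imp_neq dest: less_imp_neq)

lemma borel_measurable_schur_fun [measurable]: "schur_fun d e \<in> borel_measurable borel"
  unfolding schur_fun_def[abs_def] by measurable

lemma schur_fun_torus [simp]: "u \<in> torus \<Longrightarrow> schur_fun d e (u * w) = schur_fun d e w"
  by (simp add: schur_fun_def)

lemma schur_fun_powr: "schur_fun d e z powr s = schur_fun (\<lambda>k. d k * s) (e * s) z"
proof (cases "z \<in> V")
  case True
  have "(\<Prod>k\<in>A. exp (- d k * L k z / N) * (1 - exp (2 * L k z)) powr (- e)) powr s
      = (\<Prod>k\<in>A. exp (- (d k * s) * L k z / N) * (1 - exp (2 * L k z)) powr (- (e * s)))" if "finite A" for A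
    using that
  proof induction
    case (insert k A)
    have "(exp (- d k * L k z / N) * (1 - exp (2 * L k z)) powr (- e)) powr s
       = exp (- (d k * s) * L k z / N) * (1 - exp (2 * L k z)) powr (- (e * s))"
      by (subst powr_mult) (auto simp: exp_powr_real powr_powr mult_ac)
    then show ?case using insert by (simp add: powr_mult prod_nonneg)
  qed simp
  then show ?thesis using True by (simp add: schur_fun_def)
next
  case False
  then show ?thesis by (simp add: schur_fun_def)
qed

text \<open>Along the orbit of \<open>w\<close> each \<open>s k\<close> is multiplied by
  \<open>mon (G k) u\<close>, so \<open>torus_poisson_le\<close> replaces every squared distance in
  the denominator by \<open>1 - |s k|^2\<close>, which depends on moduli only.\<close>

lemma absk_torus_average:
  assumes z: "z \<in> V" and w: "w \<in> V"
  shows "(\<integral>\<^sup>+u. ennreal (absk z (u * w)) \<partial>torus_measure)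
    \<le> ennreal (kb * exp (\<Sum>k\<in>UNIV. (1 - h k) * (L k z + L k w) / N) * (\<Prod>k\<in>UNIV. 1 / (1 - exp (2 * (L k z + L k w)))))"
proof -
  define s where "s k = cnj (mon (G k) z) * mon (G k) w" for k
  have sn: "cmod (s k) = exp (L k z + L k w)" for k
    using z w mon_eq_0_iff[of z "G k"] mon_eq_0_iff[of w "G k"] by (simp add: s_def norm_mult L_def exp_add V_def)
  have s1: "cmod (s k) < 1" for k using L_neg[OF z, of k] L_neg[OF w, of k] by (simp add: sn)
  define E where "E = kb * exp (\<Sum>k\<in>UNIV. (1 - h k) * (L k z + L k w) / N)"
  have E: "E \<ge> 0" using kb_nonneg by (simp add: E_def)
  have "(\<integral>\<^sup>+u. ennreal (absk z (u * w)) \<partial>torus_measure)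
    = (\<integral>\<^sup>+u. ennreal E * ennreal (\<Prod>k\<in>UNIV. 1 / (cmod (1 - s k * mon (G k) u))\<^sup>2) \<partial>torus_measure)"
  proof (rule nn_integral_cong_AE)
    show "AE u in torus_measure. ennreal (absk z (u * w)) = ennreal E * ennreal (\<Prod>k\<in>UNIV. 1 / (cmod (1 - s k * mon (G k) u))\<^sup>2)"
      using AE_torus
    proof eventually_elim
      case (elim u)
      have "cmod (1 - mon (G k) (cp z (u * w))) = cmod (1 - s k * mon (G k) u)" for k
      proof -
        have "1 - mon (G k) (cp z (u * w)) = cnj (1 - s k * mon (G k) u)" by (simp add: mon_cp mon_mult s_def mult_ac)
        then show ?thesis by (simp only: complex_mod_cnj)
      qed
      then have "absk z (u * w) = E * (\<Prod>k\<in>UNIV. 1 / (cmod (1 - s k * mon (G k) u))\<^sup>2)"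
        using z w elim by (simp add: absk_def E_def)
      then show ?case using E by (simp add: ennreal_mult prod_nonneg)
    qed
  qed
  also have "\<dots> = ennreal E * (\<integral>\<^sup>+u. ennreal (\<Prod>k\<in>UNIV. 1 / (cmod (1 - s k * mon (G k) u))\<^sup>2) \<partial>torus_measure)"
    by (rule nn_integral_cmult) measurable
  also have "\<dots> \<le> ennreal E * ennreal (\<Prod>k\<in>UNIV. 1 / (1 - (cmod (s k))\<^sup>2))"
    by (intro mult_left_mono torus_poisson_le s1) auto
  also have "\<dots> = ennreal (E * (\<Prod>k\<in>UNIV. 1 / (1 - exp (2 * (L k z + L k w)))))"
  proof -
    have "(cmod (s k))\<^sup>2 = exp (2 * (L k z + L k w))" for k by (simp only: sn exp_double)
    then show ?thesis by (simp only: ennreal_mult'[OF E])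
  qed
  finally show ?thesis by (simp add: E_def)
qed

text \<open>After averaging over phases the integrand is a product, and each factor is the disc
  estimate with exponent \<open>(h k + 1 - d k) / N\<close>: \<open>1 - h k\<close> comes from the
  kernel, \<open>- d k\<close> from the test function, \<open>2 * h k\<close> from Lebesgue measure.
  The upper bound on \<open>d k\<close> makes this exponent positive; the lower bound lets the
  remaining \<open>exp ((1 - h k) * L k z / N)\<close> be dominated by the factor of the test
  function at \<open>z\<close>.\<close>

lemma schur_estimate:
  fixes d :: "'n \<Rightarrow> real"
  assumes d: "\<And>k. h k - 1 \<le> d k" "\<And>k. d k < h k + 1" and e: "0 < e" "e < 1"
  shows "\<exists>A>0. \<forall>z. (\<integral>\<^sup>+w. ennreal (absk z w * schur_fun d e w) \<partial>lborel) \<le> ennreal (A * schur_fun d e z)"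
proof -
  define P where "P k c \<longleftrightarrow> c > 0 \<and> (\<forall>x<0. (\<integral>\<^sup>+y. ennreal (exp ((h k + 1 - d k) / N * y) * (1 - exp (2 * y)) powr (- e) / (1 - exp (2 * (x + y)))) * indicator {..<0} y \<partial>lborel)
      \<le> ennreal (c * (1 - exp (2 * x)) powr (- e)))" for k and c :: real
  have "\<exists>c. P k c" for k
  proof -
    have pos: "(h k + 1 - d k) / N > 0" using d(2)[of k] N_pos by simp
    obtain c where c: "c > 0" "\<And>x. x < 0 \<Longrightarrow> (\<integral>\<^sup>+y. ennreal (exp ((h k + 1 - d k) / N * y) * (1 - exp (2 * y)) powr (- e) / (1 - exp (2 * (x + y)))) * indicator {..<0} y \<partial>lborel)
      \<le> ennreal (c * (1 - exp (2 * x)) powr (- e))"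
      by (rule nn_integral_disc_estimate[OF e pos]) blast
    then show ?thesis unfolding P_def by blast
  qed
  then obtain C where C0: "\<And>k. P k (C k)" by metis
  have C: "C k > 0" "x < 0 \<Longrightarrow> (\<integral>\<^sup>+y. ennreal (exp ((h k + 1 - d k) / N * y) * (1 - exp (2 * y)) powr (- e) / (1 - exp (2 * (x + y)))) * indicator {..<0} y \<partial>lborel)
      \<le> ennreal (C k * (1 - exp (2 * x)) powr (- e))" for k x
    using C0[of k] unfolding P_def by blast+
  \<comment> \<open>\<open>kb + 1\<close> rather than \<open>kb\<close>, because \<open>A\<close>
    has to be positive and \<open>kb\<close> is only known to be nonnegative.\<close>
  define A where "A = (kb + 1) * rc * (\<Prod>k\<in>UNIV. C k)"
  have "A > 0" using kb_nonneg rc(1) C(1) by (auto simp: A_def intro!: mult_pos_pos prod_pos)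
  moreover have "(\<integral>\<^sup>+w. ennreal (absk z w * schur_fun d e w) \<partial>lborel) \<le> ennreal (A * schur_fun d e z)" for z
  proof (cases "z \<in> V")
    case False
    then show ?thesis by (simp add: absk_def)
  next
    case z: True
    define f where "f k y = exp ((1 - h k) * (L k z + y) / N) * (1 / (1 - exp (2 * (L k z + y)))) * (exp (- d k * y / N) * (1 - exp (2 * y)) powr (- e))" for k y
    have fnn: "f k y \<ge> 0" if "y < 0" for k y
      using that L_neg[OF z, of k] by (auto simp: f_def)
    have "(\<integral>\<^sup>+w. ennreal (absk z w * schur_fun d e w) \<partial>lborel)
      = (\<integral>\<^sup>+w. \<integral>\<^sup>+u. ennreal (absk z (u * w) * schur_fun d e (u * w)) \<partial>torus_measure \<partial>lborel)"
      by (rule nn_integral_torus_average) measurable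
    also have "\<dots> \<le> (\<integral>\<^sup>+w. ennreal kb * ((\<Prod>k\<in>UNIV. ennreal (f k (L k w))) * indicator U w) \<partial>lborel)"
    proof (rule nn_integral_mono_AE)
      show "AE w in lborel. (\<integral>\<^sup>+u. ennreal (absk z (u * w) * schur_fun d e (u * w)) \<partial>torus_measure)
          \<le> ennreal kb * ((\<Prod>k\<in>UNIV. ennreal (f k (L k w))) * indicator U w)"
        using AE_vec_nonzero
      proof eventually_elim
        case (elim w)
        have "(\<integral>\<^sup>+u. ennreal (absk z (u * w) * schur_fun d e (u * w)) \<partial>torus_measure) = (\<integral>\<^sup>+u. ennreal (absk z (u * w)) * ennreal (schur_fun d e w) \<partial>torus_measure)"
          using AE_torus
          by (intro nn_integral_cong_AE) (auto elim!: eventually_mono simp: absk_nonneg less_imp_le[OF schur_fun_pos] ennreal_mult)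
        also have "\<dots> = (\<integral>\<^sup>+u. ennreal (absk z (u * w)) \<partial>torus_measure) * ennreal (schur_fun d e w)"
          by (rule nn_integral_multc) measurable
        also have "\<dots> \<le> ennreal kb * ((\<Prod>k\<in>UNIV. ennreal (f k (L k w))) * indicator U w)"
        proof (cases "w \<in> V")
          case True
          have "(\<integral>\<^sup>+u. ennreal (absk z (u * w)) \<partial>torus_measure) * ennreal (schur_fun d e w)
            \<le> ennreal (kb * exp (\<Sum>k\<in>UNIV. (1 - h k) * (L k z + L k w) / N) * (\<Prod>k\<in>UNIV. 1 / (1 - exp (2 * (L k z + L k w))))) * ennreal (schur_fun d e w)"
            by (intro mult_right_mono absk_torus_average z True) simp
          also have "\<dots> = ennreal (kb * (\<Prod>k\<in>UNIV. f k (L k w)))"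
          proof -
            have sw: "schur_fun d e w = (\<Prod>k\<in>UNIV. exp (- d k * L k w / N) * (1 - exp (2 * L k w)) powr (- e))"
              using True by (simp add: schur_fun_def)
            have "kb * exp (\<Sum>k\<in>UNIV. (1 - h k) * (L k z + L k w) / N) * (\<Prod>k\<in>UNIV. 1 / (1 - exp (2 * (L k z + L k w)))) * schur_fun d e w
              = kb * (\<Prod>k\<in>UNIV. f k (L k w))"
              by (simp only: f_def prod.distrib sw exp_sum[OF finite_class.finite_UNIV] mult.assoc)
            then show ?thesis
              by (simp only: ennreal_mult''[OF less_imp_le[OF schur_fun_pos], symmetric])
          qed
          also have "\<dots> = ennreal kb * ((\<Prod>k\<in>UNIV. ennreal (f k (L k w))) * indicator U w)"
            using True L_neg[OF True] by (simp add: ennreal_mult kb_nonneg prod_nonneg fnn prod_ennreal V_def)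
          finally show ?thesis .
        next
          case False
          have "(\<integral>\<^sup>+u. ennreal (absk z (u * w)) \<partial>torus_measure) = (\<integral>\<^sup>+u. 0 \<partial>(torus_measure :: (complex^'n) measure))"
            using AE_torus False by (intro nn_integral_cong_AE) (auto elim!: eventually_mono simp: absk_def)
          then show ?thesis by simp
        qed
        finally show ?case .
      qed
    qed
    also have "\<dots> = ennreal kb * (\<integral>\<^sup>+w. (\<Prod>k\<in>UNIV. ennreal (f k (L k w))) * indicator U w \<partial>lborel)"
      unfolding f_def by (rule nn_integral_cmult) measurable
    also have "(\<integral>\<^sup>+w. (\<Prod>k\<in>UNIV. ennreal (f k (L k w))) * indicator U w \<partial>lborel)
      = rc * (\<Prod>k\<in>UNIV. \<integral>\<^sup>+y. ennreal (f k y) * ennreal (exp (2 * h k / N * y)) * indicator {..<0} y \<partial>lborel)"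
      by (rule nn_integral_U_prod) (simp add: f_def)
    also have "ennreal kb * (rc * (\<Prod>k\<in>UNIV. \<integral>\<^sup>+y. ennreal (f k y) * ennreal (exp (2 * h k / N * y)) * indicator {..<0} y \<partial>lborel))
      \<le> ennreal kb * (ennreal rc * (\<Prod>k\<in>UNIV. ennreal (C k * (exp (- d k * L k z / N) * (1 - exp (2 * L k z)) powr (- e)))))"
    proof (intro mult_left_mono prod_mono_ennreal)
      fix k
      have "(\<integral>\<^sup>+y. ennreal (f k y) * ennreal (exp (2 * h k / N * y)) * indicator {..<0} y \<partial>lborel)
        = (\<integral>\<^sup>+y. ennreal (exp ((1 - h k) * L k z / N)) * (ennreal (exp ((h k + 1 - d k) / N * y) * (1 - exp (2 * y)) powr (- e) / (1 - exp (2 * (L k z + y)))) * indicator {..<0} y) \<partial>lborel)"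
      proof (rule nn_integral_cong)
        fix y :: real
        have "exp ((1 - h k) * (L k z + y) / N) * exp (- d k * y / N) * exp (2 * h k / N * y) = exp ((1 - h k) * L k z / N) * exp ((h k + 1 - d k) / N * y)"
          using N_pos by (simp add: exp_add[symmetric] field_simps)
        then have "f k y * exp (2 * h k / N * y) = exp ((1 - h k) * L k z / N) * (exp ((h k + 1 - d k) / N * y) * (1 - exp (2 * y)) powr (- e) / (1 - exp (2 * (L k z + y))))"
          by (simp add: f_def mult_ac)
        then show "ennreal (f k y) * ennreal (exp (2 * h k / N * y)) * indicator {..<0} y
          = ennreal (exp ((1 - h k) * L k z / N)) * (ennreal (exp ((h k + 1 - d k) / N * y) * (1 - exp (2 * y)) powr (- e) / (1 - exp (2 * (L k z + y)))) * indicator {..<0} y)"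
          using fnn[of y k] L_neg[OF z, of k] by (auto simp: indicator_def simp flip: ennreal_mult')
      qed
      also have "\<dots> = ennreal (exp ((1 - h k) * L k z / N)) * (\<integral>\<^sup>+y. ennreal (exp ((h k + 1 - d k) / N * y) * (1 - exp (2 * y)) powr (- e) / (1 - exp (2 * (L k z + y)))) * indicator {..<0} y \<partial>lborel)"
        by (rule nn_integral_cmult) measurable
      also have "\<dots> \<le> ennreal (exp (- d k * L k z / N)) * ennreal (C k * (1 - exp (2 * L k z)) powr (- e))"
      proof (intro mult_mono C(2) L_neg[OF z] ennreal_leI)
        have "(1 - h k) * L k z \<le> - d k * L k z"
          using d(1)[of k] L_neg[OF z, of k] by (intro mult_right_mono_neg) auto
        then show "exp ((1 - h k) * L k z / N) \<le> exp (- d k * L k z / N)"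
          unfolding exp_le_cancel_iff using N_pos by (intro divide_right_mono) auto
      qed auto
      also have "\<dots> = ennreal (C k * (exp (- d k * L k z / N) * (1 - exp (2 * L k z)) powr (- e)))"
        using C(1)[of k] by (simp add: mult_ac flip: ennreal_mult')
      finally show "(\<integral>\<^sup>+y. ennreal (f k y) * ennreal (exp (2 * h k / N * y)) * indicator {..<0} y \<partial>lborel)
         \<le> ennreal (C k * (exp (- d k * L k z / N) * (1 - exp (2 * L k z)) powr (- e)))" .
    qed auto
    also have "\<dots> = ennreal (kb * rc * (\<Prod>k\<in>UNIV. C k) * schur_fun d e z)"
    proof -
      have "(\<Prod>k\<in>UNIV. ennreal (C k * (exp (- d k * L k z / N) * (1 - exp (2 * L k z)) powr (- e))))
        = ennreal ((\<Prod>k\<in>UNIV. C k) * schur_fun d e z)"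
        using z C(1) by (subst prod_ennreal) (auto simp: less_imp_le prod.distrib schur_fun_def)
      then show ?thesis
        using kb_nonneg rc(1) C(1) by (simp add: mult.assoc ennreal_mult' prod_nonneg less_imp_le)
    qed
    also have "\<dots> \<le> ennreal (A * schur_fun d e z)"
      unfolding A_def using rc(1) C(1) schur_fun_pos[of d e z]
      by (intro ennreal_leI mult_right_mono) (auto simp: less_imp_le prod_nonneg)
    finally show ?thesis .
  qed
  ultimately show ?thesis by blast
qed

lemma in_Lp_rep:
  assumes "rep U f f'" and "p > 0"
  shows "in_Lp U p f \<longleftrightarrow> (\<integral>\<^sup>+w. ennreal (cmod (f' w) powr p) \<partial>lborel) < \<infinity>"
    and "Lp_norm U p f = enn2real (\<integral>\<^sup>+w. ennreal (cmod (f' w) powr p) \<partial>lborel) powr (1 / p)"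
  using rep_nn_integral_powr[OF assms(1) borel_U assms(2)] rep_measurable_lebesgue_on[OF borel_U assms(1)]
  by (auto simp: in_Lp_def Lp_norm_def)

lemma bergman_proj_orthogonal:
  assumes f: "rep U f f'" and proj: "is_bergman_proj U f g" and k: "in_A2 U k"
  shows "(\<integral>w. (f' w - indicator U w *\<^sub>R g w) * cnj (indicator U w *\<^sub>R k w) \<partial>lborel) = 0"
  using rep_integral[OF f rep_holomorphic rep_holomorphic borel_U, of g k] proj k
  by (auto simp: is_bergman_proj_def in_A2_def)

text \<open>The estimate is needed for the test function raised to both conjugate exponents, that
  is, \<open>h k - 1 \<le> d k * s < h k + 1\<close> for \<open>s = p\<close> and
  \<open>s = q\<close>. The least \<open>d k\<close> meeting the lower bounds leaves the requirement
  that \<open>h k - 1\<close> times \<open>max p q / min p q\<close> be below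
  \<open>h k + 1\<close>. This ratio is \<open>p - 1\<close> or \<open>1 / (p - 1)\<close>, and the
  two cases are the two hypotheses on \<open>p\<close>.\<close>

theorem bergman_bounded:
  fixes p :: real
  assumes p: "p > 1" and hp: "\<And>k. p * (h k - 1) < 2 * h k" "\<And>k. 2 * h k < p * (h k + 1)"
  shows "bergman_Lp_bounded U p"
proof -
  define q where "q = p / (p - 1)"
  have q: "q > 1" "1 / p + 1 / q = 1" using p by (auto simp: q_def field_simps)
  define d where "d k = (h k - 1) / min p q" for k
  \<comment> \<open>Any \<open>e\<close> with \<open>e * p\<close> and \<open>e * q\<close> strictly
    between 0 and 1 would do.\<close>
  define e where "e = 1 / (2 * max p q)"
  have cond: "h k - 1 \<le> d k * s" "d k * s < h k + 1" "0 < e * s" "e * s < 1" if s: "s = p \<or> s = q" for s :: real and k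
  proof -
    have h1: "real_of_int (h k) - 1 \<ge> 0" using h_pos[of k] by simp
    have mn: "min p q > 0" using p q by simp
    have "s \<ge> min p q" using s by auto
    then have "(real_of_int (h k) - 1) * 1 \<le> (real_of_int (h k) - 1) * (s / min p q)" using h1 mn by (intro mult_left_mono) auto
    then show "h k - 1 \<le> d k * s" by (simp add: d_def)
    show "0 < e * s" using s p q by (auto simp: e_def)
    show "e * s < 1" using s p q by (auto simp: e_def field_simps max_def)
    show "d k * s < h k + 1"
    proof (cases "s = min p q")
      case True
      have "min p q \<noteq> 0" using mn by linarith
      then have "d k * s = h k - 1" unfolding True d_def by simp
      then show ?thesis by simp
    next
      case False
      show ?thesis
      proof (cases "p \<le> q")
        case True
        then have "s = q" "min p q = p" using False s by auto
        then have "d k * s = (h k - 1) * (q / p)" by (simp add: d_def)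
        moreover have "q / p = 1 / (p - 1)" using p by (simp add: q_def)
        ultimately have "d k * s = (h k - 1) * (1 / (p - 1))" by (simp only:)
        also have "\<dots> < h k + 1" using p hp(2)[of k] by (simp add: field_simps)
        finally show ?thesis .
      next
        case F: False
        then have "s = p" "min p q = q" using False s by auto
        then have "d k * s = (h k - 1) * (p / q)" by (simp add: d_def)
        moreover have "p / q = p - 1" using p by (simp add: q_def)
        ultimately have "d k * s = (h k - 1) * (p - 1)" by (simp only:)
        also have "\<dots> < h k + 1" using p hp(1)[of k] by (simp add: algebra_simps)
        finally show ?thesis .
      qed
    qed
  qed
  define \<phi> where "\<phi> = schur_fun d e"
  obtain A1 where A1: "A1 > 0" "\<And>z. (\<integral>\<^sup>+w. ennreal (absk z w * \<phi> w powr q) \<partial>lborel) \<le> ennreal (A1 * \<phi> z powr q)"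
    using schur_estimate[of "\<lambda>k. d k * q" "e * q"] cond[of q] unfolding \<phi>_def schur_fun_powr by blast
  obtain A2 where A2: "A2 > 0" "\<And>z. (\<integral>\<^sup>+w. ennreal (absk z w * \<phi> w powr p) \<partial>lborel) \<le> ennreal (A2 * \<phi> z powr p)"
    using schur_estimate[of "\<lambda>k. d k * p" "e * p"] cond[of p] unfolding \<phi>_def schur_fun_powr by blast
  define A where "A = max A1 A2"
  have A: "A > 0" using A1 by (simp add: A_def)
  have B1: "(\<integral>\<^sup>+w. ennreal (absk z w * \<phi> w powr q) \<partial>lborel) \<le> ennreal (A * \<phi> z powr q)" for z
    by (rule order_trans[OF A1(2)]) (auto simp: A_def intro!: ennreal_leI mult_right_mono)
  have B2: "(\<integral>\<^sup>+z. ennreal (absk z w * \<phi> z powr p) \<partial>lborel) \<le> ennreal (A * \<phi> w powr p)" for w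
    unfolding absk_sym[of _ w]
    by (rule order_trans[OF A2(2)]) (auto simp: A_def intro!: ennreal_leI mult_right_mono)
  have [measurable]: "\<phi> \<in> borel_measurable borel" by (simp add: \<phi>_def)
  show ?thesis
    unfolding bergman_Lp_bounded_def
  proof (intro exI[of _ A] conjI allI impI A)
    fix f g assume f2: "in_Lp U 2 f" and fp: "in_Lp U p f" and proj: "is_bergman_proj U f g"
    obtain f' where f': "rep U f f'" using rep_exists[OF borel_U] f2 by (auto simp: in_Lp_def)
    define g' where "g' = (\<lambda>w. indicator U w *\<^sub>R g w)"
    have gA: "in_A2 U g" using proj by (simp add: is_bergman_proj_def)
    then have g': "rep U g g'" unfolding g'_def by (intro rep_holomorphic) (simp add: in_A2_def)
    have [measurable]: "f' \<in> borel_measurable borel" "g' \<in> borel_measurable borel" using f' g' by (auto simp: rep_def)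
    have sf: "square_integrable f'" using f2 rep_in_L2[OF f' borel_U] by simp
    have "AE z in lborel. z \<in> U \<longrightarrow> g z = (\<integral>w. kern (cp z w) * f' w \<partial>lborel)"
    proof (rule bergman_representation[OF sf _ gA])
      show "f' w = 0" if "w \<notin> U" for w using f' that by (simp add: rep_def)
      show "(\<integral>w. (f' w - indicator U w *\<^sub>R g w) * cnj (indicator U w *\<^sub>R mon a w) \<partial>lborel) = 0" if "adm a" for a
        by (rule bergman_proj_orthogonal[OF f' proj in_A2_mon[OF that]])
    qed
    then have gK: "AE z in lborel. ennreal (cmod (g' z)) \<le> (\<integral>\<^sup>+w. ennreal (absk z w * cmod (f' w)) \<partial>lborel)"
      using AE_vec_nonzero
    proof eventually_elim
      case (elim z)
      show ?case
      proof (cases "z \<in> U")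
        case True
        then have z: "z \<in> V" using elim by (simp add: V_def)
        have "ennreal (cmod (g' z)) = ennreal (cmod (\<integral>w. kern (cp z w) * f' w \<partial>lborel))" using elim True by (simp add: g'_def)
        \<comment> \<open>If the integrand is not integrable, its integral is 0 by convention and
          the bound holds as well.\<close>
        also have "\<dots> \<le> (\<integral>\<^sup>+w. ennreal (cmod (kern (cp z w) * f' w)) \<partial>lborel)"
          by (cases "integrable lborel (\<lambda>w. kern (cp z w) * f' w)") (auto simp: integral_norm_bound_ennreal not_integrable_integral_eq)
        also have "\<dots> \<le> (\<integral>\<^sup>+w. ennreal (absk z w * cmod (f' w)) \<partial>lborel)"
        proof (rule nn_integral_mono_AE)
          show "AE w in lborel. ennreal (cmod (kern (cp z w) * f' w)) \<le> ennreal (absk z w * cmod (f' w))"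
            using AE_vec_nonzero
          proof eventually_elim
            case (elim w)
            show ?case
            proof (cases "w \<in> U")
              case True
              then have "w \<in> V" using elim by (simp add: V_def)
              from norm_kern_le_absk[OF z this] show ?thesis by (simp add: norm_mult ennreal_leI mult_right_mono)
            next
              case False
              then show ?thesis using f' by (simp add: rep_def)
            qed
          qed
        qed
        finally show ?thesis .
      qed (simp add: g'_def)
    qed
    have "(\<integral>\<^sup>+z. ennreal (cmod (g' z) powr p) \<partial>lborel) \<le> ennreal (A powr p) * (\<integral>\<^sup>+w. ennreal (cmod (f' w) powr p) \<partial>lborel)"
      using p q A B1 B2 gK
      by (intro schur_test[of p q absk \<phi> "\<lambda>w. cmod (f' w)" "\<lambda>z. cmod (g' z)" A])
         (auto simp: absk_nonneg \<phi>_def schur_fun_pos)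
    moreover have fin: "(\<integral>\<^sup>+w. ennreal (cmod (f' w) powr p) \<partial>lborel) < \<infinity>"
      using fp in_Lp_rep(1)[OF f'] p by simp
    ultimately have le: "(\<integral>\<^sup>+z. ennreal (cmod (g' z) powr p) \<partial>lborel) \<le> ennreal (A powr p) * (\<integral>\<^sup>+w. ennreal (cmod (f' w) powr p) \<partial>lborel)"
      by simp
    also have lt: "\<dots> < \<infinity>" using fin by (simp add: ennreal_mult_less_top)
    finally show "in_Lp U p g" using in_Lp_rep(1)[OF g'] p by simp
    have "enn2real (\<integral>\<^sup>+z. ennreal (cmod (g' z) powr p) \<partial>lborel) \<le> enn2real (ennreal (A powr p) * (\<integral>\<^sup>+w. ennreal (cmod (f' w) powr p) \<partial>lborel))"
      using le lt by (intro enn2real_mono) auto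
    also have "\<dots> = A powr p * enn2real (\<integral>\<^sup>+w. ennreal (cmod (f' w) powr p) \<partial>lborel)"
      by (simp add: enn2real_mult)
    finally have "Lp_norm U p g \<le> (A powr p * enn2real (\<integral>\<^sup>+w. ennreal (cmod (f' w) powr p) \<partial>lborel)) powr (1 / p)"
      unfolding in_Lp_rep(2)[OF g' order_less_trans[OF zero_less_one p]] using p by (intro powr_mono2) auto
    also have "\<dots> = A * Lp_norm U p f"
      unfolding in_Lp_rep(2)[OF f' order_less_trans[OF zero_less_one p]] using p A by (simp add: powr_mult powr_powr)
    finally show "Lp_norm U p g \<le> A * Lp_norm U p f" .
  qed
qed

end

subsection \<open>Failure of boundedness outside the range\<close>

lemma holomorphic_n_compose:
  assumes g: "holomorphic_n g S" and f: "\<And>z. z \<in> S \<Longrightarrow> f field_differentiable (at (g z))"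
  shows "holomorphic_n (\<lambda>z. f (g z)) S"
  unfolding holomorphic_n_def
proof
  fix z assume z: "z \<in> S"
  obtain L where L: "(g has_derivative L) (at z)" "\<And>c v. L (cscale c v) = c * L v"
    using g z unfolding holomorphic_n_def by metis
  obtain f' where f': "(f has_field_derivative f') (at (g z))"
    using f[OF z] unfolding field_differentiable_def by blast
  have "((\<lambda>z. f (g z)) has_derivative (\<lambda>v. f' * L v)) (at z)"
    using has_derivative_compose[OF L(1) f'[unfolded has_field_derivative_def]] .
  then show "\<exists>L. ((\<lambda>z. f (g z)) has_derivative L) (at z) \<and> (\<forall>c v. L (cscale c v) = c * L v)"
    by (intro exI[of _ "\<lambda>v. f' * L v"]) (simp add: L(2))
qed

context monomial_domain
begin

lemma emeasure_U: "emeasure lborel U < \<infinity>" "emeasure lborel U > 0"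
proof -
  have "emeasure lborel U = ennreal (rc * (\<Prod>k\<in>UNIV. N / (2 * real_of_int (h k))))"
    using nn_integral_U_exp[of "\<lambda>_. 0"] h_pos by (simp add: order_less_le_trans[OF zero_less_one])
  moreover have "rc * (\<Prod>k\<in>UNIV. N / (2 * real_of_int (h k))) > 0"
    using rc(1) N_pos h_pos by (intro mult_pos_pos prod_pos ballI) (auto simp: order_less_le_trans[OF zero_less_one])
  ultimately show "emeasure lborel U < \<infinity>" "emeasure lborel U > 0" by simp_all
qed

definition IU :: "(complex^'n \<Rightarrow> complex) \<Rightarrow> complex" where
  "IU F = (\<integral>w. indicator U w *\<^sub>R F w \<partial>lborel)"

lemma IU_cong: "(\<And>w. w \<in> U \<Longrightarrow> F w = H w) \<Longrightarrow> IU F = IU H"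
  unfolding IU_def by (intro Bochner_Integration.integral_cong) (auto simp: indicator_def)

lemma integrable_U_bounded:
  fixes F :: "complex^'n \<Rightarrow> 'b::{banach, second_countable_topology}"
  assumes [measurable]: "F \<in> borel_measurable borel" and B: "\<And>w. w \<in> U \<Longrightarrow> norm (F w) \<le> B"
  shows "integrable lborel (\<lambda>w. indicator U w *\<^sub>R F w)"
proof (rule integrableI_bounded)
  have "(\<integral>\<^sup>+w. ennreal (norm (indicator U w *\<^sub>R F w)) \<partial>lborel) \<le> (\<integral>\<^sup>+w. ennreal B * indicator U w \<partial>lborel)"
    using B by (intro nn_integral_mono) (auto simp: indicator_def ennreal_leI)
  also have "\<dots> < \<infinity>" using emeasure_U by (simp add: nn_integral_cmult ennreal_mult_less_top)
  finally show "(\<integral>\<^sup>+w. ennreal (norm (indicator U w *\<^sub>R F w)) \<partial>lborel) < \<infinity>" .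
qed measurable

lemma square_integrable_U_bounded:
  assumes [measurable]: "F \<in> borel_measurable borel" and B: "\<And>w. w \<in> U \<Longrightarrow> cmod (F w) \<le> B"
  shows "square_integrable (\<lambda>w. indicator U w *\<^sub>R F w)"
proof -
  have "(\<integral>\<^sup>+w. ennreal ((cmod (indicator U w *\<^sub>R F w))\<^sup>2) \<partial>lborel) \<le> (\<integral>\<^sup>+w. ennreal (B\<^sup>2) * indicator U w \<partial>lborel)"
    using B by (intro nn_integral_mono) (auto simp: indicator_def ennreal_leI intro!: power_mono)
  also have "\<dots> < \<infinity>" using emeasure_U by (simp add: nn_integral_cmult ennreal_mult_less_top)
  finally show ?thesis by (simp add: square_integrable_def)
qed

lemma rep_indicator: "F \<in> borel_measurable borel \<Longrightarrow> rep U F (\<lambda>w. indicator U w *\<^sub>R F w)"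
  by (auto simp: rep_def)

lemma in_Lp_U_bounded:
  assumes [measurable]: "F \<in> borel_measurable borel" and B: "\<And>w. w \<in> U \<Longrightarrow> cmod (F w) \<le> B" and p: "p > 0"
  shows "in_Lp U p F"
proof -
  have "(\<integral>\<^sup>+w. ennreal (cmod (indicator U w *\<^sub>R F w) powr p) \<partial>lborel) \<le> (\<integral>\<^sup>+w. ennreal (B powr p) * indicator U w \<partial>lborel)"
    using B p by (intro nn_integral_mono) (auto simp: indicator_def ennreal_leI intro!: powr_mono2)
  also have "\<dots> < \<infinity>" using emeasure_U by (simp add: nn_integral_cmult ennreal_mult_less_top)
  finally show ?thesis using in_Lp_rep(1)[OF rep_indicator p, of F] by simp
qed

lemma is_bergman_projI:
  assumes g: "in_A2 U g" and f: "rep U f f'"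
    and eq: "\<And>k. in_A2 U k \<Longrightarrow> (\<integral>w. (f' w - indicator U w *\<^sub>R g w) * cnj (indicator U w *\<^sub>R k w) \<partial>lborel) = 0"
  shows "is_bergman_proj U f g"
  using rep_integral[OF f rep_holomorphic rep_holomorphic borel_U, of g] g eq
  by (auto simp: is_bergman_proj_def in_A2_def)

lemma in_A2_sum:
  assumes "finite I" and g: "\<And>i. i \<in> I \<Longrightarrow> in_A2 U (g i)"
  shows "in_A2 U (\<lambda>z. \<Sum>i\<in>I. c i * g i z)"
proof -
  have hol: "holomorphic_n (\<lambda>z. \<Sum>i\<in>I. c i * g i z) U"
    using g by (intro holomorphic_n_sum) (auto simp: in_A2_def)
  have sq: "square_integrable (\<lambda>w. indicator U w *\<^sub>R (\<Sum>i\<in>I. c i * g i w))"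
    using assms
  proof (induction I)
    case empty
    then show ?case by (simp add: square_integrable_def)
  next
    case (insert j I)
    define K :: real where "K = 2"
    have K: "K \<ge> 0" by (simp add: K_def)
    let ?F = "\<lambda>w. indicator U w *\<^sub>R (\<Sum>i\<in>I. c i * g i w)"
    let ?G = "\<lambda>w. indicator U w *\<^sub>R g j w"
    have F: "square_integrable ?F" and G: "square_integrable ?G"
      using insert in_A2_square_integrable[of "g j"] by auto
    have [measurable]: "?F \<in> borel_measurable borel" "?G \<in> borel_measurable borel"
      using F G by (auto simp: square_integrable_def)
    have "(\<integral>\<^sup>+w. ennreal ((cmod (c j * ?G w + ?F w))\<^sup>2) \<partial>lborel)
       \<le> (\<integral>\<^sup>+w. ennreal (K * (cmod (c j))\<^sup>2) * ennreal ((cmod (?G w))\<^sup>2) + ennreal K * ennreal ((cmod (?F w))\<^sup>2) \<partial>lborel)"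
    proof (rule nn_integral_mono)
      fix w
      have "(cmod (c j * ?G w + ?F w))\<^sup>2 \<le> (cmod (c j * ?G w) + cmod (?F w))\<^sup>2"
        by (intro power_mono norm_triangle_ineq) auto
      also have "\<dots> \<le> 2 * (cmod (c j * ?G w))\<^sup>2 + 2 * (cmod (?F w))\<^sup>2"
        using zero_le_power2[of "cmod (c j * ?G w) - cmod (?F w)"] by (simp add: power2_sum power2_diff)
      also have "\<dots> = (K * (cmod (c j))\<^sup>2) * (cmod (?G w))\<^sup>2 + K * (cmod (?F w))\<^sup>2"
        by (simp only: norm_mult power_mult_distrib mult.assoc K_def)
      finally show "ennreal ((cmod (c j * ?G w + ?F w))\<^sup>2) \<le> ennreal (K * (cmod (c j))\<^sup>2) * ennreal ((cmod (?G w))\<^sup>2) + ennreal K * ennreal ((cmod (?F w))\<^sup>2)"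
        by (simp only: ennreal_mult[symmetric] ennreal_plus[symmetric] K mult_nonneg_nonneg zero_le_power2 ennreal_leI)
    qed
    also have "\<dots> = ennreal (K * (cmod (c j))\<^sup>2) * (\<integral>\<^sup>+w. ennreal ((cmod (?G w))\<^sup>2) \<partial>lborel) + ennreal K * (\<integral>\<^sup>+w. ennreal ((cmod (?F w))\<^sup>2) \<partial>lborel)"
      by (simp add: nn_integral_add nn_integral_cmult del: norm_scaleR)
    also have "\<dots> < \<infinity>" using F G unfolding square_integrable_def
      by (simp add: ennreal_mult_less_top del: norm_scaleR)
    finally have lt: "(\<integral>\<^sup>+w. ennreal ((cmod (c j * ?G w + ?F w))\<^sup>2) \<partial>lborel) < \<infinity>" .
    have "(\<lambda>w. c j * ?G w + ?F w) \<in> borel_measurable borel" by measurable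
    then have "square_integrable (\<lambda>w. c j * ?G w + ?F w)"
      unfolding square_integrable_def using lt by blast
    then show ?case using insert by (simp add: scaleR_add_right)
  qed
  show ?thesis using hol rep_in_L2[OF rep_holomorphic[OF hol] borel_U] sq by (simp add: in_A2_def)
qed

lemma in_A2_cmult: "in_A2 U g \<Longrightarrow> in_A2 U (\<lambda>z. c * g z)"
  using in_A2_sum[of "{()}" "\<lambda>_. g" "\<lambda>_. c"] by simp

text \<open>Both \<open>\<psi> * mon a\<close> and \<open>d * mon a\<close> pair with
  \<open>k\<close> to the conjugate of its coefficient at \<open>a\<close> times the integral of
  \<open>\<psi> * |mon a|^2\<close>. If \<open>a\<close> is not admissible, that coefficient is 0,
  whence the default \<open>d = 0\<close>. Integrability is recorded so that such identities can be
  added up.\<close>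

lemma pairing_radial_mon:
  assumes k: "in_A2 U k" and [measurable]: "\<psi> \<in> borel_measurable borel"
    and \<psi>: "\<And>u w. u \<in> torus \<Longrightarrow> \<psi> (u * w) = \<psi> w"
    and B: "\<And>w. w \<in> U \<Longrightarrow> \<forall>j. w$j \<noteq> 0 \<Longrightarrow> cmod (complex_of_real (\<psi> w) * mon a w) \<le> B"
  defines "d \<equiv> (if adm a then (\<integral>w. indicator U w * (\<psi> w * (cmod (mon a w))\<^sup>2) \<partial>lborel) / msq a else 0)"
  shows "(\<integral>w. (indicator U w *\<^sub>R (complex_of_real (\<psi> w) * mon a w) - indicator U w *\<^sub>R (complex_of_real d * mon a w)) * cnj (indicator U w *\<^sub>R k w) \<partial>lborel) = 0"
    and "integrable lborel (\<lambda>w. (indicator U w *\<^sub>R (complex_of_real (\<psi> w) * mon a w) - indicator U w *\<^sub>R (complex_of_real d * mon a w)) * cnj (indicator U w *\<^sub>R k w))"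
proof -
  define k' where "k' = (\<lambda>w. indicator U w *\<^sub>R k w)"
  have sk: "square_integrable k'" unfolding k'_def by (rule in_A2_square_integrable[OF k])
  then have [measurable]: "k' \<in> borel_measurable borel" by (simp add: square_integrable_def)
  \<comment> \<open>The bound \<open>B\<close> is available only off the coordinate hyperplanes, so
    the product is set to 0 on them.\<close>
  define b where "b = (\<lambda>w. if \<forall>j. w$j \<noteq> 0 then complex_of_real (\<psi> w) * mon a w else 0)"
  have [measurable]: "b \<in> borel_measurable borel" unfolding b_def by measurable
  have "square_integrable (\<lambda>w. indicator U w *\<^sub>R b w)"
  proof (rule square_integrable_U_bounded)
    show "cmod (b w) \<le> max B 0" if w: "w \<in> U" for w
    proof (cases "\<forall>j. w$j \<noteq> 0")
      case True
      show ?thesis unfolding b_def if_P[OF True] by (rule max.coboundedI1[OF B[OF w True]])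
    next
      case False
      show ?thesis unfolding b_def if_not_P[OF False] by simp
    qed
  qed measurable
  then have s1: "square_integrable (\<lambda>w. indicator U w *\<^sub>R (complex_of_real (\<psi> w) * mon a w))"
    by (rule square_integrable_bound[of _ _ 1]) (measurable, use AE_vec_nonzero in \<open>eventually_elim; simp add: b_def\<close>)
  obtain c where c: "\<And>a w. w \<in> U \<Longrightarrow> (\<forall>j. w$j \<noteq> 0) \<Longrightarrow> (\<integral>u. k' (u * w) * mon (\<lambda>j. - a j) u \<partial>torus_measure) = c a * mon a w"
    "\<And>a. \<not> adm a \<Longrightarrow> c a = 0"
    "\<And>a. adm a \<Longrightarrow> (\<integral>w. (indicator U w *\<^sub>R mon a w) * cnj (k' w) \<partial>lborel) = cnj (c a) * msq a"
    unfolding k'_def by (rule laurent_coefficients[OF k]) blast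
  have i1: "integrable lborel (\<lambda>w. (indicator U w *\<^sub>R (complex_of_real (\<psi> w) * mon a w)) * cnj (k' w))"
    by (intro square_integrable_mult s1 square_integrable_cnj sk)
  have e1: "(\<integral>w. (indicator U w *\<^sub>R (complex_of_real (\<psi> w) * mon a w)) * cnj (k' w) \<partial>lborel) = cnj (c a) * complex_of_real (\<integral>w. indicator U w * (\<psi> w * (cmod (mon a w))\<^sup>2) \<partial>lborel)"
    using radial_pairing[of k' \<psi> a "c a"] c(1) \<psi> i1 by simp
  have i2: "integrable lborel (\<lambda>w. (indicator U w *\<^sub>R (complex_of_real d * mon a w)) * cnj (k' w))"
  proof (cases "adm a")
    case True
    have "integrable lborel (\<lambda>w. complex_of_real d * ((indicator U w *\<^sub>R mon a w) * cnj (k' w)))"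
      by (intro integrable_mult_right square_integrable_mult square_integrable_mon True square_integrable_cnj sk)
    then show ?thesis by (simp add: mult_ac)
  qed (simp add: d_def)
  have e2: "(\<integral>w. (indicator U w *\<^sub>R (complex_of_real d * mon a w)) * cnj (k' w) \<partial>lborel) = cnj (c a) * complex_of_real (\<integral>w. indicator U w * (\<psi> w * (cmod (mon a w))\<^sup>2) \<partial>lborel)"
  proof (cases "adm a")
    case True
    have "(\<integral>w. (indicator U w *\<^sub>R (complex_of_real d * mon a w)) * cnj (k' w) \<partial>lborel) = (\<integral>w. complex_of_real d * ((indicator U w *\<^sub>R mon a w) * cnj (k' w)) \<partial>lborel)"
      by (simp add: mult_ac)
    also have "\<dots> = complex_of_real d * (cnj (c a) * msq a)"
      by (simp only: Bochner_Integration.integral_mult_right_zero c(3)[OF True])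
    also have "complex_of_real d * complex_of_real (msq a) = complex_of_real (\<integral>w. indicator U w * (\<psi> w * (cmod (mon a w))\<^sup>2) \<partial>lborel)"
      using True msq_pos[OF True] by (simp add: d_def)
    then have "complex_of_real d * (cnj (c a) * msq a) = cnj (c a) * complex_of_real (\<integral>w. indicator U w * (\<psi> w * (cmod (mon a w))\<^sup>2) \<partial>lborel)"
      by (simp add: mult_ac)
    finally show ?thesis .
  next
    case False
    then show ?thesis using c(2)[OF False] by (simp add: d_def)
  qed
  have eq: "(indicator U w *\<^sub>R (complex_of_real (\<psi> w) * mon a w) - indicator U w *\<^sub>R (complex_of_real d * mon a w)) * cnj (indicator U w *\<^sub>R k w)
    = (indicator U w *\<^sub>R (complex_of_real (\<psi> w) * mon a w)) * cnj (k' w) - (indicator U w *\<^sub>R (complex_of_real d * mon a w)) * cnj (k' w)" for w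
    by (simp only: left_diff_distrib k'_def)
  show "(\<integral>w. (indicator U w *\<^sub>R (complex_of_real (\<psi> w) * mon a w) - indicator U w *\<^sub>R (complex_of_real d * mon a w)) * cnj (indicator U w *\<^sub>R k w) \<partial>lborel) = 0"
    unfolding eq Bochner_Integration.integral_diff[OF i1 i2] e1 e2 by simp
  show "integrable lborel (\<lambda>w. (indicator U w *\<^sub>R (complex_of_real (\<psi> w) * mon a w) - indicator U w *\<^sub>R (complex_of_real d * mon a w)) * cnj (indicator U w *\<^sub>R k w))"
    unfolding eq by (intro Bochner_Integration.integrable_diff i1 i2)
qed

lemma radial_mon_projection:
  assumes a: "adm a" and [measurable]: "\<psi> \<in> borel_measurable borel"
    and \<psi>: "\<And>u w. u \<in> torus \<Longrightarrow> \<psi> (u * w) = \<psi> w"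
    and B: "\<And>w. w \<in> U \<Longrightarrow> \<forall>j. w$j \<noteq> 0 \<Longrightarrow> cmod (complex_of_real (\<psi> w) * mon a w) \<le> B"
  shows "is_bergman_proj U (\<lambda>w. complex_of_real (\<psi> w) * mon a w)
    (\<lambda>w. complex_of_real ((\<integral>w. indicator U w * (\<psi> w * (cmod (mon a w))\<^sup>2) \<partial>lborel) / msq a) * mon a w)"
proof (rule is_bergman_projI[OF in_A2_cmult[OF in_A2_mon[OF a]] rep_indicator])
  fix k assume k: "in_A2 U k"
  show "(\<integral>w. (indicator U w *\<^sub>R (complex_of_real (\<psi> w) * mon a w)
      - indicator U w *\<^sub>R (complex_of_real ((\<integral>w. indicator U w * (\<psi> w * (cmod (mon a w))\<^sup>2) \<partial>lborel) / msq a) * mon a w))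
      * cnj (indicator U w *\<^sub>R k w) \<partial>lborel) = 0"
    using pairing_radial_mon(1)[OF k assms(2) \<psi> B] unfolding if_P[OF a] .
qed measurable

lemma powr_norm_cmult_mon:
  assumes "d \<ge> 0" "p > 0"
  shows "(\<integral>\<^sup>+w. ennreal (cmod (indicator U w *\<^sub>R (complex_of_real d * mon a w)) powr p) \<partial>lborel)
    = ennreal (d powr p) * (\<integral>\<^sup>+w. ennreal (cmod (mon a w) powr p) * indicator U w \<partial>lborel)"
proof -
  have "(\<integral>\<^sup>+w. ennreal (cmod (indicator U w *\<^sub>R (complex_of_real d * mon a w)) powr p) \<partial>lborel)
      = (\<integral>\<^sup>+w. ennreal (d powr p) * (ennreal (cmod (mon a w) powr p) * indicator U w) \<partial>lborel)"
    using assms by (intro nn_integral_cong) (auto simp: indicator_def norm_mult powr_mult simp flip: ennreal_mult)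
  also have "\<dots> = ennreal (d powr p) * (\<integral>\<^sup>+w. ennreal (cmod (mon a w) powr p) * indicator U w \<partial>lborel)"
    by (rule nn_integral_cmult) measurable
  finally show ?thesis .
qed

text \<open>\<open>mon a / (1 + |mon a|)\<close> is bounded, hence in every relevant space since the
  polyhedron has finite measure, and its projection is a positive multiple of
  \<open>mon a\<close>.\<close>

lemma not_bounded_large_exponent:
  assumes a: "adm a" and p: "p > 0" and inf: "(\<integral>\<^sup>+w. ennreal (cmod (mon a w) powr p) * indicator U w \<partial>lborel) = \<infinity>"
  shows "\<not> bergman_Lp_bounded U p"
proof
  assume bd: "bergman_Lp_bounded U p"
  define \<psi> where "\<psi> w = 1 / (1 + cmod (mon a w))" for w
  define F where "F w = complex_of_real (\<psi> w) * mon a w" for w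
  define d where "d = (\<integral>w. indicator U w * (\<psi> w * (cmod (mon a w))\<^sup>2) \<partial>lborel) / msq a"
  have [measurable]: "\<psi> \<in> borel_measurable borel" unfolding \<psi>_def by measurable
  have [measurable]: "F \<in> borel_measurable borel" unfolding F_def by measurable
  have Fn: "cmod (F w) = \<psi> w * cmod (mon a w)" for w
  proof -
    have "\<psi> w \<ge> 0" by (simp add: \<psi>_def)
    then show ?thesis by (simp add: F_def norm_mult)
  qed
  have B: "cmod (F w) \<le> 1" for w
  proof -
    have "cmod (F w) = \<psi> w * cmod (mon a w)" by (rule Fn)
    also have "\<dots> = cmod (mon a w) / (1 + cmod (mon a w))" by (simp add: \<psi>_def)
    also have "\<dots> \<le> 1" by (subst divide_le_eq_1_pos) (auto intro: add_pos_nonneg)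
    finally show ?thesis .
  qed
  have d0: "d > 0"
  proof -
    define J where "J w = indicator U w * (\<psi> w * (cmod (mon a w))\<^sup>2)" for w
    have J0: "J w \<ge> 0" for w by (simp add: J_def \<psi>_def)
    have iJ: "integrable lborel J"
    proof -
      have "integrable lborel (\<lambda>w. norm ((indicator U w *\<^sub>R F w) * (indicator U w *\<^sub>R mon a w)))"
        by (intro integrable_norm square_integrable_mult square_integrable_U_bounded[of F 1] square_integrable_mon a B) measurable
      then show ?thesis
        by (rule Bochner_Integration.integrable_cong[THEN iffD1, rotated -1])
           (auto simp: J_def Fn norm_mult power2_eq_square indicator_def)
    qed
    have "(\<integral>w. J w \<partial>lborel) \<noteq> 0"
    proof
      assume "(\<integral>w. J w \<partial>lborel) = 0"
      then have "AE w in lborel. J w = 0"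
        using integral_nonneg_eq_0_iff_AE[OF iJ] J0 by simp
      then have "AE w in lborel. w \<notin> U"
        using AE_vec_nonzero
      proof eventually_elim
        case (elim w)
        have "\<psi> w > 0" by (simp add: \<psi>_def add_pos_nonneg)
        then show ?case using elim mon_eq_0_iff[of w a] by (auto simp: J_def)
      qed
      then have "emeasure lborel U = 0"
        using borel_U by (subst (asm) AE_iff_measurable[of U]) auto
      then show False using emeasure_U by simp
    qed
    then have "(\<integral>w. J w \<partial>lborel) > 0" using J0 by (simp add: order_less_le integral_nonneg)
    then show ?thesis using msq_pos[OF a] by (simp add: d_def J_def)
  qed
  have proj: "is_bergman_proj U F (\<lambda>w. complex_of_real d * mon a w)"
    unfolding F_def[abs_def] d_def
    by (rule radial_mon_projection[of _ _ 1]) (use a B in \<open>auto simp: F_def \<psi>_def mon_mult norm_mult norm_mon_torus\<close>)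
  have "in_Lp U p (\<lambda>w. complex_of_real d * mon a w)"
    using bd proj B p unfolding bergman_Lp_bounded_def
    by (metis (no_types, lifting) in_Lp_U_bounded[of F 1] \<open>F \<in> borel_measurable borel\<close> zero_less_numeral)
  then have "ennreal (d powr p) * (\<integral>\<^sup>+w. ennreal (cmod (mon a w) powr p) * indicator U w \<partial>lborel) < \<infinity>"
    using in_Lp_rep(1)[OF rep_indicator p, of "\<lambda>w. complex_of_real d * mon a w"] powr_norm_cmult_mon[of d p a] p d0
    by simp
  then show False using inf d0 by (simp add: ennreal_mult_top)
qed

text \<open>Testing on the truncations of \<open>mon a * |mon a| powr (q - 2)\<close> to \<open>|mon a| \<le> M\<close>.\<close>

lemma not_bounded_dual_exponent:
  assumes a: "adm a" and p: "p > 1" and q: "q = p / (p - 1)"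
    and inf: "(\<integral>\<^sup>+w. ennreal (cmod (mon a w) powr q) * indicator U w \<partial>lborel) = \<infinity>"
  shows "\<not> bergman_Lp_bounded U p"
proof
  assume "bergman_Lp_bounded U p"
  then obtain C where C: "C > 0" "\<And>f g. in_Lp U 2 f \<Longrightarrow> in_Lp U p f \<Longrightarrow> is_bergman_proj U f g \<Longrightarrow> in_Lp U p g \<and> Lp_norm U p g \<le> C * Lp_norm U p f"
    unfolding bergman_Lp_bounded_def by blast
  have p0: "p > 0" using p by simp
  \<comment> \<open>Because of \<open>(q - 1) * p = q\<close>, the \<open>p\<close>-th power of the
    test function and the integrand of its projection coefficient are the same truncation of
    \<open>|mon a| powr q\<close>, so both are measured by \<open>I M\<close>.\<close>
  have q1: "q > 1" "(q - 1) * p = q" using p by (auto simp: q field_simps)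
  define \<psi> where "\<psi> M w = (if cmod (mon a w) \<le> real M then cmod (mon a w) powr (q - 2) else 0)" for M w
  define F where "F M w = complex_of_real (\<psi> M w) * mon a w" for M w
  define J where "J M w = indicator U w * (if cmod (mon a w) \<le> real M then cmod (mon a w) powr q else 0)" for M w
  define I where "I M = (\<integral>w. J M w \<partial>lborel)" for M
  have [measurable]: "\<psi> M \<in> borel_measurable borel" for M unfolding \<psi>_def by measurable
  have [measurable]: "F M \<in> borel_measurable borel" for M unfolding F_def by measurable
  have [measurable]: "J M \<in> borel_measurable borel" for M unfolding J_def by measurable
  have Fn: "cmod (F M w) = (if cmod (mon a w) \<le> real M then cmod (mon a w) powr (q - 1) else 0)" for M w
  proof (cases "mon a w = 0")
    case False
    have "cmod (mon a w) powr (q - 2) * cmod (mon a w) = cmod (mon a w) powr (q - 2) * cmod (mon a w) powr 1" using False by simp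
    also have "\<dots> = cmod (mon a w) powr (q - 1)" by (simp only: powr_add[symmetric]) simp
    finally show ?thesis by (simp add: F_def \<psi>_def norm_mult)
  qed (simp add: F_def)
  have FB: "cmod (F M w) \<le> real M powr (q - 1)" for M w
    unfolding Fn using q1 by (auto intro!: powr_mono2)
  have JF: "ennreal (cmod (indicator U w *\<^sub>R F M w) powr p) = ennreal (J M w)" for M w
    using q1 p by (simp add: Fn J_def indicator_def powr_powr)
  have J0: "J M w \<ge> 0" for M w by (auto simp: J_def)
  have iJ: "integrable lborel (J M)" for M
  proof -
    have "integrable lborel (\<lambda>w. indicator U w *\<^sub>R (if cmod (mon a w) \<le> real M then cmod (mon a w) powr q else 0))"
      using q1 by (intro integrable_U_bounded[of _ "real M powr q"]) (auto intro!: powr_mono2)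
    moreover have "J M = (\<lambda>w. indicator U w *\<^sub>R (if cmod (mon a w) \<le> real M then cmod (mon a w) powr q else 0))"
      by (rule ext) (simp add: J_def)
    ultimately show ?thesis by simp
  qed
  have nJ: "(\<integral>\<^sup>+w. ennreal (J M w) \<partial>lborel) = ennreal (I M)" for M
    unfolding I_def by (rule nn_integral_eq_integral[OF iJ]) (simp add: J0)
  have I0: "I M \<ge> 0" for M unfolding I_def by (simp add: J0)
  define P where "P = (\<integral>\<^sup>+w. ennreal (cmod (mon a w) powr p) * indicator U w \<partial>lborel)"
  have proj: "is_bergman_proj U (F M) (\<lambda>w. complex_of_real (I M / msq a) * mon a w)" for M
  proof -
    have "(\<integral>w. indicator U w * (\<psi> M w * (cmod (mon a w))\<^sup>2) \<partial>lborel) = I M"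
      unfolding I_def
    proof (rule Bochner_Integration.integral_cong[OF refl])
      fix w
      have "\<psi> M w * (cmod (mon a w))\<^sup>2 = (if cmod (mon a w) \<le> real M then cmod (mon a w) powr q else 0)"
      proof (cases "mon a w = 0")
        case True
        then show ?thesis using q1 by simp
      next
        case False
        have "cmod (mon a w) powr (q - 2) * (cmod (mon a w))\<^sup>2 = cmod (mon a w) powr (q - 2) * cmod (mon a w) powr 2" using False by simp
        also have "\<dots> = cmod (mon a w) powr q" by (simp only: powr_add[symmetric]) simp
        finally show ?thesis by (simp add: \<psi>_def)
      qed
      then show "indicator U w * (\<psi> M w * (cmod (mon a w))\<^sup>2) = J M w" by (simp add: J_def)
    qed
    moreover have "is_bergman_proj U (\<lambda>w. complex_of_real (\<psi> M w) * mon a w)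
      (\<lambda>w. complex_of_real ((\<integral>w. indicator U w * (\<psi> M w * (cmod (mon a w))\<^sup>2) \<partial>lborel) / msq a) * mon a w)"
    proof (rule radial_mon_projection[OF a])
      show "\<psi> M (u * w) = \<psi> M w" if "u \<in> torus" for u w
        using that by (simp add: \<psi>_def mon_mult norm_mult norm_mon_torus)
      show "cmod (complex_of_real (\<psi> M w) * mon a w) \<le> real M powr (q - 1)" for w
        using FB[of M w] by (simp only: F_def)
    qed measurable
    ultimately show ?thesis by (simp add: F_def[abs_def])
  qed
  have rF: "rep U (F M) (\<lambda>w. indicator U w *\<^sub>R F M w)" for M by (rule rep_indicator) measurable
  have fp: "Lp_norm U p (F M) = I M powr (1 / p)" for M
    unfolding in_Lp_rep(2)[OF rF p0] JF nJ using I0 by simp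
  have gp: "ennreal ((I M / msq a) powr p) * P < \<infinity>"
      "enn2real (ennreal ((I M / msq a) powr p) * P) powr (1 / p) \<le> C * I M powr (1 / p)" for M
  proof -
    have "in_Lp U p (\<lambda>w. complex_of_real (I M / msq a) * mon a w) \<and> Lp_norm U p (\<lambda>w. complex_of_real (I M / msq a) * mon a w) \<le> C * Lp_norm U p (F M)"
      by (rule C(2)[OF in_Lp_U_bounded in_Lp_U_bounded proj]) (use FB p0 in auto)
    moreover have r: "rep U (\<lambda>w. complex_of_real (I M / msq a) * mon a w) (\<lambda>w. indicator U w *\<^sub>R (complex_of_real (I M / msq a) * mon a w))"
      by (rule rep_indicator) measurable
    moreover have "(\<integral>\<^sup>+w. ennreal (cmod (indicator U w *\<^sub>R (complex_of_real (I M / msq a) * mon a w)) powr p) \<partial>lborel) = ennreal ((I M / msq a) powr p) * P"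
      unfolding P_def using I0[of M] msq_pos[OF a] p0 by (intro powr_norm_cmult_mon) auto
    ultimately show "ennreal ((I M / msq a) powr p) * P < \<infinity>"
      "enn2real (ennreal ((I M / msq a) powr p) * P) powr (1 / p) \<le> C * I M powr (1 / p)"
      using in_Lp_rep[OF r p0] fp by auto
  qed
  have "P \<noteq> 0"
  proof
    assume "P = 0"
    then have "AE w in lborel. ennreal (cmod (mon a w) powr p) * indicator U w = 0"
      unfolding P_def by (subst (asm) nn_integral_0_iff_AE) auto
    then have "AE w in lborel. w \<notin> U"
      using AE_vec_nonzero
    proof eventually_elim
      case (elim w)
      then show ?case using mon_eq_0_iff[of w a] by (auto simp: indicator_def)
    qed
    then have "emeasure lborel U = 0"
      using borel_U by (subst (asm) AE_iff_measurable[of U]) auto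
    then show False using emeasure_U by simp
  qed
  \<comment> \<open>For finite \<open>P\<close>, boundedness makes \<open>I M\<close> at most a
    constant times \<open>I M powr (1 / p)\<close>, which bounds \<open>I M powr (1 / q)\<close>.
    For infinite \<open>P\<close> the projection has finite norm only if its coefficient is 0. The
    bound is spelled out to show that it is independent of \<open>M\<close>.\<close>
  have bound: "I M \<le> B" if "B = (if P = \<infinity> then 0 else ((C * msq a) / enn2real P powr (1 / p)) powr q)" for M B
  proof (cases "P = \<infinity>")
    case True
    then have "(I M / msq a) powr p = 0" using gp(1)[of M] by (auto simp: ennreal_mult_top split: if_splits)
    then have "I M = 0" using msq_pos[OF a] by simp
    then show ?thesis using that True by simp
  next
    case False
    define S where "S = enn2real P"
    have S: "S > 0" "P = ennreal S" using \<open>P \<noteq> 0\<close> False by (auto simp: S_def enn2real_positive_iff less_top zero_less_iff_neq_zero)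
    show ?thesis
    proof (cases "I M = 0")
      case True
      then show ?thesis using that False by simp
    next
      case F: False
      then have IM: "I M > 0" using I0[of M] by simp
      have "enn2real (ennreal ((I M / msq a) powr p) * P) = (I M / msq a) powr p * S"
        using S by (simp add: enn2real_mult)
      then have "((I M / msq a) powr p * S) powr (1 / p) \<le> C * I M powr (1 / p)"
        using gp(2)[of M] by simp
      then have "(I M / msq a) * S powr (1 / p) \<le> C * I M powr (1 / p)"
        using IM msq_pos[OF a] p0 S by (simp add: powr_mult powr_powr)
      then have "I M * S powr (1 / p) \<le> C * msq a * I M powr (1 / p)"
        using msq_pos[OF a] by (simp add: field_simps)
      then have "I M / I M powr (1 / p) \<le> C * msq a / S powr (1 / p)"
        using S IM by (simp add: field_simps)
      moreover have "I M / I M powr (1 / p) = I M powr (1 / q)"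
      proof -
        have "1 / q = 1 - 1 / p" using p by (simp add: q field_simps)
        then show ?thesis using IM by (simp add: powr_diff)
      qed
      ultimately have "(I M powr (1 / q)) powr q \<le> (C * msq a / S powr (1 / p)) powr q"
        using q1 by (intro powr_mono2) auto
      then show ?thesis using IM q1 that False by (simp add: powr_powr S_def)
    qed
  qed
  then obtain B where B: "\<And>M. I M \<le> B" by blast
  have "(\<integral>\<^sup>+w. (SUP M. ennreal (J M w)) \<partial>lborel) = (SUP M. \<integral>\<^sup>+w. ennreal (J M w) \<partial>lborel)"
  proof (rule nn_integral_monotone_convergence_SUP)
    show "incseq (\<lambda>M w. ennreal (J M w))"
      by (auto simp: incseq_def le_fun_def J_def indicator_def intro!: ennreal_leI)
  qed measurable
  also have "\<dots> \<le> ennreal B" unfolding nJ using B by (intro SUP_least ennreal_leI)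
  also have "\<dots> < \<infinity>" by simp
  also have "(\<integral>\<^sup>+w. (SUP M. ennreal (J M w)) \<partial>lborel) = (\<integral>\<^sup>+w. ennreal (cmod (mon a w) powr q) * indicator U w \<partial>lborel)"
  proof (rule nn_integral_cong)
    fix w
    show "(SUP M. ennreal (J M w)) = ennreal (cmod (mon a w) powr q) * indicator U w"
    proof (rule antisym)
      show "(SUP M. ennreal (J M w)) \<le> ennreal (cmod (mon a w) powr q) * indicator U w"
        by (intro SUP_least) (auto simp: J_def indicator_def)
      obtain M where "cmod (mon a w) \<le> real M" using real_arch_simple by blast
      then have "ennreal (cmod (mon a w) powr q) * indicator U w = ennreal (J M w)" by (simp add: J_def indicator_def)
      also have "\<dots> \<le> (SUP M. ennreal (J M w))" by (rule SUP_upper) simp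
      finally show "ennreal (cmod (mon a w) powr q) * indicator U w \<le> (SUP M. ennreal (J M w))" .
    qed
  qed
  finally show False using inf by simp
qed

section \<open>Orthogonality of monomials and the exponent 1\<close>

lemma integral_mon_cnj_mon:
  assumes int: "integrable lborel (\<lambda>w. indicator U w *\<^sub>R (mon a w * cnj (mon b w)))"
  shows "IU (\<lambda>w. mon a w * cnj (mon b w)) = (if a = b then complex_of_real (\<integral>w. indicator U w * (cmod (mon a w))\<^sup>2 \<partial>lborel) else 0)"
proof -
  have "IU (\<lambda>w. mon a w * cnj (mon b w)) = (\<integral>w. (\<integral>u. indicator U (u * w) *\<^sub>R (mon a (u * w) * cnj (mon b (u * w))) \<partial>torus_measure) \<partial>lborel)"
    unfolding IU_def by (rule integral_torus_average[OF int])
  also have "\<dots> = (\<integral>w. (if a = b then complex_of_real (indicator U w * (cmod (mon a w))\<^sup>2) else 0) \<partial>lborel)"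
  proof (rule Bochner_Integration.integral_cong[OF refl])
    fix w
    have "(\<integral>u. indicator U (u * w) *\<^sub>R (mon a (u * w) * cnj (mon b (u * w))) \<partial>torus_measure)
      = (\<integral>u. (indicator U w *\<^sub>R (mon a w * cnj (mon b w))) * mon (\<lambda>j. a j - b j) u \<partial>torus_measure)"
    proof (rule integral_cong_AE)
      show "AE u in torus_measure. indicator U (u * w) *\<^sub>R (mon a (u * w) * cnj (mon b (u * w))) = (indicator U w *\<^sub>R (mon a w * cnj (mon b w))) * mon (\<lambda>j. a j - b j) u"
        using AE_torus
      proof eventually_elim
        case (elim u)
        have "mon (\<lambda>j. a j - b j) u = mon a u * cnj (mon b u)"
          using mon_diff[of u a b] torus_nonzero[OF elim] cnj_mon_torus[OF elim] by (simp add: divide_inverse)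
        then show ?case using elim by (simp add: mon_mult indicator_def)
      qed
    qed measurable
    also have "\<dots> = (indicator U w *\<^sub>R (mon a w * cnj (mon b w))) * (if a = b then 1 else 0)"
    proof -
      have "(\<lambda>j. a j - b j) = (\<lambda>_. 0) \<longleftrightarrow> a = b" by (auto simp: fun_eq_iff)
      then show ?thesis by (simp add: integral_mon_torus)
    qed
    also have "\<dots> = (if a = b then complex_of_real (indicator U w * (cmod (mon a w))\<^sup>2) else 0)"
      using complex_norm_square[of "mon b w", symmetric] by (simp add: scaleR_conv_of_real)
    finally show "(\<integral>u. indicator U (u * w) *\<^sub>R (mon a (u * w) * cnj (mon b (u * w))) \<partial>torus_measure)
      = (if a = b then complex_of_real (indicator U w * (cmod (mon a w))\<^sup>2) else 0)" .
  qed
  also have "\<dots> = (if a = b then complex_of_real (\<integral>w. indicator U w * (cmod (mon a w))\<^sup>2 \<partial>lborel) else 0)"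
    by (simp del: of_real_mult add: integral_complex_of_real)
  finally show ?thesis .
qed

lemma IU_sum:
  assumes "\<And>i. i \<in> I \<Longrightarrow> integrable lborel (\<lambda>w. indicator U w *\<^sub>R F i w)"
  shows "IU (\<lambda>w. \<Sum>i\<in>I. F i w) = (\<Sum>i\<in>I. IU (F i))"
    and "integrable lborel (\<lambda>w. indicator U w *\<^sub>R (\<Sum>i\<in>I. F i w))"
  unfolding IU_def scaleR_sum_right using assms
  by (auto intro!: Bochner_Integration.integral_sum Bochner_Integration.integrable_sum)

lemma IU_sum2:
  assumes "\<And>i j. integrable lborel (\<lambda>w. indicator U w *\<^sub>R F i j w)"
  shows "IU (\<lambda>w. \<Sum>i\<in>I. \<Sum>j\<in>J. F i j w) = (\<Sum>i\<in>I. \<Sum>j\<in>J. IU (F i j))"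
  using assms by (simp add: IU_sum)

lemma IU_cmult: "IU (\<lambda>w. c * F w) = c * IU F"
  unfolding IU_def by (simp only: mult_scaleR_right[symmetric] Bochner_Integration.integral_mult_right_zero)

text \<open>With \<open>t = mon (G k)\<close>, which maps \<open>U\<close> into the unit disc, test on \<open>|\<Sum>a\<le>M. t ^ a|\<^sup>2\<close> and pair its
  projection \<open>g\<close> with \<open>v = - ln (1 - s t)\<close>: here \<open>v - cnj v\<close> is bounded, \<open>\<integral> g v = 0\<close>, and \<open>\<integral> g cnj v\<close> is
  a sum whose size is \<open>\<Sum>b\<le>M. \<mu> b * harm b\<close>, compared to \<open>\<Sum>b\<le>M. \<mu> b\<close> for the norm of the test function.\<close>

lemma not_bounded_one: "\<not> bergman_Lp_bounded U 1"
proof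
  assume "bergman_Lp_bounded U 1"
  then obtain C where C: "C > 0" "\<And>f g. in_Lp U 2 f \<Longrightarrow> in_Lp U 1 f \<Longrightarrow> is_bergman_proj U f g \<Longrightarrow> in_Lp U 1 g \<and> Lp_norm U 1 g \<le> C * Lp_norm U 1 f"
    unfolding bergman_Lp_bounded_def by blast
  \<comment> \<open>Any index would do.\<close>
  define k :: 'n where "k = undefined"
  define e where "e m = (\<lambda>j. m * G k j)" for m :: int
  define t where "t w = mon (G k) w" for w
  define \<mu> where "\<mu> a = (\<integral>w. indicator U w * (cmod (t w) ^ a)\<^sup>2 \<partial>lborel)" for a :: nat
  have [measurable]: "t \<in> borel_measurable borel" unfolding t_def by measurable
  have t1: "cmod (t w) < 1" if "w \<in> U" for w using that by (simp add: t_def U_def)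
  have t1': "cmod (t w) ^ a \<le> 1" if "w \<in> U" for w a using t1[OF that] by (simp add: power_le_one)
  have te: "t w ^ a = mon (e (int a)) w" for w a by (simp add: t_def e_def mon_power)
  have dot_e: "dot (e m) l = (if k = l then m * N else 0)" for m l
    unfolding e_def dot_cmult dot_G by simp
  \<comment> \<open>Negative powers of \<open>t\<close> are excluded because \<open>N\<close>
    exceeds \<open>h k\<close>: already for \<open>m = -1\<close> the relevant number
    \<open>h k - N\<close> is negative.\<close>
  have adm_e: "adm (e m) \<longleftrightarrow> m \<ge> 0" for m
  proof
    assume "adm (e m)"
    then have "dot (e m) k + h k \<ge> 1" unfolding adm_def by blast
    then have "m * N + h k \<ge> 1" by (simp add: dot_e)
    then have "m * N > - N" using N_gt[of k] by (simp add: h_def)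
    then have "(m + 1) * N > 0" by (simp add: distrib_right)
    then show "m \<ge> 0" using N_pos by (simp add: zero_less_mult_iff)
  next
    assume m: "m \<ge> 0"
    show "adm (e m)" unfolding adm_def
    proof
      fix l
      have "dot (e m) l \<ge> 0" using m N_pos by (simp add: dot_e)
      then show "dot (e m) l + h l \<ge> 1" using h_pos[of l] by linarith
    qed
  qed
  have e_inj: "e m = e m' \<longleftrightarrow> m = m'" for m m'
  proof
    assume "e m = e m'"
    then have "dot (e m) k = dot (e m') k" by (simp only:)
    then have "m * N = m' * N" unfolding dot_e by simp
    then show "m = m'" using N_pos by simp
  qed simp
  have \<mu>_msq: "\<mu> a = msq (e (int a))" for a
    unfolding \<mu>_def using integral_U_mon_sq[of "e (int a)"] by (simp add: adm_e te[symmetric] norm_power)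
  define E where "E = rc * (N / 2) * (\<Prod>l\<in>UNIV - {k}. N / (2 * real_of_int (h l)))"
  have E: "E > 0" unfolding E_def using rc(1) N_pos h_pos
    by (intro mult_pos_pos prod_pos ballI) (auto simp: order_less_le_trans[OF zero_less_one])
  have \<mu>_eq: "\<mu> a = E / (a * N + h k)" for a
  proof -
    have "(\<Prod>l\<in>UNIV. N / (2 * (dot (e (int a)) l + h l))) = N / (2 * (int a * N + h k)) * (\<Prod>l\<in>UNIV - {k}. N / (2 * real_of_int (h l)))"
      by (subst prod.remove[of _ k]) (auto simp: dot_e intro!: prod.cong)
    then show ?thesis by (simp add: \<mu>_msq msq_def E_def)
  qed
  have hk: "1 \<le> h k" "h k \<le> N" using h_pos[of k] N_gt[of k] by (auto simp: h_def)
  \<comment> \<open>The weights dominate a multiple of the harmonic series, because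
    \<open>h k\<close> is at most \<open>N\<close>.\<close>
  have \<mu>_ge: "\<mu> a \<ge> E / N * inverse (real (Suc a))" for a
  proof -
    have "real a * N + h k \<le> N * real (Suc a)" using hk(2) by (simp add: algebra_simps)
    moreover have "real a * N + h k > 0" using hk(1) N_pos by (intro add_nonneg_pos) auto
    ultimately have "E / (N * real (Suc a)) \<le> E / (a * N + h k)" using E by (intro divide_left_mono) auto
    then show ?thesis by (simp add: \<mu>_eq field_simps)
  qed
  have \<mu>_pos: "\<mu> a > 0" for a using msq_pos[of "e (int a)"] by (simp add: \<mu>_msq adm_e)
  have IU_t: "IU (\<lambda>w. t w ^ a * cnj (t w ^ b)) = (if a = b then complex_of_real (\<mu> a) else 0)" for a b
  proof -
    have "integrable lborel (\<lambda>w. indicator U w *\<^sub>R (t w ^ a * cnj (t w ^ b)))"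
      using t1' by (intro integrable_U_bounded[of _ 1]) (auto simp: norm_mult norm_power intro!: mult_le_one)
    then show ?thesis
      using integral_mon_cnj_mon[of "e (int a)" "e (int b)"] unfolding te
      by (simp add: e_inj \<mu>_def te[symmetric] norm_power)
  qed
  define f where "f M w = (\<Sum>a\<le>M. \<Sum>b\<le>M. t w ^ a * cnj (t w ^ b))" for M w
  \<comment> \<open>Off the zeros of \<open>t\<close>, the product
    \<open>t ^ a * cnj (t ^ b)\<close> is the power of \<open>t\<close> with exponent
    \<open>a - b\<close> times the radial factor \<open>|t| ^ (2 * b)\<close>. It projects to a
    multiple of that power, or to 0 if \<open>b > a\<close>.\<close>
  define \<gamma> where "\<gamma> a b = (if b \<le> a then complex_of_real (\<mu> a / \<mu> (a - b)) else 0)" for a b :: nat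
  define g where "g M w = (\<Sum>x\<in>{..M}\<times>{..M}. \<gamma> (fst x) (snd x) * t w ^ (fst x - snd x))" for M w
  have [measurable]: "f M \<in> borel_measurable borel" "g M \<in> borel_measurable borel" for M
    unfolding f_def g_def by measurable
  have f_sq: "f M w = complex_of_real ((cmod (\<Sum>a\<le>M. t w ^ a))\<^sup>2)" for M w
    unfolding f_def complex_norm_square cnj_sum sum_product ..
  have gA: "in_A2 U (g M)" for M
    unfolding g_def te by (intro in_A2_sum in_A2_mon) (auto simp: adm_e)
  have fB: "cmod (f M w) \<le> real (Suc M) * real (Suc M)" if w: "w \<in> U" for M w
  proof -
    have "cmod (f M w) \<le> (\<Sum>a\<le>M. \<Sum>b\<le>M. 1)"
      unfolding f_def using t1'[OF w]
      by (intro sum_norm_le) (auto simp: norm_mult norm_power intro!: mult_le_one)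
    then show ?thesis by simp
  qed
  have proj: "is_bergman_proj U (f M) (g M)" for M
  proof (rule is_bergman_projI[OF gA rep_indicator])
    fix v assume v: "in_A2 U v"
    define v' where "v' = (\<lambda>w. indicator U w *\<^sub>R v w)"
    have sv: "square_integrable v'" unfolding v'_def by (rule in_A2_square_integrable[OF v])
    then have [measurable]: "v' \<in> borel_measurable borel" by (simp add: square_integrable_def)
    define T where "T x w = (indicator U w *\<^sub>R (t w ^ fst x * cnj (t w ^ snd x)) - indicator U w *\<^sub>R (\<gamma> (fst x) (snd x) * t w ^ (fst x - snd x))) * cnj (v' w)" for x :: "nat \<times> nat" and w
    have T: "integrable lborel (T x) \<and> (\<integral>w. T x w \<partial>lborel) = 0" for x
    proof -
      obtain a b where x: "x = (a, b)" by (cases x)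
      define \<psi> where "\<psi> w = cmod (t w) ^ (2 * b)" for w
      have [measurable]: "\<psi> \<in> borel_measurable borel" unfolding \<psi>_def by measurable
      define m where "m = e (int a - int b)"
      have tm: "t w ^ a * cnj (t w ^ b) = complex_of_real (\<psi> w) * mon m w" if "\<forall>j. w$j \<noteq> 0" for w
      proof -
        have nz: "t w \<noteq> 0" using mon_eq_0_iff[OF that] by (simp add: t_def)
        have "mon m w = mon (\<lambda>j. e (int a) j - e (int b) j) w" by (simp add: m_def e_def left_diff_distrib)
        also have "\<dots> = t w ^ a / t w ^ b" using mon_diff[OF that] by (simp add: te)
        finally have "complex_of_real (\<psi> w) * mon m w = (t w ^ b * cnj (t w ^ b)) * (t w ^ a / t w ^ b)"
          unfolding complex_norm_square[symmetric] by (simp add: \<psi>_def norm_power power_mult[symmetric] mult.commute)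
        then show ?thesis using nz by simp
      qed
      have \<psi>B: "cmod (complex_of_real (\<psi> w) * mon m w) \<le> 1" if "w \<in> U" "\<forall>j. w$j \<noteq> 0" for w
        unfolding tm[OF that(2), symmetric] using t1'[OF that(1)] by (simp add: norm_mult norm_power mult_le_one)
      define d where "d = (if adm m then (\<integral>w. indicator U w * (\<psi> w * (cmod (mon m w))\<^sup>2) \<partial>lborel) / msq m else 0)"
      have d: "\<gamma> a b * t w ^ (a - b) = complex_of_real d * mon m w" for w
      proof (cases "b \<le> a")
        case True
        then have m: "m = e (int (a - b))" by (simp add: m_def of_nat_diff)
        have "(\<integral>w. indicator U w * (\<psi> w * (cmod (mon m w))\<^sup>2) \<partial>lborel) = \<mu> a"
        proof -
          have "\<psi> w * (cmod (mon m w))\<^sup>2 = (cmod (t w) ^ a)\<^sup>2" for w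
          proof -
            have "2 * b + (a - b) * 2 = a * 2" using True by simp
            then show ?thesis
              unfolding m te[symmetric] \<psi>_def norm_power by (simp add: power_mult[symmetric] power_add[symmetric])
          qed
          then show ?thesis by (simp add: \<mu>_def)
        qed
        then have "d = \<mu> a / \<mu> (a - b)" using True by (simp add: d_def m adm_e \<mu>_msq)
        then show ?thesis using True by (simp add: \<gamma>_def m te)
      next
        case False
        then have "\<not> adm m" by (simp add: m_def adm_e)
        then show ?thesis using False by (simp add: \<gamma>_def d_def)
      qed
      have pr: "(\<integral>w. (indicator U w *\<^sub>R (complex_of_real (\<psi> w) * mon m w) - indicator U w *\<^sub>R (complex_of_real d * mon m w)) * cnj (v' w) \<partial>lborel) = 0"
          "integrable lborel (\<lambda>w. (indicator U w *\<^sub>R (complex_of_real (\<psi> w) * mon m w) - indicator U w *\<^sub>R (complex_of_real d * mon m w)) * cnj (v' w))"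
        unfolding v'_def d_def
        by (rule pairing_radial_mon[OF v _ _ \<psi>B]; simp add: \<psi>_def t_def mon_mult norm_mult norm_mon_torus)+
      have ae: "AE w in lborel. T x w = (indicator U w *\<^sub>R (complex_of_real (\<psi> w) * mon m w) - indicator U w *\<^sub>R (complex_of_real d * mon m w)) * cnj (v' w)"
        using AE_vec_nonzero
      proof eventually_elim
        case (elim w)
        show ?case by (simp only: T_def x fst_conv snd_conv tm[OF elim] d)
      qed
      have [measurable]: "T x \<in> borel_measurable borel" unfolding T_def[abs_def] by measurable
      have "integrable lborel (T x)"
        using pr(2) ae by (subst integrable_cong_AE) auto
      moreover have "(\<integral>w. T x w \<partial>lborel) = 0"
        using pr(1) ae by (subst integral_cong_AE) auto
      ultimately show ?thesis by simp
    qed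
    have "(indicator U w *\<^sub>R f M w - indicator U w *\<^sub>R g M w) * cnj (indicator U w *\<^sub>R v w) = (\<Sum>x\<in>{..M}\<times>{..M}. T x w)" for w
    proof -
      have "f M w = (\<Sum>x\<in>{..M}\<times>{..M}. t w ^ fst x * cnj (t w ^ snd x))"
        unfolding f_def sum.cartesian_product by (simp add: case_prod_beta)
      then show ?thesis
        unfolding T_def v'_def g_def sum_distrib_right[symmetric] sum_subtractf scaleR_sum_right[symmetric] by simp
    qed
    then show "(\<integral>w. (indicator U w *\<^sub>R f M w - indicator U w *\<^sub>R g M w) * cnj (indicator U w *\<^sub>R v w) \<partial>lborel) = 0"
      using T by simp
  qed measurable
  have IU_f: "IU (f M) = complex_of_real (\<Sum>a\<le>M. \<mu> a)" for M
  proof -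
    have i: "integrable lborel (\<lambda>w. indicator U w *\<^sub>R (t w ^ a * cnj (t w ^ b)))" for a b
      using t1' by (intro integrable_U_bounded[of _ 1]) (auto simp: norm_mult norm_power intro!: mult_le_one)
    have "IU (f M) = (\<Sum>a\<le>M. \<Sum>b\<le>M. IU (\<lambda>w. t w ^ a * cnj (t w ^ b)))"
      unfolding f_def using i by (rule IU_sum2)
    then show ?thesis unfolding IU_t by simp
  qed
  have f_norm: "Lp_norm U 1 (f M) = (\<Sum>a\<le>M. \<mu> a)" for M
  proof -
    have i: "integrable lborel (\<lambda>w. indicator U w *\<^sub>R f M w)"
      using fB by (intro integrable_U_bounded) auto
    have "(\<integral>\<^sup>+w. ennreal (cmod (indicator U w *\<^sub>R f M w)) \<partial>lborel) = ennreal (\<integral>w. cmod (indicator U w *\<^sub>R f M w) \<partial>lborel)"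
      by (rule nn_integral_eq_integral[OF integrable_norm[OF i]]) simp
    moreover have "(\<integral>w. cmod (indicator U w *\<^sub>R f M w) \<partial>lborel) = (\<Sum>a\<le>M. \<mu> a)"
    proof -
      have "complex_of_real (cmod (indicator U w *\<^sub>R f M w)) = indicator U w *\<^sub>R f M w" for w
        unfolding f_sq by (simp add: indicator_def norm_power)
      then have "complex_of_real (\<integral>w. cmod (indicator U w *\<^sub>R f M w) \<partial>lborel) = IU (f M)"
        unfolding IU_def by (simp only: integral_complex_of_real[symmetric])
      then show ?thesis using IU_f[of M] by (simp only: of_real_eq_iff)
    qed
    ultimately show ?thesis
      using in_Lp_rep(2)[OF rep_indicator, of "f M" 1] \<mu>_pos
      by (simp add: sum_nonneg less_imp_le)
  qed
  \<comment> \<open>With \<open>s\<close> below 1 the function \<open>v\<close> is bounded and its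
    series converges geometrically; the limit at 1 is taken later, in finite sums.\<close>
  have main: "(\<Sum>b\<le>M. \<mu> b * (\<Sum>j=1..b. s ^ j / j)) \<le> 2 * pi * C * (\<Sum>b\<le>M. \<mu> b)" if s: "0 < s" "s < 1" for s M
  proof -
    define v where "v w = - Ln (1 - complex_of_real s * t w)" for w
    have st: "cmod (complex_of_real s * t w) < 1" if "w \<in> U" for w
    proof -
      have "cmod (complex_of_real s * t w) \<le> cmod (t w)" using s by (simp add: norm_mult mult_left_le_one_le)
      then show ?thesis using t1[OF that] by linarith
    qed
    have st': "cmod (complex_of_real s * t w) \<le> s" if "w \<in> U" for w
      using s t1[OF that] by (simp add: norm_mult mult_left_le less_imp_le)
    have Re_pos: "Re (1 - complex_of_real s * t w) > 0" if "w \<in> U" for w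
      using st[OF that] complex_Re_le_cmod[of "complex_of_real s * t w"] by (simp only: minus_complex.sel one_complex.sel)
    \<comment> \<open>The term \<open>j = 0\<close> is 0, since division by 0 gives 0.\<close>
    have v_sums: "(\<lambda>j. complex_of_real (s ^ j / j) * t w ^ j) sums v w" if "w \<in> U" for w
    proof -
      have "cmod (- (complex_of_real s * t w)) < 1" using st[OF that] by simp
      from sums_minus[OF Ln_series'[OF this]] show ?thesis
        by (simp add: v_def power_mult_distrib)
    qed
    have v_ser_norm: "cmod (complex_of_real (s ^ j / j) * t w ^ j) \<le> s ^ j" if "w \<in> U" for w j
    proof -
      have "s ^ j / j \<le> s ^ j" using s by (cases "j = 0") (auto simp: divide_le_eq mult_le_cancel_left1)
      then have "(s ^ j / j) * cmod (t w) ^ j \<le> s ^ j * 1" using t1'[OF that, of j] s by (intro mult_mono) auto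
      then show ?thesis using s by (simp add: norm_mult norm_power norm_divide)
    qed
    have gs: "summable (\<lambda>j. s ^ j)" using s by simp
    have [measurable]: "v \<in> borel_measurable borel" unfolding v_def by measurable
    have vB: "cmod (v w) \<le> (\<Sum>j. s ^ j)" if "w \<in> U" for w
      unfolding sums_unique[OF v_sums[OF that]] using v_ser_norm[OF that] by (intro norm_suminf_le gs) auto
    have vA: "in_A2 U v"
    proof -
      have "holomorphic_n t U"
        unfolding t_def[abs_def] by (rule holomorphic_n_mon) (auto simp: U_def)
      then have hol: "holomorphic_n v U"
        unfolding v_def[abs_def]
      proof (rule holomorphic_n_compose)
        fix z assume "z \<in> U"
        then have nz: "1 - complex_of_real s * t z \<notin> \<real>\<^sub>\<le>\<^sub>0" using Re_pos[of z] by (auto simp: complex_nonpos_Reals_iff)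
        have "((\<lambda>x. 1 - complex_of_real s * x) has_field_derivative (- complex_of_real s)) (at (t z))"
          by (auto intro!: derivative_eq_intros)
        from DERIV_minus[OF DERIV_chain2[OF has_field_derivative_Ln[OF nz] this]]
        show "(\<lambda>x. - Ln (1 - complex_of_real s * x)) field_differentiable at (t z)"
          unfolding field_differentiable_def by blast
      qed
      moreover have "in_Lp U 2 v" by (rule in_Lp_U_bounded[OF _ vB]) auto
      ultimately show ?thesis by (simp add: in_A2_def)
    qed
    have IU_v: "(\<lambda>j. complex_of_real (s ^ j / j) * IU (\<lambda>w. F w * t w ^ j)) sums IU (\<lambda>w. F w * v w)"
      if [measurable]: "F \<in> borel_measurable borel" and FB: "\<And>w. w \<in> U \<Longrightarrow> cmod (F w) \<le> B" for F B
    proof -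
      define H where "H j w = indicator U w *\<^sub>R (F w * (complex_of_real (s ^ j / j) * t w ^ j))" for j w
      have FBv: "cmod (F w * (complex_of_real (s ^ j / j) * t w ^ j)) \<le> B * s ^ j" if "w \<in> U" for j w
        unfolding norm_mult[of "F w"]
        by (rule mult_mono[OF FB[OF that] v_ser_norm[OF that]]) (use order_trans[OF norm_ge_zero FB[OF that]] in auto)
      have HB: "cmod (H j w) \<le> indicator U w * (B * s ^ j)" for j w
      proof (cases "w \<in> U")
        case True
        show ?thesis using FBv[OF True] by (simp only: H_def indicator_simps(1)[OF True] scaleR_one mult_1)
      qed (simp add: H_def)
      have iH: "integrable lborel (H j)" for j
        unfolding H_def by (rule integrable_U_bounded[OF _ FBv]) measurable
      have iB: "integrable lborel (\<lambda>w. indicator U w * (B * s ^ j))" for j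
      proof -
        have "integrable lborel (\<lambda>w. indicator U w *\<^sub>R (B * s ^ j))"
          by (rule integrable_U_bounded[of _ "\<bar>B * s ^ j\<bar>"]) auto
        then show ?thesis by (simp only: real_scaleR_def)
      qed
      have "(\<lambda>j. \<integral>w. H j w \<partial>lborel) sums (\<integral>w. (\<Sum>j. H j w) \<partial>lborel)"
      proof (rule sums_integral[OF iH])
        show "AE w in lborel. summable (\<lambda>j. norm (H j w))"
        proof (rule AE_I2)
          fix w
          have "summable (\<lambda>j. indicator U w * (B * s ^ j))" by (intro summable_mult gs)
          then show "summable (\<lambda>j. norm (H j w))" by (rule summable_comparison_test') (simp add: HB)
        qed
        have "(\<integral>w. norm (H j w) \<partial>lborel) \<le> (B * measure lborel U) * s ^ j" for j
        proof -
          have "(\<integral>w. norm (H j w) \<partial>lborel) \<le> (\<integral>w. indicator U w * (B * s ^ j) \<partial>lborel)"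
            by (intro integral_mono integrable_norm iH iB HB)
          then show ?thesis by (simp add: mult_ac)
        qed
        then show "summable (\<lambda>j. \<integral>w. norm (H j w) \<partial>lborel)"
          by (intro summable_comparison_test'[OF summable_mult[OF gs, of "B * measure lborel U"]]) simp
      qed
      moreover have "(\<integral>w. H j w \<partial>lborel) = complex_of_real (s ^ j / j) * IU (\<lambda>w. F w * t w ^ j)" for j
      proof -
        have "H j w = complex_of_real (s ^ j / j) * (indicator U w *\<^sub>R (F w * t w ^ j))" for w
          by (simp add: H_def mult_ac)
        then show ?thesis unfolding IU_def by (simp only: Bochner_Integration.integral_mult_right_zero)
      qed
      moreover have "(\<integral>w. (\<Sum>j. H j w) \<partial>lborel) = IU (\<lambda>w. F w * v w)"
        unfolding IU_def
      proof (rule Bochner_Integration.integral_cong[OF refl])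
        fix w
        show "(\<Sum>j. H j w) = indicator U w *\<^sub>R (F w * v w)"
        proof (cases "w \<in> U")
          case True
          have "(\<lambda>j. F w * (complex_of_real (s ^ j / j) * t w ^ j)) sums (F w * v w)" by (intro sums_mult v_sums True)
          then show ?thesis using True by (simp add: H_def sums_iff)
        qed (simp add: H_def)
      qed
      ultimately show ?thesis by simp
    qed
    \<comment> \<open>Orthogonality keeps the terms with \<open>a + j = b\<close>, so each
      \<open>b\<close> from \<open>j\<close> to \<open>M\<close> contributes once.\<close>
    have IU_ft: "IU (\<lambda>w. f M w * t w ^ j) = complex_of_real (\<Sum>b=j..M. \<mu> b)" for j
    proof -
      have i: "integrable lborel (\<lambda>w. indicator U w *\<^sub>R (t w ^ a * cnj (t w ^ b)))" for a b
        using t1' by (intro integrable_U_bounded[of _ 1]) (auto simp: norm_mult norm_power intro!: mult_le_one)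
      have "IU (\<lambda>w. f M w * t w ^ j) = IU (\<lambda>w. \<Sum>a\<le>M. \<Sum>b\<le>M. t w ^ (a + j) * cnj (t w ^ b))"
        unfolding f_def by (intro IU_cong) (simp add: sum_distrib_left sum_distrib_right power_add mult_ac)
      also have "\<dots> = (\<Sum>a\<le>M. \<Sum>b\<le>M. IU (\<lambda>w. t w ^ (a + j) * cnj (t w ^ b)))"
        using i by (rule IU_sum2)
      also have "\<dots> = (\<Sum>b\<le>M. \<Sum>a\<le>M. if a + j = b then complex_of_real (\<mu> b) else 0)"
        unfolding IU_t by (subst sum.swap) (intro sum.cong, auto)
      also have "\<dots> = (\<Sum>b\<le>M. if j \<le> b then complex_of_real (\<mu> b) else 0)"
      proof (intro sum.cong refl)
        fix b assume b: "b \<in> {..M}"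
        have "(\<Sum>a\<le>M. if a + j = b then complex_of_real (\<mu> b) else 0) = (\<Sum>a\<le>M. if a = b - j \<and> j \<le> b then complex_of_real (\<mu> b) else 0)"
          by (intro sum.cong) auto
        also have "\<dots> = (if j \<le> b then complex_of_real (\<mu> b) else 0)"
          using b by (cases "j \<le> b") auto
        finally show "(\<Sum>a\<le>M. if a + j = b then complex_of_real (\<mu> b) else 0) = (if j \<le> b then complex_of_real (\<mu> b) else 0)" .
      qed
      also have "\<dots> = (\<Sum>b\<in>{b\<in>{..M}. j \<le> b}. complex_of_real (\<mu> b))"
        by (rule sum.inter_filter[symmetric]) simp
      also have "{b\<in>{..M}. j \<le> b} = {j..M}" by auto
      finally show ?thesis by simp
    qed
    have IU_fv: "IU (\<lambda>w. f M w * v w) = complex_of_real (\<Sum>b\<le>M. \<mu> b * (\<Sum>j=1..b. s ^ j / j))"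
    proof -
      have fin: "(\<lambda>j. complex_of_real (s ^ j / j) * IU (\<lambda>w. f M w * t w ^ j)) sums (\<Sum>j\<le>M. complex_of_real (s ^ j / j) * IU (\<lambda>w. f M w * t w ^ j))"
        by (rule sums_finite) (auto simp: IU_ft)
      have "(\<lambda>j. complex_of_real (s ^ j / j) * IU (\<lambda>w. f M w * t w ^ j)) sums IU (\<lambda>w. f M w * v w)"
        by (rule IU_v[OF _ fB]) measurable
      then have "IU (\<lambda>w. f M w * v w) = (\<Sum>j\<le>M. complex_of_real (s ^ j / j) * IU (\<lambda>w. f M w * t w ^ j))"
        using fin by (rule sums_unique2)
      also have "\<dots> = complex_of_real (\<Sum>j\<le>M. \<Sum>b=j..M. s ^ j / j * \<mu> b)"
        unfolding IU_ft by (simp add: sum_distrib_left)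
      also have "(\<Sum>j\<le>M. \<Sum>b=j..M. s ^ j / j * \<mu> b) = (\<Sum>b\<le>M. \<Sum>j\<le>b. s ^ j / j * \<mu> b)"
        unfolding sum.Sigma[OF finite_atMost ballI[OF finite_atMost]] sum.Sigma[OF finite_atMost ballI[OF finite_atLeastAtMost]]
        by (rule sum.reindex_bij_witness[of _ prod.swap prod.swap]) auto
      also have "\<dots> = (\<Sum>b\<le>M. \<mu> b * (\<Sum>j=1..b. s ^ j / j))"
      proof (intro sum.cong refl)
        fix b
        have "(\<Sum>j\<le>b. s ^ j / j * \<mu> b) = (\<Sum>j=1..b. s ^ j / j * \<mu> b)"
          by (rule sum.mono_neutral_right) (auto simp: Suc_le_eq)
        then show "(\<Sum>j\<le>b. s ^ j / j * \<mu> b) = \<mu> b * (\<Sum>j=1..b. s ^ j / j)" by (simp add: sum_distrib_left mult.commute)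
      qed
      finally show ?thesis .
    qed
    define Bg where "Bg = (\<Sum>x\<in>{..M}\<times>{..M}. cmod (\<gamma> (fst x) (snd x)))"
    have gB: "cmod (g M w) \<le> Bg" if "w \<in> U" for w
      unfolding g_def Bg_def using t1'[OF that]
      by (intro sum_norm_le) (auto simp: norm_mult norm_power intro!: mult_left_le)
    \<comment> \<open>For positive \<open>j\<close> the product is a combination of positive powers
      of \<open>t\<close>, which are orthogonal to constants; for \<open>j = 0\<close> the
      coefficient is 0.\<close>
    have IU_gt: "complex_of_real (s ^ j / j) * IU (\<lambda>w. g M w * t w ^ j) = 0" for j
    proof (cases "j = 0")
      case False
      have i: "integrable lborel (\<lambda>w. indicator U w *\<^sub>R (c * (t w ^ a * cnj (t w ^ b))))" for a b c
        using t1' by (intro integrable_U_bounded[of _ "cmod c"]) (auto simp: norm_mult norm_power intro!: mult_left_le mult_le_one)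
      have "IU (\<lambda>w. g M w * t w ^ j) = IU (\<lambda>w. \<Sum>x\<in>{..M}\<times>{..M}. \<gamma> (fst x) (snd x) * (t w ^ (fst x - snd x + j) * cnj (t w ^ 0)))"
        unfolding g_def by (intro IU_cong) (simp add: sum_distrib_left sum_distrib_right power_add mult_ac)
      also have "\<dots> = (\<Sum>x\<in>{..M}\<times>{..M}. \<gamma> (fst x) (snd x) * IU (\<lambda>w. t w ^ (fst x - snd x + j) * cnj (t w ^ 0)))"
      proof -
        have i': "integrable lborel (\<lambda>w. indicator U w *\<^sub>R (\<gamma> (fst x) (snd x) * (t w ^ (fst x - snd x + j) * cnj (t w ^ 0))))" for x
          by (rule i)
        show ?thesis by (simp only: IU_sum(1)[OF i'] IU_cmult)
      qed
      also have "\<dots> = 0" unfolding IU_t using False by (intro sum.neutral) auto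
      finally show ?thesis by simp
    qed simp
    have IU_gv: "IU (\<lambda>w. g M w * v w) = 0"
    proof -
      have "(\<lambda>j. complex_of_real (s ^ j / j) * IU (\<lambda>w. g M w * t w ^ j)) sums IU (\<lambda>w. g M w * v w)"
        by (rule IU_v[OF _ gB]) measurable
      then show ?thesis unfolding IU_gt by (rule sums_unique2[OF _ sums_zero])
    qed
    have int: "integrable lborel (\<lambda>w. indicator U w *\<^sub>R (F w * H w))"
      if [measurable]: "F \<in> borel_measurable borel" "H \<in> borel_measurable borel" and b: "\<And>w. w \<in> U \<Longrightarrow> cmod (F w) \<le> B" "\<And>w. w \<in> U \<Longrightarrow> cmod (H w) \<le> B'" for F H B B'
      using b order_trans[OF norm_ge_zero b(1)] by (intro integrable_U_bounded[of _ "B * B'"]) (auto simp: norm_mult intro!: mult_mono)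
    have vBc: "cmod (cnj (v w)) \<le> (\<Sum>j. s ^ j)" if "w \<in> U" for w using vB[OF that] by simp
    have "IU (\<lambda>w. f M w * cnj (v w)) = IU (\<lambda>w. g M w * cnj (v w))"
    proof -
      have "0 = (\<integral>w. (indicator U w *\<^sub>R f M w - indicator U w *\<^sub>R g M w) * cnj (indicator U w *\<^sub>R v w) \<partial>lborel)"
        using bergman_proj_orthogonal[OF rep_indicator proj vA, of M] by simp
      also have "\<dots> = (\<integral>w. indicator U w *\<^sub>R (f M w * cnj (v w)) - indicator U w *\<^sub>R (g M w * cnj (v w)) \<partial>lborel)"
        by (intro Bochner_Integration.integral_cong) (auto simp: indicator_def left_diff_distrib)
      also have "\<dots> = IU (\<lambda>w. f M w * cnj (v w)) - IU (\<lambda>w. g M w * cnj (v w))"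
        unfolding IU_def
        by (intro Bochner_Integration.integral_diff int[OF _ _ fB vBc] int[OF _ _ gB vBc]) auto
      finally show ?thesis by simp
    qed
    \<comment> \<open>The integral of \<open>g M * v\<close> is 0, so \<open>v\<close> may be
      subtracted. What remains has modulus twice the imaginary part of a principal logarithm, hence
      at most \<open>2 * pi\<close>, uniformly in \<open>s\<close>.\<close>
    also have "\<dots> = IU (\<lambda>w. g M w * (cnj (v w) - v w))"
    proof -
      have "IU (\<lambda>w. g M w * (cnj (v w) - v w)) = (\<integral>w. indicator U w *\<^sub>R (g M w * cnj (v w)) - indicator U w *\<^sub>R (g M w * v w) \<partial>lborel)"
        unfolding IU_def by (simp add: right_diff_distrib scaleR_diff_right)
      also have "\<dots> = IU (\<lambda>w. g M w * cnj (v w)) - IU (\<lambda>w. g M w * v w)"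
        unfolding IU_def
        by (intro Bochner_Integration.integral_diff int[OF _ _ gB vBc] int[OF _ _ gB vB]) auto
      finally show ?thesis using IU_gv by simp
    qed
    finally have fg: "IU (\<lambda>w. f M w * cnj (v w)) = IU (\<lambda>w. g M w * (cnj (v w) - v w))" .
    have "IU (\<lambda>w. f M w * cnj (v w)) = cnj (IU (\<lambda>w. f M w * v w))"
    proof -
      have "indicator U w *\<^sub>R (f M w * cnj (v w)) = cnj (indicator U w *\<^sub>R (f M w * v w))" for w
        unfolding f_sq by simp
      then show ?thesis unfolding IU_def by (simp only: Bochner_Integration.integral_cnj)
    qed
    then have "IU (\<lambda>w. f M w * cnj (v w)) = complex_of_real (\<Sum>b\<le>M. \<mu> b * (\<Sum>j=1..b. s ^ j / j))"
      unfolding IU_fv by simp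
    then have "(\<Sum>b\<le>M. \<mu> b * (\<Sum>j=1..b. s ^ j / j)) \<le> cmod (IU (\<lambda>w. g M w * (cnj (v w) - v w)))"
      unfolding fg[symmetric] by (simp only: norm_of_real abs_ge_self)
    also have "\<dots> \<le> (\<integral>w. cmod (indicator U w *\<^sub>R (g M w * (cnj (v w) - v w))) \<partial>lborel)"
      unfolding IU_def by (rule integral_norm_bound)
    also have "\<dots> \<le> (\<integral>w. 2 * pi * cmod (indicator U w *\<^sub>R g M w) \<partial>lborel)"
    proof (rule integral_mono)
      have vv: "cmod (cnj (v w) - v w) \<le> 2 * pi" if "w \<in> U" for w
      proof -
        have "1 - complex_of_real s * t w \<noteq> 0"
        proof
          assume "1 - complex_of_real s * t w = 0"
          then have "complex_of_real s * t w = 1" by simp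
          then show False using st[OF that] by (simp only: norm_one)
        qed
        then have "\<bar>Im (v w)\<bar> \<le> pi"
          using mpi_less_Im_Ln[of "1 - complex_of_real s * t w"] Im_Ln_le_pi[of "1 - complex_of_real s * t w"] by (auto simp: v_def abs_le_iff)
        moreover have "cmod (cnj (v w) - v w) = 2 * \<bar>Im (v w)\<bar>"
        proof -
          have "cnj (v w) - v w = - (complex_of_real (2 * Im (v w)) * \<i>)" by (simp add: complex_eq_iff)
          then show ?thesis by (simp only: norm_minus_cancel norm_mult norm_of_real norm_ii)
        qed
        ultimately show ?thesis by simp
      qed
      show "integrable lborel (\<lambda>w. cmod (indicator U w *\<^sub>R (g M w * (cnj (v w) - v w))))"
        by (intro integrable_norm int[OF _ _ gB vv]) auto
      show "integrable lborel (\<lambda>w. 2 * pi * cmod (indicator U w *\<^sub>R g M w))"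
        by (intro integrable_mult_right integrable_norm integrable_U_bounded[OF _ gB]) auto
      show "cmod (indicator U w *\<^sub>R (g M w * (cnj (v w) - v w))) \<le> 2 * pi * cmod (indicator U w *\<^sub>R g M w)" for w
        using mult_left_mono[OF vv, of w "cmod (g M w)"] by (cases "w \<in> U") (auto simp: norm_mult mult_ac)
    qed
    also have "\<dots> = 2 * pi * Lp_norm U 1 (g M)"
    proof -
      have "(\<integral>\<^sup>+w. ennreal (cmod (indicator U w *\<^sub>R g M w)) \<partial>lborel) = ennreal (\<integral>w. cmod (indicator U w *\<^sub>R g M w) \<partial>lborel)"
        by (rule nn_integral_eq_integral[OF integrable_norm[OF integrable_U_bounded[OF _ gB]]]) auto
      then have "Lp_norm U 1 (g M) = (\<integral>w. cmod (indicator U w *\<^sub>R g M w) \<partial>lborel)"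
        using in_Lp_rep(2)[OF rep_indicator, of "g M" 1] by simp
      then show ?thesis by simp
    qed
    also have "\<dots> \<le> 2 * pi * (C * Lp_norm U 1 (f M))"
      using C(2)[OF in_Lp_U_bounded[OF _ fB] in_Lp_U_bounded[OF _ fB] proj] by (intro mult_left_mono) auto
    finally show ?thesis by (simp add: f_norm mult_ac)
  qed
  define K where "K = 2 * pi * C"
  \<comment> \<open>In the limit the inner sums become harmonic numbers. Their mean with weights
    \<open>\<mu> b\<close> would be at most \<open>K\<close>, which is impossible as
    \<open>harm b\<close> tends to infinity and the weights have infinite sum.\<close>
  have harm: "(\<Sum>b\<le>M. \<mu> b * (harm b - K)) \<le> 0" for M
  proof -
    have "((\<lambda>s. \<Sum>b\<le>M. \<mu> b * (\<Sum>j=1..b. s ^ j / j)) \<longlongrightarrow> (\<Sum>b\<le>M. \<mu> b * (\<Sum>j=1..b. 1 ^ j / j))) (at_left (1::real))"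
      by (intro tendsto_intros) auto
    moreover have "\<forall>\<^sub>F s in at_left (1::real). (\<Sum>b\<le>M. \<mu> b * (\<Sum>j=1..b. s ^ j / j)) \<le> 2 * pi * C * (\<Sum>b\<le>M. \<mu> b)"
      using eventually_at_left_real[OF zero_less_one] by eventually_elim (use main in auto)
    ultimately have "(\<Sum>b\<le>M. \<mu> b * (\<Sum>j=1..b. 1 ^ j / j)) \<le> 2 * pi * C * (\<Sum>b\<le>M. \<mu> b)"
      by (rule tendsto_upperbound) auto
    then have "(\<Sum>b\<le>M. \<mu> b * harm b) \<le> K * (\<Sum>b\<le>M. \<mu> b)" by (simp add: harm_def K_def divide_inverse)
    then show ?thesis by (simp add: right_diff_distrib sum_subtractf sum_distrib_left mult.commute)
  qed
  have "\<forall>\<^sub>F b in sequentially. harm b \<ge> K + 1" using harm_at_top by (simp add: filterlim_at_top)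
  then obtain b0 where b0: "\<And>b. b \<ge> b0 \<Longrightarrow> harm b \<ge> K + 1" by (auto simp: eventually_sequentially)
  \<comment> \<open>Bounds the contribution of the finitely many indices at which
    \<open>harm b\<close> may still be below \<open>K + 1\<close>.\<close>
  define Q where "Q = (\<Sum>b<b0. \<mu> b * \<bar>harm b - K\<bar>)"
  have upper: "E / N * harm (Suc M) \<le> Q + E / N * harm b0" if M: "M \<ge> b0" for M
  proof -
    have split: "(\<Sum>b\<le>M. F b) = (\<Sum>b<b0. F b) + (\<Sum>b=b0..M. F b)" for F :: "nat \<Rightarrow> real"
    proof -
      have "{..M} = {..<b0} \<union> {b0..M}" using M by auto
      moreover have "{..<b0} \<inter> {b0..M} = {}" by auto
      ultimately show ?thesis by (simp add: sum.union_disjoint)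
    qed
    have "(\<Sum>b=b0..M. E / N * inverse (real (Suc b))) \<le> (\<Sum>b=b0..M. \<mu> b * (harm b - K))"
    proof (rule sum_mono)
      fix b assume "b \<in> {b0..M}"
      then have "1 \<le> harm b - K" using b0[of b] by simp
      then have "\<mu> b * 1 \<le> \<mu> b * (harm b - K)" using \<mu>_pos[of b] by (intro mult_left_mono) auto
      then show "E / N * inverse (real (Suc b)) \<le> \<mu> b * (harm b - K)" using \<mu>_ge[of b] by simp
    qed
    also have "\<dots> \<le> - (\<Sum>b<b0. \<mu> b * (harm b - K))" using harm[of M] unfolding split by simp
    also have "\<dots> \<le> Q" unfolding Q_def sum_negf[symmetric]
      using \<mu>_pos by (intro sum_mono) (auto simp: mult_minus_right[symmetric] simp del: mult_minus_right intro!: mult_left_mono less_imp_le)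
    finally have "E / N * (\<Sum>b=b0..M. inverse (real (Suc b))) \<le> Q" by (simp add: sum_distrib_left)
    moreover have "harm (Suc M) = harm b0 + (\<Sum>b=b0..M. inverse (real (Suc b)))"
      using M by (induction M rule: dec_induct) (simp_all add: harm_Suc)
    ultimately show ?thesis by (simp add: distrib_left)
  qed
  have "\<forall>\<^sub>F n in sequentially. harm n \<ge> (Q + E / N * harm b0) / (E / N) + 1" using harm_at_top by (simp add: filterlim_at_top)
  then obtain n0 where n0: "\<And>n. n \<ge> n0 \<Longrightarrow> harm n \<ge> (Q + E / N * harm b0) / (E / N) + 1" by (auto simp: eventually_sequentially)
  have EN: "E / N > 0" using E N_pos by simp
  have "harm (Suc (max n0 b0)) \<le> (Q + E / N * harm b0) / (E / N)"
    unfolding pos_le_divide_eq[OF EN] using upper[of "max n0 b0"] by (simp add: mult.commute)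
  moreover have "n0 \<le> Suc (max n0 b0)" by (simp add: le_SucI)
  ultimately show False using n0[of "Suc (max n0 b0)"] by linarith
qed

end

subsection \<open>Integral data of a monomial polyhedron\<close>

lemma bezout_finite_int:
  fixes y :: "'a \<Rightarrow> int"
  assumes "finite S"
  shows "\<exists>c. (\<Sum>j\<in>S. c j * y j) = Gcd (y ` S)"
  using assms
proof induction
  case (insert i S)
  then obtain c where c: "(\<Sum>j\<in>S. c j * y j) = Gcd (y ` S)" by blast
  obtain u v where uv: "u * y i + v * Gcd (y ` S) = gcd (y i) (Gcd (y ` S))" using bezout_int by blast
  have "(\<Sum>j\<in>insert i S. (if j = i then u else v * c j) * y j) = u * y i + (\<Sum>j\<in>S. v * c j * y j)"
    using insert by (simp, intro sum.cong) auto
  also have "\<dots> = Gcd (y ` insert i S)" using uv c by (simp add: mult.assoc flip: sum_distrib_left)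
  finally show ?case by (intro exI[of _ "\<lambda>j. if j = i then u else v * c j"])
qed simp

lemma rats_common_denominator:
  fixes x :: "'a \<Rightarrow> real"
  assumes "finite S" "\<And>i. i \<in> S \<Longrightarrow> x i \<in> \<rat>"
  shows "\<exists>d::int. d > 0 \<and> (\<forall>i\<in>S. of_int d * x i \<in> \<int>)"
  using assms
proof induction
  case empty
  show ?case by (intro exI[of _ 1]) simp
next
  case (insert i S)
  then obtain d :: int where d: "d > 0" "\<forall>i\<in>S. of_int d * x i \<in> \<int>" by auto
  from insert.prems[of i] obtain a b :: int where ab: "b > 0" "x i = of_int a / of_int b"
    by (metis Rats_cases' insertI1)
  have "of_int (d * b) * x j \<in> \<int>" if "j \<in> insert i S" for j
  proof (cases "j = i")
    case True
    have "of_int (d * b) * x i = of_int (d * a)" using ab by simp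
    then show ?thesis using True by (metis Ints_of_int)
  next
    case False
    then have "of_int d * x j \<in> \<int>" using that d by simp
    then have "of_int b * (of_int d * x j) \<in> \<int>" by (rule Ints_mult[OF Ints_of_int])
    then show ?thesis by (simp add: mult_ac)
  qed
  then show ?case using d ab by (intro exI[of _ "d * b"]) auto
qed

lemma det_Rats:
  fixes A :: "real^'n^'n"
  assumes "\<And>i j. A$i$j \<in> \<rat>"
  shows "det A \<in> \<rat>"
  unfolding det_def using assms by (intro Rats_sum Rats_mult Rats_prod) (auto simp: sign_def)

text \<open>Two primitive integral vectors on the same line differ by a sign: \<open>cross\<close>
  states proportionality without division, and comparing gcds shows that the ratio has modulus 1.
  This makes the definite description well defined.\<close>

lemma proj_height_eq:
  fixes y :: "int^'n" and x :: "real^'n"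
  assumes lam: "lam \<noteq> 0" and y: "\<And>k. real_of_int (y$k) = lam * x$k" and g: "Gcd (range (\<lambda>k. y$k)) = 1"
  shows "proj_height x = (\<Sum>k\<in>UNIV. \<bar>y$k\<bar>)"
  unfolding proj_height_def
proof (rule the_equality)
  show "\<exists>(y'::int^'n) lam. lam \<noteq> 0 \<and> (\<forall>k. real_of_int (y'$k) = lam * x$k) \<and> Gcd (range (\<lambda>k. y'$k)) = 1 \<and> (\<Sum>k\<in>UNIV. \<bar>y$k\<bar>) = (\<Sum>k\<in>UNIV. \<bar>y'$k\<bar>)"
    using assms by blast
  fix s assume "\<exists>(y'::int^'n) lam'. lam' \<noteq> 0 \<and> (\<forall>k. real_of_int (y'$k) = lam' * x$k) \<and> Gcd (range (\<lambda>k. y'$k)) = 1 \<and> s = (\<Sum>k\<in>UNIV. \<bar>y'$k\<bar>)"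
  then obtain y' :: "int^'n" and lam' where y': "lam' \<noteq> 0" "\<And>k. real_of_int (y'$k) = lam' * x$k" "Gcd (range (\<lambda>k. y'$k)) = 1" "s = (\<Sum>k\<in>UNIV. \<bar>y'$k\<bar>)"
    by blast
  have "\<exists>k. y$k \<noteq> 0"
  proof (rule ccontr)
    assume "\<nexists>k. y$k \<noteq> 0"
    then have "range (\<lambda>k. y$k) = {0}" by auto
    then show False using g by simp
  qed
  then obtain k0 where k0: "y$k0 \<noteq> 0" by blast
  have cross: "y'$k0 * y$k = y$k0 * y'$k" for k
  proof -
    have "real_of_int (y'$k0 * y$k) = real_of_int (y$k0 * y'$k)" by (simp add: y y'(2))
    then show ?thesis by (simp only: of_int_eq_iff)
  qed
  have "\<bar>y'$k0\<bar> = Gcd ((*) (y'$k0) ` range (\<lambda>k. y$k))" by (simp add: Gcd_mult g)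
  also have "(*) (y'$k0) ` range (\<lambda>k. y$k) = (*) (y$k0) ` range (\<lambda>k. y'$k)"
    using cross by (auto simp: image_iff)
  also have "Gcd \<dots> = \<bar>y$k0\<bar>" by (simp add: Gcd_mult y'(3))
  finally have a: "\<bar>y'$k0\<bar> = \<bar>y$k0\<bar>" .
  have "\<bar>y'$k\<bar> = \<bar>y$k\<bar>" for k
  proof -
    have "\<bar>y'$k0\<bar> * \<bar>y$k\<bar> = \<bar>y$k0\<bar> * \<bar>y'$k\<bar>" using cross[of k] by (simp flip: abs_mult)
    then show ?thesis using a k0 by simp
  qed
  then show "s = (\<Sum>k\<in>UNIV. \<bar>y$k\<bar>)" by (simp add: y'(4))
qed

text \<open>Positivity of the factor preserves the signs of a column; its rationality will keep
  rescaled rows rational.\<close>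

lemma primitive_multiple:
  fixes x :: "real^'n"
  assumes x: "\<And>k. x$k \<in> \<rat>" "x \<noteq> 0"
  obtains y :: "int^'n" and lam where "lam > 0" "lam \<in> \<rat>" "\<And>k. real_of_int (y$k) = lam * x$k" "Gcd (range (\<lambda>k. y$k)) = 1"
proof -
  obtain d :: int where d: "d > 0" "\<And>k. of_int d * x$k \<in> \<int>"
    using rats_common_denominator[of UNIV "\<lambda>k. x$k"] x by auto
  then have "\<forall>k. \<exists>m::int. of_int d * x$k = of_int m" by (metis Ints_cases)
  then obtain m where m: "\<And>k. of_int d * x$k = real_of_int (m k)" by metis
  define g where "g = Gcd (range m)"
  have "\<exists>k. m k \<noteq> 0"
  proof -
    obtain k where "x$k \<noteq> 0" using x(2) by (auto simp: vec_eq_iff)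
    then have "real_of_int (m k) \<noteq> 0" using d(1) by (simp flip: m)
    then show ?thesis by auto
  qed
  then have g: "g > 0" unfolding g_def
    by (metis Gcd_0_iff Gcd_int_greater_eq_0 order_less_le rangeI singletonD subsetD)
  define y :: "int^'n" where "y = (\<chi> k. m k div g)"
  have my: "m k = g * y$k" for k unfolding y_def g_def by simp
  show thesis
  proof
    show "real_of_int d / real_of_int g > 0" using d g by simp
    show "real_of_int d / real_of_int g \<in> \<rat>" by simp
    show "real_of_int (y$k) = real_of_int d / real_of_int g * x$k" for k
    proof -
      have "real_of_int d * x$k = real_of_int g * real_of_int (y$k)" using my[of k] m[of k] by simp
      then show ?thesis using g by (simp add: field_simps)
    qed
    have "range m = (*) g ` range (\<lambda>k. y$k)" using my by (auto simp: image_iff)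
    then have "g = g * Gcd (range (\<lambda>k. y$k))" using g by (metis Gcd_mult g_def normalize_Gcd normalize_mult abs_of_pos normalize_int_def)
    then show "Gcd (range (\<lambda>k. y$k)) = 1" using g by simp
  qed
qed

section \<open>The logarithmic cone and the inverse matrix\<close>

lemma mpow_exp: "mpow (exp x) b = exp (b * x)"
  by (simp add: mpow_def powr_def)

lemma prod_mpow_exp:
  assumes "\<And>k. z$k \<noteq> 0"
  shows "(\<Prod>k\<in>UNIV. mpow (cmod (z$k)) (b k)) = exp (\<Sum>k\<in>UNIV. b k * ln (cmod (z$k)))"
proof -
  have "mpow (cmod (z$k)) (b k) = exp (b k * ln (cmod (z$k)))" for k
    using mpow_exp[of "ln (cmod (z$k))" "b k"] assms[of k] by simp
  then show ?thesis by (simp add: exp_sum)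
qed

text \<open>Logarithms of moduli turn the polyhedron into the cone of all \<open>x\<close> with
  \<open>B *v x\<close> negative in every entry. The cone is nonempty because a nonempty open set is
  not contained in the coordinate hyperplanes; a cone point with a positive coordinate could be
  scaled until boundedness fails.\<close>

lemma monomial_polyhedron_cone:
  fixes B :: "real^'n^'n"
  assumes ne: "monomial_polyhedron B \<noteq> {}" and op: "open (monomial_polyhedron B)" and bd: "bounded (monomial_polyhedron B)"
  shows "\<exists>x. \<forall>j. (B *v x)$j < 0" and "(\<forall>j. (B *v x)$j < 0) \<Longrightarrow> x$k \<le> 0"
proof -
  have "\<exists>w\<in>monomial_polyhedron B. \<forall>k. w$k \<noteq> 0"
  proof (rule ccontr)
    assume c: "\<not> (\<exists>w\<in>monomial_polyhedron B. \<forall>k. w$k \<noteq> 0)"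
    have "AE w in lborel. w \<notin> monomial_polyhedron B"
      using AE_vec_nonzero by eventually_elim (use c in blast)
    then have "emeasure lborel (monomial_polyhedron B) = 0"
      using op by (subst (asm) AE_iff_measurable[of "monomial_polyhedron B"]) auto
    then have "negligible (monomial_polyhedron B)"
      using op by (simp add: negligible_iff_null_sets null_sets_def)
    then show False using open_not_negligible[OF op ne] by blast
  qed
  then obtain w where w: "w \<in> monomial_polyhedron B" "\<And>k. w$k \<noteq> 0" by blast
  have "(B *v (\<chi> k. ln (cmod (w$k))))$j < 0" for j
  proof -
    have "(\<Prod>k\<in>UNIV. mpow (cmod (w$k)) (B$j$k)) < 1" using w(1) by (simp add: monomial_polyhedron_def)
    then show ?thesis using prod_mpow_exp[of w "\<lambda>k. B$j$k"] w(2) by (simp add: matrix_vector_mult_def)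
  qed
  then show "\<exists>x. \<forall>j. (B *v x)$j < 0" by blast
  assume x: "\<forall>j. (B *v x)$j < 0"
  obtain R where R: "\<And>z. z \<in> monomial_polyhedron B \<Longrightarrow> norm z \<le> R" using bd by (auto simp: bounded_iff)
  show "x$k \<le> 0"
  proof (rule ccontr)
    assume xk: "\<not> x$k \<le> 0"
    \<comment> \<open>Scaled so that coordinate \<open>k\<close> of \<open>z\<close> has modulus
      \<open>exp (max R 1)\<close>, which exceeds \<open>R\<close>.\<close>
    define t where "t = max R 1 / x$k"
    have t: "t > 0" using xk by (simp add: t_def)
    define z :: "complex^'n" where "z = (\<chi> k. of_real (exp (t * x$k)))"
    have "(\<Prod>i\<in>UNIV. mpow (cmod (z$i)) (B$j$i)) < 1" for j
    proof -
      have "(\<Prod>i\<in>UNIV. mpow (cmod (z$i)) (B$j$i)) = exp (\<Sum>i\<in>UNIV. B$j$i * (t * x$i))"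
        by (subst prod_mpow_exp) (auto simp: z_def)
      also have "(\<Sum>i\<in>UNIV. B$j$i * (t * x$i)) = t * (B *v x)$j"
        by (simp add: matrix_vector_mult_def sum_distrib_left mult_ac)
      finally show ?thesis using t x by (simp add: mult_pos_neg)
    qed
    then have "z \<in> monomial_polyhedron B" by (auto simp: monomial_polyhedron_def z_def)
    then have "cmod (z$k) \<le> R" using R Finite_Cartesian_Product.norm_nth_le order_trans by blast
    moreover have "t * x$k = max R 1" using xk by (simp add: t_def)
    ultimately have "exp (max R 1) \<le> R" by (simp add: z_def)
    then show False using exp_ge_add_one_self[of "max R 1"] max.cobounded1[of R 1] by linarith
  qed
qed

lemma affine_nonpos_imp_zero:
  fixes a v :: real
  assumes "\<And>t. a + t * v \<le> 0"
  shows "v = 0"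
proof (rule ccontr)
  assume "v \<noteq> 0"
  then have "a + ((1 - a) / v) * v = 1" by simp
  then show False using assms[of "(1 - a) / v"] by simp
qed

lemma matrix_inv_left: "invertible A \<Longrightarrow> matrix_inv A ** A = mat 1"
  and matrix_inv_right: "invertible A \<Longrightarrow> A ** matrix_inv A = mat 1"
  unfolding invertible_def matrix_inv_def by (rule someI2_ex, assumption, simp)+

text \<open>A kernel vector of \<open>B\<close> would add whole lines to the cone, on which all
  coordinates are nonpositive, so it is 0. The inverse maps strictly negative vectors to nonpositive
  ones, and small perturbations of negated unit vectors then give the sign of its entries.\<close>

lemma monomial_polyhedron_inverse:
  fixes B :: "real^'n^'n"
  assumes ne: "monomial_polyhedron B \<noteq> {}" and op: "open (monomial_polyhedron B)" and bd: "bounded (monomial_polyhedron B)"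
  shows "invertible B" and "matrix_inv B $ i $ j \<ge> 0"
proof -
  note cone = monomial_polyhedron_cone[OF ne op bd]
  obtain x0 where x0: "\<And>j. (B *v x0)$j < 0" using cone(1) by blast
  have "v = 0" if v: "B *v v = 0" for v
  proof -
    have "x0$k + t * v$k \<le> 0" for k t
    proof -
      have "B *v (x0 + t *\<^sub>R v) = B *v x0" by (simp add: matrix_vector_right_distrib scaleR_matrix_vector_assoc[symmetric] matrix_vector_mult_scaleR v)
      then have "(x0 + t *\<^sub>R v)$k \<le> 0" using x0 by (intro cone(2)) simp
      then show ?thesis by simp
    qed
    then have "v$k = 0" for k by (rule affine_nonpos_imp_zero)
    then show "v = 0" by (simp add: vec_eq_iff)
  qed
  then show inv: "invertible B"
    using matrix_left_invertible_ker[of B] by (simp add: invertible_left_inverse)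
  show "matrix_inv B $ i $ j \<ge> 0"
  proof (rule ccontr)
    assume neg: "\<not> matrix_inv B $ i $ j \<ge> 0"
    define s where "s = (\<Sum>m\<in>UNIV. matrix_inv B $ i $ m)"
    define S where "S = \<bar>s\<bar> + 1"
    have S: "S > 0" by (simp add: S_def add_nonneg_pos)
    \<comment> \<open>Small enough that the perturbation uses up at most half of the supposedly
      negative entry.\<close>
    define e where "e = - matrix_inv B $ i $ j / (2 * S)"
    have e: "e > 0" unfolding e_def by (rule divide_pos_pos) (use neg S in auto)
    define y :: "real^'n" where "y = (\<chi> m. - (if m = j then 1 else 0) - e)"
    have "B *v (matrix_inv B *v y) = y"
      using matrix_inv_right[OF inv] by (simp add: matrix_vector_mul_assoc)
    then have "(matrix_inv B *v y)$i \<le> 0" using e by (intro cone(2)) (simp add: y_def)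
    moreover have "(matrix_inv B *v y)$i = - matrix_inv B $ i $ j - e * s"
    proof -
      have "(matrix_inv B *v y)$i = (\<Sum>m\<in>UNIV. (if m = j then - matrix_inv B $ i $ j else 0) - e * matrix_inv B $ i $ m)"
        unfolding matrix_vector_mult_def y_def by (simp, intro sum.cong) (auto simp: algebra_simps)
      then show ?thesis by (simp add: sum_subtractf sum_distrib_left s_def)
    qed
    moreover have "e * s \<le> - matrix_inv B $ i $ j / 2"
    proof -
      have "e * s \<le> e * S" using e by (intro mult_left_mono) (auto simp: S_def)
      also have "\<dots> = - matrix_inv B $ i $ j / 2" using S by (simp add: e_def)
      finally show ?thesis .
    qed
    ultimately show False using neg by simp
  qed
qed

text \<open>Cramer's rule writes the entry as a quotient of determinants of rational
  matrices.\<close>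

lemma matrix_inv_column_Rats:
  fixes B :: "real^'n^'n"
  assumes B: "\<And>i j. B$i$j \<in> \<rat>" and inv: "invertible B"
  shows "(matrix_inv B *v axis l 1)$k \<in> \<rat>"
proof -
  have d: "det B \<noteq> 0" using inv by (simp add: invertible_det_nz)
  have "B *v (matrix_inv B *v axis l 1) = axis l 1"
    using matrix_inv_right[OF inv] by (simp add: matrix_vector_mul_assoc)
  then have "matrix_inv B *v axis l 1 = (\<chi> k. det (\<chi> i j. if j = k then axis l 1 $ i else B $ i $ j) / det B)"
    using cramer[OF d] by blast
  moreover have "det (\<chi> i j. if j = k then axis l 1 $ i else B $ i $ j) \<in> \<rat>"
    using B by (intro det_Rats) (auto simp: axis_def)
  ultimately show ?thesis using det_Rats[OF B] by simp
qed

lemma mpow_mult: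
  assumes "r \<ge> 0" "c > 0"
  shows "mpow r (c * b) = mpow r b powr c"
  using assms by (auto simp: mpow_def powr_powr mult.commute)

lemma powi_eq_mpow:
  assumes "r \<ge> 0" "r = 0 \<Longrightarrow> n \<ge> 0"
  shows "r powi n = mpow r (of_int n)"
proof (cases "r = 0")
  case True
  then show ?thesis by (auto simp: mpow_def power_int_0_left_if)
next
  case False
  then show ?thesis using assms by (auto simp: mpow_def powr_real_of_int')
qed

lemma prod_powr: "(\<And>i. i \<in> I \<Longrightarrow> f i \<ge> 0) \<Longrightarrow> (\<Prod>i\<in>I. f i powr c) = (\<Prod>i\<in>I. f i) powr (c::real)"
  by (induction I rule: infinite_finite_induct) (auto simp: powr_mult prod_nonneg)

text \<open>Column \<open>k\<close> of the inverse is multiplied by \<open>lam k\<close> to become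
  primitive, and row \<open>k\<close> of \<open>B\<close> by \<open>N / lam k\<close>, which is
  positive and so preserves the inequality it defines. The products of the rescaled matrices are
  \<open>N\<close> times the identity, with \<open>N\<close> a common denominator times a number
  exceeding all heights.\<close>

lemma monomial_polyhedron_structure:
  fixes B :: "real^'n^'n"
  assumes rat: "\<forall>i j. B$i$j \<in> \<rat>"
    and ne: "monomial_polyhedron B \<noteq> {}" and op: "open (monomial_polyhedron B)" and bd: "bounded (monomial_polyhedron B)"
  obtains Y G :: "'n \<Rightarrow> 'n \<Rightarrow> int" and N where "monomial_cone Y G N" "monomial_cone.U G = monomial_polyhedron B"
    "\<And>k. proj_height (matrix_inv B *v axis k 1) = (\<Sum>j\<in>UNIV. Y k j)" "\<And>k. Gcd (range (Y k)) = 1"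
proof -
  note inv = monomial_polyhedron_inverse(1)[OF ne op bd]
  note nn = monomial_polyhedron_inverse(2)[OF ne op bd]
  define A where "A = matrix_inv B"
  have AB: "A ** B = mat 1" and BA: "B ** A = mat 1" unfolding A_def using matrix_inv_left[OF inv] matrix_inv_right[OF inv] by auto
  have col: "(A *v axis k 1)$j = A$j$k" for j k by (simp add: matrix_vector_mult_basis column_def)
  define P where "P k y lam \<longleftrightarrow> lam > 0 \<and> lam \<in> \<rat> \<and> (\<forall>j. real_of_int (y$j) = lam * A$j$k) \<and> Gcd (range (\<lambda>j. y$j)) = 1" for k and y :: "int^'n" and lam :: real
  have "\<exists>y lam. P k y lam" for k
  proof -
    have "A *v axis k 1 \<noteq> 0"
    proof
      assume "A *v axis k 1 = 0"
      then have "B *v (A *v axis k 1) = 0" by simp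
      then have "axis k (1::real) = 0" by (simp add: matrix_vector_mul_assoc BA)
      then show False by (simp add: axis_eq_0_iff)
    qed
    then obtain y :: "int^'n" and lam where "lam > 0" "lam \<in> \<rat>" "\<And>j. real_of_int (y$j) = lam * (A *v axis k 1)$j" "Gcd (range (\<lambda>j. y$j)) = 1"
      using primitive_multiple[of "A *v axis k 1"] matrix_inv_column_Rats[of B, OF _ inv] rat unfolding A_def by metis
    then show ?thesis unfolding P_def col by blast
  qed
  then obtain yv lam where P: "\<And>k. P k (yv k) (lam k)" by metis
  define Y where "Y k j = yv k $ j" for k j
  have lam: "lam k > 0" "lam k \<in> \<rat>" for k using P[of k] by (auto simp: P_def)
  have Yeq: "real_of_int (Y k j) = lam k * A$j$k" for k j using P[of k] by (auto simp: P_def Y_def)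
  have YG1: "Gcd (range (Y k)) = 1" for k using P[of k] by (auto simp: P_def Y_def)
  have Y0: "Y k j \<ge> 0" for k j
  proof -
    have "real_of_int (Y k j) \<ge> 0" unfolding Yeq using lam[of k] nn[of j k] by (simp add: A_def)
    then show ?thesis by simp
  qed
  obtain d :: int where d: "d > 0" "\<And>k j. of_int d * (B$k$j / lam k) \<in> \<int>"
  proof -
    have "\<exists>d::int. d > 0 \<and> (\<forall>x\<in>UNIV. of_int d * (case x of (k, j) \<Rightarrow> B$k$j / lam k) \<in> \<int>)"
      using rat lam by (intro rats_common_denominator) auto
    then show thesis using that by force
  qed
  \<comment> \<open>One more than the sum of all entries of \<open>Y\<close>, hence larger than each
    height.\<close>
  define m where "m = 1 + (\<Sum>k\<in>UNIV. \<Sum>j\<in>UNIV. Y k j)"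
  have m: "m \<ge> 1" using Y0 by (auto simp: m_def intro!: sum_nonneg)
  define N where "N = d * m"
  have N: "N > 0" using d m by (simp add: N_def)
  have "\<forall>k j. \<exists>g::int. real_of_int g = of_int N * (B$k$j / lam k)"
  proof (intro allI)
    fix k j
    have "of_int m * (of_int d * (B$k$j / lam k)) \<in> \<int>" by (rule Ints_mult[OF Ints_of_int d(2)])
    then have "of_int N * (B$k$j / lam k) \<in> \<int>" by (simp add: N_def mult_ac)
    then show "\<exists>g::int. real_of_int g = of_int N * (B$k$j / lam k)" by (metis Ints_cases)
  qed
  then obtain G :: "'n \<Rightarrow> 'n \<Rightarrow> int" where G: "\<And>k j. real_of_int (G k j) = of_int N * (B$k$j / lam k)" by metis
  have cone: "monomial_cone Y G N"
  proof
    show "N > 0" by (rule N)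
    show "(\<Sum>j\<in>UNIV. G k j * Y l j) = (if k = l then N else 0)" for k l
    proof -
      have "real_of_int (\<Sum>j\<in>UNIV. G k j * Y l j) = (\<Sum>j\<in>UNIV. (N * lam l / lam k) * (B$k$j * A$j$l))"
        by (simp add: G Yeq mult_ac)
      also have "\<dots> = (N * lam l / lam k) * (B ** A)$k$l" by (simp add: matrix_matrix_mult_def sum_distrib_left)
      also have "\<dots> = real_of_int (if k = l then N else 0)" using lam(1)[of k] lam(1)[of l] by (simp add: BA mat_def)
      finally show ?thesis by (simp only: of_int_eq_iff)
    qed
    show "(\<Sum>k\<in>UNIV. Y k i * G k j) = (if i = j then N else 0)" for i j
    proof -
      have "real_of_int (\<Sum>k\<in>UNIV. Y k i * G k j) = (\<Sum>k\<in>UNIV. N * (A$i$k * B$k$j))"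
      proof -
        have "real_of_int (Y k i) * real_of_int (G k j) = N * (A$i$k * B$k$j)" for k
          using lam[of k] by (simp add: G Yeq)
        then show ?thesis by simp
      qed
      also have "\<dots> = N * (A ** B)$i$j" by (simp add: matrix_matrix_mult_def sum_distrib_left)
      also have "\<dots> = real_of_int (if i = j then N else 0)" by (simp add: AB mat_def)
      finally show ?thesis by (simp only: of_int_eq_iff)
    qed
    show "Y k j \<ge> 0" for k j by (rule Y0)
    show "(\<Sum>j\<in>UNIV. Y k j) < N" for k
    proof -
      have "(\<Sum>j\<in>UNIV. Y k j) \<le> (\<Sum>k\<in>UNIV. \<Sum>j\<in>UNIV. Y k j)"
        using Y0 by (intro member_le_sum[of k UNIV "\<lambda>k. \<Sum>j\<in>UNIV. Y k j"]) (auto intro!: sum_nonneg)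
      also have "\<dots> < m" by (simp add: m_def)
      also have "m \<le> N" using d m by (simp add: N_def mult_le_cancel_right1)
      finally show ?thesis .
    qed
  qed
  have "monomial_cone.U G = monomial_polyhedron B"
  proof -
    have sgn: "0 \<le> G k j \<longleftrightarrow> 0 \<le> B$k$j" for k j
    proof -
      have "0 \<le> G k j \<longleftrightarrow> 0 \<le> real_of_int (G k j)" by simp
      also have "\<dots> \<longleftrightarrow> 0 \<le> B$k$j" unfolding G using N lam[of k] by (simp add: zero_le_mult_iff zero_le_divide_iff)
      finally show ?thesis .
    qed
    have "cmod (mon (G k) z) < 1 \<longleftrightarrow> (\<Prod>j\<in>UNIV. mpow (cmod (z$j)) (B$k$j)) < 1"
      if z: "\<forall>j. z$j = 0 \<longrightarrow> 0 \<le> G k j" for k z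
    proof -
      \<comment> \<open>The monomial of row \<open>G k\<close> is the \<open>c\<close>-th power of
        the product for row \<open>k\<close> of \<open>B\<close>, so both are below 1
        together.\<close>
      define c where "c = N / lam k"
      have c: "c > 0" using N lam[of k] by (simp add: c_def)
      have "cmod (mon (G k) z) = (\<Prod>j\<in>UNIV. mpow (cmod (z$j)) (B$k$j) powr c)"
        unfolding norm_mon
      proof (intro prod.cong refl)
        fix j
        have "cmod (z$j) powi G k j = mpow (cmod (z$j)) (of_int (G k j))" using z by (intro powi_eq_mpow) auto
        also have "real_of_int (G k j) = c * B$k$j" by (simp add: G c_def)
        finally show "cmod (z$j) powi G k j = mpow (cmod (z$j)) (B$k$j) powr c" using c by (simp add: mpow_mult)
      qed
      also have "\<dots> = (\<Prod>j\<in>UNIV. mpow (cmod (z$j)) (B$k$j)) powr c"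
        by (rule prod_powr) (simp add: mpow_def)
      finally have eq: "cmod (mon (G k) z) = (\<Prod>j\<in>UNIV. mpow (cmod (z$j)) (B$k$j)) powr c" .
      have "(\<Prod>j\<in>UNIV. mpow (cmod (z$j)) (B$k$j)) \<ge> 0" by (intro prod_nonneg) (simp add: mpow_def)
      moreover have "x powr c < 1 \<longleftrightarrow> x < 1" if "x \<ge> 0" for x
        using c that powr_less_mono2[of c x 1] ge_one_powr_ge_zero[of x c] by (cases "x < 1") auto
      ultimately have "(\<Prod>j\<in>UNIV. mpow (cmod (z$j)) (B$k$j)) powr c < 1 \<longleftrightarrow> (\<Prod>j\<in>UNIV. mpow (cmod (z$j)) (B$k$j)) < 1"
        by blast
      then show ?thesis unfolding eq .
    qed
    then have "((\<forall>j. z$j = 0 \<longrightarrow> 0 \<le> G k j) \<and> cmod (mon (G k) z) < 1)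
        \<longleftrightarrow> ((\<forall>j. z$j = 0 \<longrightarrow> 0 \<le> B$k$j) \<and> (\<Prod>j\<in>UNIV. mpow (cmod (z$j)) (B$k$j)) < 1)" for k z
      unfolding sgn by blast
    then show ?thesis unfolding monomial_cone.U_def[OF cone] monomial_polyhedron_def
      by (simp only:)
  qed
  moreover have "proj_height (matrix_inv B *v axis k 1) = (\<Sum>j\<in>UNIV. Y k j)" for k
  proof -
    have "proj_height (A *v axis k 1) = (\<Sum>j\<in>UNIV. \<bar>yv k $ j\<bar>)"
      using P[of k] by (intro proj_height_eq[of "lam k"]) (auto simp: P_def col)
    then show ?thesis using Y0 by (simp add: A_def Y_def)
  qed
  ultimately show thesis using that cone YG1 by blast
qed

context monomial_domain
begin

text \<open>Bezout coefficients of the primitive vector \<open>Y k\<close> have pairing 1 with it.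
  Adding large multiples of the other \<open>G l\<close> raises the remaining pairings and leaves
  this one unchanged.\<close>

lemma adm_exponent_exists:
  assumes g: "Gcd (range (Y k)) = 1"
  shows "\<exists>a. adm a \<and> dot a k + h k = 1"
proof -
  obtain c where c: "(\<Sum>j\<in>UNIV. c j * Y k j) = 1"
    using bezout_finite_int[of UNIV "Y k"] g by auto
  \<comment> \<open>\<open>T\<close> outweighs every negative pairing of \<open>c\<close>; the -1 in
    \<open>a\<close> undoes the shift to \<open>a + 1\<close> in the definition of
    admissibility.\<close>
  define T where "T = 1 + (\<Sum>l\<in>UNIV. \<bar>dot c l\<bar>)"
  define a where "a j = c j + T * (\<Sum>l\<in>UNIV - {k}. G l j) - 1" for j
  have dota: "dot a l + h l = dot c l + T * (\<Sum>m\<in>UNIV - {k}. dot (G m) l)" for l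
    unfolding a_def dot_diff dot_add dot_cmult dot_sum by (simp add: dot_1)
  have k: "dot a k + h k = 1"
  proof -
    have "(\<Sum>m\<in>UNIV - {k}. dot (G m) k) = 0" by (intro sum.neutral) (auto simp: dot_G)
    then show ?thesis using c by (simp add: dota) (simp add: dot_def)
  qed
  moreover have "dot a l + h l \<ge> 1" for l
  proof (cases "l = k")
    case False
    have "(\<Sum>m\<in>UNIV - {k}. dot (G m) l) = (\<Sum>m\<in>UNIV - {k}. if m = l then N else 0)"
      unfolding dot_G by (intro sum.cong) auto
    then have s: "(\<Sum>m\<in>UNIV - {k}. dot (G m) l) = N" using False by simp
    have "\<bar>dot c l\<bar> \<le> (\<Sum>l\<in>UNIV. \<bar>dot c l\<bar>)" by (rule member_le_sum) auto
    then have T: "T \<ge> 1 + \<bar>dot c l\<bar>" by (simp add: T_def)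
    moreover have "T * 1 \<le> T * N" using T N_pos by (intro mult_left_mono) auto
    ultimately show ?thesis unfolding dota s by linarith
  qed (simp add: k)
  ultimately show ?thesis unfolding adm_def by blast
qed

text \<open>The two conditions of \<open>bergman_bounded\<close> read
  \<open>(p - 2) * h k < p\<close> and \<open>(2 - p) * h k < p\<close>. According to the position
  of \<open>p\<close> relative to 2 one of them is automatic, while the other is hardest for the
  largest height.\<close>

theorem bergman_bounded_iff:
  assumes prim: "\<And>k. Gcd (range (Y k)) = 1" and p: "1 \<le> p"
    and \<kappa>: "\<kappa> = real_of_int (Max (range h))"
  shows "bergman_Lp_bounded U p \<longleftrightarrow> 2 * \<kappa> / (\<kappa> + 1) < p \<and> (\<kappa> = 1 \<or> p < 2 * \<kappa> / (\<kappa> - 1))"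
proof -
  have "Max (range h) \<in> range h" by (intro Max_in) auto
  then obtain k where k: "h k = Max (range h)" by (metis imageE)
  have hk: "real_of_int (h k) = \<kappa>" by (simp add: k \<kappa>)
  have le: "real_of_int (h l) \<le> \<kappa>" for l unfolding \<kappa> by simp
  have \<kappa>1: "\<kappa> \<ge> 1" using h_pos[of k] hk by linarith
  show ?thesis
  proof
    assume R: "2 * \<kappa> / (\<kappa> + 1) < p \<and> (\<kappa> = 1 \<or> p < 2 * \<kappa> / (\<kappa> - 1))"
    then have lower: "2 * \<kappa> < p * (\<kappa> + 1)" using \<kappa>1 by (simp add: divide_less_eq)
    have upper: "p * (\<kappa> - 1) < 2 * \<kappa>" using R \<kappa>1 by (cases "\<kappa> = 1") (auto simp: less_divide_eq)
    have p1: "p > 1"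
    proof (rule ccontr)
      assume "\<not> p > 1"
      then have "p = 1" using p by simp
      then show False using lower \<kappa>1 by simp
    qed
    show "bergman_Lp_bounded U p"
    proof (rule bergman_bounded[OF p1])
      fix l
      have h1: "1 \<le> real_of_int (h l)" using h_pos[of l] by simp
      show "p * (h l - 1) < 2 * h l"
      proof (cases "p \<le> 2")
        case True
        then have "p * (real_of_int (h l) - 1) \<le> 2 * (real_of_int (h l) - 1)" using h1 by (intro mult_right_mono) auto
        then show ?thesis by simp
      next
        case False
        then have "(p - 2) * h l \<le> (p - 2) * \<kappa>" using le[of l] by (intro mult_left_mono) auto
        then show ?thesis using upper by (simp add: algebra_simps)
      qed
      show "2 * h l < p * (h l + 1)"
      proof (cases "p \<ge> 2")
        case True
        then have "2 * (real_of_int (h l) + 1) \<le> p * (real_of_int (h l) + 1)" using h1 by (intro mult_right_mono) auto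
        then show ?thesis by simp
      next
        case False
        then have "(2 - p) * h l \<le> (2 - p) * \<kappa>" using le[of l] by (intro mult_left_mono) auto
        then show ?thesis using lower by (simp add: algebra_simps)
      qed
    qed
  next
    assume bd: "bergman_Lp_bounded U p"
    then have p1: "p > 1" using not_bounded_one p by (cases "p = 1") auto
    obtain a where a: "adm a" "dot a k + h k = 1" using adm_exponent_exists[OF prim] by blast
    \<comment> \<open>With this pairing \<open>|mon a|^s\<close> is not integrable once
      \<open>s * (\<kappa> - 1) \<ge> 2 * \<kappa>\<close>. The case \<open>s = p\<close> yields the
      upper bound, the conjugate exponent the lower one.\<close>
    have dak: "real_of_int (dot a k) = 1 - \<kappa>" using a(2) hk by linarith
    have inf: "(\<integral>\<^sup>+w. ennreal (cmod (mon a w) powr s) * indicator U w \<partial>lborel) = \<infinity>" if "2 * \<kappa> \<le> s * (\<kappa> - 1)" for s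
    proof -
      have "\<not> s * dot a k + 2 * h k > 0" using that by (simp add: dak hk algebra_simps)
      then show ?thesis unfolding nn_integral_U_mon by auto
    qed
    have "2 * \<kappa> < p * (\<kappa> + 1)"
    proof (rule ccontr)
      assume "\<not> 2 * \<kappa> < p * (\<kappa> + 1)"
      then have "2 * \<kappa> \<le> p / (p - 1) * (\<kappa> - 1)" using p1 by (simp add: field_simps)
      from not_bounded_dual_exponent[OF a(1) p1 refl inf[OF this]] show False using bd by blast
    qed
    moreover have "\<kappa> = 1 \<or> p * (\<kappa> - 1) < 2 * \<kappa>"
      using not_bounded_large_exponent[OF a(1) _ inf, of p] bd p1 by force
    ultimately show "2 * \<kappa> / (\<kappa> + 1) < p \<and> (\<kappa> = 1 \<or> p < 2 * \<kappa> / (\<kappa> - 1))"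
      using \<kappa>1 by (auto simp: divide_less_eq less_divide_eq)
  qed
qed

end

theorem theorem1p1:
  fixes B :: "real^'n^'n" and p :: real
  assumes "CARD('n) \<ge> 2"
    and "\<forall>i j. B$i$j \<in> \<rat>"
    and "monomial_polyhedron B \<noteq> {}"
    and "open (monomial_polyhedron B)"
    and "connected (monomial_polyhedron B)"
    and "bounded (monomial_polyhedron B)"
    and "1 \<le> p"
  shows "invertible B \<and>
    (bergman_Lp_bounded (monomial_polyhedron B) p \<longleftrightarrow>
      (let k = real_of_int (complexity B) in
        2 * k / (k + 1) < p \<and> (k = 1 \<or> p < 2 * k / (k - 1))))"
proof
  show "invertible B" by (rule monomial_polyhedron_inverse(1)[OF assms(3,4,6)])
  obtain Y G :: "'n \<Rightarrow> 'n \<Rightarrow> int" and N where st: "monomial_cone Y G N" "monomial_cone.U G = monomial_polyhedron B"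
    "\<And>k. proj_height (matrix_inv B *v axis k 1) = (\<Sum>j\<in>UNIV. Y k j)" "\<And>k. Gcd (range (Y k)) = 1"
    using monomial_polyhedron_structure[OF assms(2,3,4,6)] by metis
  interpret monomial_domain Y G N
    using st(1,2) assms(4) by (simp add: monomial_domain_def monomial_domain_axioms_def)
  have "complexity B = Max (range h)"
    unfolding complexity_def st(3) h_def[abs_def] ..
  then show "bergman_Lp_bounded (monomial_polyhedron B) p \<longleftrightarrow>
      (let k = real_of_int (complexity B) in
        2 * k / (k + 1) < p \<and> (k = 1 \<or> p < 2 * k / (k - 1)))"
    using bergman_bounded_iff[OF st(4) assms(7) refl] unfolding st(2) Let_def by simp
qed

end
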